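(* Consider the index-2 integral-algebraic equation $$x_1(t)+\int_0^t [K_{11}(t,s)x_1(s)+K_{12}(t,s)x_2(s)]\,ds=f_1(t),\qquad \int_0^t K_{21}(t,s)x_1(s)\,ds=f_2(t),\qquad t\in I=[0,T],$$ where $f_2(0)=0$ and $|K_{21}(t,t)K_{12}(t,t)|\ge k_0>0$ for all $t\in I$. Let $m\ge1$ be an integer, and assume that $f_1\in C^{d+1}(I)$, $f_2\in C^{d+2}(I)$, $K_{11}\in C^{d+1}(D)$ and $K_{12},K_{21}\in C^{d+2}(D)$, where - if $m$ is even, $d=m+2$ (so that the exact solution satisfies $x_1,x_2\in C^{m+2}(I)$); - if $m$ is odd, $d=m+3$ (so that the exact solution satisfies $x_1,x_2\in C^{m+3}(I)$), and in addition $x_1^{(m)}(0)=0$. Let $e_{p,h}=x_p-x_{p,h}$, $p=1,2$, be the errors of the discontinuous Galerkin solution. Let $\bar h>0$ be such that for every uniform mesh $I_h$ with $h<\bar h$ the discontinuous Galerkin solution is uniquely defined (such an $\bar h$ exists). Then there is a constant $C$ independent of $h$ such that for all uniform meshes $I_h$ with $h<\bar h$ and all $0\le n\le N-1$ and all admissible $r$, $$|e_{1,h}(t_n+s_rh)|\le C\times\begin{cases}h^{m+1},&m\text{ odd},\\ h^m,&m\text{ even},\end{cases}$$ $$\|e_{2,h}\|_\infty=\sup_{t\in I}|e_{2,h}(t)|\le Ch^{m-1}\quad\text{if }m\text{ is odd},$$ $$|e_{2,h}(t_n+s_rh)|\le Ch^{m-2}\quad\text{if }m\text{ is even}.$$ Here,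 if $m$ is odd, the points $\{s_r\}_{r=0}^{m-1}$ satisfy $P_{m+1}'(s_r)=0$, whereas if $m$ is even, the points $\{s_r\}_{r=1}^{m-1}$ satisfy $P_m'(s_r)=0$.
   Context: $I=[0,T]$, $D=\{(t,s):0\le s\le t\le T\}$; all functions are real-valued. For an integer $N\ge2$, the uniform mesh is $I_h=\{t_n=nh:0\le n\le N\}$ with $h=T/N$, and $\sigma_n=(t_n,t_{n+1}]$. $S_{m-1}^{(-1)}(I_h)$ is the space of functions $v$ such that $v|_{\sigma_n}$ is a real polynomial of degree at most $m-1$ for each $0\le n\le N-1$ (no continuity at mesh points); the value at $t=0$ is understood as the limit from the right. $P_j$ is the shifted Legendre polynomial of degree $j$ on $[0,1]$; the zeros of $P_j'$ lie in $(0,1)$. The discontinuous Galerkin (DG) solution is the pair $x_{1,h},x_{2,h}\in S_{m-1}^{(-1)}(I_h)$ satisfying, for all $\phi\in S_{m-1}^{(-1)}(I_h)$ and $0\le n\le N-1$, $$\int_{t_n}^{t_{n+1}}\Bigl[x_{1,h}(s)+\int_0^s\bigl(K_{11}(s,\tau)x_{1,h}(\tau)+K_{12}(s,\tau)x_{2,h}(\tau)\bigr)d\tau\Bigr]\phi(s)\,ds=\int_{t_n}^{t_{n+1}}f_1(s)\phi(s)\,ds,$$ $$\int_{t_n}^{t_{n+1}}\Bigl(\int_0^s K_{21}(s,\tau)x_{1,h}(\tau)\,d\tau\Bigr)\phi(s)\,ds=\int_{t_n}^{t_{n+1}}f_2(s)\phi(s)\,ds.$$ *)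

theory Defs
  imports "HOL-Analysis.Analysis" "HOL-Computational_Algebra.Polynomial"
begin

text \<open>
  Smoothness of class \<open>C\<^sup>k\<close> on a set, with derivatives taken within the set (one-sided at
  boundary points). It is only used for an interval \<open>[0,T]\<close> with \<open>T > 0\<close> and for a triangle:
  closed convex sets with nonempty interior, on which derivatives within the set are unique and
  this notion is the usual one (partial derivatives up to order \<open>k\<close> exist in the interior and
  extend continuously to the closed set). The function \<open>G\<close> is the gradient.
\<close>

primrec Ck_on :: "nat \<Rightarrow> 'a::euclidean_space set \<Rightarrow> ('a \<Rightarrow> real) \<Rightarrow> bool" where
  "Ck_on 0 S f \<longleftrightarrow> continuous_on S f"
| "Ck_on (Suc k) S f \<longleftrightarrow>
     (\<exists>G. (\<forall>p\<in>S. (f has_derivative (\<lambda>v. G p \<bullet> v)) (at p within S)) \<and>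
          (\<forall>b\<in>Basis. Ck_on k S (\<lambda>p. G p \<bullet> b)))"

text \<open>Iterated derivative within \<open>S\<close>; at an endpoint of an interval it is one-sided, so it does
  not depend on values outside \<open>S\<close>.\<close>

primrec deriv_within :: "nat \<Rightarrow> real set \<Rightarrow> (real \<Rightarrow> real) \<Rightarrow> real \<Rightarrow> real" where
  "deriv_within 0 S f = f"
| "deriv_within (Suc k) S f = (\<lambda>x. vector_derivative (deriv_within k S f) (at x within S))"

definition kernel_domain :: "real \<Rightarrow> (real \<times> real) set" where
  "kernel_domain T = {(t, s). 0 \<le> s \<and> s \<le> t \<and> t \<le> T}"

definition iae_solution ::
  "real \<Rightarrow> (real \<Rightarrow> real \<Rightarrow> real) \<Rightarrow> (real \<Rightarrow> real \<Rightarrow> real) \<Rightarrow> (real \<Rightarrow> real \<Rightarrow> real) \<Rightarrow>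
   (real \<Rightarrow> real) \<Rightarrow> (real \<Rightarrow> real) \<Rightarrow> (real \<Rightarrow> real) \<Rightarrow> (real \<Rightarrow> real) \<Rightarrow> bool" where
  "iae_solution T K11 K12 K21 f1 f2 x1 x2 \<longleftrightarrow>
     continuous_on {0..T} x1 \<and> continuous_on {0..T} x2 \<and>
     (\<forall>t\<in>{0..T}.
        x1 t + integral {0..t} (\<lambda>s. K11 t s * x1 s + K12 t s * x2 s) = f1 t \<and>
        integral {0..t} (\<lambda>s. K21 t s * x1 s) = f2 t)"

definition stepsize :: "real \<Rightarrow> nat \<Rightarrow> real" where
  "stepsize T N = T / real N"

definition mesh :: "real \<Rightarrow> nat \<Rightarrow> nat \<Rightarrow> real" where
  "mesh T N n = real n * stepsize T N"

text \<open>The space \<open>S\<^sub>q\<^sup>(\<^sup>-\<^sup>1\<^sup>)(I\<^sub>h)\<close>. Its elements are represented by functions on all of \<open>\<real>\<close>;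
  only the values on \<open>[0,T]\<close> are constrained, hence only those are meaningful. The value at
  \<open>0\<close> is the limit from the right.\<close>

definition dg_space :: "real \<Rightarrow> nat \<Rightarrow> nat \<Rightarrow> (real \<Rightarrow> real) set" where
  "dg_space T N q =
     {v. (\<forall>n<N. \<exists>p :: real poly. degree p \<le> q \<and>
            (\<forall>t\<in>{mesh T N n <.. mesh T N (Suc n)}. v t = poly p t)) \<and>
         (v \<longlongrightarrow> v 0) (at_right 0)}"

definition dg_solution ::
  "real \<Rightarrow> (real \<Rightarrow> real \<Rightarrow> real) \<Rightarrow> (real \<Rightarrow> real \<Rightarrow> real) \<Rightarrow> (real \<Rightarrow> real \<Rightarrow> real) \<Rightarrow>
   (real \<Rightarrow> real) \<Rightarrow> (real \<Rightarrow> real) \<Rightarrow> nat \<Rightarrow> nat \<Rightarrow> (real \<Rightarrow> real) \<Rightarrow> (real \<Rightarrow> real) \<Rightarrow> bool" where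
  "dg_solution T K11 K12 K21 f1 f2 m N y1 y2 \<longleftrightarrow>
     y1 \<in> dg_space T N (m - 1) \<and> y2 \<in> dg_space T N (m - 1) \<and>
     (\<forall>\<phi>\<in>dg_space T N (m - 1). \<forall>n<N.
        integral {mesh T N n .. mesh T N (Suc n)}
          (\<lambda>s. (y1 s + integral {0..s} (\<lambda>\<tau>. K11 s \<tau> * y1 \<tau> + K12 s \<tau> * y2 \<tau>)) * \<phi> s) =
        integral {mesh T N n .. mesh T N (Suc n)} (\<lambda>s. f1 s * \<phi> s) \<and>
        integral {mesh T N n .. mesh T N (Suc n)}
          (\<lambda>s. integral {0..s} (\<lambda>\<tau>. K21 s \<tau> * y1 \<tau>) * \<phi> s) =
        integral {mesh T N n .. mesh T N (Suc n)} (\<lambda>s. f2 s * \<phi> s))"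

text \<open>Uniqueness is equality on \<open>[0,T]\<close>, since values outside are irrelevant.\<close>

definition dg_uniquely_solvable ::
  "real \<Rightarrow> (real \<Rightarrow> real \<Rightarrow> real) \<Rightarrow> (real \<Rightarrow> real \<Rightarrow> real) \<Rightarrow> (real \<Rightarrow> real \<Rightarrow> real) \<Rightarrow>
   (real \<Rightarrow> real) \<Rightarrow> (real \<Rightarrow> real) \<Rightarrow> nat \<Rightarrow> nat \<Rightarrow> bool" where
  "dg_uniquely_solvable T K11 K12 K21 f1 f2 m N \<longleftrightarrow>
     (\<exists>y1 y2. dg_solution T K11 K12 K21 f1 f2 m N y1 y2) \<and>
     (\<forall>y1 y2 z1 z2.
        dg_solution T K11 K12 K21 f1 f2 m N y1 y2 \<longrightarrow>
        dg_solution T K11 K12 K21 f1 f2 m N z1 z2 \<longrightarrow>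
        (\<forall>t\<in>{0..T}. y1 t = z1 t \<and> y2 t = z2 t))"

text \<open>Shifted Legendre polynomial on \<open>[0,1]\<close>, by Rodrigues' formula
  \<open>P\<^sub>j(x) = (1/j!) (d/dx)\<^sup>j (x\<^sup>2 - x)\<^sup>j\<close>.\<close>

definition shifted_legendre :: "nat \<Rightarrow> real poly" where
  "shifted_legendre j = smult (1 / fact j) ((pderiv ^^ j) ([:0, -1, 1:] ^ j))"

end

theory Submission
  imports Defs
begin

text \<open>
  The second equation involves \<open>x1\<close> only, so both error estimates come from one analysis of a Volterra
  equation of the first kind whose moments against polynomials of degree below \<open>m\<close> are prescribed on
  every cell. The primitive of the error is continuous. On a cell it is a polynomial \<open>D\<close> of degree at most
  \<open>m\<close> plus the remainder \<open>\<omega>\<close> of the Legendre projection of degree \<open>m\<close> of the exact primitive. After an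
  integration by parts in the Volterra integral, the moment equations control every Legendre coefficient of
  \<open>D\<close> except the top one, and continuity at the mesh points turns into a recursion with factor \<open>(-1)^m\<close> for
  the remaining unknown, to which a Gronwall argument applies.

  For odd \<open>m\<close> this recursion oscillates. The jumps of \<open>\<omega>\<close> have leading part
  \<open>c * h^(m + 1) * (x^(m)(t_n) + x^(m)(t_(n + 1)))\<close> in the oscillating mode, which telescopes; its initial value
  vanishes for \<open>x1\<close> because \<open>x1^(m)(0) = 0\<close>, and this gains two orders. Up to higher order, \<open>h\<close> times
  the error is a combination of \<open>P'_m\<close> (from \<open>D\<close>) and \<open>P'_(m + 1)\<close> (from \<open>\<omega>\<close>), which explains the
  superconvergence points. The first equation is of the same type for \<open>x2\<close>, with the error of \<open>x1\<close> as a
  perturbation of its moments.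
\<close>

subsection \<open>Shifted Legendre polynomials\<close>

text \<open>The primitive is projected to degree \<open>m\<close>, although the tests have degree
  below \<open>m\<close>. The spare degree is essential: the remainder is of size
  \<open>h^(m + 1)\<close>, while for odd \<open>m\<close> the polynomial \<open>D\<close> must be
  bounded by \<open>h^(m + 2)\<close>. Being orthogonal to degree \<open>m\<close>, the remainder
  stays invisible to the tests after multiplication by an affine function or after one integration.
  Apart from the constant memory term, the moment equations on a cell see it only with a factor
  \<open>h^2\<close>.

  Two sizes run through all estimates. All moments are bounded by \<open>a\<close>, those with odd
  \<open>j + m\<close> must be at most \<open>h * b\<close>, and \<open>D\<close> is of size
  \<open>b\<close>. Differentiation removes the constant mode, which carries the memory, so up to a
  multiple of P'_m the derivative is of size \<open>a + h * b\<close>.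

  Passing to \<open>x2\<close> costs a division by \<open>h\<close>. For even \<open>m\<close> no
  parity helps, and \<open>b\<close> worsens from \<open>h^m\<close> to order
  \<open>h^(m - 2)\<close>. For odd \<open>m\<close> the leading error of \<open>x1\<close> is a
  multiple of P'_(m + 1), which is antisymmetric about the midpoint of the cell; its moments vanish
  for odd \<open>j + m\<close>, and \<open>b\<close> worsens from \<open>h^(m + 2)\<close> only to
  order \<open>h^m\<close>.\<close>

lemma power_dvd_pderiv:
  fixes q :: "real poly"
  assumes "q ^ Suc n dvd p"
  shows "q ^ n dvd pderiv p"
proof -
  obtain r where "p = q ^ Suc n * r" using assms by blast
  then have "pderiv p = q ^ n * (q * pderiv r + of_nat (Suc n) * pderiv q * r)"
    by (simp add: pderiv_mult pderiv_power_Suc algebra_simps of_nat_poly del: of_nat_Suc power_Suc) (simp add: algebra_simps)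
  then show ?thesis by simp
qed

lemma power_dvd_pderiv_funpow:
  fixes q :: "real poly"
  shows "i \<le> j \<Longrightarrow> q ^ (j - i) dvd (pderiv ^^ i) (q ^ j)"
proof (induction i)
  case (Suc i)
  then have "q ^ Suc (j - Suc i) dvd (pderiv ^^ i) (q ^ j)"
    by (metis Suc_diff_Suc Suc_leD Suc_le_lessD)
  then show ?case by (simp add: power_dvd_pderiv del: power_Suc)
qed simp

text \<open>Fewer than \<open>j\<close> derivatives leave at least one factor x^2 - x in the j-th
  power. This removes the boundary terms when Rodrigues' formula is integrated by parts.\<close>

lemma rodrigues_endpoints:
  assumes "i < j" "x \<in> {0, 1::real}"
  shows "poly ((pderiv ^^ i) ([:0, -1, 1:] ^ j)) x = 0"
proof -
  have "[:0, -1, 1:] dvd [:0, -1, 1::real:] ^ (j - i)"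
    using assms(1) by (simp add: dvd_power)
  then have "[:0, -1, 1:] dvd (pderiv ^^ i) ([:0, -1, 1::real:] ^ j)"
    using power_dvd_pderiv_funpow[of i j "[:0, -1, 1::real:]"] assms(1) dvd_trans by auto
  then obtain r where "(pderiv ^^ i) ([:0, -1, 1:] ^ j) = [:0, -1, 1::real:] * r" by blast
  then show ?thesis using assms(2) by auto
qed

lemma continuous_on_poly_real [continuous_intros]: "continuous_on S (\<lambda>u. poly p (u::real))"
  by (intro continuous_intros)

lemma poly_parts:
  fixes p q :: "real poly"
  assumes "poly q 0 = 0" "poly q 1 = 0"
  shows "integral {0..1} (\<lambda>u. poly p u * poly (pderiv q) u) = - integral {0..1} (\<lambda>u. poly (pderiv p) u * poly q u)"
proof -
  have "((\<lambda>u. poly (pderiv (p * q)) u) has_integral (poly (p * q) 1 - poly (p * q) 0)) {0..1}"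
    by (intro fundamental_theorem_of_calculus)
       (auto simp: has_real_derivative_iff_has_vector_derivative[symmetric] simp del: poly_mult
             intro!: has_field_derivative_at_within[OF poly_DERIV])
  then have "integral {0..1} (\<lambda>u. poly p u * poly (pderiv q) u + poly (pderiv p) u * poly q u) = 0"
    using assms by (simp add: pderiv_mult algebra_simps integral_unique)
  moreover have "integral {0..1} (\<lambda>u. poly p u * poly (pderiv q) u + poly (pderiv p) u * poly q u)
     = integral {0..1} (\<lambda>u. poly p u * poly (pderiv q) u) + integral {0..1} (\<lambda>u. poly (pderiv p) u * poly q u)"
    by (intro integral_add integrable_continuous_real continuous_intros)
  ultimately show ?thesis by simp
qed

text \<open>All intermediate derivatives are included so that the induction closes: one integration
  by parts lowers the degree of \<open>p\<close> and the number \<open>i\<close> of derivatives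
  together, and the boundary terms vanish as long as fewer than \<open>j\<close> derivatives are
  left on the other factor.\<close>

lemma rodrigues_orthogonal:
  fixes p :: "real poly"
  shows "i \<le> j \<Longrightarrow> degree p < i \<Longrightarrow>
    integral {0..1} (\<lambda>u. poly p u * poly ((pderiv ^^ i) ([:0, -1, 1:] ^ j)) u) = 0"
proof (induction i arbitrary: p)
  case (Suc i)
  have *: "integral {0..1} (\<lambda>u. poly (pderiv p) u * poly ((pderiv ^^ i) ([:0, -1, 1:] ^ j)) u) = 0"
  proof (cases "degree p = 0")
    case True
    then have "pderiv p = 0" by (simp add: pderiv_eq_0_iff)
    then show ?thesis by simp
  next
    case False
    then show ?thesis using Suc by (intro Suc.IH) (auto simp: degree_pderiv)
  qed
  show ?case
    using poly_parts[of "(pderiv ^^ i) ([:0, -1, 1:] ^ j)" p] * Suc.prems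
      rodrigues_endpoints[of i j 0] rodrigues_endpoints[of i j 1] by simp
qed simp

lemma degree_pderiv_funpow: "degree ((pderiv ^^ i) (p :: real poly)) = degree p - i"
  by (induction i) (auto simp: degree_pderiv)

lemma degree_rodrigues: "degree ([:0, -1, 1::real:] ^ j) = 2 * j"
  by (simp add: degree_power_eq)

lemma degree_shifted_legendre [simp]: "degree (shifted_legendre j) = j"
  unfolding shifted_legendre_def by (simp add: degree_pderiv_funpow degree_rodrigues)

section \<open>Legendre moments and orthogonal projection on the unit interval\<close>

definition legendre_moment :: "(real \<Rightarrow> real) \<Rightarrow> nat \<Rightarrow> real" where
  "legendre_moment f j = integral {0..1} (\<lambda>u. f u * poly (shifted_legendre j) u)"

lemma legendre_orthogonal:
  assumes "degree p < j"
  shows "legendre_moment (poly p) j = 0"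
  using rodrigues_orthogonal[of j j p] assms
  unfolding legendre_moment_def shifted_legendre_def by (simp add: algebra_simps)

text \<open>The squared L2 norm on [0,1], by which a moment is divided to give a Legendre
  coefficient.\<close>

definition legendre_norm2 :: "nat \<Rightarrow> real" where
  "legendre_norm2 j = legendre_moment (poly (shifted_legendre j)) j"

lemma shifted_legendre_nonzero: "shifted_legendre j \<noteq> 0"
proof
  assume "shifted_legendre j = 0"
  then have "(pderiv ^^ j) ([:0, -1, 1::real:] ^ j) = 0"
    by (simp add: shifted_legendre_def)
  then have "lead_coeff ((pderiv ^^ j) ([:0, -1, 1::real:] ^ j)) = 0" by simp
  \<comment> \<open>Up to as many derivatives as the degree allows, here \<open>j\<close> out of
    \<open>2 * j\<close>, the leading coefficient stays nonzero.\<close>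
  moreover have "lead_coeff ((pderiv ^^ i) p) \<noteq> 0" if "p \<noteq> 0" "i \<le> degree p" for i and p :: "real poly"
    using that(2)
  proof (induction i)
    case (Suc i)
    then have "(pderiv ((pderiv ^^ i) p)) \<noteq> 0"
      by (simp add: pderiv_eq_0_iff degree_pderiv_funpow)
    then show ?case by simp
  qed (use that in simp)
  ultimately show False by (metis degree_rodrigues le_add1 mult_2 pCons_eq_0_iff power_not_zero zero_neq_one)
qed

lemma legendre_norm2_pos: "legendre_norm2 j > 0"
proof -
  let ?f = "\<lambda>u. poly (shifted_legendre j) u * poly (shifted_legendre j) u"
  have c: "continuous_on {0..1} ?f" by (intro continuous_intros)
  \<comment> \<open>A continuous nonnegative function with zero integral vanishes identically, which
    would give a nonzero polynomial infinitely many zeros.\<close>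
  have "integral {0..1} ?f \<noteq> 0"
  proof
    assume "integral {0..1} ?f = 0"
    then have i: "(?f has_integral 0) (cbox 0 1)"
      using integrable_integral[OF integrable_continuous_real[OF c]] by (simp only: cbox_interval)
    have "?f u = 0" if "u \<in> {0..1}" for u
      by (rule has_integral_0_cbox_imp_0[OF _ _ i]) (use c that in \<open>auto simp: cbox_interval\<close>)
    then have "\<forall>u\<in>{0..1}. ?f u = 0" by blast
    then have "{0..1} \<subseteq> {u. poly (shifted_legendre j) u = 0}" by auto
    moreover have "finite {u. poly (shifted_legendre j) u = 0}"
      using shifted_legendre_nonzero poly_roots_finite by blast
    ultimately have "finite {0..1::real}" using finite_subset by blast
    then show False using infinite_Icc[of 0 "1::real"] by simp
  qed
  moreover have "integral {0..1} ?f \<ge> 0"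
    by (intro integral_nonneg integrable_continuous_real c) auto
  ultimately show ?thesis unfolding legendre_norm2_def legendre_moment_def by simp
qed

lemma legendre_orthogonal_legendre:
  "legendre_moment (poly (shifted_legendre i)) j = (if i = j then legendre_norm2 j else 0)"
proof -
  have "legendre_moment (poly (shifted_legendre i)) j = legendre_moment (poly (shifted_legendre j)) i"
    unfolding legendre_moment_def by (simp add: mult.commute)
  then show ?thesis
    using legendre_orthogonal[of "shifted_legendre i" j] legendre_orthogonal[of "shifted_legendre j" i]
    by (cases i j rule: linorder_cases) (auto simp: legendre_norm2_def)
qed

lemma moment_add:
  assumes "continuous_on {0..1} f" "continuous_on {0..1} g"
  shows "legendre_moment (\<lambda>u. f u + g u) j = legendre_moment f j + legendre_moment g j"
  unfolding legendre_moment_def distrib_right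
  by (intro integral_add integrable_continuous_real continuous_intros assms)

lemma moment_diff:
  assumes "continuous_on {0..1} f" "continuous_on {0..1} g"
  shows "legendre_moment (\<lambda>u. f u - g u) j = legendre_moment f j - legendre_moment g j"
  unfolding legendre_moment_def left_diff_distrib
  by (intro integral_diff integrable_continuous_real continuous_intros assms)

lemma moment_cmult: "legendre_moment (\<lambda>u. c * f u) j = c * legendre_moment f j"
  unfolding legendre_moment_def by (simp add: mult.assoc)

lemma moment_sum:
  assumes "\<And>i. i \<in> I \<Longrightarrow> continuous_on {0..1} (f i)" "finite I"
  shows "legendre_moment (\<lambda>u. \<Sum>i\<in>I. f i u) j = (\<Sum>i\<in>I. legendre_moment (f i) j)"
  unfolding legendre_moment_def sum_distrib_right
  by (intro integral_sum integrable_continuous_real continuous_intros assms)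

lemma moment_cong:
  assumes "\<And>u. u \<in> {0..1} \<Longrightarrow> f u = g u"
  shows "legendre_moment f j = legendre_moment g j"
  unfolding legendre_moment_def using assms by (intro integral_cong) auto

definition legendre_proj :: "nat \<Rightarrow> (real \<Rightarrow> real) \<Rightarrow> real poly" where
  "legendre_proj m f = (\<Sum>j\<le>m. smult (legendre_moment f j / legendre_norm2 j) (shifted_legendre j))"

lemma degree_legendre_proj: "degree (legendre_proj m f) \<le> m"
  unfolding legendre_proj_def
  by (rule degree_sum_le) (auto intro: order_trans[OF degree_smult_le])

lemma moment_legendre_proj:
  assumes "j \<le> m"
  shows "legendre_moment (poly (legendre_proj m f)) j = legendre_moment f j"
proof -
  have "legendre_moment (poly (legendre_proj m f)) j =
     (\<Sum>i\<le>m. legendre_moment f i / legendre_norm2 i * legendre_moment (poly (shifted_legendre i)) j)"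
    unfolding legendre_proj_def poly_sum poly_smult
    by (subst moment_sum) (auto intro!: continuous_on_mult_left continuous_on_poly_real simp only: moment_cmult finite_atMost)
  also have "\<dots> = (\<Sum>i\<le>m. if i = j then legendre_moment f j else 0)"
    using legendre_norm2_pos[of j] by (intro sum.cong) (auto simp: legendre_orthogonal_legendre)
  finally show ?thesis using assms by simp
qed

text \<open>There is a Legendre polynomial of every exact degree, so the top coefficient can be
  removed by a multiple of the one of degree \<open>Suc m\<close>. The difference has degree at most
  \<open>m\<close> and is orthogonal to it, so both parts are reproduced separately.\<close>

lemma legendre_proj_poly:
  fixes p :: "real poly"
  shows "degree p \<le> m \<Longrightarrow> legendre_proj m (poly p) = p"
proof (induction m arbitrary: p)
  case 0
  then obtain c where p: "p = [:c:]" by (metis degree_0_id le_0_eq)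
  have l: "shifted_legendre 0 = [:1:]" by (simp add: shifted_legendre_def one_pCons)
  show ?case by (simp add: legendre_proj_def legendre_norm2_def legendre_moment_def p l)
next
  case (Suc m)
  define c where "c = coeff p (Suc m) / coeff (shifted_legendre (Suc m)) (Suc m)"
  define q where "q = p - smult c (shifted_legendre (Suc m))"
  have nz: "coeff (shifted_legendre (Suc m)) (Suc m) \<noteq> 0"
    using shifted_legendre_nonzero[of "Suc m"] leading_coeff_0_iff[of "shifted_legendre (Suc m)"] by simp
  have "coeff q i = 0" if "i > m" for i
  proof (cases "i = Suc m")
    case True
    then show ?thesis using nz by (simp add: q_def c_def)
  next
    case False
    then show ?thesis using that Suc.prems by (simp add: q_def coeff_eq_0)
  qed
  then have dq: "degree q \<le> m" by (intro degree_le) auto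
  have mom: "legendre_moment (poly p) j = legendre_moment (poly q) j + c * legendre_moment (poly (shifted_legendre (Suc m))) j" for j
  proof -
    have "poly p = (\<lambda>u. poly q u + c * poly (shifted_legendre (Suc m)) u)"
      by (auto simp: q_def)
    then show ?thesis by (simp add: moment_add continuous_intros moment_cmult)
  qed
  have lq: "legendre_moment (poly q) (Suc m) = 0" using legendre_orthogonal dq by simp
  have "legendre_proj (Suc m) (poly p) = legendre_proj m (poly q) + smult c (shifted_legendre (Suc m))"
    unfolding legendre_proj_def
    using legendre_norm2_pos[of "Suc m"]
    by (simp add: mom lq legendre_orthogonal_legendre)
  also have "legendre_proj m (poly q) = q" by (rule Suc.IH[OF dq])
  finally show ?case by (simp add: q_def)
qed

lemma poly_legendre_expansion:
  assumes "degree p \<le> m"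
  shows "poly p u = (\<Sum>j\<le>m. legendre_moment (poly p) j / legendre_norm2 j * poly (shifted_legendre j) u)"
  using arg_cong[OF legendre_proj_poly[OF assms], of "\<lambda>p. poly p u"]
  by (simp add: legendre_proj_def poly_sum)

lemma poly_pderiv_legendre_expansion:
  assumes "degree p \<le> m"
  shows "poly (pderiv p) u = (\<Sum>j\<le>m. legendre_moment (poly p) j / legendre_norm2 j * poly (pderiv (shifted_legendre j)) u)"
proof -
  have *: "pderiv (sum f A) = (\<Sum>a\<in>A. pderiv (f a))" for f :: "nat \<Rightarrow> real poly" and A
    by (rule higher_pderiv_sum[of 1, simplified])
  show ?thesis
  using arg_cong[OF legendre_proj_poly[OF assms], of "\<lambda>p. poly (pderiv p) u"]
  by (simp add: legendre_proj_def poly_sum * pderiv_smult)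
qed

lemma poly_bounded_01: obtains B where "B > 0" "\<And>u. u \<in> {0..1::real} \<Longrightarrow> \<bar>poly p u\<bar> \<le> B"
proof -
  have "compact ((\<lambda>u. poly p u) ` {0..1::real})"
    by (intro compact_continuous_image continuous_intros) auto
  then have "bounded ((\<lambda>u. poly p u) ` {0..1::real})" by (rule compact_imp_bounded)
  then show ?thesis using that unfolding bounded_pos by auto
qed

lemma moment_bound:
  obtains B where "B > 0" "\<And>f w. continuous_on {0..1} f \<Longrightarrow> (\<And>u. u \<in> {0..1} \<Longrightarrow> \<bar>f u\<bar> \<le> w) \<Longrightarrow> \<bar>legendre_moment f j\<bar> \<le> B * w"
proof -
  obtain B where B: "B > 0" "\<And>u. u \<in> {0..1::real} \<Longrightarrow> \<bar>poly (shifted_legendre j) u\<bar> \<le> B"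
    using poly_bounded_01[of "shifted_legendre j"] by blast
  show ?thesis
  proof (rule that[OF B(1)])
    fix f :: "real \<Rightarrow> real" and w :: real
    assume f: "continuous_on {0..1} f" "\<And>u. u \<in> {0..1} \<Longrightarrow> \<bar>f u\<bar> \<le> (w::real)"
    have "norm (integral {0..1} (\<lambda>u. f u * poly (shifted_legendre j) u)) \<le> w * B * (1 - 0)"
      by (rule integral_bound)
         (auto intro!: continuous_intros f mult_mono B simp: abs_mult order_trans[OF _ f(2)])
    then show "\<bar>legendre_moment f j\<bar> \<le> B * w"
      by (simp add: legendre_moment_def mult.commute)
  qed
qed

section \<open>Reflection, endpoint values and zeros of the derivative\<close>

lemma pcompose_power: "pcompose (p ^ n) q = pcompose p q ^ n" for p q :: "real poly"
  by (induction n) (auto simp: pcompose_mult pcompose_1)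

lemma pderiv_funpow_reflect:
  fixes p :: "real poly"
  shows "(pderiv ^^ i) (pcompose p [:1, -1:]) = smult ((-1) ^ i) (pcompose ((pderiv ^^ i) p) [:1, -1:])"
  by (induction i) (auto simp: pderiv_smult pderiv_pcompose pderiv_pCons pcompose_smult)

lemma legendre_reflect:
  fixes u :: real
  shows "poly (shifted_legendre j) (1 - u) = (-1) ^ j * poly (shifted_legendre j) u"
proof -
  \<comment> \<open>The polynomial x^2 - x is invariant under x -> 1 - x, so every derivative
    contributes only a sign.\<close>
  have "[:0, -1, 1:] ^ j = pcompose ([:0, -1, 1::real:] ^ j) [:1, -1:]"
    by (simp add: pcompose_power pcompose_pCons)
  then have "(pderiv ^^ j) ([:0, -1, 1::real:] ^ j) = smult ((-1) ^ j) (pcompose ((pderiv ^^ j) ([:0, -1, 1:] ^ j)) [:1, -1:])"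
    using pderiv_funpow_reflect[of j "[:0, -1, 1::real:] ^ j"] by metis
  then have "poly ((pderiv ^^ j) ([:0, -1, 1::real:] ^ j)) u = (-1) ^ j * poly ((pderiv ^^ j) ([:0, -1, 1:] ^ j)) (1 - u)"
    by (drule_tac arg_cong[where f = "\<lambda>p. poly p u"]) (simp only: poly_smult poly_pcompose, simp)
  then show ?thesis
    by (simp add: shifted_legendre_def power_mult_distrib[symmetric] flip: mult.assoc)
qed

lemma poly_nonneg_coeffs_pos:
  fixes p :: "real poly"
  assumes "\<And>i. coeff p i \<ge> 0" "coeff p 0 > 0" "u \<ge> 0"
  shows "poly p u > 0"
proof -
  have "poly p u = (\<Sum>i\<le>degree p. coeff p i * u ^ i)" by (simp add: poly_altdef)
  also have "\<dots> \<ge> (\<Sum>i\<in>{0}. coeff p i * u ^ i)"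
    using assms by (intro sum_mono2) auto
  finally show ?thesis using assms(2) by simp
qed

lemma pderiv_funpow_translate:
  fixes p :: "real poly"
  shows "(pderiv ^^ i) (pcompose p [:1, 1:]) = pcompose ((pderiv ^^ i) p) [:1, 1:]"
  by (induction i) (auto simp: pderiv_pcompose pderiv_pCons)

lemma coeff_pderiv_funpow:
  "coeff ((pderiv ^^ i) (p :: real poly)) k = pochhammer (of_nat (Suc k)) i * coeff p (k + i)"
  by (induction i arbitrary: k) (auto simp: coeff_pderiv pochhammer_rec algebra_simps)

text \<open>With x = 1 + u the base x^2 - x becomes u * (1 + u), so the binomial theorem gives
  nonnegative coefficients. The value at 1 and the sign of the derivative beyond 1 are both read off
  from this expansion.\<close>

lemma coeff_rodrigues_translate:
  "coeff (pcompose ([:0, -1, 1::real:] ^ j) [:1, 1:]) k = (if k < j then 0 else of_nat (j choose (k - j)))"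
proof -
  have "pcompose ([:0, -1, 1::real:] ^ j) [:1, 1:] = monom 1 j * [:1, 1:] ^ j"
    by (simp add: pcompose_power pcompose_pCons monom_altdef power_mult_distrib[symmetric])
  also have "[:1, 1:] ^ j = (\<Sum>i\<le>j. monom (of_nat (j choose i)) i :: real poly)"
  proof -
    have "[:1, 1::real:] = monom 1 1 + 1" by (simp add: monom_altdef one_pCons)
    then have "[:1, 1:] ^ j = (\<Sum>i\<le>j. of_nat (j choose i) * monom 1 1 ^ i * 1 ^ (j - i) :: real poly)"
      by (metis binomial_ring)
    then show ?thesis by (simp add: monom_power of_nat_poly smult_monom)
  qed
  finally have *: "pcompose ([:0, -1, 1::real:] ^ j) [:1, 1:] = monom 1 j * (\<Sum>i\<le>j. monom (of_nat (j choose i)) i)" .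
  show ?thesis unfolding *
    by (auto simp: coeff_monom_mult coeff_sum binomial_eq_0)
qed

lemma legendre_translate_coeffs:
  "coeff (pcompose (shifted_legendre j) [:1, 1:]) k = 1 / fact j * (pochhammer (of_nat (Suc k)) j * of_nat (j choose k))"
  by (simp add: shifted_legendre_def pcompose_smult pderiv_funpow_translate[symmetric] coeff_pderiv_funpow
      coeff_rodrigues_translate del: pochhammer_Suc)

lemma poly_translate: "poly (pcompose p [:1, 1:]) u = poly p (1 + u)" for p :: "real poly"
  by (simp add: poly_pcompose)

lemma legendre_at_1: "poly (shifted_legendre j) 1 = 1"
  using legendre_translate_coeffs[of j 0] poly_translate[of "shifted_legendre j" 0]
  by (simp add: poly_0_coeff_0 pochhammer_fact[symmetric])

lemma legendre_at_0: "poly (shifted_legendre j) 0 = (-1) ^ j"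
  using legendre_reflect[of j 1] legendre_at_1
  by (metis cancel_comm_monoid_add_class.diff_cancel mult.right_neutral)

text \<open>All Taylor coefficients at 1 are nonnegative and the linear one is positive, so the
  derivative cannot vanish at 1 or to the right of it.\<close>

lemma legendre_deriv_pos:
  assumes "j \<ge> 1" "s \<ge> 1"
  shows "poly (pderiv (shifted_legendre j)) s > 0"
proof -
  have "poly (pderiv (shifted_legendre j)) s = poly (pderiv (pcompose (shifted_legendre j) [:1, 1:])) (s - 1)"
    using pderiv_funpow_translate[of 1 "shifted_legendre j"] by (simp add: poly_translate)
  also have "\<dots> > 0"
    using assms by (intro poly_nonneg_coeffs_pos)
      (auto simp: coeff_pderiv legendre_translate_coeffs pochhammer_nonneg simp del: pochhammer_Suc
            intro!: mult_nonneg_nonneg mult_pos_pos pochhammer_pos pochhammer_nonneg divide_pos_pos)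
  finally show ?thesis .
qed

lemma legendre_deriv_reflect:
  "poly (pderiv (shifted_legendre j)) (1 - u) = - ((-1) ^ j * poly (pderiv (shifted_legendre j)) u)"
proof -
  have "(\<lambda>u. poly (shifted_legendre j) (1 - u)) = (\<lambda>u. (-1) ^ j * poly (shifted_legendre j) u)"
    using legendre_reflect by auto
  moreover have "((\<lambda>u. poly (shifted_legendre j) (1 - u)) has_real_derivative - poly (pderiv (shifted_legendre j)) (1 - u)) (at u)"
    by (auto intro!: derivative_eq_intros poly_DERIV)
  moreover have "((\<lambda>u. (-1) ^ j * poly (shifted_legendre j) u) has_real_derivative (-1) ^ j * poly (pderiv (shifted_legendre j)) u) (at u)"
    by (auto intro!: derivative_eq_intros poly_DERIV)
  ultimately show ?thesis using DERIV_unique by fastforce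
qed

text \<open>Positivity from 1 on, together with the reflection u -> 1 - u, excludes all real zeros
  outside (0,1). The theorem quantifies over all real zeros, and this places the corresponding
  points inside their cells.\<close>

lemma legendre_deriv_roots:
  assumes "j \<ge> 1" "poly (pderiv (shifted_legendre j)) s = 0"
  shows "0 < s" "s < 1"
proof -
  show "s < 1" using legendre_deriv_pos[of j s] assms by fastforce
  show "0 < s"
  proof (rule ccontr)
    assume "\<not> 0 < s"
    then have "poly (pderiv (shifted_legendre j)) (1 - s) > 0"
      using legendre_deriv_pos[of j "1 - s"] assms by simp
    then show False using legendre_deriv_reflect[of j s] assms(2) by simp
  qed
qed

subsection \<open>A discrete Gronwall inequality\<close>

text \<open>Here \<open>c n j\<close> are the Legendre coefficients on the cell \<open>n\<close>. All of them except the top one are controlled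
  directly, so the continuity conditions at the mesh points, in which Legendre polynomials take the values
  \<open>1\<close> and \<open>(-1)^j\<close>, form a recursion \<open>z (n + 1) = (-1)^m * z n + \<dots>\<close> for the top one. The defects
  \<open>\<tau>\<close> need not be small with \<open>h\<close>: they telescope in this recursion. The terms \<open>g n j\<close> enter the nodal
  values only for odd \<open>j + m\<close>, where they have to be smaller by a factor \<open>h\<close>.\<close>

lemma discrete_stability:
  fixes m :: nat and T C0 :: real
  assumes "m \<ge> 1" "T > 0" "C0 \<ge> 0"
  obtains C h0 where "C > 0" "h0 > 0"
    "\<And>h N c r g \<tau> a b. \<lbrakk>0 < h; h < h0; real N * h \<le> T; 0 \<le> a; a \<le> b;
      \<And>n j. n < N \<Longrightarrow> j < m \<Longrightarrow> \<bar>c n j - (if j = 0 then r n else 0) - g n j\<bar>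
          \<le> C0 * h * ((\<Sum>j\<le>m. \<bar>c n j\<bar>) + h * (\<Sum>i<n. \<Sum>j\<le>m. \<bar>c i j\<bar>) + b);
      \<And>n j. n < N \<Longrightarrow> j < m \<Longrightarrow> \<bar>g n j\<bar> \<le> a;
      \<And>n j. n < N \<Longrightarrow> j < m \<Longrightarrow> odd (j + m) \<Longrightarrow> \<bar>g n j\<bar> \<le> h * b;
      r 0 = 0;
      \<And>n. Suc n < N \<Longrightarrow> \<bar>r (Suc n) - r n\<bar>
          \<le> C0 * h * ((\<Sum>j\<le>m. \<bar>c n j\<bar>) + h * (\<Sum>i<n. \<Sum>j\<le>m. \<bar>c i j\<bar>) + b);
      \<bar>(\<Sum>j\<le>m. (-1) ^ j * c 0 j) - \<tau> 0\<bar> \<le> b;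
      \<And>n. Suc n < N \<Longrightarrow>
          \<bar>(\<Sum>j\<le>m. (-1) ^ j * c (Suc n) j) - (\<Sum>j\<le>m. c n j) - \<tau> (Suc n) + (-1) ^ m * \<tau> n\<bar> \<le> h * b;
      \<And>n. n < N \<Longrightarrow> \<bar>\<tau> n\<bar> \<le> b\<rbrakk> \<Longrightarrow>
      \<forall>n<N. (\<Sum>j\<le>m. \<bar>c n j\<bar>) \<le> C * b \<and>
        (\<forall>j<m. \<bar>c n j - (if j = 0 then r n else 0)\<bar> \<le> a + C * h * b)"
proof -
  \<comment> \<open>\<open>A\<close> bounds the growth of the combined unknown \<open>Z\<close> in
    one step: 1 from the jump condition, \<open>2 * m * (1 + C0)\<close> from the passage through a
    cell, \<open>C0\<close> from the increment of \<open>r\<close>. \<open>A1\<close> adds what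
    accumulates over a time of length \<open>T\<close>, \<open>A2\<close> the recovery of all
    coefficients, and \<open>G\<close> is the resulting Gronwall factor. The threshold
    \<open>h0\<close> allows the implicit term in \<open>y n\<close> to be absorbed with the factor
    1/2.\<close>
  define A where "A = 1 + 2 * real m * (1 + C0) + C0"
  define A1 where "A1 = 1 + A * (1 + T)"
  define A2 where "A2 = 2 * real m * (A1 + 1 + C0) + 2 * A1 + 1"
  define G where "G = exp (2 * A2 * T)"
  define C where "C = 2 * A2 * G + C0 * (2 * A2 * G + G + 1)"
  define h0 where "h0 = min 1 (1 / (4 * real m * C0 + 1))"
  have A: "A \<ge> 1" "C0 \<le> A" using assms by (auto simp: A_def)
  have A1: "A1 \<ge> 1" using A assms by (simp add: A1_def)
  have A2: "A2 \<ge> 1" using A1 assms by (auto simp: A2_def)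
  have G: "G > 0" by (simp add: G_def)
  have C: "C > 0" using A2 G assms by (auto simp: C_def intro!: add_pos_nonneg)
  have h0: "h0 > 0" using assms by (simp add: h0_def add_nonneg_pos)
  show ?thesis
  proof (rule that[OF C h0])
    fix h :: real and N :: nat and c g :: "nat \<Rightarrow> nat \<Rightarrow> real" and r \<tau> :: "nat \<Rightarrow> real" and a b :: real
    define y where "y n = (\<Sum>j\<le>m. \<bar>c n j\<bar>)" for n
    define S where "S n = h * (\<Sum>i<n. y i)" for n
    assume h: "0 < h" "h < h0" and Nh: "real N * h \<le> T" and a: "0 \<le> a" "a \<le> b"
    assume "\<And>n j. n < N \<Longrightarrow> j < m \<Longrightarrow> \<bar>c n j - (if j = 0 then r n else 0) - g n j\<bar>
          \<le> C0 * h * ((\<Sum>j\<le>m. \<bar>c n j\<bar>) + h * (\<Sum>i<n. \<Sum>j\<le>m. \<bar>c i j\<bar>) + b)"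
    then have c: "\<bar>c n j - (if j = 0 then r n else 0) - g n j\<bar> \<le> C0 * h * (y n + S n + b)" if "n < N" "j < m" for n j
      using that unfolding y_def S_def by simp
    assume g: "\<And>n j. n < N \<Longrightarrow> j < m \<Longrightarrow> \<bar>g n j\<bar> \<le> a"
      "\<And>n j. n < N \<Longrightarrow> j < m \<Longrightarrow> odd (j + m) \<Longrightarrow> \<bar>g n j\<bar> \<le> h * b"
    assume r0: "r 0 = 0"
    assume "\<And>n. Suc n < N \<Longrightarrow> \<bar>r (Suc n) - r n\<bar>
          \<le> C0 * h * ((\<Sum>j\<le>m. \<bar>c n j\<bar>) + h * (\<Sum>i<n. \<Sum>j\<le>m. \<bar>c i j\<bar>) + b)"
    then have r: "\<bar>r (Suc n) - r n\<bar> \<le> C0 * h * (y n + S n + b)" if "Suc n < N" for n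
      using that unfolding y_def S_def by simp
    define L where "L n = (\<Sum>j\<le>m. (-1) ^ j * c n j)" for n
    define R where "R n = (\<Sum>j\<le>m. c n j)" for n
    define \<sigma> where "\<sigma> = ((-1) ^ m :: real)"
    have s: "\<bar>\<sigma>\<bar> = 1" by (simp add: \<sigma>_def power_abs)
    assume "\<bar>(\<Sum>j\<le>m. (-1) ^ j * c 0 j) - \<tau> 0\<bar> \<le> b"
    then have L0: "\<bar>L 0 - \<tau> 0\<bar> \<le> b" by (simp add: L_def)
    assume "\<And>n. Suc n < N \<Longrightarrow>
          \<bar>(\<Sum>j\<le>m. (-1) ^ j * c (Suc n) j) - (\<Sum>j\<le>m. c n j) - \<tau> (Suc n) + (-1) ^ m * \<tau> n\<bar> \<le> h * b"
    then have jump: "\<bar>L (Suc n) - R n - \<tau> (Suc n) + \<sigma> * \<tau> n\<bar> \<le> h * b" if "Suc n < N" for n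
      using that unfolding L_def R_def \<sigma>_def by simp
    assume \<tau>: "\<And>n. n < N \<Longrightarrow> \<bar>\<tau> n\<bar> \<le> b"
    have b: "b \<ge> 0" using a by simp
    have y0: "y n \<ge> 0" for n by (auto simp: y_def intro: sum_nonneg)
    have S0: "S n \<ge> 0" for n using h y0 by (auto simp: S_def intro!: sum_nonneg mult_nonneg_nonneg)
    have Smono: "S i \<le> S n" if "i \<le> n" for i n
      unfolding S_def using h y0 that by (intro mult_left_mono sum_mono2) auto
    \<comment> \<open>The passage from the left to the right end of a cell. In
      \<open>R n - \<sigma> * L n\<close> the coefficient with index \<open>j\<close> has the weight
      1 - (-1)^(j + m), which is 0 for \<open>j = m\<close> and for all even \<open>j + m\<close>.
      The uncontrolled top coefficient drops out, and only the modes with odd \<open>j + m\<close>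
      remain; this is why \<open>g\<close> has to be small only there.\<close>
    have RL: "\<bar>R n - \<sigma> * L n - (1 - \<sigma>) * r n\<bar> \<le> 2 * real m * (1 + C0) * h * (b + y n + S n)" if n: "n < N" for n
    proof -
      define w where "w j = 1 - \<sigma> * (-1) ^ j" for j :: nat
      have wj: "w j = 1 - (-1) ^ (j + m)" for j by (simp add: w_def \<sigma>_def power_add)
      have wm: "w m = 0" by (simp add: w_def \<sigma>_def flip: power_mult_distrib)
      have "R n - \<sigma> * L n = (\<Sum>j\<le>m. w j * c n j)"
        by (simp add: R_def L_def w_def sum_distrib_left sum_subtractf left_diff_distrib mult.assoc)
      also have "\<dots> = (\<Sum>j<m. w j * c n j)" using wm by (simp add: lessThan_Suc_atMost[symmetric])
      also have "\<dots> = (\<Sum>j<m. w j * (c n j - (if j = 0 then r n else 0))) + (\<Sum>j<m. if j = 0 then w 0 * r n else 0)"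
        by (subst sum.distrib[symmetric]) (auto intro!: sum.cong simp: algebra_simps)
      also have "(\<Sum>j<m. if j = 0 then w 0 * r n else 0) = (1 - \<sigma>) * r n"
        using assms(1) by (simp add: w_def)
      finally have "\<bar>R n - \<sigma> * L n - (1 - \<sigma>) * r n\<bar> = \<bar>\<Sum>j<m. w j * (c n j - (if j = 0 then r n else 0))\<bar>" by simp
      also have "\<dots> \<le> (\<Sum>j<m. 2 * (1 + C0) * h * (b + y n + S n))"
      proof (intro order_trans[OF sum_abs] sum_mono)
        fix j assume j: "j \<in> {..<m}"
        show "\<bar>w j * (c n j - (if j = 0 then r n else 0))\<bar> \<le> 2 * (1 + C0) * h * (b + y n + S n)"
        proof (cases "odd (j + m)")
          case False
          then have "w j = 0" by (simp add: wj)
          then show ?thesis using h b y0[of n] S0[of n] assms by (simp add: mult_nonneg_nonneg add_nonneg_nonneg)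
        next
          case True
          then have w: "w j = 2" by (simp add: wj)
          have "\<bar>c n j - (if j = 0 then r n else 0)\<bar> \<le> h * b + C0 * h * (y n + S n + b)"
            using c[OF n, of j] g(2)[OF n _ True] j by auto
          also have "\<dots> \<le> (1 + C0) * h * (b + y n + S n)"
          proof -
            have "0 \<le> h * (y n + S n)" using h y0[of n] S0[of n] by simp
            then show ?thesis by (simp add: algebra_simps)
          qed
          finally have "2 * \<bar>c n j - (if j = 0 then r n else 0)\<bar> \<le> 2 * ((1 + C0) * h * (b + y n + S n))" by (rule mult_left_mono) simp
          then show ?thesis unfolding abs_mult w by (simp only: mult.assoc abs_numeral)
        qed
      qed
      finally show ?thesis by (simp add: algebra_simps)
    qed
    \<comment> \<open>Since the mode 0 contains \<open>r n\<close>, the passage through a cell adds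
      \<open>(1 - \<sigma>) * r n\<close>, which is not of order \<open>h\<close>. Subtracting
      \<open>r n\<close> as well as \<open>\<tau> n\<close> turns this into the increment of
      \<open>r\<close>. Then \<open>Z (Suc n)\<close> is \<open>\<sigma> * Z n\<close> up to terms
      of order \<open>h\<close>, and the modulus 1 of \<open>\<sigma>\<close> keeps the recursion
      stable.\<close>
    define Z where "Z n = L n - \<tau> n - r n" for n
    have Zstep: "\<bar>Z (Suc n)\<bar> \<le> \<bar>Z n\<bar> + A * h * (b + y n + S n)" if n: "Suc n < N" for n
    proof -
      have "Z (Suc n) = \<sigma> * Z n + (L (Suc n) - R n - \<tau> (Suc n) + \<sigma> * \<tau> n)
         + (R n - \<sigma> * L n - (1 - \<sigma>) * r n) - (r (Suc n) - r n)"
        by (simp add: Z_def algebra_simps)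
      then have "\<bar>Z (Suc n)\<bar> \<le> \<bar>\<sigma> * Z n\<bar> + h * b + 2 * real m * (1 + C0) * h * (b + y n + S n) + C0 * h * (y n + S n + b)"
        using jump[OF n] RL[of n] r[OF n] n by linarith
      also have "\<bar>\<sigma> * Z n\<bar> = \<bar>Z n\<bar>" using s by (simp add: abs_mult)
      also have "\<bar>Z n\<bar> + h * b + 2 * real m * (1 + C0) * h * (b + y n + S n) + C0 * h * (y n + S n + b)
         \<le> \<bar>Z n\<bar> + A * h * (b + y n + S n)"
      proof -
        have "0 \<le> h * (y n + S n)" using h y0 S0 by simp
        then show ?thesis by (simp add: A_def algebra_simps)
      qed
      finally show ?thesis .
    qed
    \<comment> \<open>The memory \<open>S\<close> is monotone, so \<open>h\<close> times its sum
      over the past cells is at most \<open>T * S n\<close>; \<open>h\<close> times the sum of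
      \<open>y\<close> is again \<open>S n\<close>.\<close>
    have acc: "A * h * (\<Sum>i<n. b + y i + S i) \<le> A * (1 + T) * (b + S n)" if "n < N" for n
    proof -
      have "h * (\<Sum>i<n. b + y i + S i) \<le> h * (\<Sum>i<n. b + y i + S n)"
        using h Smono by (intro mult_left_mono sum_mono) auto
      also have "\<dots> = real n * h * (b + S n) + S n"
        by (simp add: sum.distrib S_def algebra_simps)
      also have "\<dots> \<le> T * (b + S n) + S n"
      proof -
        have "real n * h \<le> real N * h" using that h by simp
        then show ?thesis using Nh b S0[of n] by (intro add_right_mono mult_right_mono) auto
      qed
      also have "\<dots> \<le> (1 + T) * (b + S n)" using b by (simp add: algebra_simps)
      finally have "A * (h * (\<Sum>i<n. b + y i + S i)) \<le> A * ((1 + T) * (b + S n))"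
        using A by (intro mult_left_mono) auto
      then show ?thesis by (simp add: mult.assoc)
    qed
    have Z: "\<bar>Z n\<bar> \<le> A1 * (b + S n)" if n: "n < N" for n
    proof -
      have "\<bar>Z n\<bar> \<le> b + A * h * (\<Sum>i<n. b + y i + S i)" using n
      proof (induction n)
        case 0 then show ?case using L0 r0 by (simp add: Z_def)
      next
        case (Suc n) then show ?case using Zstep[of n] by (simp add: algebra_simps)
      qed
      also have "\<dots> \<le> b + A * (1 + T) * (b + S n)" using acc[OF n] by simp
      also have "\<dots> \<le> A1 * (b + S n)" using S0[of n] by (simp add: A1_def algebra_simps)
      finally show ?thesis .
    qed
    have rb: "\<bar>r n\<bar> \<le> A1 * (b + S n)" if n: "n < N" for n
    proof -
      have "\<bar>r n\<bar> \<le> A * h * (\<Sum>i<n. b + y i + S i)" using n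
      proof (induction n)
        case 0 then show ?case using r0 by simp
      next
        case (Suc n)
        have "C0 * h * (y n + S n + b) \<le> A * h * (y n + S n + b)"
          using A h y0 S0 b by (intro mult_right_mono) auto
        then show ?case using Suc r[of n] by (simp add: algebra_simps)
      qed
      also have "\<dots> \<le> A * (1 + T) * (b + S n)" using acc[OF n] by simp
      also have "\<dots> \<le> A1 * (b + S n)" using S0[of n] b by (simp add: A1_def algebra_simps)
      finally show ?thesis .
    qed
    \<comment> \<open>The top coefficient is the only one without a direct bound; it is recovered
      from the left value \<open>L n\<close>, where it has the factor \<open>\<sigma>\<close>. The
      bounds for the others contain \<open>y n\<close> itself with a factor \<open>h\<close>, which
      is absorbed on the left.\<close>
    have yb: "y n \<le> 2 * A2 * (b + S n)" if n: "n < N" for n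
    proof -
      define q where "q = (\<Sum>j<m. \<bar>c n j\<bar>)"
      have cj: "\<bar>c n j\<bar> \<le> A1 * (b + S n) + b + C0 * h * (y n + S n + b)" if j: "j < m" for j
      proof -
        have "\<bar>c n j\<bar> \<le> \<bar>r n\<bar> + a + C0 * h * (y n + S n + b)"
          using c[OF n j] g(1)[OF n j] by (auto split: if_splits)
        then show ?thesis using rb[OF n] a by linarith
      qed
      have q: "q \<le> real m * (A1 * (b + S n) + b + C0 * h * (y n + S n + b))"
        unfolding q_def using sum_bounded_above[of "{..<m}" "\<lambda>j. \<bar>c n j\<bar>"] cj by simp
      have "L n = (\<Sum>j<m. (-1) ^ j * c n j) + \<sigma> * c n m"
        unfolding L_def lessThan_Suc_atMost[symmetric] by (simp add: \<sigma>_def)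
      moreover have "\<bar>\<Sum>j<m. (-1) ^ j * c n j\<bar> \<le> q"
        unfolding q_def by (rule order_trans[OF sum_abs]) (simp add: abs_mult power_abs)
      ultimately have "\<bar>\<sigma> * c n m\<bar> \<le> \<bar>L n\<bar> + q" by linarith
      then have cm: "\<bar>c n m\<bar> \<le> \<bar>L n\<bar> + q" using s by (simp add: abs_mult)
      have Ln: "\<bar>L n\<bar> \<le> 2 * A1 * (b + S n) + b"
        using Z[OF n] rb[OF n] \<tau>[OF n] by (simp add: Z_def)
      have "y n = q + \<bar>c n m\<bar>" unfolding y_def q_def lessThan_Suc_atMost[symmetric] by simp
      then have "y n \<le> 2 * (real m * (A1 * (b + S n) + b + C0 * h * (y n + S n + b))) + 2 * A1 * (b + S n) + b"
        using cm q Ln by linarith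
      also have "\<dots> \<le> A2 * (b + S n) + 2 * real m * C0 * h * y n"
      proof -
        have h1: "h \<le> 1" using h by (simp add: h0_def)
        have "2 * real m * C0 * (h * (b + S n)) \<le> 2 * real m * C0 * (1 * (b + S n))"
          using S0[of n] assms h1 b by (intro mult_left_mono mult_right_mono) auto
        moreover have "0 \<le> real m * C0 * b" using assms b by simp
        moreover have "0 \<le> real m * S n" using S0 by simp
        ultimately show ?thesis using S0[of n] unfolding A2_def by (simp only: algebra_simps)
      qed
      also have "2 * real m * C0 * h * y n \<le> 1 / 2 * y n"
      proof (intro mult_right_mono y0)
        have "h \<le> 1 / (4 * real m * C0 + 1)" using h by (simp add: h0_def)
        moreover have "4 * real m * C0 + 1 > 0" using assms by (simp add: add_nonneg_pos)
        ultimately have "h * (4 * real m * C0 + 1) \<le> 1" by (simp add: pos_le_divide_eq)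
        then show "2 * real m * C0 * h \<le> 1 / 2" using h by (simp add: algebra_simps)
      qed
      finally show ?thesis by simp
    qed
    \<comment> \<open>The Gronwall argument proper: \<open>b + S n\<close> grows at most by the
      factor \<open>1 + 2 * A2 * h\<close> per cell, and there are at most \<open>T / h\<close>
      cells.\<close>
    have SG: "b + S n \<le> G * b" if n: "n < N" for n
    proof -
      have "b + S n \<le> (1 + 2 * A2 * h) ^ n * b" using n
      proof (induction n)
        case 0 then show ?case by (simp add: S_def)
      next
        case (Suc n)
        have "b + S (Suc n) = b + S n + h * y n" by (simp add: S_def algebra_simps)
        also have "\<dots> \<le> b + S n + h * (2 * A2 * (b + S n))"
          using yb[of n] Suc h by (intro add_left_mono mult_left_mono) auto
        also have "\<dots> = (1 + 2 * A2 * h) * (b + S n)" by (simp add: algebra_simps)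
        also have "\<dots> \<le> (1 + 2 * A2 * h) * ((1 + 2 * A2 * h) ^ n * b)"
          using Suc A2 h by (intro mult_left_mono) auto
        finally show ?case by (simp add: mult.assoc)
      qed
      also have "(1 + 2 * A2 * h) ^ n * b \<le> G * b"
      proof (intro mult_right_mono b)
        have "(1 + 2 * A2 * h) ^ n \<le> exp (2 * A2 * h) ^ n"
          using exp_ge_add_one_self[of "2 * A2 * h"] A2 h by (intro power_mono) auto
        also have "\<dots> = exp (2 * A2 * (real n * h))" by (simp add: exp_of_nat_mult[symmetric] algebra_simps)
        also have "\<dots> \<le> G"
        proof -
          have "real n * h \<le> real N * h" using n h by simp
          then have "real n * h \<le> T" using Nh by linarith
          then show ?thesis using A2 by (simp add: G_def)
        qed
        finally show "(1 + 2 * A2 * h) ^ n \<le> G" .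
      qed
      finally show ?thesis .
    qed
    have yG: "y n \<le> 2 * A2 * G * b" if n: "n < N" for n
    proof -
      have "2 * A2 * (b + S n) \<le> 2 * A2 * (G * b)" using SG[OF n] A2 by (intro mult_left_mono) auto
      then show ?thesis using yb[OF n] by (simp add: mult.assoc)
    qed
    show "\<forall>n<N. (\<Sum>j\<le>m. \<bar>c n j\<bar>) \<le> C * b \<and>
        (\<forall>j<m. \<bar>c n j - (if j = 0 then r n else 0)\<bar> \<le> a + C * h * b)"
    proof (intro allI impI conjI)
      fix n assume n: "n < N"
      have "0 \<le> C0 * (2 * A2 * G + G + 1) * b" using assms A2 G b by auto
      then show "(\<Sum>j\<le>m. \<bar>c n j\<bar>) \<le> C * b" using yG[OF n] by (simp add: y_def C_def algebra_simps)
      fix j assume j: "j < m"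
      have "C0 * h * (y n + S n + b) \<le> C0 * h * ((2 * A2 * G + G + 1) * b)"
        using yG[OF n] SG[OF n] b h assms by (intro mult_left_mono) (auto simp: algebra_simps)
      also have "\<dots> \<le> C * h * b"
      proof -
        have "0 \<le> 2 * A2 * G * (h * b)" using A2 G h b by auto
        then show ?thesis by (simp add: C_def algebra_simps)
      qed
      finally show "\<bar>c n j - (if j = 0 then r n else 0)\<bar> \<le> a + C * h * b"
        using c[OF n j] g(1)[OF n j] by linarith
    qed
  qed
qed

subsection \<open>Smooth functions and Volterra operators\<close>

lemma Ck_on_real_Suc:
  fixes f :: "real \<Rightarrow> real"
  shows "Ck_on (Suc k) S f \<longleftrightarrow>
    (\<exists>g. (\<forall>p\<in>S. (f has_real_derivative g p) (at p within S)) \<and> Ck_on k S g)"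
  by (simp add: has_field_derivative_def)

lemma Ck_on_cong:
  assumes "\<And>x. x \<in> S \<Longrightarrow> f x = g x"
  shows "Ck_on k S f \<longleftrightarrow> Ck_on k S g"
proof (cases k)
  case 0
  then show ?thesis using assms by (simp cong: continuous_on_cong)
next
  case (Suc l)
  have "(f has_derivative F) (at p within S) \<longleftrightarrow> (g has_derivative F) (at p within S)" if "p \<in> S" for p F
    using that assms has_derivative_transform[of p S f g F] has_derivative_transform[of p S g f F] by auto
  then show ?thesis by (simp add: Suc)
qed

lemma Ck_on_continuous: "Ck_on k S f \<Longrightarrow> continuous_on S f"
  by (cases k) (auto simp: continuous_on_eq_continuous_within intro: has_derivative_continuous)

lemma Ck_on_SucD: "Ck_on (Suc k) S f \<Longrightarrow> Ck_on k S f"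
proof (induction k arbitrary: f)
  case 0
  then show ?case unfolding Ck_on.simps(1) by (rule Ck_on_continuous)
next
  case (Suc k)
  obtain G where G: "\<forall>p\<in>S. (f has_derivative (\<lambda>v. G p \<bullet> v)) (at p within S)"
      "\<forall>b\<in>Basis. Ck_on (Suc k) S (\<lambda>p. G p \<bullet> b)"
    using Suc.prems by (subst (asm) Ck_on.simps) blast
  have "\<forall>b\<in>Basis. Ck_on k S (\<lambda>p. G p \<bullet> b)" using G(2) Suc.IH by blast
  then show ?case using G(1) by (subst Ck_on.simps) blast
qed

lemma Ck_on_mono: "Ck_on k S f \<Longrightarrow> j \<le> k \<Longrightarrow> Ck_on j S f"
proof (induction k)
  case (Suc k)
  then show ?case using Ck_on_SucD by (metis le_SucE)
qed simp

lemma Ck_on_real_derivE: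
  fixes f :: "real \<Rightarrow> real"
  assumes "Ck_on (Suc k) S f"
  obtains g where "\<And>p. p \<in> S \<Longrightarrow> (f has_real_derivative g p) (at p within S)" "Ck_on k S g"
  using assms unfolding Ck_on_real_Suc by blast

lemma Ck_on_real_SucI:
  fixes f :: "real \<Rightarrow> real"
  assumes "\<And>p. p \<in> S \<Longrightarrow> (f has_real_derivative g p) (at p within S)" "Ck_on k S g"
  shows "Ck_on (Suc k) S f"
  using assms unfolding Ck_on_real_Suc by blast

lemma Ck_on_add:
  fixes f g :: "real \<Rightarrow> real"
  shows "Ck_on k S f \<Longrightarrow> Ck_on k S g \<Longrightarrow> Ck_on k S (\<lambda>x. f x + g x)"
proof (induction k arbitrary: f g)
  case (Suc k)
  from Suc.prems obtain f' g' where "\<And>p. p \<in> S \<Longrightarrow> (f has_real_derivative f' p) (at p within S)" "Ck_on k S f'"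
    "\<And>p. p \<in> S \<Longrightarrow> (g has_real_derivative g' p) (at p within S)" "Ck_on k S g'"
    by (metis Ck_on_real_derivE)
  then show ?case
    by (intro Ck_on_real_SucI[where g = "\<lambda>x. f' x + g' x"] Suc.IH) (auto intro: DERIV_add)
qed (auto intro: continuous_on_add)

lemma Ck_on_mult:
  fixes f g :: "real \<Rightarrow> real"
  shows "Ck_on k S f \<Longrightarrow> Ck_on k S g \<Longrightarrow> Ck_on k S (\<lambda>x. f x * g x)"
proof (induction k arbitrary: f g)
  case (Suc k)
  from Suc.prems obtain f' g' where *: "\<And>p. p \<in> S \<Longrightarrow> (f has_real_derivative f' p) (at p within S)" "Ck_on k S f'"
    "\<And>p. p \<in> S \<Longrightarrow> (g has_real_derivative g' p) (at p within S)" "Ck_on k S g'"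
    by (metis Ck_on_real_derivE)
  have "Ck_on k S (\<lambda>x. f' x * g x + g' x * f x)"
    by (intro Ck_on_add Suc.IH * Ck_on_SucD[OF Suc.prems(1)] Ck_on_SucD[OF Suc.prems(2)])
  then show ?case
    by (intro Ck_on_real_SucI[where g = "\<lambda>x. f' x * g x + g' x * f x"]) (auto intro: DERIV_mult *)
qed (auto intro: continuous_on_mult)

lemma Ck_on_const: "Ck_on k S (\<lambda>x::real. c)"
proof (induction k arbitrary: c)
  case (Suc k)
  then show ?case by (intro Ck_on_real_SucI[where g = "\<lambda>x. 0"]) auto
qed auto

lemma Ck_on_diff:
  fixes f g :: "real \<Rightarrow> real"
  assumes "Ck_on k S f" "Ck_on k S g"
  shows "Ck_on k S (\<lambda>x. f x - g x)"
  using Ck_on_add[OF assms(1) Ck_on_mult[OF Ck_on_const[of k S "-1"] assms(2)]] by simp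

lemma Ck_on_inverse:
  fixes f :: "real \<Rightarrow> real"
  shows "Ck_on k S f \<Longrightarrow> (\<And>x. x \<in> S \<Longrightarrow> f x \<noteq> 0) \<Longrightarrow> Ck_on k S (\<lambda>x. inverse (f x))"
proof (induction k arbitrary: f)
  case (Suc k)
  obtain f' where f': "\<And>p. p \<in> S \<Longrightarrow> (f has_real_derivative f' p) (at p within S)" "Ck_on k S f'"
    by (metis Ck_on_real_derivE Suc.prems(1))
  have i: "Ck_on k S (\<lambda>x. inverse (f x))" using Suc.IH[OF Ck_on_SucD[OF Suc.prems(1)] Suc.prems(2)] by blast
  have "Ck_on k S (\<lambda>x. (- 1) * (inverse (f x) * f' x * inverse (f x)))"
    by (intro Ck_on_mult Ck_on_const i f')
  then show ?case
    by (intro Ck_on_real_SucI[where g = "\<lambda>x. (- 1) * (inverse (f x) * f' x * inverse (f x))"])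
       (auto intro!: DERIV_inverse' f' Suc.prems)
qed (auto intro: continuous_on_inverse)

text \<open>\<open>Ck_on\<close> hides the derivatives behind nested existential quantifiers.
  Choosing them once, as a sequence, makes Taylor's theorem applicable.\<close>

lemma Ck_on_derivs:
  fixes f :: "real \<Rightarrow> real"
  assumes "Ck_on k S f"
  obtains D where "D 0 = f" "\<And>j p. j < k \<Longrightarrow> p \<in> S \<Longrightarrow> (D j has_real_derivative D (Suc j) p) (at p within S)"
    "\<And>j. j \<le> k \<Longrightarrow> continuous_on S (D j)"
proof -
  have "\<exists>D. D 0 = f \<and> (\<forall>j<k. \<forall>p\<in>S. (D j has_real_derivative D (Suc j) p) (at p within S)) \<and>
    (\<forall>j\<le>k. continuous_on S (D j))"
    using assms
  proof (induction k arbitrary: f)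
    case 0
    then show ?case by (intro exI[of _ "\<lambda>_. f"]) auto
  next
    case (Suc k)
    obtain g where g: "\<And>p. p \<in> S \<Longrightarrow> (f has_real_derivative g p) (at p within S)" "Ck_on k S g"
      using Suc.prems by (metis Ck_on_real_derivE)
    obtain D where D: "D 0 = g" "\<forall>j<k. \<forall>p\<in>S. (D j has_real_derivative D (Suc j) p) (at p within S)"
      "\<forall>j\<le>k. continuous_on S (D j)" using Suc.IH[OF g(2)] by blast
    have "continuous_on S f" using Suc.prems Ck_on_continuous by blast
    then show ?case
      using D g(1) by (intro exI[of _ "case_nat f D"]) (auto split: nat.split)
  qed
  then show ?thesis using that by blast
qed

text \<open>Derivatives within a nondegenerate interval are unique, also at its endpoints, so the
  choice made by \<open>vector_derivative\<close> agrees with any chain \<open>D\<close>. This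
  carries the condition on the m-th derivative at 0 over to the chain used in the estimates.\<close>

lemma deriv_within_eq:
  assumes T: "T > 0" and D: "D 0 = f"
    "\<And>j p. j < k \<Longrightarrow> p \<in> {0..T} \<Longrightarrow> (D j has_real_derivative D (Suc j) p) (at p within {0..T})"
    and "j \<le> k" "t \<in> {0..T}"
  shows "deriv_within j {0..T} f t = D j t"
  using assms(4,5)
proof (induction j arbitrary: t)
  case 0
  then show ?case using D by simp
next
  case (Suc j)
  have "(D j has_vector_derivative D (Suc j) t) (at t within {0..T})"
    using D(2)[of j t] Suc.prems by (simp add: has_real_derivative_iff_has_vector_derivative)
  then have "(deriv_within j {0..T} f has_vector_derivative D (Suc j) t) (at t within {0..T})"
    by (rule has_vector_derivative_transform[rotated 2]) (use Suc in auto)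
  then show ?case
    using vector_derivative_within_cbox[of 0 T] T Suc.prems by (auto simp: cbox_interval)
qed

section \<open>Kernels on the triangle\<close>

lemma kernel_domain_compact: "compact (kernel_domain T)"
proof -
  have "kernel_domain T = {p. 0 \<le> snd p} \<inter> {p. snd p \<le> fst p} \<inter> {p. fst p \<le> T}"
    by (auto simp: kernel_domain_def)
  moreover have "closed \<dots>"
    by (intro closed_Int closed_Collect_le continuous_intros)
  moreover have "kernel_domain T \<subseteq> {0..T} \<times> {0..T}" by (auto simp: kernel_domain_def)
  then have "bounded (kernel_domain T)"
    using bounded_subset bounded_Times bounded_closed_interval by metis
  ultimately show ?thesis by (simp add: compact_eq_bounded_closed)
qed

lemma kernel_bounded:
  assumes "continuous_on (kernel_domain T) (\<lambda>(t, s). K t s)"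
  obtains C where "C > 0" "\<And>t s. 0 \<le> s \<Longrightarrow> s \<le> t \<Longrightarrow> t \<le> T \<Longrightarrow> \<bar>K t s\<bar> \<le> (C::real)"
proof -
  have "bounded ((\<lambda>(t, s). K t s) ` kernel_domain T)"
    by (intro compact_imp_bounded compact_continuous_image assms kernel_domain_compact)
  then obtain C where C: "C > 0" "\<forall>y\<in>(\<lambda>(t, s). K t s) ` kernel_domain T. norm y \<le> C"
    unfolding bounded_pos by blast
  have "\<bar>K t s\<bar> \<le> C" if "0 \<le> s" "s \<le> t" "t \<le> T" for t s
    using C(2) that by (force simp: kernel_domain_def)
  then show ?thesis using that C(1) by blast
qed

text \<open>One chain rule gives all three derivatives: the gradient within the triangle is composed
  with the curves t -> (t, s), s -> (t, s) and t -> (t, t), each of which stays in the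
  triangle.\<close>

lemma kernel_partials:
  assumes "Ck_on (Suc k) (kernel_domain T) (\<lambda>(t, s). K t s)"
  obtains K1 K2 where "Ck_on k (kernel_domain T) (\<lambda>(t, s). K1 t s)" "Ck_on k (kernel_domain T) (\<lambda>(t, s). K2 t s)"
    "\<And>t s. 0 \<le> s \<Longrightarrow> s \<le> t \<Longrightarrow> t \<le> T \<Longrightarrow> ((\<lambda>t. K t s) has_real_derivative K1 t s) (at t within {s..T})"
    "\<And>t s. 0 \<le> s \<Longrightarrow> s \<le> t \<Longrightarrow> t \<le> T \<Longrightarrow> ((\<lambda>s. K t s) has_real_derivative K2 t s) (at s within {0..t})"
    "\<And>t. t \<in> {0..T} \<Longrightarrow> ((\<lambda>t. K t t) has_real_derivative (K1 t t + K2 t t)) (at t within {0..T})"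
proof -
  let ?D = "kernel_domain T"
  obtain G where G: "\<And>p. p \<in> ?D \<Longrightarrow> ((\<lambda>(t, s). K t s) has_derivative (\<lambda>v. G p \<bullet> v)) (at p within ?D)"
      "\<forall>b\<in>Basis. Ck_on k ?D (\<lambda>p. G p \<bullet> b)"
    using assms by auto
  have B: "(1, 0) \<in> (Basis :: (real \<times> real) set)" "(0, 1) \<in> (Basis :: (real \<times> real) set)"
    by (auto simp: Basis_prod_def)
  have b1: "(\<lambda>(t, s). fst (G (t, s))) = (\<lambda>p. G p \<bullet> (1, 0))"
    and b2: "(\<lambda>(t, s). snd (G (t, s))) = (\<lambda>p. G p \<bullet> (0, 1))"
    by (auto simp: inner_prod_def)
  have curve: "((\<lambda>u. K (\<alpha> u) (\<beta> u)) has_real_derivative (fst (G (\<alpha> u, \<beta> u)) * a + snd (G (\<alpha> u, \<beta> u)) * b)) (at u within S)"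
    if "(\<alpha> has_real_derivative a) (at u within S)" "(\<beta> has_real_derivative b) (at u within S)"
      "u \<in> S" "(\<lambda>u. (\<alpha> u, \<beta> u)) ` S \<subseteq> ?D" for \<alpha> \<beta> a b u S
  proof -
    have "((\<lambda>u. (\<alpha> u, \<beta> u)) has_derivative (\<lambda>v. (a * v, b * v))) (at u within S)"
      using that(1,2) unfolding has_field_derivative_def by (rule has_derivative_Pair)
    moreover have "((\<lambda>(t, s). K t s) has_derivative (\<lambda>v. G (\<alpha> u, \<beta> u) \<bullet> v)) (at (\<alpha> u, \<beta> u) within (\<lambda>u. (\<alpha> u, \<beta> u)) ` S)"
      using that(3,4) by (intro has_derivative_subset[OF G(1)]) auto
    ultimately have "((\<lambda>x. (\<lambda>(t, s). K t s) (\<alpha> x, \<beta> x)) has_derivative (\<lambda>v. G (\<alpha> u, \<beta> u) \<bullet> (a * v, b * v))) (at u within S)"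
      by (rule has_derivative_in_compose)
    moreover have "(\<lambda>v. G (\<alpha> u, \<beta> u) \<bullet> (a * v, b * v)) = (*) (fst (G (\<alpha> u, \<beta> u)) * a + snd (G (\<alpha> u, \<beta> u)) * b)"
      by (auto simp: inner_prod_def algebra_simps fun_eq_iff)
    ultimately show ?thesis unfolding has_field_derivative_def by simp
  qed
  show ?thesis
  proof (rule that[of "\<lambda>t s. fst (G (t, s))" "\<lambda>t s. snd (G (t, s))"])
    show "Ck_on k ?D (\<lambda>(t, s). fst (G (t, s)))" "Ck_on k ?D (\<lambda>(t, s). snd (G (t, s)))"
      unfolding b1 b2 using G(2) B by auto
    show "((\<lambda>t. K t s) has_real_derivative fst (G (t, s))) (at t within {s..T})"
      if "0 \<le> s" "s \<le> t" "t \<le> T" for t s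
    proof -
      have "(\<lambda>u. (u, s)) ` {s..T} \<subseteq> ?D" using that by (auto simp: kernel_domain_def)
      then show ?thesis using curve[of "\<lambda>t. t" 1 t "{s..T}" "\<lambda>_. s" 0] that by simp
    qed
    show "((\<lambda>s. K t s) has_real_derivative snd (G (t, s))) (at s within {0..t})"
      if "0 \<le> s" "s \<le> t" "t \<le> T" for t s
    proof -
      have "(\<lambda>u. (t, u)) ` {0..t} \<subseteq> ?D" using that by (auto simp: kernel_domain_def)
      then show ?thesis using curve[of "\<lambda>_. t" 0 s "{0..t}" "\<lambda>s. s" 1] that by simp
    qed
    show "((\<lambda>t. K t t) has_real_derivative (fst (G (t, t)) + snd (G (t, t)))) (at t within {0..T})"
      if "t \<in> {0..T}" for t
    proof -
      have "(\<lambda>u. (u, u)) ` {0..T} \<subseteq> ?D" by (auto simp: kernel_domain_def)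
      then show ?thesis using curve[of "\<lambda>t. t" 1 t "{0..T}" "\<lambda>s. s" 1] that by simp
    qed
  qed
qed

lemma Ck_on_diagonal:
  "Ck_on k (kernel_domain T) (\<lambda>(t, s). K t s) \<Longrightarrow> Ck_on k {0..T} (\<lambda>t. K t t)"
proof (induction k arbitrary: K)
  case 0
  then have "continuous_on (kernel_domain T) (\<lambda>(t, s). K t s)" by simp
  then have "continuous_on {0..T} (\<lambda>t. (\<lambda>(t, s). K t s) (t, t))"
    by (rule continuous_on_compose2) (auto intro!: continuous_intros simp: kernel_domain_def)
  then show ?case by simp
next
  case (Suc k)
  obtain K1 K2 where "Ck_on k (kernel_domain T) (\<lambda>(t, s). K1 t s)" "Ck_on k (kernel_domain T) (\<lambda>(t, s). K2 t s)"
    "\<And>t. t \<in> {0..T} \<Longrightarrow> ((\<lambda>t. K t t) has_real_derivative (K1 t t + K2 t t)) (at t within {0..T})"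
    by (rule kernel_partials[OF Suc.prems]) blast
  then show ?case by (intro Ck_on_real_SucI[where g = "\<lambda>t. K1 t t + K2 t t"] Ck_on_add Suc.IH) auto
qed

lemma continuous_on_kernel_section:
  assumes "continuous_on (kernel_domain T) (\<lambda>(t, s). K t s)" "t \<le> T"
  shows "continuous_on {0..t} (\<lambda>s. K t s)"
proof -
  have "continuous_on {0..t} (\<lambda>s. (\<lambda>(t, s). K t s) (t, s))"
    using assms by (intro continuous_on_compose2[OF assms(1)]) (auto intro!: continuous_intros simp: kernel_domain_def)
  then show ?thesis by simp
qed

text \<open>The substitution s = b p * v moves the dependence on the upper limit into the integrand,
  where continuity of parameter integrals over a fixed interval applies. It degenerates for
  \<open>b p = 0\<close>, which is treated separately.\<close>

lemma continuous_on_variable_integral: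
  fixes g :: "'a::topological_space \<Rightarrow> real \<Rightarrow> real"
  assumes "continuous_on (Sigma U (\<lambda>p. {0..b p})) (\<lambda>(p, s). g p s)" "continuous_on U b" "\<And>p. p \<in> U \<Longrightarrow> b p \<ge> 0"
  shows "continuous_on U (\<lambda>p. integral {0..b p} (g p))"
proof -
  have "integral {0..b p} (g p) = b p * integral (cbox 0 1) (\<lambda>v. g p (b p * v))" if "p \<in> U" for p
  proof (cases "b p = 0")
    case False
    then have "b p > 0" using assms(3)[OF that] by simp
    then show ?thesis
      using integral_stretch_real[of "b p" 0 "b p" "\<lambda>s. g p s"] by (simp add: cbox_interval)
  qed simp
  moreover have "continuous_on U (\<lambda>p. b p * integral (cbox 0 1) (\<lambda>v. g p (b p * v)))"
  proof (intro continuous_on_mult assms(2) integral_continuous_on_param)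
    have "continuous_on (U \<times> cbox 0 1) (\<lambda>q. (\<lambda>(p, s). g p s) (fst q, b (fst q) * snd q))"
      using assms(3)
      by (intro continuous_on_compose2[OF assms(1)] continuous_intros continuous_on_compose2[OF assms(2)])
         (auto simp: mult_left_le)
    then show "continuous_on (U \<times> cbox 0 1) (\<lambda>(p, v). g p (b p * v))" by (simp add: split_beta')
  qed
  ultimately show ?thesis by (simp cong: continuous_on_cong)
qed

section \<open>Volterra operators: continuity, differentiation and regularity\<close>

lemma volterra_continuous:
  fixes x :: "real \<Rightarrow> real"
  assumes K: "continuous_on (kernel_domain T) (\<lambda>(t, s). K t s)" and x: "continuous_on {0..T} x"
  shows "continuous_on {0..T} (\<lambda>t. integral {0..t} (\<lambda>s. K t s * x s))"
proof (rule continuous_on_variable_integral[where b = "\<lambda>t. t" and g = "\<lambda>t s. K t s * x s"])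
  have "Sigma {0..T} (\<lambda>t. {0..t}) = kernel_domain T" by (auto simp: kernel_domain_def)
  moreover have "continuous_on (kernel_domain T) (\<lambda>q. (\<lambda>(t, s). K t s) q * x (snd q))"
    by (intro continuous_intros K continuous_on_compose2[OF x]) (auto simp: kernel_domain_def)
  ultimately show "continuous_on (Sigma {0..T} (\<lambda>t. {0..t})) (\<lambda>(t, s). K t s * x s)"
    by (simp add: split_beta')
qed (auto intro: continuous_intros)

text \<open>The Leibniz rule with a moving upper limit. The kernel lives on the triangle only,
  whereas differentiation under an integral with frozen limit needs it on the square, so it is
  extended first. Then the upper limit and the parameter are treated as independent variables, and
  the result is restricted to the diagonal.\<close>

lemma volterra_derivative:
  assumes T: "T > 0" and K: "continuous_on (kernel_domain T) (\<lambda>(t, s). K t s)"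
    and K1: "continuous_on (kernel_domain T) (\<lambda>(t, s). K1 t s)"
    and deriv: "\<And>t s. 0 \<le> s \<Longrightarrow> s \<le> t \<Longrightarrow> t \<le> T \<Longrightarrow> ((\<lambda>t. K t s) has_real_derivative K1 t s) (at t within {s..T})"
    and x: "continuous_on {0..T} x" and t0: "t0 \<in> {0..T}"
  shows "((\<lambda>t. integral {0..t} (\<lambda>s. K t s * x s)) has_real_derivative
    (K t0 t0 * x t0 + integral {0..t0} (\<lambda>s. K1 t0 s * x s))) (at t0 within {0..T})"
proof -
  let ?I = "{0..T}"
  \<comment> \<open>Where t < s, the derivative in \<open>t\<close> is frozen at its diagonal value.
    There \<open>L\<close> is the linear extrapolation K s s + (t - s) * K1 s s, while on the
    triangle it equals \<open>K\<close> by the fundamental theorem; its derivative in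
    \<open>t\<close> is continuous on the whole square.\<close>
  define \<kappa> where "\<kappa> t s = K1 (max t s) s" for t s
  define L where "L t s = K s s - s * K1 s s + integral {0..t} (\<lambda>\<tau>. \<kappa> \<tau> s)" for t s
  have kc: "continuous_on (?I \<times> ?I) (\<lambda>(t, s). \<kappa> t s)"
  proof -
    have "continuous_on (?I \<times> ?I) (\<lambda>q. (\<lambda>(t, s). K1 t s) (max (fst q) (snd q), snd q))"
      by (intro continuous_on_compose2[OF K1] continuous_intros) (auto simp: kernel_domain_def)
    then show ?thesis by (simp add: \<kappa>_def split_beta')
  qed
  have kc1: "continuous_on ?I (\<lambda>t. \<kappa> t s)" if "s \<in> ?I" for s
  proof -
    have "continuous_on ?I (\<lambda>t. (\<lambda>(t, s). \<kappa> t s) (t, s))"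
      using that by (intro continuous_on_compose2[OF kc] continuous_intros) auto
    then show ?thesis by simp
  qed
  have LK: "L t s = K t s" if "0 \<le> s" "s \<le> t" "t \<le> T" for t s
  proof -
    have int: "(\<lambda>\<tau>. \<kappa> \<tau> s) integrable_on {0..t}"
      using that by (intro integrable_continuous_real continuous_on_subset[OF kc1]) auto
    have "integral {0..t} (\<lambda>\<tau>. \<kappa> \<tau> s) = integral {0..s} (\<lambda>\<tau>. \<kappa> \<tau> s) + integral {s..t} (\<lambda>\<tau>. \<kappa> \<tau> s)"
      using Henstock_Kurzweil_Integration.integral_combine[of 0 s t "\<lambda>\<tau>. \<kappa> \<tau> s"] that int by simp
    also have "integral {0..s} (\<lambda>\<tau>. \<kappa> \<tau> s) = integral {0..s} (\<lambda>\<tau>. K1 s s)"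
      by (intro integral_cong) (auto simp: \<kappa>_def max_def)
    also have "integral {s..t} (\<lambda>\<tau>. \<kappa> \<tau> s) = integral {s..t} (\<lambda>\<tau>. K1 \<tau> s)"
      by (intro integral_cong) (auto simp: \<kappa>_def max_def)
    also have "\<dots> = K t s - K s s"
    proof (intro integral_unique fundamental_theorem_of_calculus that)
      fix \<tau> assume "\<tau> \<in> {s..t}"
      then have "((\<lambda>t. K t s) has_real_derivative K1 \<tau> s) (at \<tau> within {s..t})"
        using that by (intro DERIV_subset[OF deriv]) auto
      then show "((\<lambda>t. K t s) has_vector_derivative K1 \<tau> s) (at \<tau> within {s..t})"
        by (simp add: has_real_derivative_iff_has_vector_derivative)
    qed
    finally show ?thesis using that by (simp add: L_def)
  qed
  have Lcont: "continuous_on ?I (\<lambda>s. L t s)" if t: "t \<in> ?I" for t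
  proof -
    have "continuous_on ?I (\<lambda>s. (\<lambda>(t, s). K t s) (s, s))" "continuous_on ?I (\<lambda>s. (\<lambda>(t, s). K1 t s) (s, s))"
      by (intro continuous_on_compose2[OF K] continuous_on_compose2[OF K1] continuous_intros; auto simp: kernel_domain_def)+
    moreover have "continuous_on ?I (\<lambda>s. integral (cbox 0 t) (\<lambda>\<tau>. \<kappa> \<tau> s))"
    proof (rule integral_continuous_on_param)
      have "continuous_on (?I \<times> cbox 0 t) (\<lambda>q. (\<lambda>(t, s). \<kappa> t s) (snd q, fst q))"
        using t by (intro continuous_on_compose2[OF kc] continuous_intros) auto
      then show "continuous_on (?I \<times> cbox 0 t) (\<lambda>(s, \<tau>). \<kappa> \<tau> s)" by (simp add: split_beta')
    qed
    ultimately show ?thesis unfolding L_def by (auto intro!: continuous_intros simp: cbox_interval)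
  qed
  have Lderiv: "((\<lambda>t. L t s) has_real_derivative \<kappa> t s) (at t within ?I)" if "s \<in> ?I" "t \<in> ?I" for s t
    unfolding L_def using integral_has_real_derivative[OF kc1[OF that(1)] that(2)]
    by (auto intro!: derivative_eq_intros)
  define F where "F u t = integral {0..u} (\<lambda>s. L t s * x s)" for u t
  define Fy where "Fy u t = integral {0..u} (\<lambda>s. \<kappa> t s * x s)" for u t
  have fx: "((\<lambda>u. F u t0) has_derivative (\<lambda>v. L t0 t0 * x t0 * v)) (at t0 within ?I)"
    unfolding F_def has_field_derivative_def[symmetric]
    using t0 by (intro integral_has_real_derivative[where g = "\<lambda>s. L t0 s * x s"] continuous_on_mult Lcont x)
  have fy: "((\<lambda>t. F u t) has_derivative blinfun_apply (blinfun_mult_left (Fy u t))) (at t within ?I)"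
    if "u \<in> ?I" "t \<in> ?I" for u t
  proof -
    have "((\<lambda>t. integral (cbox 0 u) (\<lambda>s. L t s * x s)) has_field_derivative integral (cbox 0 u) (\<lambda>s. \<kappa> t s * x s)) (at t within ?I)"
    proof (rule leibniz_rule_field_derivative[where f = "\<lambda>t s. L t s * x s" and fx = "\<lambda>t s. \<kappa> t s * x s"])
      show "((\<lambda>t. L t s * x s) has_real_derivative \<kappa> t s * x s) (at t within ?I)"
        if "t \<in> ?I" "s \<in> cbox 0 u" for t s
        using that \<open>u \<in> ?I\<close> by (auto intro!: derivative_eq_intros Lderiv)
      show "(\<lambda>s. L t s * x s) integrable_on cbox 0 u" if "t \<in> ?I" for t
      proof -
        have "continuous_on ?I (\<lambda>s. L t s * x s)" by (intro continuous_on_mult Lcont x that)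
        then have "continuous_on {0..u} (\<lambda>s. L t s * x s)"
          using \<open>u \<in> ?I\<close> by (rule_tac continuous_on_subset) auto
        then show ?thesis unfolding cbox_interval by (rule integrable_continuous_real)
      qed
      have "continuous_on (?I \<times> cbox 0 u) (\<lambda>q. (\<lambda>(t, s). \<kappa> t s) q * x (snd q))"
        using \<open>u \<in> ?I\<close> by (intro continuous_intros continuous_on_subset[OF kc] continuous_on_compose2[OF x]) auto
      then show "continuous_on (?I \<times> cbox 0 u) (\<lambda>(t, s). \<kappa> t s * x s)" by (simp add: split_beta')
    qed (use that in auto)
    then show ?thesis
      unfolding F_def Fy_def has_field_derivative_def by (simp add: cbox_interval mult_commute_abs)
  qed
  have cont: "continuous_on (?I \<times> ?I) (\<lambda>(u, t). Fy u t)"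
  proof -
    have "continuous_on (?I \<times> ?I) (\<lambda>q. integral {0..fst q} (\<lambda>s. \<kappa> (snd q) s * x s))"
    proof (rule continuous_on_variable_integral[where b = fst and g = "\<lambda>q s. \<kappa> (snd q) s * x s"])
      have "continuous_on (Sigma (?I \<times> ?I) (\<lambda>q. {0..fst q})) (\<lambda>w. (\<lambda>(t, s). \<kappa> t s) (snd (fst w), snd w) * x (snd w))"
        by (intro continuous_intros continuous_on_compose2[OF kc] continuous_on_compose2[OF x]) auto
      then show "continuous_on (Sigma (?I \<times> ?I) (\<lambda>q. {0..fst q})) (\<lambda>(q, s). \<kappa> (snd q) s * x s)"
        by (simp add: split_beta')
    qed (auto intro!: continuous_intros)
    then show ?thesis by (simp add: Fy_def split_beta')
  qed
  \<comment> \<open>For total differentiability it is enough that one partial derivative exists at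
    the point and the other one exists nearby and is continuous there.\<close>
  have "((\<lambda>(u, t). F u t) has_derivative (\<lambda>(a, b). L t0 t0 * x t0 * a + blinfun_mult_left (Fy t0 t0) b)) (at (t0, t0) within ?I \<times> ?I)"
  proof (rule has_derivative_partialsI[OF fx fy])
    have "continuous_on (?I \<times> ?I) (\<lambda>q. blinfun_mult_left ((\<lambda>(u, t). Fy u t) q))"
      by (intro continuous_intros cont)
    then have "continuous_on (?I \<times> ?I) (\<lambda>(u, t). blinfun_mult_left (Fy u t))" by (simp add: split_beta')
    then show "continuous (at (t0, t0) within ?I \<times> ?I) (\<lambda>(u, t). blinfun_mult_left (Fy u t))"
      using t0 by (simp add: continuous_on_eq_continuous_within)
  qed (use t0 in auto)
  then have "((\<lambda>(u, t). F u t) has_derivative (\<lambda>(a, b). L t0 t0 * x t0 * a + blinfun_mult_left (Fy t0 t0) b)) (at ((\<lambda>t. (t, t)) t0) within (\<lambda>t. (t, t)) ` ?I)"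
    by (rule has_derivative_subset) auto
  moreover have "((\<lambda>t. (t, t)) has_derivative (\<lambda>v. (v, v))) (at t0 within ?I)"
    by (intro derivative_intros)
  ultimately have "((\<lambda>t. F t t) has_derivative (\<lambda>v. L t0 t0 * x t0 * v + Fy t0 t0 * v)) (at t0 within ?I)"
    by (auto dest!: has_derivative_in_compose[of "\<lambda>t. (t, t)" "\<lambda>v. (v, v)" t0 ?I "\<lambda>(u, t). F u t", rotated] simp: mult.commute)
  moreover have "(\<lambda>v. L t0 t0 * x t0 * v + Fy t0 t0 * v) = (*) (L t0 t0 * x t0 + Fy t0 t0)"
    by (simp add: fun_eq_iff distrib_right)
  ultimately have "((\<lambda>t. F t t) has_real_derivative (L t0 t0 * x t0 + Fy t0 t0)) (at t0 within ?I)"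
    unfolding has_field_derivative_def by simp
  moreover have "L t0 t0 = K t0 t0" using LK t0 by simp
  moreover have "Fy t0 t0 = integral {0..t0} (\<lambda>s. K1 t0 s * x s)"
    unfolding Fy_def by (intro integral_cong) (auto simp: \<kappa>_def max_def)
  moreover have "F t t = integral {0..t} (\<lambda>s. K t s * x s)" if "t \<in> ?I" for t
    unfolding F_def using that by (intro integral_cong) (auto simp: LK)
  ultimately show ?thesis
    using has_field_derivative_transform_within[of "\<lambda>t. F t t" _ t0 ?I 1] t0 by force
qed

text \<open>Integration gains one derivative over \<open>x\<close>: the derivative is
  \<open>K t t * x t\<close> plus a Volterra integral whose kernel is one class lower. For
  \<open>k = 0\<close> the truncated difference \<open>k - 1\<close> leaves plain continuity of
  \<open>x\<close>.\<close>

lemma volterra_Ck: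
  assumes T: "T > 0"
  shows "Ck_on k (kernel_domain T) (\<lambda>(t, s). K t s) \<Longrightarrow> Ck_on (k - 1) {0..T} x \<Longrightarrow>
    Ck_on k {0..T} (\<lambda>t. integral {0..t} (\<lambda>s. K t s * x s))"
proof (induction k arbitrary: K)
  case 0
  then show ?case by (simp add: volterra_continuous)
next
  case (Suc k)
  obtain K1 K2 where K1: "Ck_on k (kernel_domain T) (\<lambda>(t, s). K1 t s)"
    "\<And>t s. 0 \<le> s \<Longrightarrow> s \<le> t \<Longrightarrow> t \<le> T \<Longrightarrow> ((\<lambda>t. K t s) has_real_derivative K1 t s) (at t within {s..T})"
    using kernel_partials[OF Suc.prems(1)] by metis
  have x: "Ck_on k {0..T} x" using Suc.prems(2) by simp
  have "Ck_on k {0..T} (\<lambda>t. K t t * x t + integral {0..t} (\<lambda>s. K1 t s * x s))"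
    by (intro Ck_on_add Ck_on_mult x Suc.IH[OF K1(1)] Ck_on_diagonal[OF Ck_on_SucD[OF Suc.prems(1)]] Ck_on_mono[OF x]) simp
  then show ?case
    using volterra_derivative[OF T Ck_on_continuous[OF Suc.prems(1)] Ck_on_continuous[OF K1(1)] K1(2) Ck_on_continuous[OF x]]
    by (intro Ck_on_real_SucI) auto
qed

text \<open>One differentiation gives an equation of the second kind, which can be solved for
  \<open>x\<close> because the diagonal does not vanish.\<close>

lemma first_kind_regularity:
  assumes T: "T > 0" and K: "Ck_on (Suc p) (kernel_domain T) (\<lambda>(t, s). K t s)"
    and nz: "\<And>t. t \<in> {0..T} \<Longrightarrow> K t t \<noteq> 0"
    and x: "continuous_on {0..T} x" and f: "Ck_on (Suc p) {0..T} f"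
    and eq: "\<And>t. t \<in> {0..T} \<Longrightarrow> integral {0..t} (\<lambda>s. K t s * x s) = f t"
  shows "Ck_on p {0..T} x"
proof -
  obtain K1 K2 where K1: "Ck_on p (kernel_domain T) (\<lambda>(t, s). K1 t s)"
    "\<And>t s. 0 \<le> s \<Longrightarrow> s \<le> t \<Longrightarrow> t \<le> T \<Longrightarrow> ((\<lambda>t. K t s) has_real_derivative K1 t s) (at t within {s..T})"
    using kernel_partials[OF K] by metis
  obtain f' where f': "\<And>t. t \<in> {0..T} \<Longrightarrow> (f has_real_derivative f' t) (at t within {0..T})" "Ck_on p {0..T} f'"
    using f Ck_on_real_derivE by metis
  have x_eq: "x t = (f' t - integral {0..t} (\<lambda>s. K1 t s * x s)) * inverse (K t t)" if t: "t \<in> {0..T}" for t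
  proof -
    have "((\<lambda>t. integral {0..t} (\<lambda>s. K t s * x s)) has_real_derivative
        (K t t * x t + integral {0..t} (\<lambda>s. K1 t s * x s))) (at t within {0..T})"
      using volterra_derivative[OF T Ck_on_continuous[OF K] Ck_on_continuous[OF K1(1)] K1(2) x t] .
    then have "(f has_real_derivative (K t t * x t + integral {0..t} (\<lambda>s. K1 t s * x s))) (at t within {0..T})"
      using has_field_derivative_transform_within[of _ _ t "{0..T}" 1 f] eq t by force
    then have "K t t * x t + integral {0..t} (\<lambda>s. K1 t s * x s) = f' t"
      using f'(1)[OF t] t unfolding has_real_derivative_iff_has_vector_derivative cbox_interval[symmetric]
      by (intro vector_derivative_unique_within_closed_interval[OF T])
    then show ?thesis using nz[OF t] by (auto simp: field_simps)
  qed
  \<comment> \<open>Bootstrap: if \<open>x\<close> is of class \<open>j\<close>, the integral on the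
    right of \<open>x_eq\<close> is of class \<open>Suc j\<close>, and therefore so is
    \<open>x\<close>, until the class of the data is reached.\<close>
  have "Ck_on j {0..T} x" if "j \<le> p" for j
    using that
  proof (induction j)
    case 0
    then show ?case using x by simp
  next
    case (Suc j)
    have "Ck_on (Suc j) {0..T} (\<lambda>t. (f' t - integral {0..t} (\<lambda>s. K1 t s * x s)) * inverse (K t t))"
    proof (rule Ck_on_mult)
      have "Ck_on (Suc j) (kernel_domain T) (\<lambda>(t, s). K1 t s)" by (rule Ck_on_mono[OF K1(1) Suc.prems])
      then show "Ck_on (Suc j) {0..T} (\<lambda>t. f' t - integral {0..t} (\<lambda>s. K1 t s * x s))"
        using Suc by (intro Ck_on_diff Ck_on_mono[OF f'(2) Suc.prems] volterra_Ck[OF T]) simp_all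
      have "Ck_on (Suc j) (kernel_domain T) (\<lambda>(t, s). K t s)" by (rule Ck_on_mono[OF K]) (use Suc.prems in simp)
      then show "Ck_on (Suc j) {0..T} (\<lambda>t. inverse (K t t))"
        using nz Ck_on_inverse[OF Ck_on_diagonal] by blast
    qed
    then show ?case by (subst Ck_on_cong[OF x_eq])
  qed
  then show ?thesis by blast
qed

text \<open>The finite set \<open>M\<close> admits the mesh points, where the primitive
  \<open>E\<close> of a discontinuous error need not be differentiable. Moving the derivative onto
  the kernel lets the analysis work with the continuous \<open>E\<close>; the formulation by
  \<open>has_integral\<close> also yields integrability of the product with
  \<open>e\<close>.\<close>

lemma volterra_by_parts:
  fixes E :: "real \<Rightarrow> real"
  assumes "0 \<le> t" and deriv: "\<And>s. s \<in> {0..t} \<Longrightarrow> ((\<lambda>s. K t s) has_real_derivative \<kappa> t s) (at s within {0..t})"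
    and \<kappa>: "continuous_on {0..t} (\<kappa> t)" and E: "continuous_on {0..t} E" "E 0 = 0"
    and "finite M" and e: "\<And>s. s \<in> {0<..<t} - M \<Longrightarrow> (E has_real_derivative e s) (at s)"
  shows "((\<lambda>s. K t s * e s) has_integral (K t t * E t - integral {0..t} (\<lambda>s. \<kappa> t s * E s))) {0..t}"
proof -
  have "((\<lambda>s. e s * K t s) has_integral (K t t * E t - integral {0..t} (\<lambda>s. \<kappa> t s * E s))) {0..t}"
  proof (rule integration_by_parts_interior_strong[OF bounded_bilinear_mult assms(6,1) E(1)])
    show "continuous_on {0..t} (K t)"
      unfolding continuous_on_eq_continuous_within using DERIV_continuous[OF deriv] by blast
    show "(E has_vector_derivative e s) (at s)" if "s \<in> {0<..<t} - M" for s
      using e[OF that] by (simp add: has_real_derivative_iff_has_vector_derivative)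
    show "(K t has_vector_derivative \<kappa> t s) (at s)" if "s \<in> {0<..<t} - M" for s
    proof -
      have "(K t has_real_derivative \<kappa> t s) (at s within {0<..<t})"
        using that by (intro DERIV_subset[OF deriv]) auto
      moreover have "at s within {0<..<t} = at s" using that by (intro at_within_open) auto
      ultimately show ?thesis by (simp add: has_real_derivative_iff_has_vector_derivative)
    qed
    have "((\<lambda>s. E s * \<kappa> t s) has_integral integral {0..t} (\<lambda>s. \<kappa> t s * E s)) {0..t}"
      using integrable_integral[OF integrable_continuous_real[OF continuous_on_mult[OF \<kappa> E(1)]]]
      by (simp add: mult.commute)
    then show "((\<lambda>s. E s * \<kappa> t s) has_integral E t * K t t - E 0 * K t 0 - (K t t * E t - integral {0..t} (\<lambda>s. \<kappa> t s * E s))) {0..t}"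
      using E(2) by (simp add: mult.commute)
  qed
  then show ?thesis by (simp add: mult.commute)
qed

section \<open>Lipschitz bounds for the kernel and its derivatives\<close>

lemma kernel_lipschitz:
  assumes "Ck_on (Suc 0) (kernel_domain T) (\<lambda>(t, s). K t s)"
  obtains C :: real where "C > 0"
    "\<And>t t' s. 0 \<le> s \<Longrightarrow> s \<le> t' \<Longrightarrow> t' \<le> t \<Longrightarrow> t \<le> T \<Longrightarrow> \<bar>K t s - K t' s\<bar> \<le> C * (t - t')"
    "\<And>t s s'. 0 \<le> s' \<Longrightarrow> s' \<le> s \<Longrightarrow> s \<le> t \<Longrightarrow> t \<le> T \<Longrightarrow> \<bar>K t s - K t s'\<bar> \<le> C * (s - s')"
proof -
  obtain K1 K2 where K: "Ck_on 0 (kernel_domain T) (\<lambda>(t, s). K1 t s)" "Ck_on 0 (kernel_domain T) (\<lambda>(t, s). K2 t s)"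
    "\<And>t s. 0 \<le> s \<Longrightarrow> s \<le> t \<Longrightarrow> t \<le> T \<Longrightarrow> ((\<lambda>t. K t s) has_real_derivative K1 t s) (at t within {s..T})"
    "\<And>t s. 0 \<le> s \<Longrightarrow> s \<le> t \<Longrightarrow> t \<le> T \<Longrightarrow> ((\<lambda>s. K t s) has_real_derivative K2 t s) (at s within {0..t})"
    by (rule kernel_partials[OF assms]) blast
  obtain C1 where C1: "C1 > 0" "\<And>t s. 0 \<le> s \<Longrightarrow> s \<le> t \<Longrightarrow> t \<le> T \<Longrightarrow> \<bar>K1 t s\<bar> \<le> C1"
    using kernel_bounded[of T K1] K(1) by auto
  obtain C2 where C2: "C2 > 0" "\<And>t s. 0 \<le> s \<Longrightarrow> s \<le> t \<Longrightarrow> t \<le> T \<Longrightarrow> \<bar>K2 t s\<bar> \<le> C2"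
    using kernel_bounded[of T K2] K(2) by auto
  show ?thesis
  proof (rule that[of "max C1 C2"])
    show "\<bar>K t s - K t' s\<bar> \<le> max C1 C2 * (t - t')" if "0 \<le> s" "s \<le> t'" "t' \<le> t" "t \<le> T" for t t' s
    proof -
      have "norm (K t s - K t' s) \<le> C1 * norm (t - t')"
        by (rule field_differentiable_bound[of "{s..T}" "\<lambda>t. K t s" "\<lambda>t. K1 t s"]) (use that C1 K in auto)
      also have "\<dots> \<le> max C1 C2 * (t - t')" using that by (auto intro: mult_right_mono)
      finally show ?thesis by simp
    qed
    show "\<bar>K t s - K t s'\<bar> \<le> max C1 C2 * (s - s')" if "0 \<le> s'" "s' \<le> s" "s \<le> t" "t \<le> T" for t s s'
    proof -
      have "norm (K t s - K t s') \<le> C2 * norm (s - s')"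
        by (rule field_differentiable_bound[of "{0..t}" "\<lambda>s. K t s" "\<lambda>s. K2 t s"]) (use that C2 K in auto)
      also have "\<dots> \<le> max C1 C2 * (s - s')" using that by (auto intro: mult_right_mono)
      finally show ?thesis by simp
    qed
  qed (use C1 in auto)
qed

text \<open>Collects under one constant what the cell analysis uses of \<open>K\<close>:
  \<open>\<kappa>\<close> is the derivative in the second argument, which remains after the
  integration by parts, and \<open>k'\<close> is the derivative of the diagonal. The bound on the
  mixed second difference of \<open>\<kappa>\<close> rests on a Lipschitz bound for the derivative
  of \<open>\<kappa>\<close> in \<open>s\<close>, which accounts for the three derivatives of
  \<open>K\<close>.\<close>

lemma kernel_bounds:
  assumes T: "T > 0" and K: "Ck_on 3 (kernel_domain T) (\<lambda>(t, s). K t s)"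
  obtains \<kappa> k' C where "(C::real) > 0"
    "continuous_on (kernel_domain T) (\<lambda>(t, s). \<kappa> t s)" "continuous_on {0..T} (\<lambda>t. K t t)"
    "\<And>t s. 0 \<le> s \<Longrightarrow> s \<le> t \<Longrightarrow> t \<le> T \<Longrightarrow> ((\<lambda>s. K t s) has_real_derivative \<kappa> t s) (at s within {0..t})"
    "\<And>t s. 0 \<le> s \<Longrightarrow> s \<le> t \<Longrightarrow> t \<le> T \<Longrightarrow> \<bar>\<kappa> t s\<bar> \<le> C"
    "\<And>t t' s. 0 \<le> s \<Longrightarrow> s \<le> t' \<Longrightarrow> t' \<le> t \<Longrightarrow> t \<le> T \<Longrightarrow> \<bar>\<kappa> t s - \<kappa> t' s\<bar> \<le> C * (t - t')"
    "\<And>t s s'. 0 \<le> s' \<Longrightarrow> s' \<le> s \<Longrightarrow> s \<le> t \<Longrightarrow> t \<le> T \<Longrightarrow> \<bar>\<kappa> t s - \<kappa> t s'\<bar> \<le> C * (s - s')"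
    "\<And>t t' s s'. 0 \<le> s' \<Longrightarrow> s' \<le> s \<Longrightarrow> s \<le> t' \<Longrightarrow> t' \<le> t \<Longrightarrow> t \<le> T \<Longrightarrow>
       \<bar>(\<kappa> t s - \<kappa> t' s) - (\<kappa> t s' - \<kappa> t' s')\<bar> \<le> C * (t - t') * (s - s')"
    "\<And>t t'. 0 \<le> t' \<Longrightarrow> t' \<le> t \<Longrightarrow> t \<le> T \<Longrightarrow> \<bar>K t t - K t' t'\<bar> \<le> C * (t - t')"
    "\<And>t t'. 0 \<le> t' \<Longrightarrow> t' \<le> t \<Longrightarrow> t \<le> T \<Longrightarrow> \<bar>K t t - K t' t' - k' t' * (t - t')\<bar> \<le> C * (t - t')^2"
    "\<And>t. 0 \<le> t \<Longrightarrow> t \<le> T \<Longrightarrow> \<bar>k' t\<bar> \<le> C"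
proof -
  let ?D = "kernel_domain T"
  have "Ck_on (Suc 2) ?D (\<lambda>(t, s). K t s)" using K by (simp add: eval_nat_numeral)
  then obtain K1 K2 where K12: "Ck_on 2 ?D (\<lambda>(t, s). K2 t s)"
    "\<And>t s. 0 \<le> s \<Longrightarrow> s \<le> t \<Longrightarrow> t \<le> T \<Longrightarrow> ((\<lambda>s. K t s) has_real_derivative K2 t s) (at s within {0..t})"
    by (rule kernel_partials) blast
  have "Ck_on (Suc (Suc 0)) ?D (\<lambda>(t, s). K2 t s)" using K12(1) by (simp add: eval_nat_numeral)
  then obtain K22 where K22: "Ck_on (Suc 0) ?D (\<lambda>(t, s). K22 t s)"
    "\<And>t s. 0 \<le> s \<Longrightarrow> s \<le> t \<Longrightarrow> t \<le> T \<Longrightarrow> ((\<lambda>s. K2 t s) has_real_derivative K22 t s) (at s within {0..t})"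
    by (rule kernel_partials) blast
  obtain C0 where C0: "C0 > 0" "\<And>t s. 0 \<le> s \<Longrightarrow> s \<le> t \<Longrightarrow> t \<le> T \<Longrightarrow> \<bar>K2 t s\<bar> \<le> C0"
    using kernel_bounded[OF Ck_on_continuous[OF K12(1)]] by auto
  obtain C1 where C1: "C1 > 0"
    "\<And>t t' s. 0 \<le> s \<Longrightarrow> s \<le> t' \<Longrightarrow> t' \<le> t \<Longrightarrow> t \<le> T \<Longrightarrow> \<bar>K2 t s - K2 t' s\<bar> \<le> C1 * (t - t')"
    "\<And>t s s'. 0 \<le> s' \<Longrightarrow> s' \<le> s \<Longrightarrow> s \<le> t \<Longrightarrow> t \<le> T \<Longrightarrow> \<bar>K2 t s - K2 t s'\<bar> \<le> C1 * (s - s')"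
    using kernel_lipschitz[OF Ck_on_mono[OF K12(1), of "Suc 0"]] by auto
  obtain C2 where C2: "C2 > 0"
    "\<And>t t' s. 0 \<le> s \<Longrightarrow> s \<le> t' \<Longrightarrow> t' \<le> t \<Longrightarrow> t \<le> T \<Longrightarrow> \<bar>K22 t s - K22 t' s\<bar> \<le> C2 * (t - t')"
    by (rule kernel_lipschitz[OF K22(1)]) blast
  have "Ck_on (Suc 1) {0..T} (\<lambda>t. K t t)" by (rule Ck_on_mono[OF Ck_on_diagonal[OF K]]) simp
  then obtain k' where k': "\<And>t. t \<in> {0..T} \<Longrightarrow> ((\<lambda>t. K t t) has_real_derivative k' t) (at t within {0..T})" "Ck_on 1 {0..T} k'"
    by (rule Ck_on_real_derivE) blast
  have "Ck_on (Suc 0) {0..T} k'" using k'(2) by simp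
  then obtain k'' where k'': "\<And>t. t \<in> {0..T} \<Longrightarrow> (k' has_real_derivative k'' t) (at t within {0..T})" "Ck_on 0 {0..T} k''"
    by (rule Ck_on_real_derivE) blast
  have bd: "\<exists>C>0. \<forall>t\<in>{0..T}. \<bar>f t\<bar> \<le> C" if "continuous_on {0..T} f" for f :: "real \<Rightarrow> real"
    using compact_imp_bounded[OF compact_continuous_image[OF that compact_Icc]] unfolding bounded_pos by auto
  obtain C3 where C3: "C3 > 0" "\<forall>t\<in>{0..T}. \<bar>k' t\<bar> \<le> C3" using bd[OF Ck_on_continuous[OF k'(2)]] by blast
  obtain C4 where C4: "C4 > 0" "\<forall>t\<in>{0..T}. \<bar>k'' t\<bar> \<le> C4" using bd[OF Ck_on_continuous[OF k''(2)]] by blast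
  define C where "C = C0 + C1 + C2 + C3 + C4"
  have C: "C > 0" "C0 \<le> C" "C1 \<le> C" "C2 \<le> C" "C3 \<le> C" "C4 \<le> C"
    using C0 C1 C2 C3 C4 by (auto simp: C_def)
  show ?thesis
  proof (rule that[OF C(1), of K2 k'])
    show "continuous_on ?D (\<lambda>(t, s). K2 t s)" by (rule Ck_on_continuous[OF K12(1)])
    show "continuous_on {0..T} (\<lambda>t. K t t)" by (rule Ck_on_continuous[OF Ck_on_diagonal[OF K]])
    show "((\<lambda>s. K t s) has_real_derivative K2 t s) (at s within {0..t})" if "0 \<le> s" "s \<le> t" "t \<le> T" for t s
      using K12(2) that by blast
    show "\<bar>K2 t s\<bar> \<le> C" if "0 \<le> s" "s \<le> t" "t \<le> T" for t s
      using C0(2)[OF that] C by simp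
    show "\<bar>K2 t s - K2 t' s\<bar> \<le> C * (t - t')" if "0 \<le> s" "s \<le> t'" "t' \<le> t" "t \<le> T" for t t' s
      using C1(2)[OF that] mult_right_mono[OF C(3), of "t - t'"] that by simp
    show "\<bar>K2 t s - K2 t s'\<bar> \<le> C * (s - s')" if "0 \<le> s'" "s' \<le> s" "s \<le> t" "t \<le> T" for t s s'
      using C1(3)[OF that] mult_right_mono[OF C(3), of "s - s'"] that by simp
    show "\<bar>(K2 t s - K2 t' s) - (K2 t s' - K2 t' s')\<bar> \<le> C * (t - t') * (s - s')"
      if "0 \<le> s'" "s' \<le> s" "s \<le> t'" "t' \<le> t" "t \<le> T" for t t' s s'
    proof -
      \<comment> \<open>Mean value theorem in \<open>s\<close> for the difference of two time
        sections; its derivative is a difference of values of \<open>K22\<close>, which is Lipschitz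
        in \<open>t\<close>.\<close>
      have "norm ((K2 t s - K2 t' s) - (K2 t s' - K2 t' s')) \<le> (C * (t - t')) * norm (s - s')"
      proof (rule field_differentiable_bound[of "{0..t'}" "\<lambda>s. K2 t s - K2 t' s" "\<lambda>s. K22 t s - K22 t' s"])
        show "((\<lambda>s. K2 t s - K2 t' s) has_field_derivative K22 t z - K22 t' z) (at z within {0..t'})"
          if "z \<in> {0..t'}" for z
          using that \<open>t' \<le> t\<close> \<open>t \<le> T\<close> by (intro DERIV_diff DERIV_subset[OF K22(2)]) auto
        show "norm (K22 t z - K22 t' z) \<le> C * (t - t')" if "z \<in> {0..t'}" for z
          using C2(2)[of z t' t] mult_right_mono[OF C(4), of "t - t'"] that \<open>t' \<le> t\<close> \<open>t \<le> T\<close> by simp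
      qed (use that in auto)
      then show ?thesis using that by simp
    qed
    show "\<bar>K t t - K t' t'\<bar> \<le> C * (t - t')" if "0 \<le> t'" "t' \<le> t" "t \<le> T" for t t'
    proof -
      have "norm (K t t - K t' t') \<le> C * norm (t - t')"
        using C3(2) C(5) that
        by (intro field_differentiable_bound[of "{0..T}" "\<lambda>t. K t t" k'] k'(1)) fastforce+
      then show ?thesis using that by simp
    qed
    show "\<bar>K t t - K t' t' - k' t' * (t - t')\<bar> \<le> C * (t - t')^2" if "0 \<le> t'" "t' \<le> t" "t \<le> T" for t t'
    proof -
      have k'lip: "\<bar>k' u - k' t'\<bar> \<le> C * (t - t')" if "u \<in> {t'..t}" for u
      proof -
        have "norm (k' u - k' t') \<le> C * norm (u - t')"
          using C4(2) C(6) that \<open>0 \<le> t'\<close> \<open>t \<le> T\<close>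
          by (intro field_differentiable_bound[of "{0..T}" k' k''] k''(1)) fastforce+
        also have "\<dots> \<le> C * (t - t')" using that C(1) by (intro mult_left_mono) auto
        finally show ?thesis by simp
      qed
      have "norm ((K t t - k' t' * t) - (K t' t' - k' t' * t')) \<le> (C * (t - t')) * norm (t - t')"
      proof (rule field_differentiable_bound[of "{t'..t}" "\<lambda>t. K t t - k' t' * t" "\<lambda>u. k' u - k' t'"])
        show "((\<lambda>t. K t t - k' t' * t) has_field_derivative k' z - k' t') (at z within {t'..t})" if "z \<in> {t'..t}" for z
        proof -
          have "((\<lambda>t. K t t) has_real_derivative k' z) (at z within {t'..t})"
            using that \<open>0 \<le> t'\<close> \<open>t \<le> T\<close> by (intro DERIV_subset[OF k'(1)]) auto
          then show ?thesis by (auto intro!: derivative_eq_intros)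
        qed
        show "norm (k' z - k' t') \<le> C * (t - t')" if "z \<in> {t'..t}" for z
          using k'lip[OF that] by simp
      qed (use that in auto)
      then show ?thesis using that by (simp add: power2_eq_square algebra_simps)
    qed
    show "\<bar>k' t\<bar> \<le> C" if "0 \<le> t" "t \<le> T" for t
      using bspec[OF C3(2), of t] C(5) that by simp
  qed
qed

subsection \<open>Stability of the first kind moment equations\<close>

lemma poly_antiderivative:
  fixes p :: "real poly"
  obtains q where "pderiv q = p" "degree q \<le> Suc (degree p)" "poly q 0 = 0"
proof -
  define q where "q = (\<Sum>i\<le>degree p. monom (coeff p i / real (Suc i)) (Suc i))"
  have *: "pderiv (sum f A) = (\<Sum>a\<in>A. pderiv (f a))" for f :: "nat \<Rightarrow> real poly" and A
    by (rule higher_pderiv_sum[of 1, simplified])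
  have "pderiv q = (\<Sum>i\<le>degree p. monom (coeff p i) i)"
    unfolding q_def * by (intro sum.cong) (auto simp: pderiv_monom simp del: of_nat_Suc)
  then have "pderiv q = p" by (simp add: poly_as_sum_of_monoms)
  moreover have "degree q \<le> Suc (degree p)"
    unfolding q_def by (rule degree_sum_le) (auto intro: order_trans[OF degree_monom_le])
  moreover have "poly q 0 = 0" by (simp add: q_def poly_sum poly_monom)
  ultimately show ?thesis using that by blast
qed

lemma integral_orthogonal_poly:
  assumes "continuous_on {0..1} \<omega>" "\<And>j. j \<le> m \<Longrightarrow> legendre_moment \<omega> j = 0" "degree p \<le> m"
  shows "integral {0..1} (\<lambda>u. \<omega> u * poly p u) = 0"
proof -
  let ?c = "\<lambda>j. legendre_moment (poly p) j / legendre_norm2 j"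
  have "integral {0..1} (\<lambda>u. \<omega> u * poly p u) =
      integral {0..1} (\<lambda>u. \<Sum>j\<le>m. ?c j * (\<omega> u * poly (shifted_legendre j) u))"
    by (intro integral_cong) (simp add: poly_legendre_expansion[OF assms(3)] sum_distrib_left algebra_simps)
  also have "\<dots> = (\<Sum>j\<le>m. integral {0..1} (\<lambda>u. ?c j * (\<omega> u * poly (shifted_legendre j) u)))"
    by (intro integral_sum integrable_continuous_real continuous_intros assms(1)) auto
  also have "\<dots> = (\<Sum>j\<le>m. ?c j * legendre_moment \<omega> j)"
    by (simp add: legendre_moment_def)
  also have "\<dots> = 0" using assms(2) by simp
  finally show ?thesis .
qed

lemma shifted_legendre_0: "shifted_legendre 0 = 1"
  by (simp add: shifted_legendre_def one_pCons)

lemma legendre_norm2_0: "legendre_norm2 0 = 1"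
  by (simp add: legendre_norm2_def legendre_moment_def shifted_legendre_0)

lemma moment_const: "legendre_moment (\<lambda>u. c) j = (if j = 0 then c else 0)"
proof -
  have "legendre_moment (poly [:c:]) j = (if j = 0 then c else 0)"
  proof (cases "j = 0")
    case True
    then show ?thesis by (simp add: legendre_moment_def shifted_legendre_0)
  qed (simp add: legendre_orthogonal)
  moreover have "poly [:c:] = (\<lambda>u. c)" by auto
  ultimately show ?thesis by (simp only:)
qed

text \<open>One integration costs one degree of orthogonality. Integration by parts moves the
  integral onto P_j, whose antiderivative has degree at most \<open>m\<close>, and the boundary term
  at 1 vanishes because \<open>\<omega>\<close> has mean zero.\<close>

lemma moment_primitive:
  assumes \<omega>: "continuous_on {0..1} \<omega>" "\<And>j. j \<le> m \<Longrightarrow> legendre_moment \<omega> j = 0" and "j < m"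
  shows "legendre_moment (\<lambda>u. integral {0..u} \<omega>) j = 0"
proof -
  obtain q where q: "pderiv q = shifted_legendre j" "degree q \<le> Suc j"
    using poly_antiderivative[of "shifted_legendre j"] by auto
  let ?V = "\<lambda>u. integral {0..u} \<omega>"
  have V1: "?V 1 = 0"
    using integral_orthogonal_poly[OF \<omega>, where p = "[:1:]"] by simp
  have V: "(?V has_vector_derivative \<omega> u) (at u within {0..1})" if "u \<in> {0..1}" for u
    using integral_has_vector_derivative[OF \<omega>(1) that] .
  have "((\<lambda>u. ?V u * poly (shifted_legendre j) u + \<omega> u * poly q u) has_integral (?V 1 * poly q 1 - ?V 0 * poly q 0)) {0..1}"
  proof (rule fundamental_theorem_of_calculus)
    fix u :: real assume u: "u \<in> {0..1}"
    have "(poly q has_vector_derivative poly (shifted_legendre j) u) (at u within {0..1})"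
      using poly_DERIV[of q u] q(1) has_field_derivative_at_within
      by (fastforce simp: has_real_derivative_iff_has_vector_derivative[symmetric])
    then show "((\<lambda>u. ?V u * poly q u) has_vector_derivative ?V u * poly (shifted_legendre j) u + \<omega> u * poly q u) (at u within {0..1})"
      using V[OF u] by (rule has_vector_derivative_mult[rotated])
  qed simp
  then have "integral {0..1} (\<lambda>u. ?V u * poly (shifted_legendre j) u + \<omega> u * poly q u) = 0"
    using V1 by (simp add: integral_unique)
  moreover have "integral {0..1} (\<lambda>u. ?V u * poly (shifted_legendre j) u + \<omega> u * poly q u)
     = legendre_moment ?V j + integral {0..1} (\<lambda>u. \<omega> u * poly q u)"
    unfolding legendre_moment_def
    by (intro integral_add integrable_continuous_real continuous_intros \<omega> indefinite_integral_continuous_1)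
  moreover have "integral {0..1} (\<lambda>u. \<omega> u * poly q u) = 0"
    using q(2) assms(3) by (intro integral_orthogonal_poly[OF \<omega>]) auto
  ultimately show ?thesis by simp
qed

lemma integral_affine:
  fixes f :: "real \<Rightarrow> real"
  assumes "h > 0"
  shows "integral {a..a + u * h} f = h * integral {0..u} (\<lambda>v. f (a + v * h))"
proof -
  have "integral {a..a + u * h} f = integral {0..u * h} (\<lambda>x. f (x + a))"
    using integral_shift_Icc_real[of 0 "u * h" f a] by (simp add: o_def add.commute)
  also have "\<dots> = h * integral {0..u} (\<lambda>v. f (a + v * h))"
    using integral_stretch_real[of h 0 "u * h" "\<lambda>x. f (x + a)"] assms by (simp add: algebra_simps)
  finally show ?thesis .
qed

lemma integral_cells:
  fixes f :: "real \<Rightarrow> real"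
  assumes "h > 0"
  shows "f integrable_on {0..real n * h} \<Longrightarrow>
    integral {0..real n * h} f = (\<Sum>i<n. h * integral {0..1} (\<lambda>v. f (real i * h + v * h)))"
proof (induction n)
  case (Suc n)
  have "integral {0..real (Suc n) * h} f = integral {0..real n * h} f + integral {real n * h..real (Suc n) * h} f"
    using Suc.prems assms
    by (intro Henstock_Kurzweil_Integration.integral_combine[symmetric]) auto
  also have "integral {real n * h..real (Suc n) * h} f = h * integral {0..1} (\<lambda>v. f (real n * h + v * h))"
    using integral_affine[OF assms, of "real n * h" 1 f] by (simp add: algebra_simps)
  also have "integral {0..real n * h} f = (\<Sum>i<n. h * integral {0..1} (\<lambda>v. f (real i * h + v * h)))"
    using assms by (intro Suc.IH integrable_on_subinterval[OF Suc.prems]) auto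
  finally show ?case by simp
qed simp

lemma abs_integral_le:
  fixes f :: "real \<Rightarrow> real"
  assumes "continuous_on {0..u} f" "0 \<le> u" "\<And>v. v \<in> {0..u} \<Longrightarrow> \<bar>f v\<bar> \<le> B"
  shows "\<bar>integral {0..u} f\<bar> \<le> B * u"
  using integral_bound[of 0 u f B] assms by simp

text \<open>The part \<open>D\<close> of \<open>E\<close> is estimated directly. The remainder
  \<open>\<omega>\<close> has mean zero on every cell, so a kernel frozen at the left end
  annihilates it and only the variation of the kernel over a cell acts on it; in an increment of
  \<open>H\<close> this yields the factor \<open>h^2\<close>. On the current cell the integral runs
  only up to \<open>u\<close> and nothing cancels, so the leading part is subtracted explicitly;
  \<open>moment_primitive\<close> shows later that the tests do not see it.\<close>

lemma history_term_bounds: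
  fixes \<kappa> :: "real \<Rightarrow> real \<Rightarrow> real" and D \<omega> :: "nat \<Rightarrow> real \<Rightarrow> real"
  assumes h: "h > 0" and N: "real N * h = T" and C: "C \<ge> 0" and w: "w \<ge> 0"
    and \<kappa>: "continuous_on (kernel_domain T) (\<lambda>(t, s). \<kappa> t s)"
    "\<And>t s. 0 \<le> s \<Longrightarrow> s \<le> t \<Longrightarrow> t \<le> T \<Longrightarrow> \<bar>\<kappa> t s\<bar> \<le> C"
    "\<And>t t' s. 0 \<le> s \<Longrightarrow> s \<le> t' \<Longrightarrow> t' \<le> t \<Longrightarrow> t \<le> T \<Longrightarrow> \<bar>\<kappa> t s - \<kappa> t' s\<bar> \<le> C * (t - t')"
    "\<And>t s s'. 0 \<le> s' \<Longrightarrow> s' \<le> s \<Longrightarrow> s \<le> t \<Longrightarrow> t \<le> T \<Longrightarrow> \<bar>\<kappa> t s - \<kappa> t s'\<bar> \<le> C * (s - s')"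
    "\<And>t t' s s'. 0 \<le> s' \<Longrightarrow> s' \<le> s \<Longrightarrow> s \<le> t' \<Longrightarrow> t' \<le> t \<Longrightarrow> t \<le> T \<Longrightarrow>
       \<bar>(\<kappa> t s - \<kappa> t' s) - (\<kappa> t s' - \<kappa> t' s')\<bar> \<le> C * (t - t') * (s - s')"
    and E: "continuous_on {0..T} E"
    "\<And>n u. n < N \<Longrightarrow> u \<in> {0..1} \<Longrightarrow> E (real n * h + u * h) = D n u + \<omega> n u"
    and D: "\<And>n u. n < N \<Longrightarrow> u \<in> {0..1} \<Longrightarrow> \<bar>D n u\<bar> \<le> Y n"
    and \<omega>: "\<And>n. n < N \<Longrightarrow> continuous_on {0..1} (\<omega> n)"
    "\<And>n. n < N \<Longrightarrow> integral {0..1} (\<omega> n) = 0"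
    "\<And>n u. n < N \<Longrightarrow> u \<in> {0..1} \<Longrightarrow> \<bar>\<omega> n u\<bar> \<le> w"
    and n: "n < N" and u: "u \<in> {0..1}"
  defines "H \<equiv> \<lambda>t. integral {0..t} (\<lambda>\<tau>. \<kappa> t \<tau> * E \<tau>)"
  shows "\<bar>H (real n * h + u * h) - H (real n * h) - \<kappa> (real n * h) (real n * h) * h * integral {0..u} (\<omega> n)\<bar>
      \<le> C * h * (Y n + h * (\<Sum>i<n. Y i)) + (T + 2) * C * h^2 * w"
    and "\<bar>H (real n * h)\<bar> \<le> C * h * (\<Sum>i<n. Y i) + T * C * h * w"
proof -
  define t where "t = real n * h"
  define s where "s = t + u * h"
  have tT: "0 \<le> t" "t \<le> s" "s \<le> t + h" "s \<le> T" "t + h \<le> T"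
  proof -
    show "0 \<le> t" "t \<le> s" "s \<le> t + h" using h u by (auto simp: t_def s_def mult_le_cancel_right1)
    have "real (Suc n) * h \<le> real N * h" using n h by (intro mult_right_mono) auto
    then show "t + h \<le> T" using N by (simp add: t_def algebra_simps)
    then show "s \<le> T" using \<open>s \<le> t + h\<close> by simp
  qed
  have nh: "real n * h \<le> T" using tT by (simp add: t_def)
  have ti: "0 \<le> real i * h" "real i * h + v * h \<le> t" "real i * h \<le> real i * h + v * h" "v * h \<le> h"
    if "i < n" "v \<in> {0..1}" for i v
  proof -
    have "real (Suc i) * h \<le> real n * h" using that h by (intro mult_right_mono) auto
    moreover show "v * h \<le> h" using that h by (auto simp: mult_le_cancel_right1)
    ultimately show "real i * h + v * h \<le> t" by (simp add: t_def algebra_simps)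
  qed (use that h in auto)
  have cE: "continuous_on {0..t'} E" if "t' \<le> T" for t'
    using continuous_on_subset[OF E(1)] that by auto
  have c\<kappa>: "continuous_on {0..t'} (\<kappa> t')" if "t' \<le> T" for t'
    using continuous_on_kernel_section[OF \<kappa>(1) that] by simp
  have c\<kappa>s: "continuous_on {0..t} (\<kappa> s)" "continuous_on {t..s} (\<kappa> s)"
    using continuous_on_subset[OF c\<kappa>[of s]] tT by auto
  have c\<kappa>t: "continuous_on {0..t} (\<kappa> t)" using c\<kappa> tT by simp
  have cEt: "continuous_on {0..t} E" using cE tT by simp
  \<comment> \<open>The change of the kernel on the past cells between the times \<open>t\<close>
    and \<open>s\<close>. It is of order \<open>h\<close>, and by the mixed difference bound its
    variation over one cell is of order \<open>h^2\<close>.\<close>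
  define g where "g \<tau> = \<kappa> s \<tau> - \<kappa> t \<tau>" for \<tau>
  have cg: "continuous_on {0..t} g" unfolding g_def by (intro continuous_intros c\<kappa>s c\<kappa>t)
  have cell: "continuous_on {0..1} (\<lambda>v. f (real i * h + v * h))" if "i < n" "continuous_on {0..t} f" for i and f :: "real \<Rightarrow> real"
    using ti[OF that(1)] h by (intro continuous_on_compose2[OF that(2)] continuous_intros) (force simp: image_subset_iff)
  have "H s = integral {0..t} (\<lambda>\<tau>. \<kappa> s \<tau> * E \<tau>) + integral {t..s} (\<lambda>\<tau>. \<kappa> s \<tau> * E \<tau>)"
    unfolding H_def using tT
    by (intro Henstock_Kurzweil_Integration.integral_combine[symmetric] integrable_continuous_real continuous_intros c\<kappa> cE) auto
  moreover have "integral {0..t} (\<lambda>\<tau>. \<kappa> s \<tau> * E \<tau>) - H t = integral {0..t} (\<lambda>\<tau>. \<kappa> s \<tau> * E \<tau> - \<kappa> t \<tau> * E \<tau>)"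
    unfolding H_def by (intro integral_diff[symmetric] integrable_continuous_real continuous_intros c\<kappa>s c\<kappa>t cEt)
  moreover have "\<dots> = integral {0..t} (\<lambda>\<tau>. g \<tau> * E \<tau>)" by (simp add: g_def left_diff_distrib)
  ultimately have Hs: "H s - H t = integral {0..t} (\<lambda>\<tau>. g \<tau> * E \<tau>) + integral {t..s} (\<lambda>\<tau>. \<kappa> s \<tau> * E \<tau>)" by simp
  have I1: "\<bar>integral {0..t} (\<lambda>\<tau>. g \<tau> * E \<tau>)\<bar> \<le> h * (C * h * (\<Sum>i<n. Y i)) + T * C * h^2 * w"
  proof -
    have b: "\<bar>integral {0..1} (\<lambda>v. g (real i * h + v * h) * E (real i * h + v * h))\<bar> \<le> C * h * Y i + C * h^2 * w"
      if i: "i < n" for i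
    proof -
      have iN: "i < N" using i n by simp
      have "\<bar>integral {0..1} (\<lambda>v. g (real i * h + v * h) * E (real i * h + v * h) - g (real i * h) * \<omega> i v)\<bar>
         \<le> (C * h * Y i + C * h^2 * w) * 1"
      proof (rule abs_integral_le)
        show "continuous_on {0..1} (\<lambda>v. g (real i * h + v * h) * E (real i * h + v * h) - g (real i * h) * \<omega> i v)"
          by (intro continuous_intros cell i cg cEt \<omega>(1) iN)
        fix v :: real assume v: "v \<in> {0..1}"
        note tv = ti[OF i v]
        have sh: "s - t \<le> h" "0 \<le> s - t" using tT by auto
        have g1: "\<bar>g (real i * h + v * h)\<bar> \<le> C * h"
        proof -
          have "\<bar>g (real i * h + v * h)\<bar> \<le> C * (s - t)" unfolding g_def using tv tT by (intro \<kappa>(3)) auto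
          also have "\<dots> \<le> C * h" using sh C by (intro mult_left_mono)
          finally show ?thesis .
        qed
        have g2: "\<bar>g (real i * h + v * h) - g (real i * h)\<bar> \<le> C * h^2"
        proof -
          have "\<bar>g (real i * h + v * h) - g (real i * h)\<bar> \<le> C * (s - t) * (real i * h + v * h - real i * h)"
            unfolding g_def using tv tT by (intro \<kappa>(5)) auto
          also have "\<dots> \<le> C * h * h" using sh C tv h v by (intro mult_mono) auto
          finally show ?thesis by (simp add: power2_eq_square)
        qed
        have "g (real i * h + v * h) * E (real i * h + v * h) - g (real i * h) * \<omega> i v =
          g (real i * h + v * h) * D i v + (g (real i * h + v * h) - g (real i * h)) * \<omega> i v"
          by (subst E(2)[OF iN v]) (simp add: algebra_simps)
        also have "\<bar>\<dots>\<bar> \<le> C * h * Y i + C * h^2 * w"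
        proof (intro order_trans[OF abs_triangle_ineq] add_mono)
          show "\<bar>g (real i * h + v * h) * D i v\<bar> \<le> C * h * Y i"
            unfolding abs_mult using g1 D[OF iN v] C h by (intro mult_mono) auto
          show "\<bar>(g (real i * h + v * h) - g (real i * h)) * \<omega> i v\<bar> \<le> C * h^2 * w"
            unfolding abs_mult using g2 \<omega>(3)[OF iN v] C h by (intro mult_mono) auto
        qed
        finally show "\<bar>g (real i * h + v * h) * E (real i * h + v * h) - g (real i * h) * \<omega> i v\<bar> \<le> C * h * Y i + C * h^2 * w" .
      qed simp
      moreover have "integral {0..1} (\<lambda>v. g (real i * h + v * h) * E (real i * h + v * h) - g (real i * h) * \<omega> i v)
         = integral {0..1} (\<lambda>v. g (real i * h + v * h) * E (real i * h + v * h)) - integral {0..1} (\<lambda>v. g (real i * h) * \<omega> i v)"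
        by (intro integral_diff integrable_continuous_real continuous_intros cell i cg cEt \<omega>(1) iN)
      ultimately show ?thesis using \<omega>(2)[OF iN] by simp
    qed
    have "integral {0..t} (\<lambda>\<tau>. g \<tau> * E \<tau>) = (\<Sum>i<n. h * integral {0..1} (\<lambda>v. g (real i * h + v * h) * E (real i * h + v * h)))"
      using integral_cells[OF h, of "\<lambda>\<tau>. g \<tau> * E \<tau>" n] integrable_continuous_real[OF continuous_on_mult[OF cg cEt]]
      by (simp add: t_def)
    also have "\<bar>\<dots>\<bar> \<le> (\<Sum>i<n. h * (C * h * Y i + C * h^2 * w))"
      using b h by (intro order_trans[OF sum_abs] sum_mono) (auto simp: abs_mult)
    also have "\<dots> = h * (C * h * (\<Sum>i<n. Y i)) + (real n * h) * (C * h^2 * w)"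
      by (simp add: sum.distrib sum_distrib_left algebra_simps)
    also have "\<dots> \<le> h * (C * h * (\<Sum>i<n. Y i)) + T * (C * h^2 * w)"
      using nh C w by (intro add_left_mono mult_right_mono) auto
    finally show ?thesis by (simp add: mult.assoc)
  qed
  have I2: "\<bar>integral {t..s} (\<lambda>\<tau>. \<kappa> s \<tau> * E \<tau>) - \<kappa> t t * h * integral {0..u} (\<omega> n)\<bar> \<le> C * h * Y n + 2 * C * h^2 * w"
  proof -
    have cu: "continuous_on {0..u} (\<lambda>v. f (t + v * h))" if "continuous_on {t..s} f" for f :: "real \<Rightarrow> real"
      using h u by (intro continuous_on_compose2[OF that] continuous_intros) (auto simp: s_def mult_right_mono)
    have c\<omega>: "continuous_on {0..u} (\<omega> n)" using continuous_on_subset[OF \<omega>(1)[OF n]] u by auto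
    have cEs: "continuous_on {t..s} E" using continuous_on_subset[OF E(1)] tT by auto
    \<comment> \<open>On the current cell the kernel is frozen at (t, t), first in the second and
      then in the first argument, at a cost of \<open>C * h\<close> each.\<close>
    let ?f = "\<lambda>v. \<kappa> s (t + v * h) * E (t + v * h) - \<kappa> t t * \<omega> n v"
    have "integral {t..s} (\<lambda>\<tau>. \<kappa> s \<tau> * E \<tau>) - \<kappa> t t * h * integral {0..u} (\<omega> n) = h * integral {0..u} ?f"
    proof -
      have "integral {0..u} ?f = integral {0..u} (\<lambda>v. \<kappa> s (t + v * h) * E (t + v * h)) - integral {0..u} (\<lambda>v. \<kappa> t t * \<omega> n v)"
        by (intro integral_diff integrable_continuous_real continuous_on_mult cu c\<kappa>s cEs c\<omega> continuous_on_const)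
      moreover have "integral {t..s} (\<lambda>\<tau>. \<kappa> s \<tau> * E \<tau>) = h * integral {0..u} (\<lambda>v. \<kappa> s (t + v * h) * E (t + v * h))"
        unfolding s_def by (rule integral_affine[OF h])
      ultimately show ?thesis by (simp add: right_diff_distrib)
    qed
    moreover have "\<bar>integral {0..u} ?f\<bar> \<le> (C * Y n + 2 * C * h * w) * u"
    proof (rule abs_integral_le)
      show "continuous_on {0..u} ?f"
        by (intro continuous_on_diff continuous_on_mult cu c\<kappa>s cEs c\<omega> continuous_on_const)
      fix v assume v: "v \<in> {0..u}"
      then have v1: "v \<in> {0..1}" using u by auto
      have vh: "0 \<le> v * h" "v * h \<le> h" "v * h \<le> u * h" using v v1 h by (auto simp: mult_le_cancel_right1)
      have "\<bar>\<kappa> s (t + v * h) - \<kappa> s t\<bar> \<le> C * h"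
      proof -
        have "\<bar>\<kappa> s (t + v * h) - \<kappa> s t\<bar> \<le> C * (t + v * h - t)" using vh tT by (intro \<kappa>(4)) (auto simp: s_def)
        also have "\<dots> \<le> C * h" using vh C by (intro mult_left_mono) auto
        finally show ?thesis .
      qed
      moreover have "\<bar>\<kappa> s t - \<kappa> t t\<bar> \<le> C * h"
      proof -
        have "\<bar>\<kappa> s t - \<kappa> t t\<bar> \<le> C * (s - t)" using tT by (intro \<kappa>(3)) auto
        also have "\<dots> \<le> C * h" using tT C by (intro mult_left_mono) auto
        finally show ?thesis .
      qed
      ultimately have k: "\<bar>\<kappa> s (t + v * h) - \<kappa> t t\<bar> \<le> 2 * C * h" by linarith
      have En: "E (t + v * h) = D n v + \<omega> n v" using E(2)[OF n v1] by (simp add: t_def)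
      have "?f v = \<kappa> s (t + v * h) * D n v + (\<kappa> s (t + v * h) - \<kappa> t t) * \<omega> n v"
        by (subst En) (simp add: algebra_simps)
      also have "\<bar>\<dots>\<bar> \<le> C * Y n + 2 * C * h * w"
      proof (intro order_trans[OF abs_triangle_ineq] add_mono)
        have "\<bar>\<kappa> s (t + v * h)\<bar> \<le> C" using vh tT by (intro \<kappa>(2)) (auto simp: s_def)
        then show "\<bar>\<kappa> s (t + v * h) * D n v\<bar> \<le> C * Y n"
          unfolding abs_mult using D[OF n v1] C by (intro mult_mono) auto
        show "\<bar>(\<kappa> s (t + v * h) - \<kappa> t t) * \<omega> n v\<bar> \<le> 2 * C * h * w"
          unfolding abs_mult using k \<omega>(3)[OF n v1] C h by (intro mult_mono) auto
      qed
      finally show "\<bar>?f v\<bar> \<le> C * Y n + 2 * C * h * w" .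
    qed (use u in auto)
    moreover have "(C * Y n + 2 * C * h * w) * u \<le> (C * Y n + 2 * C * h * w) * 1"
    proof (rule mult_left_mono)
      have "0 \<le> Y n" using D[OF n, of 0] by force
      then show "0 \<le> C * Y n + 2 * C * h * w" using C h w by simp
    qed (use u in auto)
    ultimately have "\<bar>integral {t..s} (\<lambda>\<tau>. \<kappa> s \<tau> * E \<tau>) - \<kappa> t t * h * integral {0..u} (\<omega> n)\<bar> \<le> h * (C * Y n + 2 * C * h * w)"
      using h by (simp add: abs_mult)
    then show ?thesis by (simp add: algebra_simps power2_eq_square)
  qed
  show "\<bar>H (real n * h + u * h) - H (real n * h) - \<kappa> (real n * h) (real n * h) * h * integral {0..u} (\<omega> n)\<bar>
      \<le> C * h * (Y n + h * (\<Sum>i<n. Y i)) + (T + 2) * C * h^2 * w"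
    using Hs I1 I2 unfolding s_def t_def by (simp add: algebra_simps)
  \<comment> \<open>At a mesh point all past cells are complete, and freezing the second argument
    alone gives one factor \<open>h\<close> in front of \<open>w\<close>.\<close>
  have "H t = (\<Sum>i<n. h * integral {0..1} (\<lambda>v. \<kappa> t (real i * h + v * h) * E (real i * h + v * h)))"
    unfolding H_def
    using integral_cells[OF h, of "\<lambda>\<tau>. \<kappa> t \<tau> * E \<tau>" n] integrable_continuous_real[OF continuous_on_mult[OF c\<kappa>t cEt]]
    by (simp add: t_def)
  also have "\<bar>\<dots>\<bar> \<le> (\<Sum>i<n. h * (C * (Y i + h * w)))"
  proof (intro order_trans[OF sum_abs] sum_mono)
    fix i assume "i \<in> {..<n}"
    then have i: "i < n" "i < N" using n by auto
    let ?f = "\<lambda>v. \<kappa> t (real i * h + v * h) * E (real i * h + v * h) - \<kappa> t (real i * h) * \<omega> i v"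
    have "\<bar>integral {0..1} ?f\<bar> \<le> (C * (Y i + h * w)) * 1"
    proof (rule abs_integral_le)
      show "continuous_on {0..1} ?f"
        by (intro continuous_intros cell i c\<kappa>t cEt \<omega>(1))
      fix v :: real assume v: "v \<in> {0..1}"
      note tv = ti[OF i(1) v]
      have "\<bar>\<kappa> t (real i * h + v * h)\<bar> \<le> C" using tv tT by (intro \<kappa>(2)) auto
      then have a: "\<bar>\<kappa> t (real i * h + v * h) * D i v\<bar> \<le> C * Y i"
        unfolding abs_mult using C D[OF i(2) v] by (intro mult_mono) auto
      have "\<bar>\<kappa> t (real i * h + v * h) - \<kappa> t (real i * h)\<bar> \<le> C * (real i * h + v * h - real i * h)"
        using tv tT by (intro \<kappa>(4)) auto
      also have "\<dots> \<le> C * h" using tv C by (intro mult_left_mono) auto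
      finally have b: "\<bar>(\<kappa> t (real i * h + v * h) - \<kappa> t (real i * h)) * \<omega> i v\<bar> \<le> C * h * w"
        unfolding abs_mult using C h \<omega>(3)[OF i(2) v] by (intro mult_mono) auto
      have "?f v = \<kappa> t (real i * h + v * h) * D i v + (\<kappa> t (real i * h + v * h) - \<kappa> t (real i * h)) * \<omega> i v"
        by (subst E(2)[OF i(2) v]) (simp add: algebra_simps)
      then show "\<bar>?f v\<bar> \<le> C * (Y i + h * w)" using a b by (simp add: algebra_simps)
    qed simp
    moreover have "integral {0..1} ?f = integral {0..1} (\<lambda>v. \<kappa> t (real i * h + v * h) * E (real i * h + v * h))
        - integral {0..1} (\<lambda>v. \<kappa> t (real i * h) * \<omega> i v)"
      by (intro integral_diff integrable_continuous_real continuous_intros cell i c\<kappa>t cEt \<omega>(1))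
    ultimately show "\<bar>h * integral {0..1} (\<lambda>v. \<kappa> t (real i * h + v * h) * E (real i * h + v * h))\<bar> \<le> h * (C * (Y i + h * w))"
      using h \<omega>(2)[OF i(2)] by (simp add: abs_mult)
  qed
  also have "\<dots> = C * h * (\<Sum>i<n. Y i) + (real n * h) * (C * h * w)"
    by (simp add: sum.distrib sum_distrib_left algebra_simps)
  also have "\<dots> \<le> C * h * (\<Sum>i<n. Y i) + T * (C * h * w)"
    using nh C w h by (intro add_left_mono mult_right_mono) auto
  finally show "\<bar>H (real n * h)\<bar> \<le> C * h * (\<Sum>i<n. Y i) + T * C * h * w" by (simp add: t_def mult.assoc)
qed

text \<open>Here the orthogonality of \<open>\<omega>\<close> up to degree \<open>m\<close>, one
  more than the tests reach, pays off. The products of \<open>\<omega>\<close> with 1 and with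
  \<open>u\<close> and the primitive of \<open>\<omega>\<close> all have zero moments of index below
  \<open>m\<close>. So in front of \<open>\<omega>\<close> the factor \<open>k\<close> may be
  replaced by an affine function with error \<open>p2\<close>, whereas in front of \<open>D\<close>
  it is replaced by its value at 0 with error \<open>p1\<close>.\<close>

lemma cell_moment_perturbation:
  fixes k H D \<omega> :: "real \<Rightarrow> real"
  assumes cont: "continuous_on {0..1} k" "continuous_on {0..1} H" "continuous_on {0..1} D" "continuous_on {0..1} \<omega>"
    and orth: "\<And>j. j \<le> m \<Longrightarrow> legendre_moment \<omega> j = 0" and j: "j < m"
    and F: "legendre_moment (\<lambda>u. k u * (D u + \<omega> u) - H u) j = F"
    and p1: "\<And>u. u \<in> {0..1} \<Longrightarrow> \<bar>k u - k 0\<bar> \<le> p1"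
    and p2: "\<And>u. u \<in> {0..1} \<Longrightarrow> \<bar>k u - k 0 - c1 * u\<bar> \<le> p2"
    and Y: "\<And>u. u \<in> {0..1} \<Longrightarrow> \<bar>D u\<bar> \<le> Y" and w: "\<And>u. u \<in> {0..1} \<Longrightarrow> \<bar>\<omega> u\<bar> \<le> w"
    and q: "\<And>u. u \<in> {0..1} \<Longrightarrow> \<bar>H u - H 0 - c2 * integral {0..u} \<omega>\<bar> \<le> q"
    and B: "\<And>f w. continuous_on {0..1} f \<Longrightarrow> (\<And>u. u \<in> {0..1} \<Longrightarrow> \<bar>f u\<bar> \<le> w) \<Longrightarrow> \<bar>legendre_moment f j\<bar> \<le> B * w"
  shows "\<bar>k 0 * legendre_moment D j - (if j = 0 then H 0 else 0) - F\<bar> \<le> B * (p1 * Y + p2 * w + q)"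
proof -
  define f1 where "f1 u = (k u - k 0) * D u" for u
  define f2 where "f2 u = (k u - k 0 - c1 * u) * \<omega> u" for u
  define f3 where "f3 u = u * \<omega> u" for u
  define V where "V u = integral {0..u} \<omega>" for u
  define Q where "Q u = H u - H 0 - c2 * V u" for u
  have cV: "continuous_on {0..1} V" unfolding V_def
    by (intro indefinite_integral_continuous_1 integrable_continuous_real cont)
  have c: "continuous_on {0..1} f1" "continuous_on {0..1} f2" "continuous_on {0..1} f3" "continuous_on {0..1} Q"
    unfolding f1_def f2_def f3_def Q_def by (intro continuous_intros cont cV)+
  have "F = legendre_moment (\<lambda>u. ((((k 0 * D u + k 0 * \<omega> u) + f1 u) + (c1 * f3 u + f2 u)) - H 0) - (Q u + c2 * V u)) j"
    unfolding F[symmetric] by (intro moment_cong) (simp add: f1_def f2_def f3_def Q_def algebra_simps)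
  also have "\<dots> = k 0 * legendre_moment D j + k 0 * legendre_moment \<omega> j + legendre_moment f1 j
      + (c1 * legendre_moment f3 j + legendre_moment f2 j) - legendre_moment (\<lambda>u. H 0) j
      - (legendre_moment Q j + c2 * legendre_moment V j)"
    by (simp add: moment_add moment_diff moment_cmult continuous_on_add continuous_on_diff continuous_on_mult_left
        continuous_on_const c cont cV)
  also have "legendre_moment \<omega> j = 0" using orth j by simp
  also have "legendre_moment V j = 0" unfolding V_def using moment_primitive[OF cont(4) orth j] .
  also have "legendre_moment f3 j = 0"
  proof -
    have "degree ([:0, 1:] * shifted_legendre j) \<le> m"
      using j by (intro order_trans[OF degree_mult_le]) simp
    from integral_orthogonal_poly[OF cont(4) orth this] show ?thesis
      by (simp add: legendre_moment_def f3_def algebra_simps)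
  qed
  finally have "k 0 * legendre_moment D j - (if j = 0 then H 0 else 0) - F
      = legendre_moment Q j - legendre_moment f1 j - legendre_moment f2 j"
    by (simp add: moment_const)
  moreover have "\<bar>legendre_moment Q j\<bar> \<le> B * q"
    using q by (intro B c) (simp add: Q_def V_def)
  moreover have "\<bar>legendre_moment f1 j\<bar> \<le> B * (p1 * Y)"
  proof (intro B c)
    fix u :: real assume u: "u \<in> {0..1}"
    show "\<bar>f1 u\<bar> \<le> p1 * Y"
      unfolding f1_def abs_mult using p1[OF u] Y[OF u] by (intro mult_mono) auto
  qed
  moreover have "\<bar>legendre_moment f2 j\<bar> \<le> B * (p2 * w)"
  proof (intro B c)
    fix u :: real assume u: "u \<in> {0..1}"
    show "\<bar>f2 u\<bar> \<le> p2 * w"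
      unfolding f2_def abs_mult using p2[OF u] w[OF u] by (intro mult_mono) auto
  qed
  ultimately show ?thesis by (simp add: distrib_left)
qed

lemma legendre_bounds:
  obtains B where "B \<ge> 1"
    "\<And>j u. j \<le> m \<Longrightarrow> u \<in> {0..1} \<Longrightarrow> \<bar>poly (shifted_legendre j) u\<bar> \<le> B"
    "\<And>j u. j \<le> m \<Longrightarrow> u \<in> {0..1} \<Longrightarrow> \<bar>poly (pderiv (shifted_legendre j)) u\<bar> \<le> B"
    "\<And>j f w. j \<le> m \<Longrightarrow> continuous_on {0..1} f \<Longrightarrow> (\<And>u. u \<in> {0..1} \<Longrightarrow> \<bar>f u\<bar> \<le> w) \<Longrightarrow> \<bar>legendre_moment f j\<bar> \<le> B * w"
    "\<And>j. j \<le> m \<Longrightarrow> 1 / legendre_norm2 j \<le> B"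
proof -
  have "\<exists>b. b > 0 \<and> (\<forall>u\<in>{0..1}. \<bar>poly p u\<bar> \<le> b)" for p :: "real poly" using poly_bounded_01[of p] by metis
  then obtain b :: "real poly \<Rightarrow> real" where b: "\<And>p. b p > 0" "\<And>p u. u \<in> {0..1} \<Longrightarrow> \<bar>poly p u\<bar> \<le> b p" by metis
  have "\<exists>c. c > 0 \<and> (\<forall>f w. continuous_on {0..1} f \<longrightarrow> (\<forall>u\<in>{0..1}. \<bar>f u\<bar> \<le> w) \<longrightarrow> \<bar>legendre_moment f j\<bar> \<le> c * w)" for j
    by (rule moment_bound[of j]) blast
  then obtain c where c: "\<And>j. c j > 0"
    "\<And>j f w. continuous_on {0..1} f \<Longrightarrow> (\<forall>u\<in>{0..1}. \<bar>f u\<bar> \<le> w) \<Longrightarrow> \<bar>legendre_moment f j\<bar> \<le> c j * w" by metis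
  define \<beta> where "\<beta> j = b (shifted_legendre j) + b (pderiv (shifted_legendre j)) + c j + 1 / legendre_norm2 j" for j
  define B where "B = 1 + (\<Sum>j\<le>m. \<beta> j)"
  have pos: "b (shifted_legendre j) > 0" "b (pderiv (shifted_legendre j)) > 0" "c j > 0" "1 / legendre_norm2 j > 0" for j
    using b c legendre_norm2_pos by auto
  have \<beta>0: "\<beta> j \<ge> 0" for j using pos[of j] by (simp add: \<beta>_def)
  have \<beta>B: "\<beta> j \<le> B" if "j \<le> m" for j
    using member_le_sum[of j "{..m}" \<beta>] \<beta>0 that by (simp add: B_def)
  have le: "b (shifted_legendre j) \<le> B" "b (pderiv (shifted_legendre j)) \<le> B" "c j \<le> B" "1 / legendre_norm2 j \<le> B"
    if "j \<le> m" for j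
    using \<beta>B[OF that] pos[of j] unfolding \<beta>_def by linarith+
  show ?thesis
  proof (rule that)
    show "B \<ge> 1" using \<beta>0 by (simp add: B_def sum_nonneg)
    show "\<bar>poly (shifted_legendre j) u\<bar> \<le> B" if "j \<le> m" "u \<in> {0..1}" for j u
      using b(2)[OF that(2)] le(1)[OF that(1)] order_trans by blast
    show "\<bar>poly (pderiv (shifted_legendre j)) u\<bar> \<le> B" if "j \<le> m" "u \<in> {0..1}" for j u
      using b(2)[OF that(2)] le(2)[OF that(1)] order_trans by blast
    show "\<bar>legendre_moment f j\<bar> \<le> B * w" if "j \<le> m" "continuous_on {0..1} f" "\<And>u. u \<in> {0..1} \<Longrightarrow> \<bar>f u\<bar> \<le> w" for j f w
    proof -
      have "0 \<le> w" using that(3)[of 0] by force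
      then have "c j * w \<le> B * w" using le(3)[OF that(1)] by (rule mult_right_mono[rotated])
      then show ?thesis using c(2)[of f w j] that by fastforce
    qed
    show "1 / legendre_norm2 j \<le> B" if "j \<le> m" for j using le(4)[OF that] .
  qed
qed

text \<open>Translates the moment equations into the recursion of \<open>discrete_stability\<close>.
  The hypothesis \<open>h * w \<le> b\<close> permits a remainder larger than \<open>b\<close>, as
  is necessary when \<open>b\<close> is of order \<open>h^(m + 2)\<close>. In the conclusion
  \<open>D n\<close> is only of size \<open>b\<close>, since its constant mode carries the memory;
  the derivative loses that mode, and apart from the top mode the rest is of size
  \<open>a + h * b\<close>.\<close>

lemma first_kind_dg_stability:
  fixes K :: "real \<Rightarrow> real \<Rightarrow> real" and T k0 :: real and m :: nat
  assumes T: "T > 0" and m: "m \<ge> 1" and K: "Ck_on 3 (kernel_domain T) (\<lambda>(t, s). K t s)"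
    and k0: "k0 > 0" "\<forall>t\<in>{0..T}. k0 \<le> \<bar>K t t\<bar>"
  obtains C h0 where "C > 0" "h0 > 0"
    "\<And>N h E e M D \<omega> F \<tau> w a b. \<lbrakk>N \<ge> 1; h = T / real N; h < h0;
      continuous_on {0..T} E; E 0 = 0; finite M;
      \<And>s. s \<in> {0<..<T} - M \<Longrightarrow> (E has_real_derivative e s) (at s);
      \<And>n. n < N \<Longrightarrow> degree (D n) \<le> m;
      \<And>n u. n < N \<Longrightarrow> u \<in> {0..1} \<Longrightarrow> E (real n * h + u * h) = poly (D n) u + \<omega> n u;
      \<And>n. n < N \<Longrightarrow> continuous_on {0..1} (\<omega> n);
      \<And>n j. n < N \<Longrightarrow> j \<le> m \<Longrightarrow> legendre_moment (\<omega> n) j = 0;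
      \<And>n u. n < N \<Longrightarrow> u \<in> {0..1} \<Longrightarrow> \<bar>\<omega> n u\<bar> \<le> w;
      \<And>n j. n < N \<Longrightarrow> j < m \<Longrightarrow> legendre_moment
        (\<lambda>u. integral {0..real n * h + u * h} (\<lambda>\<tau>. K (real n * h + u * h) \<tau> * e \<tau>)) j = F n j;
      \<And>n j. n < N \<Longrightarrow> j < m \<Longrightarrow> \<bar>F n j\<bar> \<le> a;
      \<And>n j. n < N \<Longrightarrow> j < m \<Longrightarrow> odd (j + m) \<Longrightarrow> \<bar>F n j\<bar> \<le> h * b;
      0 \<le> a; a \<le> b; h * w \<le> b;
      \<bar>\<omega> 0 0 + \<tau> 0\<bar> \<le> b;
      \<And>n. Suc n < N \<Longrightarrow> \<bar>\<omega> n 1 - \<omega> (Suc n) 0 - \<tau> (Suc n) + (-1) ^ m * \<tau> n\<bar> \<le> h * b;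
      \<And>n. n < N \<Longrightarrow> \<bar>\<tau> n\<bar> \<le> b\<rbrakk> \<Longrightarrow>
      \<forall>n<N. \<exists>\<beta>. \<bar>\<beta>\<bar> \<le> C * b \<and> (\<forall>u\<in>{0..1}. \<bar>poly (D n) u\<bar> \<le> C * b \<and>
        \<bar>poly (pderiv (D n)) u - \<beta> * poly (pderiv (shifted_legendre m)) u\<bar> \<le> C * (a + h * b))"
proof -
  obtain \<kappa> k' C1 where C1: "(C1::real) > 0" and \<kappa>: "continuous_on (kernel_domain T) (\<lambda>(t, s). \<kappa> t s)"
    and ck: "continuous_on {0..T} (\<lambda>t. K t t)"
    and K\<kappa>: "\<And>t s. 0 \<le> s \<Longrightarrow> s \<le> t \<Longrightarrow> t \<le> T \<Longrightarrow> ((\<lambda>s. K t s) has_real_derivative \<kappa> t s) (at s within {0..t})"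
    and \<kappa>b: "\<And>t s. 0 \<le> s \<Longrightarrow> s \<le> t \<Longrightarrow> t \<le> T \<Longrightarrow> \<bar>\<kappa> t s\<bar> \<le> C1"
    "\<And>t t' s. 0 \<le> s \<Longrightarrow> s \<le> t' \<Longrightarrow> t' \<le> t \<Longrightarrow> t \<le> T \<Longrightarrow> \<bar>\<kappa> t s - \<kappa> t' s\<bar> \<le> C1 * (t - t')"
    "\<And>t s s'. 0 \<le> s' \<Longrightarrow> s' \<le> s \<Longrightarrow> s \<le> t \<Longrightarrow> t \<le> T \<Longrightarrow> \<bar>\<kappa> t s - \<kappa> t s'\<bar> \<le> C1 * (s - s')"
    "\<And>t t' s s'. 0 \<le> s' \<Longrightarrow> s' \<le> s \<Longrightarrow> s \<le> t' \<Longrightarrow> t' \<le> t \<Longrightarrow> t \<le> T \<Longrightarrow>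
       \<bar>(\<kappa> t s - \<kappa> t' s) - (\<kappa> t s' - \<kappa> t' s')\<bar> \<le> C1 * (t - t') * (s - s')"
    and kb: "\<And>t t'. 0 \<le> t' \<Longrightarrow> t' \<le> t \<Longrightarrow> t \<le> T \<Longrightarrow> \<bar>K t t - K t' t'\<bar> \<le> C1 * (t - t')"
    "\<And>t t'. 0 \<le> t' \<Longrightarrow> t' \<le> t \<Longrightarrow> t \<le> T \<Longrightarrow> \<bar>K t t - K t' t' - k' t' * (t - t')\<bar> \<le> C1 * (t - t')^2"
    by (rule kernel_bounds[OF T K]) blast
  obtain B where B: "B \<ge> 1"
    "\<And>j u. j \<le> m \<Longrightarrow> u \<in> {0..1} \<Longrightarrow> \<bar>poly (shifted_legendre j) u\<bar> \<le> B"
    "\<And>j u. j \<le> m \<Longrightarrow> u \<in> {0..1} \<Longrightarrow> \<bar>poly (pderiv (shifted_legendre j)) u\<bar> \<le> B"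
    and Bm: "\<And>j f w. j \<le> m \<Longrightarrow> continuous_on {0..1} f \<Longrightarrow> (\<And>u. u \<in> {0..1} \<Longrightarrow> \<bar>f u\<bar> \<le> w) \<Longrightarrow> \<bar>legendre_moment f j\<bar> \<le> B * w"
    and B\<gamma>: "\<And>j. j \<le> m \<Longrightarrow> 1 / legendre_norm2 j \<le> B"
    by (rule legendre_bounds[of m]) blast
  \<comment> \<open>\<open>Ca\<close> belongs to the moment equations and \<open>Cb\<close> to the
    increments of \<open>r\<close>, which involve the memory and the diagonal; \<open>G\<close>
    accounts for the division of the data by the diagonal and by the norms of the Legendre
    polynomials.\<close>
  define Ca where "Ca = B^2 * C1 * (2 * B + T + 3) / k0"
  define Cb where "Cb = (C1 * B + (T + 2) * C1) / k0 + (C1 * B + T * C1) * C1 / k0^2"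
  define C0 where "C0 = Ca + Cb"
  define G where "G = B / k0 + 1"
  have Cab: "Ca \<ge> 0" "Cb \<ge> 0" using B(1) C1 T k0 by (auto simp: Ca_def Cb_def)
  then have C0: "C0 \<ge> 0" by (simp add: C0_def)
  have G: "G \<ge> 1" using B(1) k0 by (simp add: G_def)
  obtain C2 h0 where C2: "C2 > 0" and h0: "h0 > 0" and
    stab: "\<And>h N c r g \<tau> a b. \<lbrakk>0 < h; h < h0; real N * h \<le> T; 0 \<le> a; a \<le> b;
      \<And>n j. n < N \<Longrightarrow> j < m \<Longrightarrow> \<bar>c n j - (if j = 0 then r n else 0) - g n j\<bar>
          \<le> C0 * h * ((\<Sum>j\<le>m. \<bar>c n j\<bar>) + h * (\<Sum>i<n. \<Sum>j\<le>m. \<bar>c i j\<bar>) + b);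
      \<And>n j. n < N \<Longrightarrow> j < m \<Longrightarrow> \<bar>g n j\<bar> \<le> a;
      \<And>n j. n < N \<Longrightarrow> j < m \<Longrightarrow> odd (j + m) \<Longrightarrow> \<bar>g n j\<bar> \<le> h * b;
      r 0 = 0;
      \<And>n. Suc n < N \<Longrightarrow> \<bar>r (Suc n) - r n\<bar>
          \<le> C0 * h * ((\<Sum>j\<le>m. \<bar>c n j\<bar>) + h * (\<Sum>i<n. \<Sum>j\<le>m. \<bar>c i j\<bar>) + b);
      \<bar>(\<Sum>j\<le>m. (-1) ^ j * c 0 j) - \<tau> 0\<bar> \<le> b;
      \<And>n. Suc n < N \<Longrightarrow>
          \<bar>(\<Sum>j\<le>m. (-1) ^ j * c (Suc n) j) - (\<Sum>j\<le>m. c n j) - \<tau> (Suc n) + (-1) ^ m * \<tau> n\<bar> \<le> h * b;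
      \<And>n. n < N \<Longrightarrow> \<bar>\<tau> n\<bar> \<le> b\<rbrakk> \<Longrightarrow>
      \<forall>n<N. (\<Sum>j\<le>m. \<bar>c n j\<bar>) \<le> C2 * b \<and>
        (\<forall>j<m. \<bar>c n j - (if j = 0 then r n else 0)\<bar> \<le> a + C2 * h * b)"
    by (fact discrete_stability[OF m T C0])
  define C where "C = B * C2 * G + real m * B * G * (1 + C2)"
  have C: "C > 0" using B(1) C2 G by (auto simp: C_def intro!: add_pos_nonneg)
  show ?thesis
  proof (rule that[OF C h0])
    fix N h E e M D \<omega> F \<tau> w a b
    assume N: "N \<ge> 1" and h: "h = T / real N" "h < h0"
      and E: "continuous_on {0..T} E" "E 0 = 0" and M: "finite M"
      and e: "\<And>s. s \<in> {0<..<T} - M \<Longrightarrow> (E has_real_derivative e s) (at s)"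
      and D: "\<And>n. n < N \<Longrightarrow> degree (D n) \<le> m"
      and ED: "\<And>n u. n < N \<Longrightarrow> u \<in> {0..1} \<Longrightarrow> E (real n * h + u * h) = poly (D n) u + \<omega> n u"
      and \<omega>: "\<And>n. n < N \<Longrightarrow> continuous_on {0..1} (\<omega> n)"
      "\<And>n j. n < N \<Longrightarrow> j \<le> m \<Longrightarrow> legendre_moment (\<omega> n) j = 0"
      "\<And>n u. n < N \<Longrightarrow> u \<in> {0..1} \<Longrightarrow> \<bar>\<omega> n u\<bar> \<le> w"
      and F: "\<And>n j. n < N \<Longrightarrow> j < m \<Longrightarrow> legendre_moment
        (\<lambda>u. integral {0..real n * h + u * h} (\<lambda>\<tau>. K (real n * h + u * h) \<tau> * e \<tau>)) j = F n j"
      "\<And>n j. n < N \<Longrightarrow> j < m \<Longrightarrow> \<bar>F n j\<bar> \<le> a"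
      "\<And>n j. n < N \<Longrightarrow> j < m \<Longrightarrow> odd (j + m) \<Longrightarrow> \<bar>F n j\<bar> \<le> h * b"
      and ab: "0 \<le> a" "a \<le> b" "h * w \<le> b"
      and jump: "\<bar>\<omega> 0 0 + \<tau> 0\<bar> \<le> b"
      "\<And>n. Suc n < N \<Longrightarrow> \<bar>\<omega> n 1 - \<omega> (Suc n) 0 - \<tau> (Suc n) + (-1) ^ m * \<tau> n\<bar> \<le> h * b"
      and \<tau>: "\<And>n. n < N \<Longrightarrow> \<bar>\<tau> n\<bar> \<le> b"
    have hp: "h > 0" and Nh: "real N * h = T" using N T h by auto
    have b: "b \<ge> 0" using ab by simp
    have w: "w \<ge> 0" using \<omega>(3)[of 0 0] N by force
    define H where "H t = integral {0..t} (\<lambda>\<tau>. \<kappa> t \<tau> * E \<tau>)" for t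
    \<comment> \<open>Dividing a moment equation by the diagonal value and the squared norm shows
      that \<open>c n j\<close> is \<open>g n j\<close> up to small terms, plus \<open>r n\<close>
      if \<open>j = 0\<close>. The memory at the left end is constant on the cell and thus enters
      only the mode 0, where the squared norm is 1.\<close>
    define c where "c n j = legendre_moment (poly (D n)) j / legendre_norm2 j" for n j
    define y where "y n = (\<Sum>j\<le>m. \<bar>c n j\<bar>)" for n
    define r where "r n = H (real n * h) / K (real n * h) (real n * h)" for n
    define g where "g n j = F n j / (K (real n * h) (real n * h) * legendre_norm2 j)" for n j
    have y0: "y n \<ge> 0" for n by (simp add: y_def sum_nonneg)
    have Dexp: "poly (D n) u = (\<Sum>j\<le>m. c n j * poly (shifted_legendre j) u)" if "n < N" for n u
      using poly_legendre_expansion[OF D[OF that]] by (simp add: c_def)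
    have Dexp': "poly (pderiv (D n)) u = (\<Sum>j\<le>m. c n j * poly (pderiv (shifted_legendre j)) u)" if "n < N" for n u
      using poly_pderiv_legendre_expansion[OF D[OF that]] by (simp add: c_def)
    have Db: "\<bar>poly (D n) u\<bar> \<le> B * y n" if "n < N" "u \<in> {0..1}" for n u
    proof -
      have "\<bar>poly (D n) u\<bar> \<le> (\<Sum>j\<le>m. \<bar>c n j\<bar> * B)"
        unfolding Dexp[OF that(1)]
        using B(2) that by (intro order_trans[OF sum_abs] sum_mono) (auto simp: abs_mult intro!: mult_left_mono)
      then show ?thesis by (simp add: y_def sum_distrib_left mult.commute)
    qed
    have tT: "0 \<le> real n * h" "real n * h \<le> real n * h + u * h" "real n * h + u * h \<le> T" "u * h \<le> h" if "n < N" "u \<in> {0..1}" for n u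
    proof -
      show *: "u * h \<le> h" using that hp by (auto simp: mult_le_cancel_right1)
      have "real (Suc n) * h \<le> real N * h" using that hp by (intro mult_right_mono) auto
      then show "real n * h + u * h \<le> T" using Nh * by (simp add: algebra_simps)
    qed (use that hp in auto)
    have int1: "integral {0..1} (\<omega> n) = 0" if "n < N" for n
      using \<omega>(2)[OF that, of 0] by (simp add: legendre_moment_def shifted_legendre_0)
    have C1': "0 \<le> C1" using C1 by simp
    have hist: "\<bar>H (real n * h + u * h) - H (real n * h) - \<kappa> (real n * h) (real n * h) * h * integral {0..u} (\<omega> n)\<bar>
        \<le> C1 * h * (B * y n + h * (\<Sum>i<n. B * y i)) + (T + 2) * C1 * h^2 * w"
      "\<bar>H (real n * h)\<bar> \<le> C1 * h * (\<Sum>i<n. B * y i) + T * C1 * h * w"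
      if "n < N" "u \<in> {0..1}" for n u
      unfolding H_def
      by (rule history_term_bounds[where D = "\<lambda>n. poly (D n)" and Y = "\<lambda>n. B * y n" and N = N and u = u]; fact)+
    define S where "S n = h * (\<Sum>i<n. y i)" for n
    have S0: "S n \<ge> 0" for n using hp y0 by (auto simp: S_def intro!: sum_nonneg mult_nonneg_nonneg)
    have BS: "h * (\<Sum>i<n. B * y i) = B * S n" for n by (simp add: S_def sum_distrib_left algebra_simps)
    have hist1: "\<bar>H (real n * h + u * h) - H (real n * h) - \<kappa> (real n * h) (real n * h) * h * integral {0..u} (\<omega> n)\<bar>
      \<le> C1 * h * (B * (y n + S n)) + (T + 2) * C1 * h^2 * w" if "n < N" "u \<in> {0..1}" for n u
      using hist(1)[OF that] unfolding BS by (simp add: algebra_simps)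
    have hist2: "\<bar>H (real n * h)\<bar> \<le> C1 * B * S n + T * C1 * h * w" if "n < N" for n
      using hist(2)[OF that, of 0] BS[of n] by (simp add: algebra_simps S_def sum_distrib_left)
    have volt: "integral {0..t} (\<lambda>s. K t s * e s) = K t t * E t - H t" if "0 \<le> t" "t \<le> T" for t
      unfolding H_def
    proof (rule integral_unique, rule volterra_by_parts[where M = M])
      show "((\<lambda>s. K t s) has_real_derivative \<kappa> t s) (at s within {0..t})" if "s \<in> {0..t}" for s
        using K\<kappa>[of s t] that \<open>t \<le> T\<close> by auto
      show "continuous_on {0..t} (\<kappa> t)" using continuous_on_kernel_section[OF \<kappa> that(2)] by simp
      show "continuous_on {0..t} E" using continuous_on_subset[OF E(1)] that by auto
      show "(E has_real_derivative e s) (at s)" if "s \<in> {0<..<t} - M" for s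
        using e that \<open>t \<le> T\<close> by auto
    qed (use that M E in auto)
    have cH: "continuous_on {0..T} H" unfolding H_def by (rule volterra_continuous[OF \<kappa> E(1)])
    have cell: "continuous_on {0..1} (\<lambda>u. f (real n * h + u * h))" if "n < N" "continuous_on {0..T} f" for n and f :: "real \<Rightarrow> real"
      using tT[OF that(1)] hp by (intro continuous_on_compose2[OF that(2)] continuous_intros) force
    have kn: "k0 \<le> \<bar>K (real n * h) (real n * h)\<bar>" if "n < N" for n
      using bspec[OF k0(2), of "real n * h"] tT[OF that, of 0] by auto
    have coef: "\<bar>c n j - (if j = 0 then r n else 0) - g n j\<bar> \<le> C0 * h * (y n + S n + b)" if n: "n < N" and j: "j < m" for n j
    proof -
      define t where "t = real n * h"
      define k where "k = K t t"
      have kk: "k0 \<le> \<bar>k\<bar>" using kn[OF n] by (simp add: k_def t_def)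
      \<comment> \<open>The terms \<open>0 * h\<close> match the values at \<open>u = 0\<close> of
        the rescaled functions to which the perturbation lemma is applied; they are simplified away
        afterwards.\<close>
      have "\<bar>K (t + 0 * h) (t + 0 * h) * legendre_moment (poly (D n)) j - (if j = 0 then H (t + 0 * h) else 0) - F n j\<bar>
        \<le> B * (C1 * h * (B * y n) + C1 * h^2 * w + (C1 * h * (B * (y n + S n)) + (T + 2) * C1 * h^2 * w))"
      proof (rule cell_moment_perturbation[where k = "\<lambda>u. K (t + u * h) (t + u * h)" and H = "\<lambda>u. H (t + u * h)"
            and \<omega> = "\<omega> n" and m = m and ?c1.0 = "k' t * h" and ?c2.0 = "\<kappa> t t * h"])
        show "continuous_on {0..1} (\<lambda>u. K (t + u * h) (t + u * h))" unfolding t_def by (rule cell[OF n ck])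
        show "continuous_on {0..1} (\<lambda>u. H (t + u * h))" unfolding t_def by (rule cell[OF n cH])
        show "continuous_on {0..1} (poly (D n))" by (rule continuous_on_poly_real)
        have "legendre_moment (\<lambda>u. K (t + u * h) (t + u * h) * (poly (D n) u + \<omega> n u) - H (t + u * h)) j
          = legendre_moment (\<lambda>u. integral {0..t + u * h} (\<lambda>\<tau>. K (t + u * h) \<tau> * e \<tau>)) j"
        proof (rule moment_cong)
          fix u :: real assume u: "u \<in> {0..1}"
          show "K (t + u * h) (t + u * h) * (poly (D n) u + \<omega> n u) - H (t + u * h) = integral {0..t + u * h} (\<lambda>\<tau>. K (t + u * h) \<tau> * e \<tau>)"
            using volt[of "t + u * h"] tT[OF n u] ED[OF n u] by (simp add: t_def)
        qed
        then show "legendre_moment (\<lambda>u. K (t + u * h) (t + u * h) * (poly (D n) u + \<omega> n u) - H (t + u * h)) j = F n j"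
          using F(1)[OF n j] by (simp add: t_def)
        fix u :: real assume u: "u \<in> {0..1}"
        note tu = tT[OF n u]
        show "\<bar>K (t + u * h) (t + u * h) - K (t + 0 * h) (t + 0 * h)\<bar> \<le> C1 * h"
        proof -
          have "\<bar>K (t + u * h) (t + u * h) - K t t\<bar> \<le> C1 * (t + u * h - t)"
            using tu by (intro kb(1)) (auto simp: t_def)
          also have "\<dots> \<le> C1 * h" using tu C1 by (intro mult_left_mono) auto
          finally show ?thesis by simp
        qed
        show "\<bar>K (t + u * h) (t + u * h) - K (t + 0 * h) (t + 0 * h) - k' t * h * u\<bar> \<le> C1 * h^2"
        proof -
          have "\<bar>K (t + u * h) (t + u * h) - K t t - k' t * (t + u * h - t)\<bar> \<le> C1 * (t + u * h - t)^2"
            using tu by (intro kb(2)) (auto simp: t_def)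
          also have "\<dots> \<le> C1 * h^2" using tu C1 hp u by (intro mult_left_mono power_mono) auto
          finally show ?thesis by (simp add: algebra_simps)
        qed
        show "\<bar>poly (D n) u\<bar> \<le> B * y n" by (rule Db[OF n u])
        show "\<bar>\<omega> n u\<bar> \<le> w" by (rule \<omega>(3)[OF n u])
        show "\<bar>H (t + u * h) - H (t + 0 * h) - \<kappa> t t * h * integral {0..u} (\<omega> n)\<bar> \<le> C1 * h * (B * (y n + S n)) + (T + 2) * C1 * h^2 * w"
          using hist1[OF n u] by (simp add: t_def)
      qed (use \<omega> n j Bm in auto)
      also have "\<dots> = B * C1 * h * (B * y n + B * (y n + S n) + (T + 3) * (h * w))"
        by (simp add: algebra_simps power2_eq_square)
      also have "\<dots> \<le> B * C1 * h * ((2 * B + T + 3) * (y n + S n + b))"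
      proof (intro mult_left_mono)
        have "(T + 3) * (h * w) \<le> (T + 3) * b" using ab T by (intro mult_left_mono) auto
        moreover have "0 \<le> B * S n" "0 \<le> B * b" "0 \<le> T * y n" "0 \<le> T * S n" using B T y0[of n] S0[of n] b by auto
        ultimately show "B * y n + B * (y n + S n) + (T + 3) * (h * w) \<le> (2 * B + T + 3) * (y n + S n + b)"
          using y0[of n] S0[of n] by (simp add: algebra_simps)
      qed (use B C1 hp in auto)
      finally have P: "\<bar>k * legendre_moment (poly (D n)) j - (if j = 0 then H t else 0) - F n j\<bar>
        \<le> B * C1 * h * ((2 * B + T + 3) * (y n + S n + b))"
        unfolding k_def mult_zero_left add_0_right .
      have gp: "legendre_norm2 j > 0" by (rule legendre_norm2_pos)
      have k_nz: "k \<noteq> 0" using kk k0 by auto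
      have "c n j - (if j = 0 then r n else 0) - g n j
        = (k * legendre_moment (poly (D n)) j - (if j = 0 then H t else 0) - F n j) / k * (1 / legendre_norm2 j)"
      proof -
        have "r n = H t / k" "g n j = F n j / (k * legendre_norm2 j)" by (simp_all add: r_def g_def k_def t_def)
        then show ?thesis using gp k_nz legendre_norm2_0 by (auto simp: c_def field_simps)
      qed
      also have "\<bar>\<dots>\<bar> \<le> (B * C1 * h * ((2 * B + T + 3) * (y n + S n + b))) / k0 * B"
        unfolding abs_mult abs_divide
        using P kk k0 B\<gamma>[of j] j gp B(1) C1 hp T y0[of n] S0[of n] b
        by (intro mult_mono frac_le) auto
      also have "\<dots> = Ca * h * (y n + S n + b)" by (simp add: Ca_def power2_eq_square)
      also have "\<dots> \<le> C0 * h * (y n + S n + b)"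
        using Cab hp y0[of n] S0[of n] b by (intro mult_right_mono) (auto simp: C0_def)
      finally show ?thesis .
    qed
    have rstep: "\<bar>r (Suc n) - r n\<bar> \<le> C0 * h * (y n + S n + b)" if n: "Suc n < N" for n
    proof -
      define t where "t = real n * h"
      define t' where "t' = real (Suc n) * h"
      have t': "t' = t + 1 * h" by (simp add: t_def t'_def algebra_simps)
      have nN: "n < N" using n by simp
      have kk: "k0 \<le> \<bar>K t t\<bar>" "k0 \<le> \<bar>K t' t'\<bar>" using kn[OF nN] kn[OF n] by (auto simp: t_def t'_def)
      have nz: "K t t \<noteq> 0" "K t' t' \<noteq> 0" using kk k0 by auto
      \<comment> \<open>At the right end of the cell the subtracted leading part is a multiple of
        the full integral of \<open>\<omega> n\<close>, which is zero.\<close>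
      have b1: "\<bar>H t' - H t\<bar> \<le> C1 * h * (B * (y n + S n)) + (T + 2) * C1 * h * b"
      proof -
        have "\<bar>H t' - H t\<bar> \<le> C1 * h * (B * (y n + S n)) + (T + 2) * C1 * h^2 * w"
          using hist1[OF nN, of 1] int1[OF nN] by (simp add: t' t_def)
        moreover have "(T + 2) * C1 * h * (h * w) \<le> (T + 2) * C1 * h * b"
          using ab T C1 hp by (intro mult_left_mono) auto
        ultimately show ?thesis by (simp add: power2_eq_square mult.assoc)
      qed
      have b2: "\<bar>H t\<bar> \<le> C1 * B * S n + T * C1 * b"
      proof -
        have "T * C1 * (h * w) \<le> T * C1 * b" using ab T C1 by (intro mult_left_mono) auto
        then show ?thesis using hist2[OF nN] by (simp add: t_def mult.assoc)
      qed
      have b3: "\<bar>K t' t' - K t t\<bar> \<le> C1 * h"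
        using kb(1)[of t t'] tT[OF nN, of 1] hp by (simp add: t_def t'_def algebra_simps)
      \<comment> \<open>Separates the increment of the memory from that of the diagonal; each of the
        two terms has a factor \<open>h\<close>.\<close>
      have "r (Suc n) - r n = (H t' - H t) / K t' t' - H t * (K t' t' - K t t) / (K t t * K t' t')"
      proof -
        have *: "r (Suc n) = H t' / K t' t'" "r n = H t / K t t" by (simp_all only: r_def t_def t'_def)
        show ?thesis unfolding * using nz by (simp add: field_simps)
      qed
      also have "\<bar>\<dots>\<bar> \<le> \<bar>(H t' - H t) / K t' t'\<bar> + \<bar>H t * (K t' t' - K t t) / (K t t * K t' t')\<bar>" by (rule abs_triangle_ineq4)
      also have "\<dots> \<le> (C1 * h * (B * (y n + S n)) + (T + 2) * C1 * h * b) / k0 + (C1 * B * S n + T * C1 * b) * (C1 * h) / (k0 * k0)"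
      proof (intro add_mono)
        show "\<bar>(H t' - H t) / K t' t'\<bar> \<le> (C1 * h * (B * (y n + S n)) + (T + 2) * C1 * h * b) / k0"
          unfolding abs_divide using b1 kk k0 by (intro frac_le) auto
        show "\<bar>H t * (K t' t' - K t t) / (K t t * K t' t')\<bar> \<le> (C1 * B * S n + T * C1 * b) * (C1 * h) / (k0 * k0)"
          unfolding abs_divide abs_mult using b2 b3 kk k0 C1 hp
          by (intro frac_le mult_mono) auto
      qed
      also have "\<dots> = h * ((C1 * (B * (y n + S n)) + (T + 2) * C1 * b) / k0 + (C1 * B * S n + T * C1 * b) * C1 / k0^2)"
        by (simp add: field_simps power2_eq_square)
      also have "\<dots> \<le> h * (((C1 * B + (T + 2) * C1) * (y n + S n + b)) / k0 + ((C1 * B + T * C1) * (y n + S n + b)) * C1 / k0^2)"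
      proof (intro mult_left_mono add_mono divide_right_mono mult_right_mono)
        have p: "0 \<le> C1 * (B * y n)" "0 \<le> C1 * (B * S n)" "0 \<le> C1 * (B * b)" "0 \<le> C1 * (T * y n)"
          "0 \<le> C1 * (T * S n)" "0 \<le> C1 * (T * b)" "0 \<le> C1 * y n" "0 \<le> C1 * S n"
          using C1 B(1) T y0[of n] S0[of n] b by auto
        show "C1 * (B * (y n + S n)) + (T + 2) * C1 * b \<le> (C1 * B + (T + 2) * C1) * (y n + S n + b)"
          using p by (simp add: algebra_simps)
        show "C1 * B * S n + T * C1 * b \<le> (C1 * B + T * C1) * (y n + S n + b)"
          using p by (simp add: algebra_simps)
      qed (use C1 hp k0 in auto)
      also have "\<dots> = Cb * h * (y n + S n + b)"
        using k0 by (simp add: Cb_def field_simps power2_eq_square)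
      also have "\<dots> \<le> C0 * h * (y n + S n + b)"
        using Cab hp y0[of n] S0[of n] b by (intro mult_right_mono) (auto simp: C0_def)
      finally show ?thesis .
    qed
    have gb: "\<bar>g n j\<bar> \<le> G * x" if "n < N" "j < m" "\<bar>F n j\<bar> \<le> x" for n j x
    proof -
      have gp: "legendre_norm2 j > 0" by (rule legendre_norm2_pos)
      have x0: "0 \<le> x" using that(3) by linarith
      have "g n j = F n j / K (real n * h) (real n * h) * (1 / legendre_norm2 j)" by (simp add: g_def)
      also have "\<bar>\<dots>\<bar> \<le> x / k0 * B"
        unfolding abs_mult abs_divide
        using that(3) kn[OF that(1)] k0 B\<gamma>[of j] that(2) gp x0 by (intro mult_mono frac_le) auto
      also have "\<dots> \<le> G * x" using x0 by (simp add: G_def algebra_simps)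
      finally show ?thesis .
    qed
    have D0: "(\<Sum>j\<le>m. (-1) ^ j * c n j) = poly (D n) 0" and D1: "(\<Sum>j\<le>m. c n j) = poly (D n) 1" if "n < N" for n
      using Dexp[OF that] by (simp_all add: legendre_at_0 legendre_at_1 mult.commute)
    have bG: "b \<le> G * b" using G b mult_right_mono[of 1 G b] by simp
    have gG: "C0 * h * (y n + S n + b) \<le> C0 * h * (y n + S n + G * b)" for n
      using C0 hp bG by (intro mult_left_mono) auto
    have main: "\<forall>n<N. (\<Sum>j\<le>m. \<bar>c n j\<bar>) \<le> C2 * (G * b) \<and>
        (\<forall>j<m. \<bar>c n j - (if j = 0 then r n else 0)\<bar> \<le> G * a + C2 * h * (G * b))"
    proof (rule stab[of h N "G * a" "G * b" c r g \<tau>])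
      show "0 < h" "h < h0" "real N * h \<le> T" "0 \<le> G * a" "G * a \<le> G * b"
        using hp h Nh G ab by (auto intro: mult_left_mono)
      show "\<bar>c n j - (if j = 0 then r n else 0) - g n j\<bar>
          \<le> C0 * h * ((\<Sum>j\<le>m. \<bar>c n j\<bar>) + h * (\<Sum>i<n. \<Sum>j\<le>m. \<bar>c i j\<bar>) + G * b)" if "n < N" "j < m" for n j
        using order_trans[OF coef[OF that] gG] by (simp add: y_def S_def)
      show "\<bar>g n j\<bar> \<le> G * a" if "n < N" "j < m" for n j using gb[OF that F(2)[OF that]] .
      show "\<bar>g n j\<bar> \<le> h * (G * b)" if "n < N" "j < m" "odd (j + m)" for n j
        using gb[OF that(1,2) F(3)[OF that]] by (simp add: algebra_simps)
      show "r 0 = 0" by (simp add: r_def H_def)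
      show "\<bar>r (Suc n) - r n\<bar> \<le> C0 * h * ((\<Sum>j\<le>m. \<bar>c n j\<bar>) + h * (\<Sum>i<n. \<Sum>j\<le>m. \<bar>c i j\<bar>) + G * b)" if "Suc n < N" for n
        using order_trans[OF rstep[OF that] gG] by (simp add: y_def S_def)
      have "poly (D 0) 0 = - \<omega> 0 0" using ED[of 0 0] N E(2) by simp
      then show "\<bar>(\<Sum>j\<le>m. (-1) ^ j * c 0 j) - \<tau> 0\<bar> \<le> G * b"
        using D0[of 0] N jump(1) bG by simp
      show "\<bar>(\<Sum>j\<le>m. (-1) ^ j * c (Suc n) j) - (\<Sum>j\<le>m. c n j) - \<tau> (Suc n) + (-1) ^ m * \<tau> n\<bar> \<le> h * (G * b)"
        if n: "Suc n < N" for n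
      proof -
        \<comment> \<open>Continuity of \<open>E\<close> at the mesh point, the only coupling of
          neighbouring cells besides the memory.\<close>
        have "poly (D (Suc n)) 0 + \<omega> (Suc n) 0 = poly (D n) 1 + \<omega> n 1"
          using ED[of "Suc n" 0] ED[of n 1] n by (simp add: algebra_simps)
        then have "(\<Sum>j\<le>m. (-1) ^ j * c (Suc n) j) - (\<Sum>j\<le>m. c n j) = \<omega> n 1 - \<omega> (Suc n) 0"
          using D0[OF n] D1[of n] n by simp
        then show ?thesis using jump(2)[OF n] mult_left_mono[OF bG, of h] hp by linarith
      qed
      show "\<bar>\<tau> n\<bar> \<le> G * b" if "n < N" for n using \<tau>[OF that] bG by simp
    qed
    show "\<forall>n<N. \<exists>\<beta>. \<bar>\<beta>\<bar> \<le> C * b \<and> (\<forall>u\<in>{0..1}. \<bar>poly (D n) u\<bar> \<le> C * b \<and>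
        \<bar>poly (pderiv (D n)) u - \<beta> * poly (pderiv (shifted_legendre m)) u\<bar> \<le> C * (a + h * b))"
    proof (intro allI impI)
      fix n assume n: "n < N"
      have yn: "y n \<le> C2 * G * b" using main n by (simp add: y_def mult.assoc)
      have CC: "B * (C2 * G * b) \<le> C * b"
      proof -
        have "0 \<le> real m * B * G * (1 + C2) * b" using B(1) G C2 b by auto
        then show ?thesis by (simp add: C_def algebra_simps)
      qed
      have "\<bar>c n m\<bar> \<le> y n" unfolding y_def by (rule member_le_sum) auto
      also have "\<dots> \<le> B * y n" using B(1) y0[of n] mult_right_mono[of 1 B "y n"] by simp
      also have "\<dots> \<le> B * (C2 * G * b)" using yn B(1) by (intro mult_left_mono) auto
      finally have \<beta>: "\<bar>c n m\<bar> \<le> C * b" using CC by linarith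
      have "\<bar>poly (D n) u\<bar> \<le> C * b" if u: "u \<in> {0..1}" for u
      proof -
        have "\<bar>poly (D n) u\<bar> \<le> B * (C2 * G * b)"
          using Db[OF n u] mult_left_mono[OF yn, of B] B(1) by linarith
        then show ?thesis using CC by linarith
      qed
      moreover have "\<bar>poly (pderiv (D n)) u - c n m * poly (pderiv (shifted_legendre m)) u\<bar> \<le> C * (a + h * b)" if u: "u \<in> {0..1}" for u
      proof -
        have "poly (pderiv (D n)) u - c n m * poly (pderiv (shifted_legendre m)) u = (\<Sum>j<m. c n j * poly (pderiv (shifted_legendre j)) u)"
          unfolding Dexp'[OF n] lessThan_Suc_atMost[symmetric] by simp
        also have "\<bar>\<dots>\<bar> \<le> (\<Sum>j<m. (G * a + C2 * h * (G * b)) * B)"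
        proof (intro order_trans[OF sum_abs] sum_mono)
          fix j assume j: "j \<in> {..<m}"
          show "\<bar>c n j * poly (pderiv (shifted_legendre j)) u\<bar> \<le> (G * a + C2 * h * (G * b)) * B"
          proof (cases "j = 0")
            \<comment> \<open>The mode 0 contains \<open>r n\<close> and is only of size
              \<open>b\<close>, but P'_0 = 0.\<close>
            case True
            then show ?thesis using G C2 hp b ab B(1) by (simp add: shifted_legendre_0)
          next
            case False
            have "\<bar>c n j - (if j = 0 then r n else 0)\<bar> \<le> G * a + C2 * h * (G * b)" using main n j by blast
            then have "\<bar>c n j\<bar> \<le> G * a + C2 * h * (G * b)" using False by simp
            then show ?thesis
              unfolding abs_mult using B(3)[of j u] j u by (intro mult_mono) auto
          qed
        qed
        also have "\<dots> = real m * B * G * (a + C2 * (h * b))" by (simp add: algebra_simps)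
        also have "\<dots> \<le> real m * B * G * ((1 + C2) * (a + h * b))"
        proof (intro mult_left_mono)
          have "0 \<le> C2 * a" "0 \<le> h * b" using C2 ab hp b by auto
          then show "a + C2 * (h * b) \<le> (1 + C2) * (a + h * b)" by (simp add: algebra_simps)
        qed (use B G in auto)
        also have "\<dots> \<le> C * (a + h * b)"
        proof -
          have "0 \<le> B * C2 * G * (a + h * b)" using B(1) C2 G ab hp b by auto
          then show ?thesis by (simp add: C_def algebra_simps)
        qed
        finally show ?thesis .
      qed
      ultimately show "\<exists>\<beta>. \<bar>\<beta>\<bar> \<le> C * b \<and> (\<forall>u\<in>{0..1}. \<bar>poly (D n) u\<bar> \<le> C * b \<and>
        \<bar>poly (pderiv (D n)) u - \<beta> * poly (pderiv (shifted_legendre m)) u\<bar> \<le> C * (a + h * b))"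
        using \<beta> by blast
    qed
  qed
qed

subsection \<open>The projection remainder of a smooth primitive\<close>

lemma integral_reflect_01:
  fixes f :: "real \<Rightarrow> real"
  shows "integral {0..1} (\<lambda>u. f (1 - u)) = integral {0..1} f"
proof -
  have "integral {0..1} (\<lambda>u. f (1 - u)) = integral {-1..0} (\<lambda>x. f (1 + x))"
    using Henstock_Kurzweil_Integration.integral_reflect_real[of 0 "-1" "\<lambda>u. f (1 + u)"] by simp
  also have "\<dots> = integral {0..1} f"
    using integral_shift_Icc_real[of "-1" 0 f 1] by (simp add: o_def add.commute)
  finally show ?thesis .
qed

lemma moment_reflect:
  "legendre_moment (\<lambda>u. f (1 - u)) j = (-1) ^ j * legendre_moment f j"
proof -
  have "legendre_moment (\<lambda>u. f (1 - u)) j = integral {0..1} (\<lambda>u. (-1) ^ j * (f (1 - u) * poly (shifted_legendre j) (1 - u)))"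
    unfolding legendre_moment_def
  proof (rule integral_cong)
    fix u :: real
    have "(-1) ^ j * ((-1) ^ j * poly (shifted_legendre j) u) = poly (shifted_legendre j) u"
      by (simp flip: mult.assoc power_mult_distrib)
    then show "f (1 - u) * poly (shifted_legendre j) u = (-1) ^ j * (f (1 - u) * poly (shifted_legendre j) (1 - u))"
      by (simp add: legendre_reflect)
  qed
  also have "\<dots> = (-1) ^ j * integral {0..1} (\<lambda>u. f u * poly (shifted_legendre j) u)"
    using integral_reflect_01[of "\<lambda>u. f u * poly (shifted_legendre j) u"] by simp
  finally show ?thesis by (simp add: legendre_moment_def)
qed

lemma moment_parity_zero:
  assumes "\<And>u. u \<in> {0..1} \<Longrightarrow> f (1 - u) = - f u" "even j"
  shows "legendre_moment f j = 0"
proof -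
  have "legendre_moment (\<lambda>u. f (1 - u)) j = legendre_moment (\<lambda>u. (-1) * f u) j"
    using assms by (intro moment_cong) auto
  then have "(-1) ^ j * legendre_moment f j = (-1) * legendre_moment f j"
    unfolding moment_reflect moment_cmult .
  then show ?thesis using assms(2) by simp
qed

lemma legendre_proj_add:
  assumes "continuous_on {0..1} f" "continuous_on {0..1} g"
  shows "legendre_proj m (\<lambda>u. f u + g u) = legendre_proj m f + legendre_proj m g"
  unfolding legendre_proj_def
  by (simp add: moment_add assms add_divide_distrib smult_add_left sum.distrib)

lemma legendre_proj_cmult: "legendre_proj m (\<lambda>u. c * f u) = smult c (legendre_proj m f)"
  by (rule poly_eqI) (simp add: legendre_proj_def moment_cmult coeff_sum sum_distrib_left mult.assoc)

text \<open>Finitely many Legendre coefficients are bounded by the maximum of \<open>f\<close>, so a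
  Taylor remainder can be projected, and the projection differentiated, without loss of
  order.\<close>

lemma legendre_proj_bound:
  obtains B where "B \<ge> 1"
    "\<And>f w u. continuous_on {0..1} f \<Longrightarrow> (\<And>u. u \<in> {0..1} \<Longrightarrow> \<bar>f u\<bar> \<le> w) \<Longrightarrow> u \<in> {0..1} \<Longrightarrow> \<bar>poly (legendre_proj m f) u\<bar> \<le> B * w"
    "\<And>f w u. continuous_on {0..1} f \<Longrightarrow> (\<And>u. u \<in> {0..1} \<Longrightarrow> \<bar>f u\<bar> \<le> w) \<Longrightarrow> u \<in> {0..1} \<Longrightarrow> \<bar>poly (pderiv (legendre_proj m f)) u\<bar> \<le> B * w"
proof -
  obtain B where B: "B \<ge> 1"
    "\<And>j u. j \<le> m \<Longrightarrow> u \<in> {0..1} \<Longrightarrow> \<bar>poly (shifted_legendre j) u\<bar> \<le> B"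
    "\<And>j u. j \<le> m \<Longrightarrow> u \<in> {0..1} \<Longrightarrow> \<bar>poly (pderiv (shifted_legendre j)) u\<bar> \<le> B"
    "\<And>j f w. j \<le> m \<Longrightarrow> continuous_on {0..1} f \<Longrightarrow> (\<And>u. u \<in> {0..1} \<Longrightarrow> \<bar>f u\<bar> \<le> w) \<Longrightarrow> \<bar>legendre_moment f j\<bar> \<le> B * w"
    "\<And>j. j \<le> m \<Longrightarrow> 1 / legendre_norm2 j \<le> B"
    by (rule legendre_bounds[of m]) blast
  have gen: "\<bar>\<Sum>j\<le>m. legendre_moment f j / legendre_norm2 j * q j\<bar> \<le> (real (Suc m) * B^3) * w"
    if f: "continuous_on {0..1} f" "\<And>u. u \<in> {0..1} \<Longrightarrow> \<bar>f u\<bar> \<le> w" and q: "\<And>j. j \<le> m \<Longrightarrow> \<bar>q j\<bar> \<le> B" for f w q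
  proof -
    have w: "0 \<le> w" using f(2)[of 0] by force
    have "\<bar>\<Sum>j\<le>m. legendre_moment f j / legendre_norm2 j * q j\<bar> \<le> (\<Sum>j\<le>m. B * w * B * B)"
    proof (intro order_trans[OF sum_abs] sum_mono)
      fix j assume "j \<in> {..m}"
      then have j: "j \<le> m" by simp
      have "\<bar>legendre_moment f j * (1 / legendre_norm2 j) * q j\<bar> \<le> B * w * B * B"
        unfolding abs_mult using B(4)[OF j f] B(5)[OF j] q[OF j] legendre_norm2_pos[of j] B(1) w
        by (intro mult_mono) auto
      then show "\<bar>legendre_moment f j / legendre_norm2 j * q j\<bar> \<le> B * w * B * B" by simp
    qed
    then show ?thesis by (simp add: power3_eq_cube algebra_simps)
  qed
  have *: "pderiv (sum f A) = (\<Sum>a\<in>A. pderiv (f a))" for f :: "nat \<Rightarrow> real poly" and A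
    by (rule higher_pderiv_sum[of 1, simplified])
  show ?thesis
  proof (rule that)
    have "1 \<le> B^3" using B(1) by (rule one_le_power)
    then show "1 \<le> real (Suc m) * B^3" using mult_mono[of 1 "real (Suc m)" 1 "B^3"] by simp
    show "\<bar>poly (legendre_proj m f) u\<bar> \<le> (real (Suc m) * B^3) * w"
      if "continuous_on {0..1} f" "\<And>u. u \<in> {0..1} \<Longrightarrow> \<bar>f u\<bar> \<le> w" "u \<in> {0..1}" for f w u
      using gen[OF that(1,2), of "\<lambda>j. poly (shifted_legendre j) u"] B(2) that(3)
      by (simp add: legendre_proj_def poly_sum)
    show "\<bar>poly (pderiv (legendre_proj m f)) u\<bar> \<le> (real (Suc m) * B^3) * w"
      if "continuous_on {0..1} f" "\<And>u. u \<in> {0..1} \<Longrightarrow> \<bar>f u\<bar> \<le> w" "u \<in> {0..1}" for f w u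
      using gen[OF that(1,2), of "\<lambda>j. poly (pderiv (shifted_legendre j)) u"] B(3) that(3)
      by (simp add: legendre_proj_def poly_sum * pderiv_smult)
  qed
qed

definition legendre_rem :: "nat \<Rightarrow> real poly \<Rightarrow> real poly" where
  "legendre_rem m p = p - legendre_proj m (poly p)"

lemma moment_legendre_rem: "j \<le> m \<Longrightarrow> legendre_moment (poly (legendre_rem m p)) j = 0"
proof -
  assume "j \<le> m"
  have "poly (legendre_rem m p) = (\<lambda>u. poly p u - poly (legendre_proj m (poly p)) u)"
    by (auto simp: legendre_rem_def)
  then show ?thesis
    using moment_legendre_proj[OF \<open>j \<le> m\<close>] by (simp add: moment_diff continuous_on_poly_real)
qed

text \<open>The remainder is orthogonal to all degrees up to \<open>m\<close> and has degree at most
  \<open>Suc m\<close>, so only the last Legendre component survives.\<close>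

lemma legendre_rem_Suc:
  assumes "degree p \<le> Suc m"
  obtains c where "legendre_rem m p = smult c (shifted_legendre (Suc m))"
proof -
  have "degree (legendre_rem m p) \<le> Suc m"
    unfolding legendre_rem_def using assms degree_legendre_proj[of m]
    by (intro degree_diff_le) (auto intro: le_SucI)
  from legendre_proj_poly[OF this]
  have "legendre_rem m p = smult (legendre_moment (poly (legendre_rem m p)) (Suc m) / legendre_norm2 (Suc m)) (shifted_legendre (Suc m))"
    by (simp add: legendre_proj_def moment_legendre_rem)
  then show ?thesis using that by blast
qed

lemma centred_power_reflect:
  "poly ([:-1/2, 1:] ^ i) (1 - u) = (-1) ^ i * poly ([:-1/2, 1:] ^ i) (u::real)"
proof -
  have "1 - u - 1/2 = - (u - 1/2)" by simp
  then have "(1 - u - 1/2) ^ i = (- (u - 1/2)) ^ i" by (simp only:)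
  also have "\<dots> = (-1) ^ i * (u - 1/2) ^ i" by (rule power_minus)
  finally show ?thesis by (simp add: poly_power)
qed

text \<open>Odd powers about the midpoint are antisymmetric and have Legendre components of odd
  index only, whose end values are opposite. For odd \<open>m\<close> this removes the term of order
  \<open>h^(m + 2)\<close> from the sum of the two end values of the projection remainder.\<close>

lemma legendre_rem_odd_ends:
  assumes "odd i"
  shows "poly (legendre_rem m ([:-1/2, 1:] ^ i)) 0 + poly (legendre_rem m ([:-1/2, 1:] ^ i)) 1 = 0"
proof -
  let ?p = "[:-1/2, 1:] ^ i :: real poly"
  have r: "poly ?p (1 - u) = - poly ?p u" for u
    using centred_power_reflect[of i u] assms by simp
  have z: "legendre_moment (poly ?p) j = 0" if "even j" for j
    using moment_parity_zero[of "poly ?p" j] r that by blast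
  have "poly (legendre_proj m (poly ?p)) 0 + poly (legendre_proj m (poly ?p)) 1 = 0"
    unfolding legendre_proj_def poly_sum sum.distrib[symmetric]
  proof (intro sum.neutral ballI)
    fix j
    show "poly (smult (legendre_moment (poly ?p) j / legendre_norm2 j) (shifted_legendre j)) 0 +
          poly (smult (legendre_moment (poly ?p) j / legendre_norm2 j) (shifted_legendre j)) 1 = 0"
      using z[of j] by (cases "even j") (auto simp: legendre_at_0 legendre_at_1)
  qed
  moreover have "poly ?p 0 + poly ?p 1 = 0"
    using centred_power_reflect[of i 0] assms by simp
  ultimately show ?thesis by (simp add: legendre_rem_def)
qed

text \<open>Taylor expansion of the primitive about the midpoint of a cell, followed by projection:
  the part of degree \<open>m\<close> is reproduced, the next power leaves a multiple of P_(m + 1),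
  and the one after that leaves \<open>V\<close>. Expanding at the midpoint makes the parity of
  these terms available. The witness \<open>\<omega>'\<close> is the derivative of
  \<open>\<omega>\<close> in the unit variable. The constant \<open>c\<close> is independent of the
  mesh and of the cell, which permits the telescoping for odd \<open>m\<close>.\<close>

lemma primitive_cell_expansion:
  fixes x :: "real \<Rightarrow> real" and D :: "nat \<Rightarrow> real \<Rightarrow> real"
  assumes T: "T > 0" and D0: "D 0 = x"
    and D: "\<And>j t. j < m + 2 \<Longrightarrow> t \<in> {0..T} \<Longrightarrow> (D j has_real_derivative D (Suc j) t) (at t within {0..T})"
    and Dc: "\<And>j. j \<le> m + 2 \<Longrightarrow> continuous_on {0..T} (D j)"
  obtains C c where "C > 0"
    "\<And>N h. N \<ge> 1 \<Longrightarrow> h = T / real N \<Longrightarrow> \<exists>P \<omega> \<omega>'. \<forall>n<N. degree (P n) \<le> m \<and> continuous_on {0..1} (\<omega> n) \<and>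
      (\<forall>u\<in>{0..1}. integral {0..real n * h + u * h} x = poly (P n) u + \<omega> n u \<and>
        h * x (real n * h + u * h) = poly (pderiv (P n)) u + \<omega>' n u \<and> \<bar>\<omega> n u\<bar> \<le> C * h ^ (m + 1) \<and> \<bar>\<omega>' n u\<bar> \<le> C * h ^ (m + 1)) \<and>
      (\<forall>j\<le>m. legendre_moment (\<omega> n) j = 0) \<and>
      (\<exists>\<alpha>. \<bar>\<alpha>\<bar> \<le> C * h ^ (m + 1) \<and> (\<forall>u\<in>{0..1}. \<bar>\<omega>' n u - \<alpha> * poly (pderiv (shifted_legendre (m + 1))) u\<bar> \<le> C * h ^ (m + 2))) \<and>
      (odd m \<longrightarrow> \<bar>\<omega> n 1 + \<omega> n 0 - c * h ^ (m + 1) * (D m (real n * h) + D m (real (Suc n) * h))\<bar> \<le> C * h ^ (m + 3) \<and>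
        \<bar>c * h ^ (m + 1) * D m (real n * h) - \<omega> n 0\<bar> \<le> C * h ^ (m + 2))"
proof -
  let ?I = "{0..T}"
  define pw where "pw i = ([:-1/2, 1:] ^ i :: real poly)" for i
  have pw: "poly (pw i) v = (v - 1/2) ^ i" for i v by (simp add: pw_def poly_power)
  define U where "U = legendre_rem m (pw (m + 1))"
  define V where "V = legendre_rem m (pw (m + 2))"
  have dp: "degree (pw i) = i" for i by (simp add: pw_def degree_power_eq)
  obtain cU where cU: "U = smult cU (shifted_legendre (Suc m))"
    using legendre_rem_Suc[of "pw (m + 1)" m] dp[of "m + 1"] unfolding U_def by auto
  have "\<exists>M>0. \<forall>t\<in>?I. \<bar>D j t\<bar> \<le> M" if "j \<le> m + 2" for j
    using compact_imp_bounded[OF compact_continuous_image[OF Dc[OF that] compact_Icc]] unfolding bounded_pos by auto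
  then obtain Mf where Mf: "\<And>j. j \<le> m + 2 \<Longrightarrow> Mf j > 0 \<and> (\<forall>t\<in>?I. \<bar>D j t\<bar> \<le> Mf j)" by metis
  define M where "M = Mf m + Mf (m + 1) + Mf (m + 2)"
  have M: "M > 0" "\<And>t. t \<in> ?I \<Longrightarrow> \<bar>D m t\<bar> \<le> M" "\<And>t. t \<in> ?I \<Longrightarrow> \<bar>D (m + 1) t\<bar> \<le> M" "\<And>t. t \<in> ?I \<Longrightarrow> \<bar>D (m + 2) t\<bar> \<le> M"
    using Mf[of m] Mf[of "m + 1"] Mf[of "m + 2"] by (fastforce simp: M_def)+
  obtain Bp where Bp: "Bp \<ge> 1"
    "\<And>f w u. continuous_on {0..1} f \<Longrightarrow> (\<And>u. u \<in> {0..1} \<Longrightarrow> \<bar>f u\<bar> \<le> w) \<Longrightarrow> u \<in> {0..1} \<Longrightarrow> \<bar>poly (legendre_proj m f) u\<bar> \<le> Bp * w"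
    "\<And>f w u. continuous_on {0..1} f \<Longrightarrow> (\<And>u. u \<in> {0..1} \<Longrightarrow> \<bar>f u\<bar> \<le> w) \<Longrightarrow> u \<in> {0..1} \<Longrightarrow> \<bar>poly (pderiv (legendre_proj m f)) u\<bar> \<le> Bp * w"
    by (rule legendre_proj_bound[of m]) blast
  obtain b1 where b1: "b1 > 0" "\<And>u. u \<in> {0..1} \<Longrightarrow> \<bar>poly U u\<bar> \<le> b1" using poly_bounded_01[of U] by blast
  obtain b2 where b2: "b2 > 0" "\<And>u. u \<in> {0..1} \<Longrightarrow> \<bar>poly V u\<bar> \<le> b2" using poly_bounded_01[of V] by blast
  obtain b3 where b3: "b3 > 0" "\<And>u. u \<in> {0..1} \<Longrightarrow> \<bar>poly (pderiv U) u\<bar> \<le> b3" using poly_bounded_01[of "pderiv U"] by blast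
  obtain b4 where b4: "b4 > 0" "\<And>u. u \<in> {0..1} \<Longrightarrow> \<bar>poly (pderiv V) u\<bar> \<le> b4" using poly_bounded_01[of "pderiv V"] by blast
  \<comment> \<open>For odd \<open>m\<close> the polynomial P_(m + 1) is 1 at both ends, so the
    leading part of the remainder there is \<open>\<alpha> n * cU\<close>, which is
    \<open>c * h^(m + 1)\<close> times the m-th derivative of \<open>x\<close> at the
    midpoint.\<close>
  define c where "c = cU / fact (m + 1)"
  define C1 where "C1 = (1 + Bp) * M"
  define C where "C = M * (b1 + b3 + \<bar>cU\<bar>) + M * (b2 + b4) * (1 + T) + C1 * (2 + T + T^2) + \<bar>c\<bar> * M * (2 + T)"
  have C1: "C1 > 0" using Bp(1) M(1) by (simp add: C1_def)
  have C: "C > 0" using M(1) b1(1) b2(1) b3(1) b4(1) C1 T by (auto simp: C_def intro!: add_pos_nonneg add_nonneg_nonneg)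
  show ?thesis
  proof (rule that[OF C, of c])
    fix N :: nat and h :: real
    assume N: "N \<ge> 1" and h: "h = T / real N"
    have hp: "h > 0" and Nh: "real N * h = T" using N T h by auto
    have hT: "h \<le> T" using N T by (simp add: h divide_le_eq)
    have hpow: "h ^ (m + 2) = h * h ^ (m + 1)" "h ^ (m + 3) = h * (h * h ^ (m + 1))" "h ^ (m + 3) = h * h ^ (m + 2)"
      by (simp_all add: eval_nat_numeral)
    have h2: "h ^ (m + 2) \<le> T * h ^ (m + 1)" "h ^ (m + 3) \<le> T * h ^ (m + 2)"
      unfolding hpow(1,3) using hT hp by (intro mult_right_mono; simp)+
    have h3: "h ^ (m + 3) \<le> T^2 * h ^ (m + 1)"
      using h2(2) mult_left_mono[OF h2(1) less_imp_le[OF T]] unfolding power2_eq_square mult.assoc by linarith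
    define mid where "mid n = real n * h + h / 2" for n
    define Xn where "Xn n u = integral {0..real n * h + u * h} x" for n u
    define P where "P n = legendre_proj m (Xn n)" for n
    define \<omega> where "\<omega> n u = Xn n u - poly (P n) u" for n u
    define \<omega>' where "\<omega>' n u = h * x (real n * h + u * h) - poly (pderiv (P n)) u" for n u
    \<comment> \<open>Taylor coefficients of the primitive in powers of u - 1/2. The primitive is
      one derivative ahead of \<open>x\<close>, so \<open>D m\<close> goes with the power m + 1 and
      \<open>D (m + 1)\<close> with m + 2.\<close>
    define \<alpha> where "\<alpha> n = h ^ (m + 1) * D m (mid n) / fact (m + 1)" for n
    define \<beta> where "\<beta> n = h ^ (m + 2) * D (m + 1) (mid n) / fact (m + 2)" for n
    have cx: "continuous_on ?I x" using Dc[of 0] D0 by simp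
    have in_I: "real n * h + u * h \<in> ?I" if "n < N" "u \<in> {0..1}" for n u
    proof -
      have "u * h \<le> h" using that hp by (auto simp: mult_le_cancel_right1)
      moreover have "real (Suc n) * h \<le> real N * h" using that hp by (intro mult_right_mono) auto
      moreover have "real (Suc n) * h = real n * h + h" by (simp add: algebra_simps)
      moreover have "0 \<le> real n * h" "0 \<le> u * h" using hp that by auto
      ultimately show ?thesis using Nh by simp
    qed
    have mid_I: "mid n \<in> ?I" if "n < N" for n
      using in_I[OF that, of "1/2"] by (simp add: mid_def)
    have dX: "(Xn n has_real_derivative h * x (real n * h + u * h)) (at u within {0..1})" if n: "n < N" and u: "u \<in> {0..1}" for n u
    proof -
      have "((\<lambda>t. integral {0..t} x) has_real_derivative x (real n * h + u * h)) (at (real n * h + u * h) within (\<lambda>u. real n * h + u * h) ` {0..1})"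
        using in_I[OF n] by (intro DERIV_subset[OF integral_has_real_derivative[OF cx in_I[OF n u]]]) auto
      moreover have "((\<lambda>u. real n * h + u * h) has_real_derivative h) (at u within {0..1})"
        by (auto intro!: derivative_eq_intros)
      ultimately have "((\<lambda>t. integral {0..t} x) \<circ> (\<lambda>u. real n * h + u * h) has_real_derivative x (real n * h + u * h) * h) (at u within {0..1})"
        by (rule DERIV_image_chain)
      then show ?thesis unfolding o_def Xn_def[abs_def] by (subst mult.commute)
    qed
    have cX: "continuous_on {0..1} (Xn n)" if "n < N" for n
      unfolding continuous_on_eq_continuous_within using DERIV_continuous[OF dX[OF that]] by blast
    have bA: "\<bar>\<alpha> n\<bar> \<le> M * h ^ (m + 1)" if "n < N" for n
    proof -
      have "\<bar>\<alpha> n\<bar> \<le> h ^ (m + 1) * M / 1"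
        unfolding \<alpha>_def abs_divide abs_mult using M(1) M(2)[OF mid_I[OF that]] hp
        by (intro frac_le mult_mono) (auto simp: fact_ge_1 simp del: fact_Suc)
      then show ?thesis by (simp add: mult.commute)
    qed
    have bB: "\<bar>\<beta> n\<bar> \<le> M * h ^ (m + 2)" if "n < N" for n
    proof -
      have "\<bar>\<beta> n\<bar> \<le> h ^ (m + 2) * M / 1"
        unfolding \<beta>_def abs_divide abs_mult using M(1) M(3)[OF mid_I[OF that]] hp
        by (intro frac_le mult_mono) (auto simp: fact_ge_1 simp del: fact_Suc)
      then show ?thesis by (simp add: mult.commute)
    qed
    have key: "\<bar>\<omega> n u - \<alpha> n * poly U u - \<beta> n * poly V u\<bar> \<le> C1 * h ^ (m + 3) \<and>
        \<bar>\<omega>' n u - \<alpha> n * poly (pderiv U) u - \<beta> n * poly (pderiv V) u\<bar> \<le> C1 * h ^ (m + 3)" if n: "n < N" and u: "u \<in> {0..1}" for n u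
    proof -
      \<comment> \<open>\<open>q\<close> is the Taylor part of degree at most \<open>m\<close>.
        Taylor's theorem is applied only to \<open>x\<close>, which bounds the derivative
        \<open>R'\<close>; as \<open>R\<close> vanishes at the midpoint, the mean value theorem then
        bounds \<open>R\<close> to the same order.\<close>
      define q where "q = [:Xn n (1/2):] + (\<Sum>i<m. smult (D i (mid n) * h ^ Suc i / fact (Suc i)) (pw (Suc i)))"
      define R where "R u = Xn n u - (poly q u + \<alpha> n * poly (pw (m + 1)) u + \<beta> n * poly (pw (m + 2)) u)" for u
      define R' where "R' u = h * (x (real n * h + u * h) - (\<Sum>i\<le>m + 1. D i (mid n) * ((u - 1/2) * h) ^ i / fact i))" for u
      have dq: "degree q \<le> m"
        unfolding q_def
      proof (intro degree_add_le degree_sum_le)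
        fix i assume "i \<in> {..<m}"
        then have "degree (pw (Suc i)) \<le> m" unfolding dp by simp
        then show "degree (smult (D i (mid n) * h ^ Suc i / fact (Suc i)) (pw (Suc i))) \<le> m"
          by (rule order_trans[OF degree_smult_le])
      qed auto
      have cR: "continuous_on {0..1} R" unfolding R_def by (intro continuous_intros cX n)
      have R'b: "\<bar>R' v\<bar> \<le> M * h ^ (m + 3)" if v: "v \<in> {0..1}" for v
      proof -
        have "norm (D 0 (real n * h + v * h) - (\<Sum>i\<le>m + 1. D i (mid n) * (real n * h + v * h - mid n) ^ i / fact i))
          \<le> M * norm (real n * h + v * h - mid n) ^ Suc (m + 1) / fact (m + 1)"
          by (rule field_Taylor[of ?I]) (use D M mid_I[OF n] in_I[OF n v] in auto)
        also have "\<dots> \<le> M * h ^ Suc (m + 1) / 1"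
        proof (intro frac_le mult_left_mono power_mono)
          have "real n * h + v * h - mid n = (v - 1/2) * h" by (simp add: mid_def algebra_simps)
          also have "\<bar>\<dots>\<bar> \<le> 1 * h" unfolding abs_mult using v hp by (intro mult_mono) (auto simp: abs_le_iff)
          finally show "norm (real n * h + v * h - mid n) \<le> h" by simp
        qed (use M hp in \<open>auto simp: fact_ge_1 simp del: fact_Suc\<close>)
        finally have "\<bar>x (real n * h + v * h) - (\<Sum>i\<le>m + 1. D i (mid n) * ((v - 1/2) * h) ^ i / fact i)\<bar> \<le> M * h ^ (m + 2)"
          by (simp add: D0 mid_def algebra_simps)
        then have "\<bar>R' v\<bar> \<le> h * (M * h ^ (m + 2))"
          unfolding R'_def abs_mult using hp by (intro mult_mono) auto
        then show ?thesis by (simp add: hpow(3) algebra_simps)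
      qed
      have q': "poly (pderiv q) v + \<alpha> n * poly (pderiv (pw (m + 1))) v + \<beta> n * poly (pderiv (pw (m + 2))) v
          = h * (\<Sum>i\<le>m + 1. D i (mid n) * ((v - 1/2) * h) ^ i / fact i)" for v
      proof -
        have *: "pderiv (sum f A) = (\<Sum>a\<in>A. pderiv (f a))" for f :: "nat \<Rightarrow> real poly" and A
          by (rule higher_pderiv_sum[of 1, simplified])
        have pp: "poly (pderiv (pw (Suc i))) v = real (Suc i) * (v - 1/2) ^ i" for i
          by (simp add: pw_def pderiv_power_Suc pderiv_pCons poly_power del: power_Suc of_nat_Suc)
        have trm: "A * h ^ Suc i / fact (Suc i) * (real (Suc i) * y ^ i) = h * (A * (y * h) ^ i / fact i)" for i A y
          by (simp add: power_mult_distrib field_simps del: of_nat_Suc)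
        have tp: "A * h ^ Suc i / fact (Suc i) * poly (pderiv (pw (Suc i))) v = h * (A * ((v - 1/2) * h) ^ i / fact i)" for i A
          by (simp only: pp trm)
        have "poly (pderiv q) v = (\<Sum>i<m. D i (mid n) * h ^ Suc i / fact (Suc i) * poly (pderiv (pw (Suc i))) v)"
          unfolding q_def by (simp add: pderiv_add * pderiv_smult poly_sum pderiv_pCons del: power_Suc fact_Suc)
        also have "\<dots> = (\<Sum>i<m. h * (D i (mid n) * ((v - 1/2) * h) ^ i / fact i))"
          by (simp only: tp)
        finally have "poly (pderiv q) v = (\<Sum>i<m. h * (D i (mid n) * ((v - 1/2) * h) ^ i / fact i))" .
        moreover have "\<alpha> n * poly (pderiv (pw (m + 1))) v = h * (D m (mid n) * ((v - 1/2) * h) ^ m / fact m)"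
          using tp[of "D m (mid n)" m] by (simp only: \<alpha>_def mult.commute[of "h ^ (m + 1)"] Suc_eq_plus1)
        moreover have "\<beta> n * poly (pderiv (pw (m + 2))) v = h * (D (m + 1) (mid n) * ((v - 1/2) * h) ^ (m + 1) / fact (m + 1))"
          using tp[of "D (m + 1) (mid n)" "m + 1"] by (simp only: \<beta>_def add_2_eq_Suc' mult.commute[of "h ^ Suc (Suc m)"] Suc_eq_plus1[symmetric])
        moreover have "{..m + 1} = insert (m + 1) (insert m {..<m})" by auto
        ultimately show ?thesis by (simp add: sum_distrib_left distrib_left)
      qed
      have dR: "(R has_real_derivative R' v) (at v within {0..1})" if v: "v \<in> {0..1}" for v
      proof -
        have "(R has_real_derivative (h * x (real n * h + v * h) - (poly (pderiv q) v + \<alpha> n * poly (pderiv (pw (m + 1))) v + \<beta> n * poly (pderiv (pw (m + 2))) v))) (at v within {0..1})"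
          unfolding R_def
          by (intro DERIV_diff dX n v DERIV_add DERIV_cmult has_field_derivative_at_within[OF poly_DERIV])
        then show ?thesis unfolding q' by (simp add: R'_def right_diff_distrib)
      qed
      have R0: "R (1/2) = 0"
        by (simp add: R_def q_def poly_sum pw)
      have Rb: "\<bar>R v\<bar> \<le> M * h ^ (m + 3)" if v: "v \<in> {0..1}" for v
      proof -
        have "norm (R v - R (1/2)) \<le> (M * h ^ (m + 3)) * norm (v - 1/2)"
          by (rule field_differentiable_bound[of "{0..1}" R R']) (use dR R'b v in auto)
        also have "\<dots> \<le> (M * h ^ (m + 3)) * 1" using v M(1) hp by (intro mult_left_mono) (auto simp: abs_le_iff)
        finally show ?thesis using R0 by simp
      qed
      have Xdec: "Xn n = (\<lambda>u. (poly q u + \<alpha> n * poly (pw (m + 1)) u) + (\<beta> n * poly (pw (m + 2)) u + R u))"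
        by (auto simp: R_def)
      have "P n = (legendre_proj m (poly q) + smult (\<alpha> n) (legendre_proj m (poly (pw (m + 1))))) +
          (smult (\<beta> n) (legendre_proj m (poly (pw (m + 2)))) + legendre_proj m R)"
        unfolding P_def
        by (subst Xdec, subst legendre_proj_add)
           (simp_all add: legendre_proj_add legendre_proj_cmult continuous_intros cR del: poly_power)
      then have Pn: "P n = q + smult (\<alpha> n) (legendre_proj m (poly (pw (m + 1)))) +
          (smult (\<beta> n) (legendre_proj m (poly (pw (m + 2)))) + legendre_proj m R)"
        using legendre_proj_poly[OF dq] by simp
      have "\<omega> n u - \<alpha> n * poly U u - \<beta> n * poly V u = R u - poly (legendre_proj m R) u"
        unfolding \<omega>_def Pn by (subst Xdec) (simp add: U_def V_def legendre_rem_def algebra_simps del: poly_power)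
      moreover have "\<omega>' n u - \<alpha> n * poly (pderiv U) u - \<beta> n * poly (pderiv V) u = R' u - poly (pderiv (legendre_proj m R)) u"
        using q'[of u] unfolding \<omega>'_def Pn R'_def
        by (simp add: U_def V_def legendre_rem_def pderiv_add pderiv_diff pderiv_smult algebra_simps del: poly_power)
      ultimately show ?thesis
        using Rb[OF u] R'b[OF u] Bp(2)[OF cR Rb u] Bp(3)[OF cR Rb u]
        by (auto simp: C1_def algebra_simps abs_le_iff)
    qed
    have key1: "\<bar>\<omega> n u - \<alpha> n * poly U u - \<beta> n * poly V u\<bar> \<le> C1 * h ^ (m + 3)"
      and key2: "\<bar>\<omega>' n u - \<alpha> n * poly (pderiv U) u - \<beta> n * poly (pderiv V) u\<bar> \<le> C1 * h ^ (m + 3)" if "n < N" "u \<in> {0..1}" for n u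
      using key[OF that] by auto
    have prod: "\<bar>\<alpha> n * y\<bar> \<le> M * b * h ^ (m + 1)" "\<bar>\<beta> n * y\<bar> \<le> M * b * h ^ (m + 2)" if "n < N" "\<bar>y\<bar> \<le> b" for n y b
    proof -
      have "\<bar>\<alpha> n\<bar> * \<bar>y\<bar> \<le> M * h ^ (m + 1) * b" using bA[OF that(1)] that(2) M(1) hp by (intro mult_mono) auto
      then show "\<bar>\<alpha> n * y\<bar> \<le> M * b * h ^ (m + 1)" by (simp add: abs_mult mult_ac)
      have "\<bar>\<beta> n\<bar> * \<bar>y\<bar> \<le> M * h ^ (m + 2) * b" using bB[OF that(1)] that(2) M(1) hp by (intro mult_mono) auto
      then show "\<bar>\<beta> n * y\<bar> \<le> M * b * h ^ (m + 2)" by (simp add: abs_mult mult_ac)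
    qed
    have Cge: "M * b1 + M * b2 * T + C1 * T^2 \<le> C" "M * b3 + M * b4 * T + C1 * T^2 \<le> C" "M * \<bar>cU\<bar> \<le> C"
      "M * b4 + C1 * T \<le> C" "2 * C1 + \<bar>c\<bar> * M \<le> C" "\<bar>c\<bar> * M + M * b2 + C1 * T \<le> C"
    proof -
      have p: "0 \<le> M * b1" "0 \<le> M * b2" "0 \<le> M * b3" "0 \<le> M * b4" "0 \<le> M * \<bar>cU\<bar>" "0 \<le> M * b2 * T" "0 \<le> M * b4 * T"
        "0 \<le> C1 * T" "0 \<le> C1 * T^2" "0 \<le> C1" "0 \<le> \<bar>c\<bar> * M" "0 \<le> \<bar>c\<bar> * M * T"
        using M(1) b1(1) b2(1) b3(1) b4(1) C1 T by auto
      have "C = M * b1 + M * b3 + M * \<bar>cU\<bar> + M * b2 + M * b4 + M * b2 * T + M * b4 * T + 2 * C1 + C1 * T + C1 * T^2 + 2 * (\<bar>c\<bar> * M) + \<bar>c\<bar> * M * T"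
        by (simp add: C_def algebra_simps)
      then show "M * b1 + M * b2 * T + C1 * T^2 \<le> C" "M * b3 + M * b4 * T + C1 * T^2 \<le> C" "M * \<bar>cU\<bar> \<le> C"
        "M * b4 + C1 * T \<le> C" "2 * C1 + \<bar>c\<bar> * M \<le> C" "\<bar>c\<bar> * M + M * b2 + C1 * T \<le> C"
        using p by linarith+
    qed
    \<comment> \<open>The lowest power dominates because \<open>h \<le> T\<close>; the powers of
      \<open>T\<close> that arise are part of the constant \<open>C\<close>.\<close>
    have up: "A * h ^ (m + 1) + B * h ^ (m + 2) + C1 * h ^ (m + 3) \<le> C * h ^ (m + 1)"
      if "A + B * T + C1 * T^2 \<le> C" "B \<ge> 0" for A B
    proof -
      have "A * h ^ (m + 1) + B * h ^ (m + 2) + C1 * h ^ (m + 3) \<le> A * h ^ (m + 1) + B * (T * h ^ (m + 1)) + C1 * (T^2 * h ^ (m + 1))"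
        using h2(1) h3 C1 that(2) by (intro add_mono mult_left_mono order_refl) auto
      also have "\<dots> = (A + B * T + C1 * T^2) * h ^ (m + 1)" by (simp add: algebra_simps)
      also have "\<dots> \<le> C * h ^ (m + 1)" using that hp by (intro mult_right_mono) auto
      finally show ?thesis .
    qed
    have up2: "A * h ^ (m + 2) + C1 * h ^ (m + 3) \<le> C * h ^ (m + 2)"
      if "A + C1 * T \<le> C" for A
    proof -
      have "A * h ^ (m + 2) + C1 * h ^ (m + 3) \<le> A * h ^ (m + 2) + C1 * (T * h ^ (m + 2))"
        using h2(2) C1 by (intro add_mono mult_left_mono order_refl) auto
      also have "\<dots> = (A + C1 * T) * h ^ (m + 2)" by (simp add: algebra_simps)
      also have "\<dots> \<le> C * h ^ (m + 2)" using that hp by (intro mult_right_mono) auto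
      finally show ?thesis .
    qed
    have res: "degree (P n) \<le> m \<and> continuous_on {0..1} (\<omega> n) \<and>
      (\<forall>u\<in>{0..1}. integral {0..real n * h + u * h} x = poly (P n) u + \<omega> n u \<and>
        h * x (real n * h + u * h) = poly (pderiv (P n)) u + \<omega>' n u \<and> \<bar>\<omega> n u\<bar> \<le> C * h ^ (m + 1) \<and> \<bar>\<omega>' n u\<bar> \<le> C * h ^ (m + 1)) \<and>
      (\<forall>j\<le>m. legendre_moment (\<omega> n) j = 0) \<and>
      (\<exists>\<alpha>. \<bar>\<alpha>\<bar> \<le> C * h ^ (m + 1) \<and> (\<forall>u\<in>{0..1}. \<bar>\<omega>' n u - \<alpha> * poly (pderiv (shifted_legendre (m + 1))) u\<bar> \<le> C * h ^ (m + 2))) \<and>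
      (odd m \<longrightarrow> \<bar>\<omega> n 1 + \<omega> n 0 - c * h ^ (m + 1) * (D m (real n * h) + D m (real (Suc n) * h))\<bar> \<le> C * h ^ (m + 3) \<and>
        \<bar>c * h ^ (m + 1) * D m (real n * h) - \<omega> n 0\<bar> \<le> C * h ^ (m + 2))" if n: "n < N" for n
    proof (intro conjI ballI allI impI)
      show "degree (P n) \<le> m" unfolding P_def by (rule degree_legendre_proj)
      show "continuous_on {0..1} (\<omega> n)" unfolding \<omega>_def by (intro continuous_intros cX n)
      show "legendre_moment (\<omega> n) j = 0" if "j \<le> m" for j
        unfolding \<omega>_def using moment_legendre_proj[OF that]
        by (simp add: moment_diff continuous_on_poly_real cX n P_def)
      fix u :: real assume u: "u \<in> {0..1}"
      show "integral {0..real n * h + u * h} x = poly (P n) u + \<omega> n u" by (simp add: \<omega>_def Xn_def)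
      show "h * x (real n * h + u * h) = poly (pderiv (P n)) u + \<omega>' n u" by (simp add: \<omega>'_def)
      have "\<bar>\<omega> n u\<bar> \<le> M * b1 * h ^ (m + 1) + M * b2 * h ^ (m + 2) + C1 * h ^ (m + 3)"
        using key1[OF n u] prod(1)[OF n b1(2)[OF u]] prod(2)[OF n b2(2)[OF u]] by linarith
      also have "\<dots> \<le> C * h ^ (m + 1)" using Cge M(1) b2 by (intro up) auto
      finally show "\<bar>\<omega> n u\<bar> \<le> C * h ^ (m + 1)" .
      have "\<bar>\<omega>' n u\<bar> \<le> M * b3 * h ^ (m + 1) + M * b4 * h ^ (m + 2) + C1 * h ^ (m + 3)"
        using key2[OF n u] prod(1)[OF n b3(2)[OF u]] prod(2)[OF n b4(2)[OF u]] by linarith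
      also have "\<dots> \<le> C * h ^ (m + 1)" using Cge M(1) b4 by (intro up) auto
      finally show "\<bar>\<omega>' n u\<bar> \<le> C * h ^ (m + 1)" .
    next
      show "\<exists>\<alpha>. \<bar>\<alpha>\<bar> \<le> C * h ^ (m + 1) \<and> (\<forall>u\<in>{0..1}. \<bar>\<omega>' n u - \<alpha> * poly (pderiv (shifted_legendre (m + 1))) u\<bar> \<le> C * h ^ (m + 2))"
      proof (intro exI conjI ballI)
        have "M * \<bar>cU\<bar> * h ^ (m + 1) \<le> C * h ^ (m + 1)" using Cge(3) hp by (intro mult_right_mono) auto
        then show "\<bar>\<alpha> n * cU\<bar> \<le> C * h ^ (m + 1)" using prod(1)[OF n order_refl, of cU] by linarith
        fix u :: real assume u: "u \<in> {0..1}"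
        have "\<alpha> n * poly (pderiv U) u = (\<alpha> n * cU) * poly (pderiv (shifted_legendre (m + 1))) u"
          by (simp add: cU pderiv_smult)
        then have "\<bar>\<omega>' n u - (\<alpha> n * cU) * poly (pderiv (shifted_legendre (m + 1))) u\<bar> \<le> M * b4 * h ^ (m + 2) + C1 * h ^ (m + 3)"
          using key2[OF n u] prod(2)[OF n b4(2)[OF u]] by linarith
        also have "\<dots> \<le> C * h ^ (m + 2)" using Cge by (intro up2) auto
        finally show "\<bar>\<omega>' n u - (\<alpha> n * cU) * poly (pderiv (shifted_legendre (m + 1))) u\<bar> \<le> C * h ^ (m + 2)" .
      qed
    next
      assume odd: "odd m"
      have U01: "poly U 0 = cU" "poly U 1 = cU" using odd by (simp_all add: cU legendre_at_0 legendre_at_1)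
      have V01: "poly V 0 + poly V 1 = 0" unfolding V_def pw_def using odd by (intro legendre_rem_odd_ends) simp
      have \<alpha>c: "\<alpha> n * cU = c * h ^ (m + 1) * D m (mid n)" by (simp add: \<alpha>_def c_def)
      have t01: "real n * h \<in> ?I" "real (Suc n) * h \<in> ?I"
        using in_I[OF n, of 0] in_I[OF n, of 1] by (auto simp: algebra_simps)
      have Tay: "\<bar>D m t - D m (mid n) - D (m + 1) (mid n) * (t - mid n)\<bar> \<le> M * \<bar>t - mid n\<bar> ^ 2" if "t \<in> ?I" for t
      proof -
        have "norm ((\<lambda>i. D (m + i)) 0 t - (\<Sum>i\<le>1. (\<lambda>i. D (m + i)) i (mid n) * (t - mid n) ^ i / fact i)) \<le> M * norm (t - mid n) ^ Suc 1 / fact 1"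
        proof (rule field_Taylor[of ?I])
          fix i s assume "s \<in> ?I" "i \<le> (1::nat)"
          then show "(D (m + i) has_field_derivative D (m + Suc i) s) (at s within ?I)" using D[of "m + i" s] by simp
        next
          fix s assume "s \<in> ?I"
          then show "norm (D (m + Suc 1) s) \<le> M" using M(4)[of s] by (simp add: numeral_2_eq_2)
        qed (use that mid_I[OF n] in auto)
        then show ?thesis by (simp add: power2_eq_square)
      qed
      have T0: "\<bar>D m (real n * h) - D m (mid n) + D (m + 1) (mid n) * (h / 2)\<bar> \<le> M * (h / 2)^2"
        using Tay[OF t01(1)] hp by (simp add: mid_def)
      have T1: "\<bar>D m (real (Suc n) * h) - D m (mid n) - D (m + 1) (mid n) * (h / 2)\<bar> \<le> M * (h / 2)^2"
        using Tay[OF t01(2)] hp by (simp add: mid_def algebra_simps)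
      \<comment> \<open>The midpoint value is replaced by the mean of the end values, which costs
        only \<open>h^2\<close> because the first-order terms of the two expansions cancel. In this
        form neighbouring cells share the value at their common mesh point.\<close>
      have S: "\<bar>2 * D m (mid n) - (D m (real n * h) + D m (real (Suc n) * h))\<bar> \<le> M * h^2"
      proof -
        have "0 \<le> M * h^2" "M * (h / 2)^2 \<le> M * h^2 / 2" using M(1) by (auto simp: power_divide)
        then show ?thesis using T0 T1 by linarith
      qed
      have k0: "\<bar>\<omega> n 0 - \<alpha> n * cU - \<beta> n * poly V 0\<bar> \<le> C1 * h ^ (m + 3)" using key1[OF n, of 0] U01 by simp
      have k1: "\<bar>\<omega> n 1 - \<alpha> n * cU - \<beta> n * poly V 1\<bar> \<le> C1 * h ^ (m + 3)" using key1[OF n, of 1] U01 by simp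
      have bV: "\<beta> n * poly V 0 + \<beta> n * poly V 1 = 0" using V01 by (metis distrib_left mult_zero_right)
      have s1: "\<bar>\<omega> n 1 + \<omega> n 0 - 2 * (\<alpha> n * cU)\<bar> \<le> 2 * C1 * h ^ (m + 3)" using k0 k1 bV by linarith
      have s2: "\<bar>2 * (\<alpha> n * cU) - c * h ^ (m + 1) * (D m (real n * h) + D m (real (Suc n) * h))\<bar> \<le> \<bar>c\<bar> * M * h ^ (m + 3)"
      proof -
        have "2 * (\<alpha> n * cU) - c * h ^ (m + 1) * (D m (real n * h) + D m (real (Suc n) * h))
          = c * h ^ (m + 1) * (2 * D m (mid n) - (D m (real n * h) + D m (real (Suc n) * h)))"
          unfolding \<alpha>c by (simp add: algebra_simps)
        also have "\<bar>\<dots>\<bar> \<le> (\<bar>c\<bar> * h ^ (m + 1)) * (M * h^2)"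
          unfolding abs_mult[of "c * h ^ (m + 1)"] using S hp by (intro mult_mono) (auto simp: abs_mult)
        also have "\<dots> = \<bar>c\<bar> * M * h ^ (m + 3)" by (simp add: hpow power2_eq_square)
        finally show ?thesis .
      qed
      have "\<bar>\<omega> n 1 + \<omega> n 0 - c * h ^ (m + 1) * (D m (real n * h) + D m (real (Suc n) * h))\<bar> \<le> (2 * C1 + \<bar>c\<bar> * M) * h ^ (m + 3)"
        unfolding distrib_right[of "2 * C1"] using s1 s2 by linarith
      also have "\<dots> \<le> C * h ^ (m + 3)" using Cge(5) hp by (intro mult_right_mono) auto
      finally show "\<bar>\<omega> n 1 + \<omega> n 0 - c * h ^ (m + 1) * (D m (real n * h) + D m (real (Suc n) * h))\<bar> \<le> C * h ^ (m + 3)" .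
      have S0: "\<bar>D m (real n * h) - D m (mid n)\<bar> \<le> M * h"
      proof -
        have "norm (D m (real n * h) - D m (mid n)) \<le> M * norm (real n * h - mid n)"
          by (rule field_differentiable_bound[of ?I "D m" "D (Suc m)"]) (use D[of m] M(3) t01 mid_I[OF n] in auto)
        also have "\<dots> \<le> M * h" using M(1) hp by (intro mult_left_mono) (auto simp: mid_def)
        finally show ?thesis by simp
      qed
      have "\<bar>c * h ^ (m + 1) * D m (real n * h) - \<alpha> n * cU\<bar> \<le> \<bar>c\<bar> * M * h ^ (m + 2)"
      proof -
        have "c * h ^ (m + 1) * D m (real n * h) - \<alpha> n * cU = c * h ^ (m + 1) * (D m (real n * h) - D m (mid n))"
          unfolding \<alpha>c by (simp add: algebra_simps)
        also have "\<bar>\<dots>\<bar> \<le> (\<bar>c\<bar> * h ^ (m + 1)) * (M * h)"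
          unfolding abs_mult[of "c * h ^ (m + 1)"] using S0 hp by (intro mult_mono) (auto simp: abs_mult)
        also have "\<dots> = \<bar>c\<bar> * M * h ^ (m + 2)" by (simp add: hpow)
        finally show ?thesis .
      qed
      then have "\<bar>c * h ^ (m + 1) * D m (real n * h) - \<omega> n 0\<bar> \<le> (\<bar>c\<bar> * M + M * b2) * h ^ (m + 2) + C1 * h ^ (m + 3)"
        using k0 prod(2)[OF n b2(2)[of 0]] unfolding distrib_right by auto
      also have "\<dots> \<le> C * h ^ (m + 2)" using Cge(6) by (intro up2)
      finally show "\<bar>c * h ^ (m + 1) * D m (real n * h) - \<omega> n 0\<bar> \<le> C * h ^ (m + 2)" .
    qed
    then show "\<exists>P \<omega> \<omega>'. \<forall>n<N. degree (P n) \<le> m \<and> continuous_on {0..1} (\<omega> n) \<and>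
      (\<forall>u\<in>{0..1}. integral {0..real n * h + u * h} x = poly (P n) u + \<omega> n u \<and>
        h * x (real n * h + u * h) = poly (pderiv (P n)) u + \<omega>' n u \<and> \<bar>\<omega> n u\<bar> \<le> C * h ^ (m + 1) \<and> \<bar>\<omega>' n u\<bar> \<le> C * h ^ (m + 1)) \<and>
      (\<forall>j\<le>m. legendre_moment (\<omega> n) j = 0) \<and>
      (\<exists>\<alpha>. \<bar>\<alpha>\<bar> \<le> C * h ^ (m + 1) \<and> (\<forall>u\<in>{0..1}. \<bar>\<omega>' n u - \<alpha> * poly (pderiv (shifted_legendre (m + 1))) u\<bar> \<le> C * h ^ (m + 2))) \<and>
      (odd m \<longrightarrow> \<bar>\<omega> n 1 + \<omega> n 0 - c * h ^ (m + 1) * (D m (real n * h) + D m (real (Suc n) * h))\<bar> \<le> C * h ^ (m + 3) \<and>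
        \<bar>c * h ^ (m + 1) * D m (real n * h) - \<omega> n 0\<bar> \<le> C * h ^ (m + 2))"
      by blast
  qed
qed

subsection \<open>Moments of discontinuous piecewise polynomials\<close>

lemma underdetermined_homogeneous:
  fixes a :: "'i \<Rightarrow> 'j \<Rightarrow> real"
  assumes "finite I" "finite J" "card I < card J"
  shows "\<exists>c. (\<exists>j\<in>J. c j \<noteq> 0) \<and> (\<forall>i\<in>I. (\<Sum>j\<in>J. a i j * c j) = 0)"
  using assms
proof (induction I arbitrary: J a rule: finite_induct)
  case empty
  then obtain j where "j \<in> J" by fastforce
  then show ?case by (intro exI[of _ "\<lambda>_. 1"]) auto
next
  case (insert i I)
  show ?case
  proof (cases "\<forall>j\<in>J. a i j = 0")
    case True
    obtain c where "\<exists>j\<in>J. c j \<noteq> 0" "\<forall>i\<in>I. (\<Sum>j\<in>J. a i j * c j) = 0"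
      using insert.IH[of J a] insert.prems insert.hyps by auto
    then show ?thesis using True by (intro exI[of _ c]) auto
  next
    case False
    \<comment> \<open>Gaussian elimination: the row \<open>i\<close> is solved for the unknown
      \<open>p\<close>, and the result is substituted into the other rows.\<close>
    then obtain p where p: "p \<in> J" "a i p \<noteq> 0" by blast
    define J' where "J' = J - {p}"
    have J': "finite J'" "card I < card J'" "p \<notin> J'" "J = insert p J'"
      using insert.prems insert.hyps p by (auto simp: J'_def)
    obtain c where c: "\<exists>j\<in>J'. c j \<noteq> 0" "\<forall>k\<in>I. (\<Sum>j\<in>J'. (a k j - a k p * a i j / a i p) * c j) = 0"
      using insert.IH[of J' "\<lambda>k j. a k j - a k p * a i j / a i p"] J' by auto
    define s where "s = (\<Sum>j\<in>J'. a i j * c j)"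
    define c' where "c' j = (if j = p then - s / a i p else c j)" for j
    have sum: "(\<Sum>j\<in>J. a k j * c' j) = (\<Sum>j\<in>J'. a k j * c j) - a k p * s / a i p" for k
    proof -
      have "(\<Sum>j\<in>J'. a k j * c' j) = (\<Sum>j\<in>J'. a k j * c j)"
        using J'(3) by (intro sum.cong) (auto simp: c'_def)
      then show ?thesis using J' by (simp add: c'_def)
    qed
    have "(\<Sum>j\<in>J. a k j * c' j) = 0" if "k \<in> insert i I" for k
    proof (cases "k = i")
      case True
      then show ?thesis using p(2) by (simp add: sum s_def)
    next
      case False
      then have "(\<Sum>j\<in>J'. (a k j - a k p * a i j / a i p) * c j) = 0" using c(2) that by blast
      also have "(\<Sum>j\<in>J'. (a k j - a k p * a i j / a i p) * c j) = (\<Sum>j\<in>J'. a k j * c j) - a k p / a i p * s"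
        by (simp add: s_def left_diff_distrib sum_subtractf sum_distrib_left algebra_simps)
      finally show ?thesis by (simp add: sum)
    qed
    moreover have "\<exists>j\<in>J. c' j \<noteq> 0"
      using c(1) J' by (auto simp: c'_def)
    ultimately show ?thesis by blast
  qed
qed

text \<open>Existence from uniqueness: with the right-hand side as an additional column, indexed by
  \<open>None\<close>, the system has a nontrivial null vector. Its component at that column cannot
  be zero by injectivity, and dividing by it gives a solution.\<close>

lemma injective_square_system_solvable:
  fixes a :: "'i \<Rightarrow> 'i \<Rightarrow> real"
  assumes "finite I" and inj: "\<And>c. (\<And>i. i \<in> I \<Longrightarrow> (\<Sum>j\<in>I. a i j * c j) = 0) \<Longrightarrow> \<forall>j\<in>I. c j = 0"
  obtains c where "\<And>i. i \<in> I \<Longrightarrow> (\<Sum>j\<in>I. a i j * c j) = r i"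
proof -
  let ?J = "insert None (Some ` I)"
  define A where "A i q = (case q of None \<Rightarrow> r i | Some j \<Rightarrow> a i j)" for i q
  have "card I < card ?J" using assms(1) by (simp add: card_image)
  then obtain d where d: "\<exists>q\<in>?J. d q \<noteq> 0" "\<forall>i\<in>I. (\<Sum>q\<in>?J. A i q * d q) = 0"
    using underdetermined_homogeneous[of I ?J A] assms(1) by auto
  have sum: "(\<Sum>q\<in>?J. A i q * d q) = r i * d None + (\<Sum>j\<in>I. a i j * d (Some j))" for i
    using assms(1) by (subst sum.insert) (auto simp: sum.reindex A_def)
  have nz: "d None \<noteq> 0"
  proof
    assume "d None = 0"
    then have "\<forall>j\<in>I. d (Some j) = 0" using d(2) sum by (intro inj) auto
    then show False using d(1) \<open>d None = 0\<close> by auto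
  qed
  have "(\<Sum>j\<in>I. a i j * (- d (Some j) / d None)) = r i" if "i \<in> I" for i
  proof -
    have 1: "r i * d None + (\<Sum>j\<in>I. a i j * d (Some j)) = 0" using d(2) that sum by auto
    have 2: "(\<Sum>j\<in>I. a i j * (- d (Some j) / d None)) = - (\<Sum>j\<in>I. a i j * d (Some j)) / d None"
      by (simp add: sum_divide_distrib sum_negf)
    show ?thesis unfolding 2 using 1 nz by (simp add: field_simps)
  qed
  then show ?thesis by (rule that)
qed

text \<open>The finite exceptional set makes this applicable both to continuous functions and to
  piecewise polynomials with jumps at the mesh points. It is stable under differences and hence
  covers the errors.\<close>

definition primitive_on :: "real \<Rightarrow> (real \<Rightarrow> real) \<Rightarrow> (real \<Rightarrow> real) \<Rightarrow> bool" where
  "primitive_on T e E \<longleftrightarrow> continuous_on {0..T} E \<and> E 0 = 0 \<and>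
    (\<exists>M. finite M \<and> (\<forall>s\<in>{0<..<T} - M. (E has_real_derivative e s) (at s)))"

lemma primitive_on_continuous:
  assumes x: "continuous_on {0..T} x"
  shows "primitive_on T x (\<lambda>t. integral {0..t} x)"
  unfolding primitive_on_def
proof (intro conjI exI[of _ "{}"] ballI)
  show "continuous_on {0..T} (\<lambda>t. integral {0..t} x)"
    by (intro indefinite_integral_continuous_1 integrable_continuous_real x)
  fix s assume s: "s \<in> {0<..<T} - {}"
  have "((\<lambda>t. integral {0..t} x) has_real_derivative x s) (at s within {0<..<T})"
    using s by (intro DERIV_subset[OF integral_has_real_derivative[OF x]]) auto
  moreover have "at s within {0<..<T} = at s" using s by (intro at_within_open) auto
  ultimately show "((\<lambda>t. integral {0..t} x) has_real_derivative x s) (at s)" by simp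
qed auto

lemma primitive_on_diff:
  assumes "primitive_on T e E" "primitive_on T f F"
  shows "primitive_on T (\<lambda>t. e t - f t) (\<lambda>t. E t - F t)"
proof -
  obtain M1 M2 where "finite M1" "\<forall>s\<in>{0<..<T} - M1. (E has_real_derivative e s) (at s)"
    "finite M2" "\<forall>s\<in>{0<..<T} - M2. (F has_real_derivative f s) (at s)"
    using assms unfolding primitive_on_def by blast
  then show ?thesis
    using assms unfolding primitive_on_def
    by (intro conjI continuous_on_diff exI[of _ "M1 \<union> M2"]) (auto intro!: DERIV_diff)
qed

text \<open>After integration by parts the operator depends on \<open>e\<close> only through its
  primitive. Hence the result is continuous although \<open>e\<close> may jump, and it is bounded by
  the maximum of \<open>E\<close>, for which the error analysis provides a better order than for
  \<open>e\<close>.\<close>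

lemma volterra_primitive:
  fixes K :: "real \<Rightarrow> real \<Rightarrow> real"
  assumes K: "Ck_on 1 (kernel_domain T) (\<lambda>(t, s). K t s)"
  obtains C where "C > 0"
    "\<And>e E t. primitive_on T e E \<Longrightarrow> t \<in> {0..T} \<Longrightarrow> (\<lambda>s. K t s * e s) integrable_on {0..t}"
    "\<And>e E. primitive_on T e E \<Longrightarrow> continuous_on {0..T} (\<lambda>t. integral {0..t} (\<lambda>s. K t s * e s))"
    "\<And>e E t b. primitive_on T e E \<Longrightarrow> t \<in> {0..T} \<Longrightarrow> (\<And>s. s \<in> {0..T} \<Longrightarrow> \<bar>E s\<bar> \<le> b) \<Longrightarrow>
       \<bar>integral {0..t} (\<lambda>s. K t s * e s)\<bar> \<le> C * b"
proof -
  have K': "Ck_on (Suc 0) (kernel_domain T) (\<lambda>(t, s). K t s)" using K by simp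
  obtain \<kappa> where \<kappa>: "Ck_on 0 (kernel_domain T) (\<lambda>(t, s). \<kappa> t s)"
    "\<And>t s. 0 \<le> s \<Longrightarrow> s \<le> t \<Longrightarrow> t \<le> T \<Longrightarrow> ((\<lambda>s. K t s) has_real_derivative \<kappa> t s) (at s within {0..t})"
    by (rule kernel_partials[OF K']) blast
  have \<kappa>c: "continuous_on (kernel_domain T) (\<lambda>(t, s). \<kappa> t s)" using \<kappa>(1) by simp
  obtain C1 where C1: "C1 > 0" "\<And>t s. 0 \<le> s \<Longrightarrow> s \<le> t \<Longrightarrow> t \<le> T \<Longrightarrow> \<bar>K t s\<bar> \<le> C1"
    using kernel_bounded[OF Ck_on_continuous[OF K]] by auto
  obtain C2 where C2: "C2 > 0" "\<And>t s. 0 \<le> s \<Longrightarrow> s \<le> t \<Longrightarrow> t \<le> T \<Longrightarrow> \<bar>\<kappa> t s\<bar> \<le> C2"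
    using kernel_bounded[OF \<kappa>c] by auto
  have hi: "((\<lambda>s. K t s * e s) has_integral (K t t * E t - integral {0..t} (\<lambda>s. \<kappa> t s * E s))) {0..t}"
    if E: "primitive_on T e E" and t: "t \<in> {0..T}" for e E t
  proof -
    obtain M where M: "finite M" "\<forall>s\<in>{0<..<T} - M. (E has_real_derivative e s) (at s)"
      using E unfolding primitive_on_def by blast
    have cE: "continuous_on {0..T} E" "E 0 = 0" using E unfolding primitive_on_def by auto
    show ?thesis
    proof (rule volterra_by_parts[where M = M])
      show "((\<lambda>s. K t s) has_real_derivative \<kappa> t s) (at s within {0..t})" if "s \<in> {0..t}" for s
        using \<kappa>(2)[of s t] that t by auto
      show "continuous_on {0..t} (\<kappa> t)" using continuous_on_kernel_section[OF \<kappa>c, of t] t by simp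
      show "continuous_on {0..t} E" using continuous_on_subset[OF cE(1)] t by auto
      show "(E has_real_derivative e s) (at s)" if "s \<in> {0<..<t} - M" for s
        using M that t by auto
    qed (use t M cE in auto)
  qed
  show ?thesis
  proof (rule that[of "C1 + C2 * \<bar>T\<bar>"])
    show "C1 + C2 * \<bar>T\<bar> > 0" using C1 C2 by (simp add: add_pos_nonneg)
    show "(\<lambda>s. K t s * e s) integrable_on {0..t}" if "primitive_on T e E" "t \<in> {0..T}" for e E t
      using hi[OF that] by blast
    show "continuous_on {0..T} (\<lambda>t. integral {0..t} (\<lambda>s. K t s * e s))" if "primitive_on T e E" for e E
    proof -
      have cE: "continuous_on {0..T} E" using that unfolding primitive_on_def by auto
      have "continuous_on {0..T} (\<lambda>t. K t t)"
        using Ck_on_continuous[OF Ck_on_diagonal[OF K]] .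
      then have "continuous_on {0..T} (\<lambda>t. K t t * E t - integral {0..t} (\<lambda>s. \<kappa> t s * E s))"
        by (intro continuous_on_diff continuous_on_mult cE volterra_continuous[OF \<kappa>c cE])
      then show ?thesis
        by (subst continuous_on_cong[OF refl integral_unique[OF hi[OF that]]])
    qed
    show "\<bar>integral {0..t} (\<lambda>s. K t s * e s)\<bar> \<le> (C1 + C2 * \<bar>T\<bar>) * b"
      if "primitive_on T e E" "t \<in> {0..T}" "\<And>s. s \<in> {0..T} \<Longrightarrow> \<bar>E s\<bar> \<le> b" for e E t b
    proof -
      have b0: "0 \<le> b" using that(3)[OF that(2)] by linarith
      have cE: "continuous_on {0..t} E"
        using that(1,2) continuous_on_subset[of "{0..T}" E "{0..t}"] unfolding primitive_on_def by auto
      have "\<bar>integral {0..t} (\<lambda>s. \<kappa> t s * E s)\<bar> \<le> (C2 * b) * t"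
      proof (rule abs_integral_le)
        show "continuous_on {0..t} (\<lambda>s. \<kappa> t s * E s)"
          using that(2) by (intro continuous_intros cE continuous_on_kernel_section[OF \<kappa>c]) auto
        show "\<bar>\<kappa> t s * E s\<bar> \<le> C2 * b" if "s \<in> {0..t}" for s
          unfolding abs_mult using that \<open>t \<in> {0..T}\<close> C2 by (intro mult_mono C2(2) \<open>\<And>s. s \<in> {0..T} \<Longrightarrow> \<bar>E s\<bar> \<le> b\<close>) auto
      qed (use that in auto)
      also have "\<dots> \<le> (C2 * b) * \<bar>T\<bar>" using that(2) C2(1) b0 by (intro mult_left_mono) auto
      finally have 1: "\<bar>integral {0..t} (\<lambda>s. \<kappa> t s * E s)\<bar> \<le> C2 * b * \<bar>T\<bar>" .
      have 2: "\<bar>K t t * E t\<bar> \<le> C1 * b"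
        unfolding abs_mult using that(2) C1 by (intro mult_mono that(3)) auto
      show ?thesis
        unfolding integral_unique[OF hi[OF that(1,2)]] using 1 2 by (simp add: algebra_simps)
    qed
  qed
qed

section \<open>Mesh cells and piecewise polynomials\<close>

lemma stepsize_pos: "T > 0 \<Longrightarrow> N \<ge> 1 \<Longrightarrow> stepsize T N > 0"
  by (simp add: stepsize_def)

lemma N_stepsize: "N \<ge> 1 \<Longrightarrow> real N * stepsize T N = T"
  by (simp add: stepsize_def)

lemma cell_point:
  assumes "T > 0" "N \<ge> 1" "n < N" "u \<in> {0..1}"
  shows "real n * stepsize T N + u * stepsize T N \<in> {0..T}"
proof -
  let ?h = "stepsize T N"
  have h: "?h > 0" using assms stepsize_pos by blast
  have "(real n + u) * ?h \<le> real N * ?h" using assms h by (intro mult_right_mono) auto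
  then show ?thesis using N_stepsize[OF assms(2), of T] h assms by (simp add: distrib_right)
qed

text \<open>The local coordinate lies in (0,1], in accordance with the left-open cells of the
  discontinuous space; hence the ceiling. The point 0 belongs to no cell and needs separate
  treatment wherever this lemma is used.\<close>

lemma cell_cover:
  assumes "T > 0" "N \<ge> 1" "t \<in> {0<..T}"
  obtains n u where "n < N" "u \<in> {0<..1}" "t = real n * stepsize T N + u * stepsize T N"
proof -
  let ?h = "stepsize T N"
  have h: "?h > 0" using assms stepsize_pos by blast
  have th: "t / ?h > 0" "t / ?h \<le> real N"
    using assms h N_stepsize[OF assms(2), of T] by (auto simp: divide_le_eq)
  define k where "k = nat (ceiling (t / ?h))"
  have k: "real k - 1 < t / ?h" "t / ?h \<le> real k" "k \<ge> 1"
    using th(1) unfolding k_def by linarith+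
  have "k \<le> N" using th(2) unfolding k_def by linarith
  show ?thesis
  proof (rule that[of "k - 1" "t / ?h - real (k - 1)"])
    show "k - 1 < N" using k \<open>k \<le> N\<close> by simp
    show "t / ?h - real (k - 1) \<in> {0<..1}" using k by (auto simp: of_nat_diff)
    show "t = real (k - 1) * ?h + (t / ?h - real (k - 1)) * ?h" using h by (simp add: algebra_simps)
  qed
qed

text \<open>The pieces are pulled back to the unit cell. The value at 0 is that of the first piece
  because both are the limit from the right.\<close>

lemma dg_space_cells:
  assumes T: "T > 0" "N \<ge> 1" and y: "y \<in> dg_space T N q"
  obtains p where "\<And>n. n < N \<Longrightarrow> degree (p n) \<le> q"
    "\<And>n u. n < N \<Longrightarrow> u \<in> {0<..1} \<Longrightarrow> y (real n * stepsize T N + u * stepsize T N) = poly (p n) u"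
    "y 0 = poly (p 0) 0"
proof -
  let ?h = "stepsize T N"
  have h: "?h > 0" using T stepsize_pos by blast
  have "\<forall>n\<in>{..<N}. \<exists>p. degree p \<le> q \<and> (\<forall>t\<in>{mesh T N n<..mesh T N (Suc n)}. y t = poly p t)"
    using y by (auto simp: dg_space_def)
  then obtain P where P: "\<forall>n\<in>{..<N}. degree (P n) \<le> q \<and> (\<forall>t\<in>{mesh T N n<..mesh T N (Suc n)}. y t = poly (P n) t)"
    by metis
  define p where "p n = pcompose (P n) [:real n * ?h, ?h:]" for n
  have py: "poly (p n) u = poly (P n) (real n * ?h + u * ?h)" for n u
    by (simp add: p_def poly_pcompose mult.commute)
  have y_eq: "y (real n * ?h + u * ?h) = poly (p n) u" if "n < N" "u \<in> {0<..1}" for n u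
    using P that h unfolding py mesh_def by (auto simp: algebra_simps mult_le_cancel_right1)
  show ?thesis
  proof (rule that[of p])
    show "degree (p n) \<le> q" if "n < N" for n
      using P that h by (simp add: p_def degree_pcompose)
    show "y 0 = poly (p 0) 0"
    proof -
      have "(y \<longlongrightarrow> y 0) (at_right 0)" using y by (simp add: dg_space_def)
      moreover have "\<forall>\<^sub>F t in at_right 0. y t = poly (P 0) t"
        unfolding eventually_at_right_field
        using P T h by (intro exI[of _ ?h]) (auto simp: mesh_def)
      ultimately have "((\<lambda>t. poly (P 0) t) \<longlongrightarrow> y 0) (at_right 0)"
        using tendsto_cong by fastforce
      moreover have "((\<lambda>t. poly (P 0) t) \<longlongrightarrow> poly (P 0) 0) (at_right 0)"
        by (intro tendsto_intros)
      ultimately have "y 0 = poly (P 0) 0" using tendsto_unique[OF trivial_limit_at_right_real] by blast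
      then show ?thesis by (simp add: py)
    qed
  qed (use y_eq in auto)
qed

text \<open>In contrast to \<open>y\<close> itself, the primitive is polynomial on the closed cells,
  since the left end of a cell does not affect integrals. The degree \<open>Suc q\<close> becomes
  \<open>m\<close> for the space under consideration.\<close>

lemma dg_space_primitive:
  assumes T: "T > 0" "N \<ge> 1" and y: "y \<in> dg_space T N q"
  shows "primitive_on T y (\<lambda>t. integral {0..t} y)"
    and "\<exists>Q. (\<forall>n<N. degree (Q n) \<le> Suc q \<and>
      (\<forall>u\<in>{0..1}. integral {0..real n * stepsize T N + u * stepsize T N} y = poly (Q n) u) \<and>
      (\<forall>u\<in>{0<..1}. stepsize T N * y (real n * stepsize T N + u * stepsize T N) = poly (pderiv (Q n)) u)) \<and>
      stepsize T N * y 0 = poly (pderiv (Q 0)) 0"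
proof -
  let ?h = "stepsize T N"
  let ?Y = "\<lambda>t. integral {0..t} y"
  have h: "?h > 0" using T stepsize_pos by blast
  obtain p where p: "\<And>n. n < N \<Longrightarrow> degree (p n) \<le> q"
    "\<And>n u. n < N \<Longrightarrow> u \<in> {0<..1} \<Longrightarrow> y (real n * ?h + u * ?h) = poly (p n) u"
    "y 0 = poly (p 0) 0"
    using dg_space_cells[OF T y] by metis
  have intcell: "y integrable_on {real n * ?h..real (Suc n) * ?h}" if n: "n < N" for n
  proof (rule integrable_spike_finite[of "{real n * ?h}"])
    show "(\<lambda>t. poly (p n) ((t - real n * ?h) / ?h)) integrable_on {real n * ?h..real (Suc n) * ?h}"
      using h by (intro integrable_continuous_real continuous_intros) auto
    fix t assume t: "t \<in> {real n * ?h..real (Suc n) * ?h} - {real n * ?h}"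
    define u where "u = (t - real n * ?h) / ?h"
    have u: "u \<in> {0<..1}" using t h by (auto simp: u_def divide_le_eq algebra_simps)
    have "t = real n * ?h + u * ?h" using h by (simp add: u_def)
    then show "y t = poly (p n) ((t - real n * ?h) / ?h)" using p(2)[OF n u] u_def by simp
  qed simp
  have int: "y integrable_on {0..real n * ?h}" if "n \<le> N" for n
    using that
  proof (induction n)
    case (Suc n)
    have "y integrable_on {0..real n * ?h}" using Suc by simp
    moreover have "y integrable_on {real n * ?h..real (Suc n) * ?h}" using Suc.prems by (intro intcell) simp
    ultimately show ?case
      by (rule Henstock_Kurzweil_Integration.integrable_combine[rotated 2]) (use h in auto)
  qed (use integrable_on_refl[of y 0] in auto)
  have intT: "y integrable_on {0..T}" using int[of N] N_stepsize[OF T(2)] by simp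
  have "\<exists>q'. pderiv q' = p n \<and> degree q' \<le> Suc (degree (p n)) \<and> poly q' 0 = 0" for n
    using poly_antiderivative[of "p n"] by metis
  then obtain q' where q': "\<And>n. pderiv (q' n) = p n" "\<And>n. degree (q' n) \<le> Suc (degree (p n))" "\<And>n. poly (q' n) 0 = 0"
    by metis
  define Q where "Q n = [:?Y (real n * ?h):] + smult ?h (q' n)" for n
  have Yc: "?Y (real n * ?h + u * ?h) = poly (Q n) u" if n: "n < N" and u: "u \<in> {0..1}" for n u
  proof -
    have le: "real n * ?h + u * ?h \<le> T" using cell_point[OF T n u] by simp
    have "?Y (real n * ?h + u * ?h) = ?Y (real n * ?h) + integral {real n * ?h..real n * ?h + u * ?h} y"
      using h u le by (intro Henstock_Kurzweil_Integration.integral_combine[symmetric] integrable_on_subinterval[OF intT]) auto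
    also have "integral {real n * ?h..real n * ?h + u * ?h} y = ?h * integral {0..u} (\<lambda>v. y (real n * ?h + v * ?h))"
      by (rule integral_affine[OF h])
    also have "integral {0..u} (\<lambda>v. y (real n * ?h + v * ?h)) = integral {0..u} (poly (p n))"
      using u p(2)[OF n] by (intro integral_spike[of "{0}"]) auto
    also have "integral {0..u} (poly (p n)) = poly (q' n) u - poly (q' n) 0"
    proof (intro integral_unique fundamental_theorem_of_calculus)
      show "(poly (q' n) has_vector_derivative poly (p n) v) (at v within {0..u})" for v
        using has_field_derivative_at_within[OF poly_DERIV[of "q' n" v]]
        unfolding q' has_real_derivative_iff_has_vector_derivative .
    qed (use u in auto)
    finally show ?thesis using q'(3) by (simp add: Q_def)
  qed
  have dQ: "pderiv (Q n) = smult ?h (p n)" for n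
    by (simp add: Q_def pderiv_add pderiv_smult q' pderiv_pCons)
  show "\<exists>Q. (\<forall>n<N. degree (Q n) \<le> Suc q \<and>
      (\<forall>u\<in>{0..1}. ?Y (real n * ?h + u * ?h) = poly (Q n) u) \<and>
      (\<forall>u\<in>{0<..1}. ?h * y (real n * ?h + u * ?h) = poly (pderiv (Q n)) u)) \<and>
      ?h * y 0 = poly (pderiv (Q 0)) 0"
  proof (intro exI[of _ Q] conjI allI impI ballI)
    fix n assume n: "n < N"
    have "degree (q' n) \<le> Suc q" using q'(2)[of n] p(1)[OF n] by linarith
    then show "degree (Q n) \<le> Suc q"
      unfolding Q_def by (intro degree_add_le order_trans[OF degree_smult_le]) auto
  qed (use Yc dQ p in auto)
  show "primitive_on T y ?Y"
    unfolding primitive_on_def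
  proof (intro conjI exI[of _ "(\<lambda>n. real n * ?h) ` {..N}"] ballI)
    show "continuous_on {0..T} ?Y" by (intro indefinite_integral_continuous_1 intT)
    fix s assume s: "s \<in> {0<..<T} - (\<lambda>n. real n * ?h) ` {..N}"
    then have "s \<in> {0<..T}" by auto
    then obtain n u where nu: "n < N" "u \<in> {0<..1}" "s = real n * ?h + u * ?h"
      by (rule cell_cover[OF T]) blast
    have "u \<noteq> 1"
    proof
      assume "u = 1"
      then have "s = real (Suc n) * ?h" using nu by (simp add: algebra_simps)
      moreover have "Suc n \<in> {..N}" using nu(1) by simp
      ultimately have "s \<in> (\<lambda>n. real n * ?h) ` {..N}" by (rule image_eqI)
      then show False using s by blast
    qed
    then have u: "u \<in> {0<..<1}" using nu by auto
    let ?I = "{real n * ?h<..<real (Suc n) * ?h}"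
    have sI: "s \<in> ?I" using u nu(3) h by (auto simp: algebra_simps)
    have "((\<lambda>t. poly (Q n) ((t - real n * ?h) / ?h)) has_real_derivative poly (pderiv (Q n)) ((s - real n * ?h) / ?h) * (1 / ?h)) (at s)"
      by (rule DERIV_chain2[OF poly_DERIV]) (use h in \<open>auto intro!: derivative_eq_intros\<close>)
    moreover have "poly (pderiv (Q n)) ((s - real n * ?h) / ?h) * (1 / ?h) = y s"
      using nu h p(2)[OF nu(1,2)] by (simp add: dQ)
    ultimately have "((\<lambda>t. poly (Q n) ((t - real n * ?h) / ?h)) has_real_derivative y s) (at s)" by simp
    then show "(?Y has_real_derivative y s) (at s)"
    proof (rule has_field_derivative_transform_within_open[of _ _ _ ?I])
      fix t assume t: "t \<in> ?I"
      define v where "v = (t - real n * ?h) / ?h"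
      have v: "v \<in> {0..1}" using t h by (auto simp: v_def divide_le_eq algebra_simps)
      have tv: "t = real n * ?h + v * ?h" using h by (simp add: v_def)
      have "?Y t = poly (Q n) v" unfolding tv by (rule Yc[OF nu(1) v])
      then show "poly (Q n) ((t - real n * ?h) / ?h) = ?Y t" unfolding v_def by (rule sym)
    qed (use sI in auto)
  qed auto
qed

section \<open>Linear structure of the discontinuous space\<close>

lemma dg_space_add:
  assumes "f \<in> dg_space T N q" "g \<in> dg_space T N q"
  shows "(\<lambda>t. f t + g t) \<in> dg_space T N q"
  unfolding dg_space_def
proof (intro CollectI conjI allI impI)
  fix n assume n: "n < N"
  obtain p1 p2 where "degree p1 \<le> q" "\<forall>t\<in>{mesh T N n<..mesh T N (Suc n)}. f t = poly p1 t"
    "degree p2 \<le> q" "\<forall>t\<in>{mesh T N n<..mesh T N (Suc n)}. g t = poly p2 t"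
    using assms n unfolding dg_space_def by blast
  then show "\<exists>p. degree p \<le> q \<and> (\<forall>t\<in>{mesh T N n<..mesh T N (Suc n)}. f t + g t = poly p t)"
    by (intro exI[of _ "p1 + p2"]) (auto intro: degree_add_le)
next
  show "((\<lambda>t. f t + g t) \<longlongrightarrow> f 0 + g 0) (at_right 0)"
    using assms unfolding dg_space_def by (intro tendsto_add) auto
qed

lemma dg_space_cmult:
  assumes "f \<in> dg_space T N q"
  shows "(\<lambda>t. c * f t) \<in> dg_space T N q"
  unfolding dg_space_def
proof (intro CollectI conjI allI impI)
  fix n assume n: "n < N"
  obtain p where "degree p \<le> q" "\<forall>t\<in>{mesh T N n<..mesh T N (Suc n)}. f t = poly p t"
    using assms n unfolding dg_space_def by blast
  then show "\<exists>p. degree p \<le> q \<and> (\<forall>t\<in>{mesh T N n<..mesh T N (Suc n)}. c * f t = poly p t)"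
    by (intro exI[of _ "smult c p"]) (auto intro: order_trans[OF degree_smult_le])
next
  show "((\<lambda>t. c * f t) \<longlongrightarrow> c * f 0) (at_right 0)"
    using assms unfolding dg_space_def by (intro tendsto_mult_left) auto
qed

lemma dg_space_poly:
  assumes "degree p \<le> q"
  shows "poly p \<in> dg_space T N q"
  unfolding dg_space_def using assms
  by (intro CollectI conjI allI impI exI[of _ p] tendsto_intros) auto

lemma dg_space_sum:
  assumes "finite A" "\<And>a. a \<in> A \<Longrightarrow> f a \<in> dg_space T N q"
  shows "(\<lambda>t. \<Sum>a\<in>A. f a t) \<in> dg_space T N q"
  using assms
proof (induction A rule: finite_induct)
  case empty
  have "poly 0 \<in> dg_space T N q" by (rule dg_space_poly) simp
  then show ?case by (simp add: poly_0[abs_def])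
next
  case (insert a A)
  then show ?case using dg_space_add[of "f a" T N q "\<lambda>t. \<Sum>a\<in>A. f a t"] by simp
qed

lemma dg_space_diff:
  assumes "f \<in> dg_space T N q" "g \<in> dg_space T N q"
  shows "(\<lambda>t. f t - g t) \<in> dg_space T N q"
  using dg_space_add[OF assms(1) dg_space_cmult[OF assms(2), of "-1"]] by simp

section \<open>The Galerkin equations as moment conditions\<close>

lemma moment_diff_integrable:
  assumes "(\<lambda>u. f u * poly (shifted_legendre j) u) integrable_on {0..1}"
    "(\<lambda>u. g u * poly (shifted_legendre j) u) integrable_on {0..1}"
  shows "legendre_moment (\<lambda>u. f u - g u) j = legendre_moment f j - legendre_moment g j"
  unfolding legendre_moment_def left_diff_distrib by (intro integral_diff assms)

lemma moment_spike:
  assumes "\<And>u. u \<in> {0<..1} \<Longrightarrow> f u = g u"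
  shows "legendre_moment f j = legendre_moment g j"
  unfolding legendre_moment_def by (rule integral_spike[of "{0}"]) (use assms in auto)

lemma moment_integrable_spike:
  assumes "continuous_on {0..1} g" "\<And>u. u \<in> {0<..1} \<Longrightarrow> f u = g u"
  shows "(\<lambda>u. f u * poly (shifted_legendre j) u) integrable_on {0..1}"
proof (rule integrable_spike_finite[of "{0}"])
  show "(\<lambda>u. g u * poly (shifted_legendre j) u) integrable_on {0..1}"
    by (intro integrable_continuous_real continuous_intros assms(1))
qed (use assms in auto)

lemma continuous_on_cell:
  assumes "T > 0" "N \<ge> 1" "n < N" "continuous_on {0..T} f"
  shows "continuous_on {0..1} (\<lambda>u. f (real n * stepsize T N + u * stepsize T N))"
  using cell_point[OF assms(1,2,3)]
  by (intro continuous_on_compose2[OF assms(4)] continuous_intros) auto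

lemma cell_integral:
  assumes "T > 0" "N \<ge> 1"
  shows "integral {mesh T N n..mesh T N (Suc n)} g =
    stepsize T N * integral {0..1} (\<lambda>u. g (real n * stepsize T N + u * stepsize T N))"
  using integral_affine[OF stepsize_pos[OF assms], of "real n * stepsize T N" 1 g]
  by (simp add: mesh_def algebra_simps)

text \<open>The equations are integrated over one cell at a time, so a single global polynomial can
  serve as test function; no extension by zero is necessary, and the condition at 0 holds
  automatically.\<close>

lemma dg_test_functions:
  assumes T: "T > 0" "N \<ge> 1" and i: "i \<le> q"
  obtains \<phi> where "\<phi> \<in> dg_space T N q"
    "\<And>g. integral {mesh T N n..mesh T N (Suc n)} (\<lambda>s. g s * \<phi> s) =
      stepsize T N * legendre_moment (\<lambda>u. g (real n * stepsize T N + u * stepsize T N)) i"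
proof -
  let ?h = "stepsize T N"
  have h: "?h > 0" using T stepsize_pos by blast
  define p where "p = pcompose (shifted_legendre i) [:- real n, 1 / ?h:]"
  have "degree p \<le> q" using i h by (simp add: p_def degree_pcompose)
  then have 1: "poly p \<in> dg_space T N q" by (rule dg_space_poly)
  have "poly p (real n * ?h + u * ?h) = poly (shifted_legendre i) u" for u
    using h by (simp add: p_def poly_pcompose field_simps)
  then have "integral {mesh T N n..mesh T N (Suc n)} (\<lambda>s. g s * poly p s) =
      ?h * legendre_moment (\<lambda>u. g (real n * ?h + u * ?h)) i" for g
    by (simp add: cell_integral[OF T] legendre_moment_def)
  with 1 show ?thesis by (rule that)
qed

text \<open>The converse direction: on a cell every test function is a combination of the first
  \<open>m\<close> Legendre polynomials. The coefficients do not depend on \<open>g\<close>, so the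
  same ones serve both sides of an equation.\<close>

lemma cell_integral_dg:
  assumes T: "T > 0" "N \<ge> 1" and \<phi>: "\<phi> \<in> dg_space T N (m - 1)" and m: "m \<ge> 1" and n: "n < N"
  obtains c where "\<And>g. (\<And>i. i < m \<Longrightarrow> (\<lambda>u. g (real n * stepsize T N + u * stepsize T N) * poly (shifted_legendre i) u) integrable_on {0..1}) \<Longrightarrow>
    integral {mesh T N n..mesh T N (Suc n)} (\<lambda>s. g s * \<phi> s) =
      (\<Sum>i<m. c i * legendre_moment (\<lambda>u. g (real n * stepsize T N + u * stepsize T N)) i)"
proof -
  let ?h = "stepsize T N"
  obtain p where p: "\<And>n. n < N \<Longrightarrow> degree (p n) \<le> m - 1"
    "\<And>n u. n < N \<Longrightarrow> u \<in> {0<..1} \<Longrightarrow> \<phi> (real n * ?h + u * ?h) = poly (p n) u"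
    using dg_space_cells[OF T \<phi>] by metis
  define d where "d i = legendre_moment (poly (p n)) i / legendre_norm2 i" for i
  have ms: "{..m - 1} = {..<m}" using m by auto
  have pd: "poly (p n) u = (\<Sum>i<m. d i * poly (shifted_legendre i) u)" for u
    using poly_legendre_expansion[OF p(1)[OF n]] ms by (simp add: d_def)
  show ?thesis
  proof (rule that[of "\<lambda>i. ?h * d i"])
    fix g assume g: "\<And>i. i < m \<Longrightarrow> (\<lambda>u. g (real n * ?h + u * ?h) * poly (shifted_legendre i) u) integrable_on {0..1}"
    have "integral {0..1} (\<lambda>u. g (real n * ?h + u * ?h) * \<phi> (real n * ?h + u * ?h))
      = integral {0..1} (\<lambda>u. \<Sum>i<m. d i * (g (real n * ?h + u * ?h) * poly (shifted_legendre i) u))"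
    proof (rule integral_spike[of "{0}"])
      fix u :: real assume "u \<in> {0..1} - {0}"
      then have "u \<in> {0<..1}" by auto
      then show "(\<Sum>i<m. d i * (g (real n * ?h + u * ?h) * poly (shifted_legendre i) u)) = g (real n * ?h + u * ?h) * \<phi> (real n * ?h + u * ?h)"
        unfolding p(2)[OF n \<open>u \<in> {0<..1}\<close>] pd by (simp add: sum_distrib_left sum_distrib_right mult_ac)
    qed simp
    also have "\<dots> = (\<Sum>i<m. integral {0..1} (\<lambda>u. d i * (g (real n * ?h + u * ?h) * poly (shifted_legendre i) u)))"
      by (rule integral_sum) (use g in \<open>auto intro: integrable_on_mult_right\<close>)
    also have "\<dots> = (\<Sum>i<m. d i * legendre_moment (\<lambda>u. g (real n * ?h + u * ?h)) i)"
      by (simp add: legendre_moment_def)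
    finally show "integral {mesh T N n..mesh T N (Suc n)} (\<lambda>s. g s * \<phi> s) =
      (\<Sum>i<m. ?h * d i * legendre_moment (\<lambda>u. g (real n * ?h + u * ?h)) i)"
      unfolding cell_integral[OF T] by (simp add: sum_distrib_left mult.assoc)
  qed
qed

lemma dg_solution_moments:
  assumes T: "T > 0" "N \<ge> 1" and m: "m \<ge> 1" and sol: "dg_solution T K11 K12 K21 f1 f2 m N y1 y2"
    and n: "n < N" and i: "i < m"
  defines "h \<equiv> stepsize T N"
  shows "legendre_moment (\<lambda>u. y1 (real n * h + u * h) + integral {0..real n * h + u * h}
      (\<lambda>\<tau>. K11 (real n * h + u * h) \<tau> * y1 \<tau> + K12 (real n * h + u * h) \<tau> * y2 \<tau>)) i
      = legendre_moment (\<lambda>u. f1 (real n * h + u * h)) i"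
    and "legendre_moment (\<lambda>u. integral {0..real n * h + u * h} (\<lambda>\<tau>. K21 (real n * h + u * h) \<tau> * y1 \<tau>)) i
      = legendre_moment (\<lambda>u. f2 (real n * h + u * h)) i"
proof -
  have h: "h > 0" using T stepsize_pos unfolding h_def by blast
  have "i \<le> m - 1" using i by simp
  then obtain \<phi> where \<phi>: "\<phi> \<in> dg_space T N (m - 1)"
    "\<And>g. integral {mesh T N n..mesh T N (Suc n)} (\<lambda>s. g s * \<phi> s) = h * legendre_moment (\<lambda>u. g (real n * h + u * h)) i"
    using dg_test_functions[OF T, of i "m - 1" n] unfolding h_def by metis
  from sol \<phi>(1) n have
    "integral {mesh T N n .. mesh T N (Suc n)} (\<lambda>s. (y1 s + integral {0..s} (\<lambda>\<tau>. K11 s \<tau> * y1 \<tau> + K12 s \<tau> * y2 \<tau>)) * \<phi> s) =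
        integral {mesh T N n .. mesh T N (Suc n)} (\<lambda>s. f1 s * \<phi> s)"
    "integral {mesh T N n .. mesh T N (Suc n)} (\<lambda>s. integral {0..s} (\<lambda>\<tau>. K21 s \<tau> * y1 \<tau>) * \<phi> s) =
        integral {mesh T N n .. mesh T N (Suc n)} (\<lambda>s. f2 s * \<phi> s)"
    unfolding dg_solution_def by blast+
  from this[unfolded \<phi>(2)[of "\<lambda>s. y1 s + integral {0..s} (\<lambda>\<tau>. K11 s \<tau> * y1 \<tau> + K12 s \<tau> * y2 \<tau>)"] \<phi>(2)[of f1]
      \<phi>(2)[of "\<lambda>s. integral {0..s} (\<lambda>\<tau>. K21 s \<tau> * y1 \<tau>)"] \<phi>(2)[of f2]]
  show "legendre_moment (\<lambda>u. y1 (real n * h + u * h) + integral {0..real n * h + u * h}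
      (\<lambda>\<tau>. K11 (real n * h + u * h) \<tau> * y1 \<tau> + K12 (real n * h + u * h) \<tau> * y2 \<tau>)) i
      = legendre_moment (\<lambda>u. f1 (real n * h + u * h)) i"
    "legendre_moment (\<lambda>u. integral {0..real n * h + u * h} (\<lambda>\<tau>. K21 (real n * h + u * h) \<tau> * y1 \<tau>)) i
      = legendre_moment (\<lambda>u. f2 (real n * h + u * h)) i"
    using h by auto
qed

lemma dg_cell_plus_continuous_integrable:
  assumes T: "T > 0" "N \<ge> 1" and y: "y \<in> dg_space T N q" and G: "continuous_on {0..T} G" and n: "n < N"
  shows "(\<lambda>u. (y (real n * stepsize T N + u * stepsize T N) + G (real n * stepsize T N + u * stepsize T N))
    * poly (shifted_legendre i) u) integrable_on {0..1}"
proof -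
  obtain p where "\<And>n u. n < N \<Longrightarrow> u \<in> {0<..1} \<Longrightarrow> y (real n * stepsize T N + u * stepsize T N) = poly (p n) u"
    using dg_space_cells[OF T y] by metis
  then show ?thesis
    using n by (intro moment_integrable_spike[where g = "\<lambda>u. poly (p n) u + G (real n * stepsize T N + u * stepsize T N)"]
        continuous_intros continuous_on_cell[OF T n G]) auto
qed

text \<open>Together with \<open>dg_solution_moments\<close> this replaces arbitrary test functions
  by \<open>m\<close> Legendre moments per cell.\<close>

lemma dg_solutionI:
  assumes T: "T > 0" "N \<ge> 1" and m: "m \<ge> 1"
    and y: "y1 \<in> dg_space T N (m - 1)" "y2 \<in> dg_space T N (m - 1)"
    and c: "continuous_on {0..T} (\<lambda>s. integral {0..s} (\<lambda>\<tau>. K11 s \<tau> * y1 \<tau> + K12 s \<tau> * y2 \<tau>))"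
    "continuous_on {0..T} (\<lambda>s. integral {0..s} (\<lambda>\<tau>. K21 s \<tau> * y1 \<tau>))"
    "continuous_on {0..T} f1" "continuous_on {0..T} f2"
    and mom: "\<And>n i. n < N \<Longrightarrow> i < m \<Longrightarrow>
      legendre_moment (\<lambda>u. y1 (real n * stepsize T N + u * stepsize T N) + integral {0..real n * stepsize T N + u * stepsize T N}
      (\<lambda>\<tau>. K11 (real n * stepsize T N + u * stepsize T N) \<tau> * y1 \<tau> + K12 (real n * stepsize T N + u * stepsize T N) \<tau> * y2 \<tau>)) i
      = legendre_moment (\<lambda>u. f1 (real n * stepsize T N + u * stepsize T N)) i"
    "\<And>n i. n < N \<Longrightarrow> i < m \<Longrightarrow>
      legendre_moment (\<lambda>u. integral {0..real n * stepsize T N + u * stepsize T N} (\<lambda>\<tau>. K21 (real n * stepsize T N + u * stepsize T N) \<tau> * y1 \<tau>)) i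
      = legendre_moment (\<lambda>u. f2 (real n * stepsize T N + u * stepsize T N)) i"
  shows "dg_solution T K11 K12 K21 f1 f2 m N y1 y2"
  unfolding dg_solution_def
proof (intro conjI ballI allI impI y)
  fix \<phi> n assume \<phi>: "\<phi> \<in> dg_space T N (m - 1)" and n: "n < N"
  let ?h = "stepsize T N"
  obtain d where d: "\<And>g. (\<And>i. i < m \<Longrightarrow> (\<lambda>u. g (real n * ?h + u * ?h) * poly (shifted_legendre i) u) integrable_on {0..1}) \<Longrightarrow>
    integral {mesh T N n..mesh T N (Suc n)} (\<lambda>s. g s * \<phi> s) = (\<Sum>i<m. d i * legendre_moment (\<lambda>u. g (real n * ?h + u * ?h)) i)"
    by (rule cell_integral_dg[OF T \<phi> m n]) blast
  have ci: "(\<lambda>u. g (real n * ?h + u * ?h) * poly (shifted_legendre i) u) integrable_on {0..1}" if "continuous_on {0..T} g" for g i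
    by (intro integrable_continuous_real continuous_intros continuous_on_cell[OF T n that])
  show "integral {mesh T N n .. mesh T N (Suc n)} (\<lambda>s. (y1 s + integral {0..s} (\<lambda>\<tau>. K11 s \<tau> * y1 \<tau> + K12 s \<tau> * y2 \<tau>)) * \<phi> s) =
        integral {mesh T N n .. mesh T N (Suc n)} (\<lambda>s. f1 s * \<phi> s)"
    using d[of "\<lambda>s. y1 s + integral {0..s} (\<lambda>\<tau>. K11 s \<tau> * y1 \<tau> + K12 s \<tau> * y2 \<tau>)"] d[of f1]
      dg_cell_plus_continuous_integrable[OF T y(1) c(1) n] ci[OF c(3)] mom(1)[OF n]
    by simp
  show "integral {mesh T N n .. mesh T N (Suc n)} (\<lambda>s. integral {0..s} (\<lambda>\<tau>. K21 s \<tau> * y1 \<tau>) * \<phi> s) =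
        integral {mesh T N n .. mesh T N (Suc n)} (\<lambda>s. f2 s * \<phi> s)"
    using d[of "\<lambda>s. integral {0..s} (\<lambda>\<tau>. K21 s \<tau> * y1 \<tau>)"] d[of f2] ci[OF c(2)] ci[OF c(4)] mom(2)[OF n]
    by simp
qed

definition volterra_moment :: "(real \<Rightarrow> real \<Rightarrow> real) \<Rightarrow> real \<Rightarrow> nat \<Rightarrow> (real \<Rightarrow> real) \<Rightarrow> nat \<Rightarrow> real" where
  "volterra_moment K h n y i =
    legendre_moment (\<lambda>u. integral {0..real n * h + u * h} (\<lambda>\<tau>. K (real n * h + u * h) \<tau> * y \<tau>)) i"

subsection \<open>Solvability and errors of the discontinuous Galerkin equations\<close>

text \<open>The stability estimate applies with zero remainder, zero data and \<open>b = 0\<close>.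
  Then the derivatives of the polynomial pieces of the primitive vanish, and these are
  \<open>h * y\<close>.\<close>

lemma dg_first_kind_unique:
  fixes K :: "real \<Rightarrow> real \<Rightarrow> real"
  assumes T: "T > 0" and m: "m \<ge> 1" and K: "Ck_on 3 (kernel_domain T) (\<lambda>(t, s). K t s)"
    and k0: "k0 > 0" "\<forall>t\<in>{0..T}. k0 \<le> \<bar>K t t\<bar>"
  obtains h0 where "h0 > 0" "\<And>N y. N \<ge> 1 \<Longrightarrow> stepsize T N < h0 \<Longrightarrow> y \<in> dg_space T N (m - 1) \<Longrightarrow>
    (\<And>n i. n < N \<Longrightarrow> i < m \<Longrightarrow> volterra_moment K (stepsize T N) n y i = 0) \<Longrightarrow> \<forall>t\<in>{0..T}. y t = 0"
proof -
  obtain C h0 where C: "C > 0" "h0 > 0" and stab: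
    "\<And>N h E e M D \<omega> F \<tau> w a b. \<lbrakk>N \<ge> 1; h = T / real N; h < h0;
      continuous_on {0..T} E; E 0 = 0; finite M;
      \<And>s. s \<in> {0<..<T} - M \<Longrightarrow> (E has_real_derivative e s) (at s);
      \<And>n. n < N \<Longrightarrow> degree (D n) \<le> m;
      \<And>n u. n < N \<Longrightarrow> u \<in> {0..1} \<Longrightarrow> E (real n * h + u * h) = poly (D n) u + \<omega> n u;
      \<And>n. n < N \<Longrightarrow> continuous_on {0..1} (\<omega> n);
      \<And>n j. n < N \<Longrightarrow> j \<le> m \<Longrightarrow> legendre_moment (\<omega> n) j = 0;
      \<And>n u. n < N \<Longrightarrow> u \<in> {0..1} \<Longrightarrow> \<bar>\<omega> n u\<bar> \<le> w;
      \<And>n j. n < N \<Longrightarrow> j < m \<Longrightarrow> legendre_moment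
        (\<lambda>u. integral {0..real n * h + u * h} (\<lambda>\<tau>. K (real n * h + u * h) \<tau> * e \<tau>)) j = F n j;
      \<And>n j. n < N \<Longrightarrow> j < m \<Longrightarrow> \<bar>F n j\<bar> \<le> a;
      \<And>n j. n < N \<Longrightarrow> j < m \<Longrightarrow> odd (j + m) \<Longrightarrow> \<bar>F n j\<bar> \<le> h * b;
      0 \<le> a; a \<le> b; h * w \<le> b;
      \<bar>\<omega> 0 0 + \<tau> 0\<bar> \<le> b;
      \<And>n. Suc n < N \<Longrightarrow> \<bar>\<omega> n 1 - \<omega> (Suc n) 0 - \<tau> (Suc n) + (-1) ^ m * \<tau> n\<bar> \<le> h * b;
      \<And>n. n < N \<Longrightarrow> \<bar>\<tau> n\<bar> \<le> b\<rbrakk> \<Longrightarrow>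
      \<forall>n<N. \<exists>\<beta>. \<bar>\<beta>\<bar> \<le> C * b \<and> (\<forall>u\<in>{0..1}. \<bar>poly (D n) u\<bar> \<le> C * b \<and>
        \<bar>poly (pderiv (D n)) u - \<beta> * poly (pderiv (shifted_legendre m)) u\<bar> \<le> C * (a + h * b))"
    by (fact first_kind_dg_stability[OF T m K k0])
  show ?thesis
  proof (rule that[OF C(2)])
    fix N y assume N: "N \<ge> 1" and hN: "stepsize T N < h0" and y: "y \<in> dg_space T N (m - 1)"
      and mom: "\<And>n i. n < N \<Longrightarrow> i < m \<Longrightarrow> volterra_moment K (stepsize T N) n y i = 0"
    let ?h = "stepsize T N"
    have h: "?h > 0" using T N stepsize_pos by blast
    have prim: "primitive_on T y (\<lambda>t. integral {0..t} y)" by (rule dg_space_primitive(1)[OF T N y])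
    obtain Q where Q: "\<And>n. n < N \<Longrightarrow> degree (Q n) \<le> m"
      "\<And>n u. n < N \<Longrightarrow> u \<in> {0..1} \<Longrightarrow> integral {0..real n * ?h + u * ?h} y = poly (Q n) u"
      "\<And>n u. n < N \<Longrightarrow> u \<in> {0<..1} \<Longrightarrow> ?h * y (real n * ?h + u * ?h) = poly (pderiv (Q n)) u"
      "?h * y 0 = poly (pderiv (Q 0)) 0"
    proof -
      have "Suc (m - 1) = m" using m by simp
      then show ?thesis using dg_space_primitive(2)[OF T N y] that by fastforce
    qed
    obtain M where M: "finite M" "\<forall>s\<in>{0<..<T} - M. ((\<lambda>t. integral {0..t} y) has_real_derivative y s) (at s)"
      using prim unfolding primitive_on_def by blast
    have "\<forall>n<N. \<exists>\<beta>. \<bar>\<beta>\<bar> \<le> C * 0 \<and> (\<forall>u\<in>{0..1}. \<bar>poly (Q n) u\<bar> \<le> C * 0 \<and>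
        \<bar>poly (pderiv (Q n)) u - \<beta> * poly (pderiv (shifted_legendre m)) u\<bar> \<le> C * (0 + ?h * 0))"
    proof (rule stab[of N ?h "\<lambda>t. integral {0..t} y" M y Q "\<lambda>n u. 0" 0 "\<lambda>n j. 0" 0 0 "\<lambda>n. 0"])
      show "legendre_moment (\<lambda>u. integral {0..real n * ?h + u * ?h} (\<lambda>\<tau>. K (real n * ?h + u * ?h) \<tau> * y \<tau>)) j = 0"
        if "n < N" "j < m" for n j using mom[OF that] by (simp add: volterra_moment_def)
      show "legendre_moment (\<lambda>u. 0) j = 0" for j by (simp add: moment_const)
    qed (use N hN M Q prim in \<open>auto simp: stepsize_def primitive_on_def\<close>)
    then have dQ: "poly (pderiv (Q n)) u = 0" if "n < N" "u \<in> {0..1}" for n u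
      using that by auto
    show "\<forall>t\<in>{0..T}. y t = 0"
    proof
      fix t assume t: "t \<in> {0..T}"
      show "y t = 0"
      proof (cases "t = 0")
        case True
        then show ?thesis using Q(4) dQ[of 0 0] N h by simp
      next
        case False
        then have "t \<in> {0<..T}" using t by auto
        then obtain n u where nu: "n < N" "u \<in> {0<..1}" "t = real n * ?h + u * ?h"
          by (rule cell_cover[OF T N]) blast
        then show ?thesis using Q(3)[OF nu(1,2)] dQ[of n u] h by simp
      qed
    qed
  qed
qed

text \<open>On each of the \<open>N\<close> cells there are \<open>m\<close> unknown coefficients
  and \<open>m\<close> moment conditions, so the linear system is square and injectivity implies
  solvability for every right-hand side.\<close>

lemma dg_first_kind_solvable:
  fixes K :: "real \<Rightarrow> real \<Rightarrow> real"
  assumes T: "T > 0" and N: "N \<ge> 1" and m: "m \<ge> 1" and K: "Ck_on 1 (kernel_domain T) (\<lambda>(t, s). K t s)"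
    and inj: "\<And>y. y \<in> dg_space T N (m - 1) \<Longrightarrow>
    (\<And>n i. n < N \<Longrightarrow> i < m \<Longrightarrow> volterra_moment K (stepsize T N) n y i = 0) \<Longrightarrow> \<forall>t\<in>{0..T}. y t = 0"
  obtains y where "y \<in> dg_space T N (m - 1)"
    "\<And>n i. n < N \<Longrightarrow> i < m \<Longrightarrow> volterra_moment K (stepsize T N) n y i = r n i"
proof -
  let ?h = "stepsize T N"
  have h: "?h > 0" using T N stepsize_pos by blast
  define I where "I = {..<N} \<times> {..<m}"
  have fI: "finite I" by (simp add: I_def)
  \<comment> \<open>Local monomials, zero outside their cell. For the first cell the point 0 is
    included, so that the value there is the limit from the right, as \<open>dg_space\<close>
    demands.\<close>
  define bs where "bs q t = (if (real (fst q) * ?h < t \<and> t \<le> real (Suc (fst q)) * ?h) \<or> (fst q = 0 \<and> t = 0)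
      then ((t - real (fst q) * ?h) / ?h) ^ snd q else 0)" for q :: "nat \<times> nat" and t
  have cells: "real n * ?h < t \<and> t \<le> real (Suc n) * ?h \<Longrightarrow> real n' * ?h < t \<and> t \<le> real (Suc n') * ?h \<Longrightarrow> n' = n" for n n' t
  proof -
    assume a: "real n * ?h < t \<and> t \<le> real (Suc n) * ?h" "real n' * ?h < t \<and> t \<le> real (Suc n') * ?h"
    then have "real n * ?h < real (Suc n') * ?h" "real n' * ?h < real (Suc n) * ?h" by linarith+
    then have "n < Suc n'" "n' < Suc n" using h by (simp_all only: mult_less_cancel_right_pos of_nat_less_iff)
    then show "n' = n" by simp
  qed
  have bs_space: "bs q \<in> dg_space T N (m - 1)" if q: "q \<in> I" for q
    unfolding dg_space_def
  proof (intro CollectI conjI allI impI)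
    obtain n j where nj: "q = (n, j)" "n < N" "j < m" using q by (auto simp: I_def)
    define p where "p = pcompose (monom 1 j) [:- real n, 1 / ?h:]"
    have pp: "poly p t = ((t - real n * ?h) / ?h) ^ j" for t
      using h by (simp add: p_def poly_pcompose poly_monom diff_divide_distrib)
    have dp: "degree p \<le> m - 1" using nj h by (simp add: p_def degree_pcompose degree_monom_eq)
    fix n' assume n': "n' < N"
    show "\<exists>p. degree p \<le> m - 1 \<and> (\<forall>t\<in>{mesh T N n'<..mesh T N (Suc n')}. bs q t = poly p t)"
    proof (cases "n' = n")
      case True
      then show ?thesis using dp nj
        by (intro exI[of _ p]) (auto simp: bs_def pp mesh_def)
    next
      case False
      have "bs q t = poly 0 t" if t: "t \<in> {mesh T N n'<..mesh T N (Suc n')}" for t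
      proof -
        have t': "real n' * ?h < t \<and> t \<le> real (Suc n') * ?h" using t by (simp add: mesh_def)
        have "t \<noteq> 0" using t' h by (metis not_less of_nat_0_le_iff zero_le_mult_iff less_imp_le)
        moreover have "\<not> (real n * ?h < t \<and> t \<le> real (Suc n) * ?h)" using cells[of n t n'] t' False by blast
        ultimately show ?thesis unfolding bs_def nj fst_conv snd_conv by auto
      qed
      then show ?thesis by (intro exI[of _ 0]) auto
    qed
  next
    obtain n j where nj: "q = (n, j)" "n < N" "j < m" using q by (auto simp: I_def)
    define p where "p = (if n = 0 then pcompose (monom 1 j) [:0, 1 / ?h:] else 0)"
    have "\<forall>\<^sub>F t in at_right 0. poly p t = bs q t"
      unfolding eventually_at_right_field
    proof (intro exI[of _ ?h] conjI allI impI h)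
      fix t assume t: "0 < t" "t < ?h"
      show "poly p t = bs q t"
      proof (cases "n = 0")
        case True
        then show ?thesis using t by (simp add: p_def bs_def nj poly_pcompose poly_monom)
      next
        case False
        then have "?h \<le> real n * ?h" using h by simp
        then have "\<not> real n * ?h < t" using t by linarith
        then show ?thesis using t False by (simp add: p_def bs_def nj)
      qed
    qed
    moreover have "((\<lambda>t. poly p t) \<longlongrightarrow> poly p 0) (at_right 0)" by (intro tendsto_intros)
    moreover have "poly p 0 = bs q 0"
      using h by (auto simp: p_def bs_def nj poly_pcompose poly_monom mult_less_0_iff)
    ultimately show "(bs q \<longlongrightarrow> bs q 0) (at_right 0)" using tendsto_cong by fastforce
  qed
  define yc where "yc c t = (\<Sum>q\<in>I. c q * bs q t)" for c t
  have yc_space: "yc c \<in> dg_space T N (m - 1)" for c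
    unfolding yc_def[abs_def] by (intro dg_space_sum fI dg_space_cmult bs_space)
  obtain C where vp:
    "\<And>e E t. primitive_on T e E \<Longrightarrow> t \<in> {0..T} \<Longrightarrow> (\<lambda>s. K t s * e s) integrable_on {0..t}"
    "\<And>e E. primitive_on T e E \<Longrightarrow> continuous_on {0..T} (\<lambda>t. integral {0..t} (\<lambda>s. K t s * e s))"
    by (rule volterra_primitive[OF K]) blast
  note prim = dg_space_primitive(1)[OF T N bs_space]
  have lin: "volterra_moment K ?h n (yc c) i = (\<Sum>q\<in>I. volterra_moment K ?h n (bs q) i * c q)" if n: "n < N" for n i c
  proof -
    let ?s = "\<lambda>u. real n * ?h + u * ?h"
    have "volterra_moment K ?h n (yc c) i = legendre_moment (\<lambda>u. \<Sum>q\<in>I. c q * integral {0..?s u} (\<lambda>\<tau>. K (?s u) \<tau> * bs q \<tau>)) i"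
      unfolding volterra_moment_def
    proof (rule moment_cong)
      fix u :: real assume u: "u \<in> {0..1}"
      have s: "?s u \<in> {0..T}" by (rule cell_point[OF T N n u])
      have "integral {0..?s u} (\<lambda>\<tau>. K (?s u) \<tau> * yc c \<tau>) = integral {0..?s u} (\<lambda>\<tau>. \<Sum>q\<in>I. c q * (K (?s u) \<tau> * bs q \<tau>))"
        by (simp add: yc_def sum_distrib_left sum_distrib_right mult_ac)
      also have "\<dots> = (\<Sum>q\<in>I. integral {0..?s u} (\<lambda>\<tau>. c q * (K (?s u) \<tau> * bs q \<tau>)))"
        by (rule integral_sum[OF fI]) (intro integrable_on_mult_right vp(1)[OF prim s])
      finally show "integral {0..?s u} (\<lambda>\<tau>. K (?s u) \<tau> * yc c \<tau>) = (\<Sum>q\<in>I. c q * integral {0..?s u} (\<lambda>\<tau>. K (?s u) \<tau> * bs q \<tau>))"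
        by simp
    qed
    also have "\<dots> = (\<Sum>q\<in>I. legendre_moment (\<lambda>u. c q * integral {0..?s u} (\<lambda>\<tau>. K (?s u) \<tau> * bs q \<tau>)) i)"
      by (rule moment_sum[OF _ fI]) (intro continuous_on_mult_left continuous_on_cell[OF T N n vp(2)[OF prim]])
    finally show ?thesis by (simp add: moment_cmult volterra_moment_def mult.commute)
  qed
  have yc_cell: "yc c (real n * ?h + u * ?h) = (\<Sum>j<m. c (n, j) * u ^ j)" if n: "n < N" and u: "u \<in> {0<..1}" for c n u
  proof -
    let ?t = "real n * ?h + u * ?h"
    have t: "real n * ?h < ?t \<and> ?t \<le> real (Suc n) * ?h" using u h by (auto simp: algebra_simps mult_le_cancel_right1)
    have t0: "?t \<noteq> 0" using u h n by (simp add: add_nonneg_eq_0_iff)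
    have b: "bs q ?t = (if fst q = n then u ^ snd q else 0)" for q
      using t t0 cells[OF t] h by (cases "fst q = n") (auto simp: bs_def)
    have "yc c ?t = (\<Sum>(n', j)\<in>I. if n' = n then c (n, j) * u ^ j else 0)"
      unfolding yc_def by (intro sum.cong) (auto simp: b)
    also have "\<dots> = (\<Sum>n'<N. \<Sum>j<m. if n' = n then c (n, j) * u ^ j else 0)"
      unfolding I_def by (rule sum.cartesian_product[symmetric])
    also have "\<dots> = (\<Sum>n'<N. if n' = n then (\<Sum>j<m. c (n, j) * u ^ j) else 0)"
      by (intro sum.cong) auto
    also have "\<dots> = (\<Sum>j<m. c (n, j) * u ^ j)" using n by simp
    finally show ?thesis .
  qed
  obtain c where c: "\<And>p. p \<in> I \<Longrightarrow> (\<Sum>q\<in>I. volterra_moment K ?h (fst p) (bs q) (snd p) * c q) = r (fst p) (snd p)"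
  proof (rule injective_square_system_solvable[OF fI, of "\<lambda>p q. volterra_moment K ?h (fst p) (bs q) (snd p)" "\<lambda>p. r (fst p) (snd p)"])
    fix c assume z: "\<And>p. p \<in> I \<Longrightarrow> (\<Sum>q\<in>I. volterra_moment K ?h (fst p) (bs q) (snd p) * c q) = 0"
    have "volterra_moment K ?h n (yc c) i = 0" if "n < N" "i < m" for n i
      using lin[OF that(1), of c i] z[of "(n, i)"] that by (simp add: I_def)
    then have y0: "\<forall>t\<in>{0..T}. yc c t = 0" using inj[OF yc_space[of c]] by blast
    show "\<forall>q\<in>I. c q = 0"
    proof
      fix q assume "q \<in> I"
      then obtain n j where q: "q = (n, j)" "n < N" "j < m" by (auto simp: I_def)
      \<comment> \<open>A polynomial that vanishes on (0,1] is zero, so its coefficients can be read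
        off from the function on one cell.\<close>
      define p where "p = (\<Sum>j<m. monom (c (n, j)) j)"
      have "poly p u = 0" if u: "u \<in> {0<..1}" for u
      proof -
        have "real n * ?h + u * ?h \<in> {0..T}" using u by (intro cell_point[OF T N q(2)]) auto
        then show ?thesis using y0 yc_cell[OF q(2) u, of c] by (simp add: p_def poly_sum poly_monom)
      qed
      then have "{0<..1} \<subseteq> {u. poly p u = 0}" by auto
      moreover have "infinite {0<..1::real}" by simp
      ultimately have "p = 0" using poly_roots_finite finite_subset by blast
      then have "coeff p j = 0" by simp
      then show "c q = 0" using q by (simp add: p_def coeff_sum)
    qed
  qed blast
  show ?thesis
  proof (rule that[OF yc_space[of c]])
    show "volterra_moment K ?h n (yc c) i = r n i" if "n < N" "i < m" for n i
      using lin[OF that(1), of c i] c[of "(n, i)"] that by (simp add: I_def)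
  qed
qed

lemma volterra_diff:
  assumes "(\<lambda>s. K t s * e s) integrable_on {0..t}" "(\<lambda>s. K t s * f s) integrable_on {0..t}"
  shows "integral {0..t} (\<lambda>s. K t s * (e s - f s)) = integral {0..t} (\<lambda>s. K t s * e s) - integral {0..t} (\<lambda>s. K t s * (f s :: real))"
  unfolding right_diff_distrib by (rule integral_diff[OF assms])

text \<open>The error analysis of a single equation, used for both unknowns; \<open>F\<close>
  contains the moments that the error leaves. The last hypothesis states how the jumps of the
  remainder are mastered: by their size if \<open>h^m \<le> b\<close>, or by telescoping if
  \<open>m\<close> is odd and the m-th derivative vanishes at 0. The function \<open>g n\<close>
  extends \<open>h\<close> times the error continuously to the closed cell. The bound on the
  integrals keeps the order of the primitive, without a division by \<open>h\<close>.\<close>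

lemma dg_volterra_error:
  fixes K :: "real \<Rightarrow> real \<Rightarrow> real" and x :: "real \<Rightarrow> real" and D :: "nat \<Rightarrow> real \<Rightarrow> real"
  assumes T: "T > 0" and m: "m \<ge> 1" and K: "Ck_on 3 (kernel_domain T) (\<lambda>(t, s). K t s)"
    and k0: "k0 > 0" "\<forall>t\<in>{0..T}. k0 \<le> \<bar>K t t\<bar>"
    and D0: "D 0 = x"
    and D: "\<And>j t. j < m + 2 \<Longrightarrow> t \<in> {0..T} \<Longrightarrow> (D j has_real_derivative D (Suc j) t) (at t within {0..T})"
    and Dc: "\<And>j. j \<le> m + 2 \<Longrightarrow> continuous_on {0..T} (D j)"
  obtains C h0 where "C > 0" "h0 > 0" "h0 \<le> 1"
    "\<And>N h y F a b. \<lbrakk>N \<ge> 1; h = stepsize T N; h < h0; y \<in> dg_space T N (m - 1);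
      \<And>n j. n < N \<Longrightarrow> j < m \<Longrightarrow> volterra_moment K h n (\<lambda>t. x t - y t) j = F n j;
      \<And>n j. n < N \<Longrightarrow> j < m \<Longrightarrow> \<bar>F n j\<bar> \<le> a;
      \<And>n j. n < N \<Longrightarrow> j < m \<Longrightarrow> odd (j + m) \<Longrightarrow> \<bar>F n j\<bar> \<le> h * b;
      0 \<le> a; a \<le> b; h ^ m \<le> b \<or> odd m \<and> D m 0 = 0 \<and> h ^ (m + 2) \<le> b\<rbrakk> \<Longrightarrow>
      \<exists>g \<alpha> \<beta>. (\<forall>n<N. continuous_on {0..1} (g n) \<and>
          (\<forall>u\<in>{0<..1}. h * (x (real n * h + u * h) - y (real n * h + u * h)) = g n u) \<and>
          \<bar>\<alpha> n\<bar> \<le> C * h ^ (m + 1) \<and> \<bar>\<beta> n\<bar> \<le> C * b \<and>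
          (\<forall>u\<in>{0..1}. \<bar>g n u - \<beta> n * poly (pderiv (shifted_legendre m)) u
             - \<alpha> n * poly (pderiv (shifted_legendre (m + 1))) u\<bar> \<le> C * (a + h * b + h ^ (m + 2)))) \<and>
        h * (x 0 - y 0) = g 0 0 \<and>
        (\<forall>t\<in>{0..T}. \<bar>integral {0..t} x - integral {0..t} y\<bar> \<le> C * (b + h ^ (m + 1)))"
proof -
  obtain Cs h0 where Cs: "Cs > 0" and h0: "h0 > 0" and stab:
    "\<And>N h E e M D \<omega> F \<tau> w a b. \<lbrakk>N \<ge> 1; h = T / real N; h < h0;
      continuous_on {0..T} E; E 0 = 0; finite M;
      \<And>s. s \<in> {0<..<T} - M \<Longrightarrow> (E has_real_derivative e s) (at s);
      \<And>n. n < N \<Longrightarrow> degree (D n) \<le> m;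
      \<And>n u. n < N \<Longrightarrow> u \<in> {0..1} \<Longrightarrow> E (real n * h + u * h) = poly (D n) u + \<omega> n u;
      \<And>n. n < N \<Longrightarrow> continuous_on {0..1} (\<omega> n);
      \<And>n j. n < N \<Longrightarrow> j \<le> m \<Longrightarrow> legendre_moment (\<omega> n) j = 0;
      \<And>n u. n < N \<Longrightarrow> u \<in> {0..1} \<Longrightarrow> \<bar>\<omega> n u\<bar> \<le> w;
      \<And>n j. n < N \<Longrightarrow> j < m \<Longrightarrow> legendre_moment
        (\<lambda>u. integral {0..real n * h + u * h} (\<lambda>\<tau>. K (real n * h + u * h) \<tau> * e \<tau>)) j = F n j;
      \<And>n j. n < N \<Longrightarrow> j < m \<Longrightarrow> \<bar>F n j\<bar> \<le> a;
      \<And>n j. n < N \<Longrightarrow> j < m \<Longrightarrow> odd (j + m) \<Longrightarrow> \<bar>F n j\<bar> \<le> h * b;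
      0 \<le> a; a \<le> b; h * w \<le> b;
      \<bar>\<omega> 0 0 + \<tau> 0\<bar> \<le> b;
      \<And>n. Suc n < N \<Longrightarrow> \<bar>\<omega> n 1 - \<omega> (Suc n) 0 - \<tau> (Suc n) + (-1) ^ m * \<tau> n\<bar> \<le> h * b;
      \<And>n. n < N \<Longrightarrow> \<bar>\<tau> n\<bar> \<le> b\<rbrakk> \<Longrightarrow>
      \<forall>n<N. \<exists>\<beta>. \<bar>\<beta>\<bar> \<le> Cs * b \<and> (\<forall>u\<in>{0..1}. \<bar>poly (D n) u\<bar> \<le> Cs * b \<and>
        \<bar>poly (pderiv (D n)) u - \<beta> * poly (pderiv (shifted_legendre m)) u\<bar> \<le> Cs * (a + h * b))"
    by (fact first_kind_dg_stability[OF T m K k0])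
  obtain Ce c where Ce: "Ce > 0" and expansion:
    "\<And>N h. N \<ge> 1 \<Longrightarrow> h = T / real N \<Longrightarrow> \<exists>P \<omega> \<omega>'. \<forall>n<N. degree (P n) \<le> m \<and> continuous_on {0..1} (\<omega> n) \<and>
      (\<forall>u\<in>{0..1}. integral {0..real n * h + u * h} x = poly (P n) u + \<omega> n u \<and>
        h * x (real n * h + u * h) = poly (pderiv (P n)) u + \<omega>' n u \<and> \<bar>\<omega> n u\<bar> \<le> Ce * h ^ (m + 1) \<and> \<bar>\<omega>' n u\<bar> \<le> Ce * h ^ (m + 1)) \<and>
      (\<forall>j\<le>m. legendre_moment (\<omega> n) j = 0) \<and>
      (\<exists>\<alpha>. \<bar>\<alpha>\<bar> \<le> Ce * h ^ (m + 1) \<and> (\<forall>u\<in>{0..1}. \<bar>\<omega>' n u - \<alpha> * poly (pderiv (shifted_legendre (m + 1))) u\<bar> \<le> Ce * h ^ (m + 2))) \<and>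
      (odd m \<longrightarrow> \<bar>\<omega> n 1 + \<omega> n 0 - c * h ^ (m + 1) * (D m (real n * h) + D m (real (Suc n) * h))\<bar> \<le> Ce * h ^ (m + 3) \<and>
        \<bar>c * h ^ (m + 1) * D m (real n * h) - \<omega> n 0\<bar> \<le> Ce * h ^ (m + 2))"
    by (rule primitive_cell_expansion[where m = m and D = D, OF T D0], erule (1) D, erule Dc, blast)
  \<comment> \<open>Enlarging \<open>b\<close> by the factor \<open>G\<close> makes room for the
    jumps of the remainder, which are at most \<open>2 * Ce * h^(m + 1)\<close>, and for the defects
    \<open>\<tau>\<close>.\<close>
  define G where "G = 1 + 2 * Ce"
  define C where "C = Cs * G + Ce"
  have G: "G \<ge> 1" "Ce \<le> G" "2 * Ce \<le> G" using Ce by (auto simp: G_def)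
  have C: "C > 0" "Ce \<le> C" "Cs * G \<le> C" "Cs \<le> C" proof -
    have "Cs * 1 \<le> Cs * G" using G(1) Cs by (intro mult_left_mono) auto
    then show "C > 0" "Ce \<le> C" "Cs * G \<le> C" "Cs \<le> C" using Cs Ce unfolding C_def by linarith+
  qed
  show ?thesis
  proof (rule that[OF C(1), of "min h0 1"])
    fix N h y F a b
    assume N: "N \<ge> 1" and hdef: "h = stepsize T N" and hh0: "h < min h0 1" and y: "y \<in> dg_space T N (m - 1)"
      and F: "\<And>n j. n < N \<Longrightarrow> j < m \<Longrightarrow> volterra_moment K h n (\<lambda>t. x t - y t) j = F n j"
      "\<And>n j. n < N \<Longrightarrow> j < m \<Longrightarrow> \<bar>F n j\<bar> \<le> a"
      "\<And>n j. n < N \<Longrightarrow> j < m \<Longrightarrow> odd (j + m) \<Longrightarrow> \<bar>F n j\<bar> \<le> h * b"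
      and ab: "0 \<le> a" "a \<le> b" and alt: "h ^ m \<le> b \<or> odd m \<and> D m 0 = 0 \<and> h ^ (m + 2) \<le> b"
    have h: "h > 0" "h < h0" "h \<le> 1" and hT: "h = T / real N" using stepsize_pos[OF T N] hh0 hdef by (auto simp: stepsize_def)
    have b0: "b \<ge> 0" using ab by simp
    have CeC: "Ce * h ^ k \<le> C * h ^ k" for k using C(2) h by (intro mult_right_mono) auto
    obtain P \<omega> \<omega>' where ex: "\<forall>n<N. degree (P n) \<le> m \<and> continuous_on {0..1} (\<omega> n) \<and>
      (\<forall>u\<in>{0..1}. integral {0..real n * h + u * h} x = poly (P n) u + \<omega> n u \<and>
        h * x (real n * h + u * h) = poly (pderiv (P n)) u + \<omega>' n u \<and> \<bar>\<omega> n u\<bar> \<le> Ce * h ^ (m + 1) \<and> \<bar>\<omega>' n u\<bar> \<le> Ce * h ^ (m + 1)) \<and>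
      (\<forall>j\<le>m. legendre_moment (\<omega> n) j = 0) \<and>
      (\<exists>\<alpha>. \<bar>\<alpha>\<bar> \<le> Ce * h ^ (m + 1) \<and> (\<forall>u\<in>{0..1}. \<bar>\<omega>' n u - \<alpha> * poly (pderiv (shifted_legendre (m + 1))) u\<bar> \<le> Ce * h ^ (m + 2))) \<and>
      (odd m \<longrightarrow> \<bar>\<omega> n 1 + \<omega> n 0 - c * h ^ (m + 1) * (D m (real n * h) + D m (real (Suc n) * h))\<bar> \<le> Ce * h ^ (m + 3) \<and>
        \<bar>c * h ^ (m + 1) * D m (real n * h) - \<omega> n 0\<bar> \<le> Ce * h ^ (m + 2))"
      using expansion[OF N hT] by blast
    have P: "degree (P n) \<le> m" "continuous_on {0..1} (\<omega> n)" if "n < N" for n using ex that by blast+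
    have Pu: "integral {0..real n * h + u * h} x = poly (P n) u + \<omega> n u" "h * x (real n * h + u * h) = poly (pderiv (P n)) u + \<omega>' n u"
      "\<bar>\<omega> n u\<bar> \<le> Ce * h ^ (m + 1)" if "n < N" "u \<in> {0..1}" for n u using ex that by blast+
    have \<omega>0: "legendre_moment (\<omega> n) j = 0" if "n < N" "j \<le> m" for n j using ex that by blast
    have "\<forall>n. \<exists>\<alpha>. n < N \<longrightarrow> \<bar>\<alpha>\<bar> \<le> Ce * h ^ (m + 1) \<and> (\<forall>u\<in>{0..1}. \<bar>\<omega>' n u - \<alpha> * poly (pderiv (shifted_legendre (m + 1))) u\<bar> \<le> Ce * h ^ (m + 2))"
      using ex by blast
    then obtain \<alpha> where \<alpha>: "\<And>n. n < N \<Longrightarrow> \<bar>\<alpha> n\<bar> \<le> Ce * h ^ (m + 1)"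
      "\<And>n u. n < N \<Longrightarrow> u \<in> {0..1} \<Longrightarrow> \<bar>\<omega>' n u - \<alpha> n * poly (pderiv (shifted_legendre (m + 1))) u\<bar> \<le> Ce * h ^ (m + 2)" by metis
    have odd1: "\<bar>\<omega> n 1 + \<omega> n 0 - c * h ^ (m + 1) * (D m (real n * h) + D m (real (Suc n) * h))\<bar> \<le> Ce * h ^ (m + 3)"
      "\<bar>c * h ^ (m + 1) * D m (real n * h) - \<omega> n 0\<bar> \<le> Ce * h ^ (m + 2)" if "n < N" "odd m" for n
      using ex that by blast+
    have "Suc (m - 1) = m" using m by simp
    then obtain Q where Q: "\<And>n. n < N \<Longrightarrow> degree (Q n) \<le> m"
      "\<And>n u. n < N \<Longrightarrow> u \<in> {0..1} \<Longrightarrow> integral {0..real n * h + u * h} y = poly (Q n) u"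
      "\<And>n u. n < N \<Longrightarrow> u \<in> {0<..1} \<Longrightarrow> h * y (real n * h + u * h) = poly (pderiv (Q n)) u"
      "h * y 0 = poly (pderiv (Q 0)) 0"
      using dg_space_primitive(2)[OF T N y] unfolding hdef by fastforce
    define E where "E t = integral {0..t} x - integral {0..t} y" for t
    \<comment> \<open>\<open>R\<close> plays the role of the polynomials called \<open>D\<close> in
      the stability estimate; here \<open>D\<close> denotes the derivatives of
      \<open>x\<close>.\<close>
    define R where "R n = P n - Q n" for n
    have cx: "continuous_on {0..T} x" using Dc[of 0] D0 by simp
    have prim: "primitive_on T (\<lambda>t. x t - y t) E"
      unfolding E_def[abs_def] by (intro primitive_on_diff primitive_on_continuous cx dg_space_primitive(1)[OF T N y])
    obtain M where M: "finite M" "\<And>s. s \<in> {0<..<T} - M \<Longrightarrow> (E has_real_derivative x s - y s) (at s)"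
      using prim unfolding primitive_on_def by blast
    define w where "w = Ce * h ^ (m + 1)"
    have w0: "w \<ge> 0" using Ce h by (simp add: w_def)
    have ER: "E (real n * h + u * h) = poly (R n) u + \<omega> n u" if "n < N" "u \<in> {0..1}" for n u
      using Pu(1)[OF that] Q(2)[OF that] by (simp add: E_def R_def)
    have hw: "h ^ (m + 2) \<le> b"
    proof (cases "h ^ m \<le> b")
      case True
      have "h ^ (m + 2) \<le> h ^ m" using h by (intro power_decreasing) auto
      then show ?thesis using True by simp
    qed (use alt in auto)
    have bG: "b \<le> G * b" using G(1) b0 mult_right_mono[of 1 G b] by simp
    \<comment> \<open>If \<open>h^m \<le> b\<close>, the jumps are at most
      \<open>h * (G * b)\<close> and \<open>\<tau> = 0\<close> works. Otherwise \<open>m\<close> is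
      odd and \<open>\<tau> n\<close> is the difference of
      \<open>c * h^(m + 1) * D m (real n * h)\<close> and \<open>\<omega> n 0\<close>. Its
      alternating jump cancels that of \<open>\<omega>\<close> up to order \<open>h^(m + 3)\<close>,
      the subtraction of \<open>\<omega> n 0\<close> keeps \<open>\<tau>\<close> itself at order
      \<open>h^(m + 2)\<close>, and in the first cell only a multiple of \<open>D m 0\<close> is
      left.\<close>
    have "\<exists>\<tau>. \<bar>\<omega> 0 0 + \<tau> 0\<bar> \<le> G * b \<and> (\<forall>n. Suc n < N \<longrightarrow> \<bar>\<omega> n 1 - \<omega> (Suc n) 0 - \<tau> (Suc n) + (-1) ^ m * \<tau> n\<bar> \<le> h * (G * b)) \<and>
      (\<forall>n<N. \<bar>\<tau> n\<bar> \<le> G * b)"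
    proof (cases "h ^ m \<le> b")
      case True
      have wh: "w = h * (Ce * h ^ m)" by (simp add: w_def)
      have CG: "2 * (Ce * h ^ m) \<le> G * b"
        using mult_mono[OF G(3) True] G(1) h by (simp add: mult.assoc)
      have Cp: "0 \<le> Ce * h ^ m" using Ce h by simp
      have 2: "2 * w \<le> h * (G * b)" using mult_left_mono[OF CG, of h] h wh by simp
      have "h * (Ce * h ^ m) \<le> 1 * (Ce * h ^ m)" using h Cp by (intro mult_right_mono) auto
      then have 1: "w \<le> G * b" using wh CG Cp by linarith
      show ?thesis
      proof (intro exI[of _ "\<lambda>_. 0"] conjI allI impI)
        show "\<bar>\<omega> 0 0 + 0\<bar> \<le> G * b" using Pu(3)[of 0 0] N 1 by (simp add: w_def)
        show "\<bar>\<omega> n 1 - \<omega> (Suc n) 0 - 0 + (-1) ^ m * 0\<bar> \<le> h * (G * b)" if "Suc n < N" for n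
          using Pu(3)[of n 1] Pu(3)[OF that, of 0] that 2 by (simp add: w_def)
        show "\<bar>0\<bar> \<le> G * b" using b0 G by simp
      qed
    next
      case False
      then have o: "odd m" "D m 0 = 0" "h ^ (m + 2) \<le> b" using alt by auto
      have CG: "Ce * h ^ (m + 2) \<le> G * b" using mult_mono[OF G(2) o(3)] G(1) h by simp
      have hG: "Ce * h ^ (m + 3) \<le> h * (G * b)" using mult_left_mono[OF CG, of h] h by (simp add: eval_nat_numeral mult_ac)
      show ?thesis
      proof (intro exI[of _ "\<lambda>n. c * h ^ (m + 1) * D m (real n * h) - \<omega> n 0"] conjI allI impI)
        show "\<bar>\<omega> 0 0 + (c * h ^ (m + 1) * D m (real 0 * h) - \<omega> 0 0)\<bar> \<le> G * b" using o(2) b0 G by simp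
        show "\<bar>c * h ^ (m + 1) * D m (real n * h) - \<omega> n 0\<bar> \<le> G * b" if "n < N" for n
          using odd1(2)[OF that o(1)] CG by linarith
        fix n assume n: "Suc n < N"
        have "\<omega> n 1 - \<omega> (Suc n) 0 - (c * h ^ (m + 1) * D m (real (Suc n) * h) - \<omega> (Suc n) 0)
            + (-1) ^ m * (c * h ^ (m + 1) * D m (real n * h) - \<omega> n 0)
          = \<omega> n 1 + \<omega> n 0 - c * h ^ (m + 1) * (D m (real n * h) + D m (real (Suc n) * h))"
          using o(1) by (simp add: algebra_simps)
        then show "\<bar>\<omega> n 1 - \<omega> (Suc n) 0 - (c * h ^ (m + 1) * D m (real (Suc n) * h) - \<omega> (Suc n) 0)
            + (-1) ^ m * (c * h ^ (m + 1) * D m (real n * h) - \<omega> n 0)\<bar> \<le> h * (G * b)"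
          using odd1(1)[of n] n o(1) hG by (metis Suc_lessD order_trans)
      qed
    qed
    then obtain \<tau> where \<tau>: "\<bar>\<omega> 0 0 + \<tau> 0\<bar> \<le> G * b"
      "\<And>n. Suc n < N \<Longrightarrow> \<bar>\<omega> n 1 - \<omega> (Suc n) 0 - \<tau> (Suc n) + (-1) ^ m * \<tau> n\<bar> \<le> h * (G * b)"
      "\<And>n. n < N \<Longrightarrow> \<bar>\<tau> n\<bar> \<le> G * b" by blast
    have main: "\<forall>n<N. \<exists>\<beta>. \<bar>\<beta>\<bar> \<le> Cs * (G * b) \<and> (\<forall>u\<in>{0..1}. \<bar>poly (R n) u\<bar> \<le> Cs * (G * b) \<and>
        \<bar>poly (pderiv (R n)) u - \<beta> * poly (pderiv (shifted_legendre m)) u\<bar> \<le> Cs * (a + h * (G * b)))"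
    proof (rule stab[of N h E M "\<lambda>t. x t - y t" R \<omega> w F a "G * b" \<tau>])
      show "N \<ge> 1" "h = T / real N" "h < h0" "finite M" "0 \<le> a" using N hT h M ab by auto
      show "continuous_on {0..T} E" "E 0 = 0" using prim unfolding primitive_on_def by auto
      show "degree (R n) \<le> m" if "n < N" for n unfolding R_def by (intro degree_diff_le P(1) Q(1) that)
      show "legendre_moment (\<lambda>u. integral {0..real n * h + u * h} (\<lambda>\<tau>. K (real n * h + u * h) \<tau> * (x \<tau> - y \<tau>))) j = F n j"
        if "n < N" "j < m" for n j using F(1)[OF that] by (simp add: volterra_moment_def)
      show "\<bar>F n j\<bar> \<le> h * (G * b)" if "n < N" "j < m" "odd (j + m)" for n j
        using F(3)[OF that] mult_left_mono[OF bG, of h] h by linarith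
      show "a \<le> G * b" using ab bG by linarith
      have "h * w = Ce * h ^ (m + 2)" by (simp add: w_def)
      moreover have "Ce * h ^ (m + 2) \<le> G * b" using h G by (intro mult_mono hw) auto
      ultimately show "h * w \<le> G * b" by linarith
      show "\<bar>\<omega> n u\<bar> \<le> w" if "n < N" "u \<in> {0..1}" for n u using Pu(3)[OF that] by (simp add: w_def)
    qed (use M(2) ER P(2) \<omega>0 F(2) \<tau> in blast)+
    then have "\<forall>n. \<exists>\<beta>. n < N \<longrightarrow> \<bar>\<beta>\<bar> \<le> Cs * (G * b) \<and> (\<forall>u\<in>{0..1}. \<bar>poly (R n) u\<bar> \<le> Cs * (G * b) \<and>
        \<bar>poly (pderiv (R n)) u - \<beta> * poly (pderiv (shifted_legendre m)) u\<bar> \<le> Cs * (a + h * (G * b)))" by blast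
    then obtain \<beta> where \<beta>: "\<And>n. n < N \<Longrightarrow> \<bar>\<beta> n\<bar> \<le> Cs * (G * b)"
      "\<And>n u. n < N \<Longrightarrow> u \<in> {0..1} \<Longrightarrow> \<bar>poly (R n) u\<bar> \<le> Cs * (G * b)"
      "\<And>n u. n < N \<Longrightarrow> u \<in> {0..1} \<Longrightarrow> \<bar>poly (pderiv (R n)) u - \<beta> n * poly (pderiv (shifted_legendre m)) u\<bar> \<le> Cs * (a + h * (G * b))"
      by metis
    define g where "g n u = poly (pderiv (R n)) u + \<omega>' n u" for n u
    have CsG: "Cs * (G * z) \<le> C * z" if "z \<ge> 0" for z using mult_right_mono[OF C(3) that] by (simp add: mult.assoc)
    show "\<exists>g \<alpha> \<beta>. (\<forall>n<N. continuous_on {0..1} (g n) \<and>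
          (\<forall>u\<in>{0<..1}. h * (x (real n * h + u * h) - y (real n * h + u * h)) = g n u) \<and>
          \<bar>\<alpha> n\<bar> \<le> C * h ^ (m + 1) \<and> \<bar>\<beta> n\<bar> \<le> C * b \<and>
          (\<forall>u\<in>{0..1}. \<bar>g n u - \<beta> n * poly (pderiv (shifted_legendre m)) u
             - \<alpha> n * poly (pderiv (shifted_legendre (m + 1))) u\<bar> \<le> C * (a + h * b + h ^ (m + 2)))) \<and>
        h * (x 0 - y 0) = g 0 0 \<and>
        (\<forall>t\<in>{0..T}. \<bar>integral {0..t} x - integral {0..t} y\<bar> \<le> C * (b + h ^ (m + 1)))"
    proof (rule exI[of _ g], rule exI[of _ \<alpha>], rule exI[of _ \<beta>], intro conjI allI impI ballI)
      fix n assume n: "n < N"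
      have "continuous_on {0..1} (\<lambda>u. poly (pderiv (R n)) u + (h * x (real n * h + u * h) - poly (pderiv (P n)) u))"
        unfolding hdef by (intro continuous_intros continuous_on_cell[OF T N n cx])
      then show "continuous_on {0..1} (g n)"
        by (rule continuous_on_eq) (use Pu(2)[OF n] in \<open>auto simp: g_def\<close>)
      show "\<bar>\<alpha> n\<bar> \<le> C * h ^ (m + 1)" using \<alpha>(1)[OF n] CeC[of "m + 1"] by linarith
      show "\<bar>\<beta> n\<bar> \<le> C * b" using \<beta>(1)[OF n] CsG[OF b0] by linarith
    next
      fix n and u :: real assume n: "n < N" and u: "u \<in> {0<..1}"
      then show "h * (x (real n * h + u * h) - y (real n * h + u * h)) = g n u"
        using Pu(2)[OF n, of u] Q(3)[OF n u] by (simp add: g_def R_def right_diff_distrib pderiv_diff)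
    next
      fix n and u :: real assume n: "n < N" and u: "u \<in> {0..1}"
      have "\<bar>g n u - \<beta> n * poly (pderiv (shifted_legendre m)) u - \<alpha> n * poly (pderiv (shifted_legendre (m + 1))) u\<bar>
        \<le> Cs * (a + h * (G * b)) + Ce * h ^ (m + 2)"
        using \<beta>(3)[OF n u] \<alpha>(2)[OF n u] by (simp add: g_def)
      also have "\<dots> \<le> C * (a + h * b) + C * h ^ (m + 2)"
      proof (intro add_mono)
        have "Cs * a \<le> C * a" using C(4) ab(1) by (intro mult_right_mono) auto
        moreover have "Cs * (G * (h * b)) \<le> C * (h * b)" using h b0 by (intro CsG) auto
        ultimately show "Cs * (a + h * (G * b)) \<le> C * (a + h * b)" by (simp add: algebra_simps)
        show "Ce * h ^ (m + 2) \<le> C * h ^ (m + 2)" using C(2) h by (intro mult_right_mono) auto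
      qed
      finally show "\<bar>g n u - \<beta> n * poly (pderiv (shifted_legendre m)) u - \<alpha> n * poly (pderiv (shifted_legendre (m + 1))) u\<bar>
        \<le> C * (a + h * b + h ^ (m + 2))" by (simp add: distrib_left)
    next
      show "h * (x 0 - y 0) = g 0 0"
        using Pu(2)[of 0 0] Q(4) N by (simp add: g_def R_def right_diff_distrib pderiv_diff)
    next
      fix t assume t: "t \<in> {0..T}"
      show "\<bar>integral {0..t} x - integral {0..t} y\<bar> \<le> C * (b + h ^ (m + 1))"
      proof (cases "t = 0")
        case True
        then show ?thesis using C b0 h by simp
      next
        case False
        then have "t \<in> {0<..T}" using t by auto
        then obtain n u where nu: "n < N" "u \<in> {0<..1}" "t = real n * h + u * h"
          unfolding hdef by (rule cell_cover[OF T N]) blast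
        have u: "u \<in> {0..1}" using nu by auto
        have "\<bar>E t\<bar> \<le> Cs * (G * b) + Ce * h ^ (m + 1)"
          unfolding nu(3) ER[OF nu(1) u] using \<beta>(2)[OF nu(1) u] Pu(3)[OF nu(1) u] by linarith
        also have "\<dots> \<le> C * b + C * h ^ (m + 1)"
          using CsG[OF b0] CeC[of "m + 1"] by linarith
        finally show ?thesis by (simp add: E_def distrib_left)
      qed
    qed
  qed (use h0 in auto)
qed

text \<open>The discrete system is triangular: the second equation determines \<open>y1\<close>, and
  with \<open>y1\<close> known the first one is an equation of the first kind for \<open>y2\<close>.
  Existence and uniqueness follow one after the other from the scalar results.\<close>

lemma dg_uniquely_solvable_small:
  fixes K11 K12 K21 :: "real \<Rightarrow> real \<Rightarrow> real" and f1 f2 :: "real \<Rightarrow> real"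
  assumes T: "T > 0" and m: "m \<ge> 1" and K11: "Ck_on 1 (kernel_domain T) (\<lambda>(t, s). K11 t s)"
    and K12: "Ck_on 3 (kernel_domain T) (\<lambda>(t, s). K12 t s)"
    and K21: "Ck_on 3 (kernel_domain T) (\<lambda>(t, s). K21 t s)"
    and k0: "k0 > 0" "\<forall>t\<in>{0..T}. k0 \<le> \<bar>K12 t t\<bar>" "\<forall>t\<in>{0..T}. k0 \<le> \<bar>K21 t t\<bar>"
    and f: "continuous_on {0..T} f1" "continuous_on {0..T} f2"
  obtains hbar where "hbar > 0" "\<And>N. N \<ge> 1 \<Longrightarrow> stepsize T N < hbar \<Longrightarrow> dg_uniquely_solvable T K11 K12 K21 f1 f2 m N"
proof -
  obtain h1 where h1: "h1 > 0" "\<And>N y. N \<ge> 1 \<Longrightarrow> stepsize T N < h1 \<Longrightarrow> y \<in> dg_space T N (m - 1) \<Longrightarrow>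
    (\<And>n i. n < N \<Longrightarrow> i < m \<Longrightarrow> volterra_moment K21 (stepsize T N) n y i = 0) \<Longrightarrow> \<forall>t\<in>{0..T}. y t = 0"
    by (fact dg_first_kind_unique[OF T m K21 k0(1,3)])
  obtain h2 where h2: "h2 > 0" "\<And>N y. N \<ge> 1 \<Longrightarrow> stepsize T N < h2 \<Longrightarrow> y \<in> dg_space T N (m - 1) \<Longrightarrow>
    (\<And>n i. n < N \<Longrightarrow> i < m \<Longrightarrow> volterra_moment K12 (stepsize T N) n y i = 0) \<Longrightarrow> \<forall>t\<in>{0..T}. y t = 0"
    by (fact dg_first_kind_unique[OF T m K12 k0(1,2)])
  have K12': "Ck_on 1 (kernel_domain T) (\<lambda>(t, s). K12 t s)" and K21': "Ck_on 1 (kernel_domain T) (\<lambda>(t, s). K21 t s)"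
    using Ck_on_mono[OF K12, of 1] Ck_on_mono[OF K21, of 1] by auto
  obtain C11 where v11: "\<And>e E t. primitive_on T e E \<Longrightarrow> t \<in> {0..T} \<Longrightarrow> (\<lambda>s. K11 t s * e s) integrable_on {0..t}"
    "\<And>e E. primitive_on T e E \<Longrightarrow> continuous_on {0..T} (\<lambda>t. integral {0..t} (\<lambda>s. K11 t s * e s))"
    by (rule volterra_primitive[OF K11]) blast
  obtain C12 where v12: "\<And>e E t. primitive_on T e E \<Longrightarrow> t \<in> {0..T} \<Longrightarrow> (\<lambda>s. K12 t s * e s) integrable_on {0..t}"
    "\<And>e E. primitive_on T e E \<Longrightarrow> continuous_on {0..T} (\<lambda>t. integral {0..t} (\<lambda>s. K12 t s * e s))"
    by (rule volterra_primitive[OF K12']) blast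
  obtain C21 where v21: "\<And>e E t. primitive_on T e E \<Longrightarrow> t \<in> {0..T} \<Longrightarrow> (\<lambda>s. K21 t s * e s) integrable_on {0..t}"
    "\<And>e E. primitive_on T e E \<Longrightarrow> continuous_on {0..T} (\<lambda>t. integral {0..t} (\<lambda>s. K21 t s * e s))"
    by (rule volterra_primitive[OF K21']) blast
  show ?thesis
  proof (rule that[of "min h1 h2"])
    show "min h1 h2 > 0" using h1 h2 by simp
    fix N assume N: "N \<ge> 1" and "stepsize T N < min h1 h2"
    then have hN: "stepsize T N < h1" "stepsize T N < h2" by auto
    let ?h = "stepsize T N"
    let ?s = "\<lambda>n u. real n * ?h + u * ?h"
    let ?S = "dg_space T N (m - 1)"
    note prim = dg_space_primitive(1)[OF T N, of _ "m - 1"]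
    define I where "I y1 y2 s = integral {0..s} (\<lambda>\<tau>. K11 s \<tau> * y1 \<tau> + K12 s \<tau> * y2 \<tau>)" for y1 y2 s
    have I: "I y1 y2 s = integral {0..s} (\<lambda>\<tau>. K11 s \<tau> * y1 \<tau>) + integral {0..s} (\<lambda>\<tau>. K12 s \<tau> * y2 \<tau>)"
      if "y1 \<in> ?S" "y2 \<in> ?S" "s \<in> {0..T}" for y1 y2 s
      unfolding I_def by (rule integral_add[OF v11(1)[OF prim[OF that(1)] that(3)] v12(1)[OF prim[OF that(2)] that(3)]])
    have cI: "continuous_on {0..T} (I y1 y2)" if "y1 \<in> ?S" "y2 \<in> ?S" for y1 y2
      using continuous_on_add[OF v11(2)[OF prim[OF that(1)]] v12(2)[OF prim[OF that(2)]]]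
      by (rule continuous_on_eq) (simp add: I[OF that])
    show "dg_uniquely_solvable T K11 K12 K21 f1 f2 m N"
      unfolding dg_uniquely_solvable_def
    proof (intro conjI allI impI)
      obtain y1 where y1: "y1 \<in> ?S"
        "\<And>n i. n < N \<Longrightarrow> i < m \<Longrightarrow> volterra_moment K21 ?h n y1 i = legendre_moment (\<lambda>u. f2 (?s n u)) i"
        by (rule dg_first_kind_solvable[OF T N m K21', where r = "\<lambda>n i. legendre_moment (\<lambda>u. f2 (?s n u)) i"],
            erule h1(2)[OF N hN(1)], blast, blast)
      \<comment> \<open>The part of the first equation that is fixed by \<open>y1\<close>. It jumps
        with \<open>y1\<close>, so the moments are split by integrability instead of
        continuity.\<close>
      let ?r = "\<lambda>n. \<lambda>u. y1 (?s n u) + integral {0..?s n u} (\<lambda>\<tau>. K11 (?s n u) \<tau> * y1 \<tau>)"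
      obtain y2 where y2: "y2 \<in> ?S"
        "\<And>n i. n < N \<Longrightarrow> i < m \<Longrightarrow> volterra_moment K12 ?h n y2 i = legendre_moment (\<lambda>u. f1 (?s n u) - ?r n u) i"
        by (rule dg_first_kind_solvable[OF T N m K12', where r = "\<lambda>n i. legendre_moment (\<lambda>u. f1 (?s n u) - ?r n u) i"],
            erule h2(2)[OF N hN(2)], blast, blast)
      have "dg_solution T K11 K12 K21 f1 f2 m N y1 y2"
      proof (rule dg_solutionI[OF T N m y1(1) y2(1)])
        show "continuous_on {0..T} (\<lambda>s. integral {0..s} (\<lambda>\<tau>. K11 s \<tau> * y1 \<tau> + K12 s \<tau> * y2 \<tau>))"
          using cI[OF y1(1) y2(1)] by (simp add: I_def[abs_def])
        show "continuous_on {0..T} (\<lambda>s. integral {0..s} (\<lambda>\<tau>. K21 s \<tau> * y1 \<tau>))" by (rule v21(2)[OF prim[OF y1(1)]])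
        fix n i assume n: "n < N" and i: "i < m"
        show "legendre_moment (\<lambda>u. integral {0..?s n u} (\<lambda>\<tau>. K21 (?s n u) \<tau> * y1 \<tau>)) i = legendre_moment (\<lambda>u. f2 (?s n u)) i"
          using y1(2)[OF n i] by (simp add: volterra_moment_def)
        have "legendre_moment (\<lambda>u. integral {0..?s n u} (\<lambda>\<tau>. K12 (?s n u) \<tau> * y2 \<tau>)) i
          = legendre_moment (\<lambda>u. (y1 (?s n u) + I y1 y2 (?s n u)) - ?r n u) i"
        proof (rule moment_cong)
          fix u :: real assume u: "u \<in> {0..1}"
          show "integral {0..?s n u} (\<lambda>\<tau>. K12 (?s n u) \<tau> * y2 \<tau>) = (y1 (?s n u) + I y1 y2 (?s n u)) - ?r n u"
            using I[OF y1(1) y2(1) cell_point[OF T N n u]] by simp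
        qed
        also have "\<dots> = legendre_moment (\<lambda>u. y1 (?s n u) + I y1 y2 (?s n u)) i - legendre_moment (?r n) i"
          by (intro moment_diff_integrable dg_cell_plus_continuous_integrable[OF T N y1(1) cI[OF y1(1) y2(1)] n]
              dg_cell_plus_continuous_integrable[OF T N y1(1) v11(2)[OF prim[OF y1(1)]] n])
        finally have "legendre_moment (\<lambda>u. f1 (?s n u) - ?r n u) i = legendre_moment (\<lambda>u. y1 (?s n u) + I y1 y2 (?s n u)) i - legendre_moment (?r n) i"
          using y2(2)[OF n i] by (simp add: volterra_moment_def)
        moreover have "legendre_moment (\<lambda>u. f1 (?s n u) - ?r n u) i = legendre_moment (\<lambda>u. f1 (?s n u)) i - legendre_moment (?r n) i"
        proof (rule moment_diff_integrable)
          show "(\<lambda>u. f1 (?s n u) * poly (shifted_legendre i) u) integrable_on {0..1}"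
            by (intro integrable_continuous_real continuous_intros continuous_on_cell[OF T N n f(1)])
          show "(\<lambda>u. ?r n u * poly (shifted_legendre i) u) integrable_on {0..1}"
            by (rule dg_cell_plus_continuous_integrable[OF T N y1(1) v11(2)[OF prim[OF y1(1)]] n])
        qed
        ultimately show "legendre_moment (\<lambda>u. y1 (?s n u) + integral {0..?s n u} (\<lambda>\<tau>. K11 (?s n u) \<tau> * y1 \<tau> + K12 (?s n u) \<tau> * y2 \<tau>)) i
          = legendre_moment (\<lambda>u. f1 (?s n u)) i"
          by (simp add: I_def)
      qed (use f in auto)
      then show "\<exists>y1 y2. dg_solution T K11 K12 K21 f1 f2 m N y1 y2" by blast
    next
      fix y1 y2 z1 z2
      assume sy: "dg_solution T K11 K12 K21 f1 f2 m N y1 y2" and sz: "dg_solution T K11 K12 K21 f1 f2 m N z1 z2"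
      have S: "y1 \<in> ?S" "y2 \<in> ?S" "z1 \<in> ?S" "z2 \<in> ?S" using sy sz unfolding dg_solution_def by auto
      have d1: "\<forall>t\<in>{0..T}. y1 t - z1 t = 0"
      proof (rule h1(2)[OF N hN(1) dg_space_diff[OF S(1,3)]])
        fix n i assume n: "n < N" and i: "i < m"
        have "volterra_moment K21 ?h n (\<lambda>t. y1 t - z1 t) i = legendre_moment (\<lambda>u.
            integral {0..?s n u} (\<lambda>\<tau>. K21 (?s n u) \<tau> * y1 \<tau>) - integral {0..?s n u} (\<lambda>\<tau>. K21 (?s n u) \<tau> * z1 \<tau>)) i"
          unfolding volterra_moment_def
        proof (rule moment_cong)
          fix u :: real assume u: "u \<in> {0..1}"
          have s: "?s n u \<in> {0..T}" by (rule cell_point[OF T N n u])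
          show "integral {0..?s n u} (\<lambda>\<tau>. K21 (?s n u) \<tau> * (y1 \<tau> - z1 \<tau>)) =
              integral {0..?s n u} (\<lambda>\<tau>. K21 (?s n u) \<tau> * y1 \<tau>) - integral {0..?s n u} (\<lambda>\<tau>. K21 (?s n u) \<tau> * z1 \<tau>)"
            by (rule volterra_diff[where K = K21 and e = y1 and f = z1, OF v21(1)[OF prim[OF S(1)] s] v21(1)[OF prim[OF S(3)] s]])
        qed
        also have "\<dots> = 0"
          using dg_solution_moments(2)[OF T N m sy n i] dg_solution_moments(2)[OF T N m sz n i]
          by (subst moment_diff) (auto intro!: continuous_on_cell[OF T N n v21(2)[OF prim[OF S(1)]]] continuous_on_cell[OF T N n v21(2)[OF prim[OF S(3)]]])
        finally show "volterra_moment K21 ?h n (\<lambda>t. y1 t - z1 t) i = 0" .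
      qed
      have d2: "\<forall>t\<in>{0..T}. y2 t - z2 t = 0"
      proof (rule h2(2)[OF N hN(2) dg_space_diff[OF S(2,4)]])
        fix n i assume n: "n < N" and i: "i < m"
        have "volterra_moment K12 ?h n (\<lambda>t. y2 t - z2 t) i = legendre_moment (\<lambda>u.
            (y1 (?s n u) + I y1 y2 (?s n u)) - (z1 (?s n u) + I z1 z2 (?s n u))) i"
          unfolding volterra_moment_def
        proof (rule moment_cong)
          fix u :: real assume u: "u \<in> {0..1}"
          have s: "?s n u \<in> {0..T}" by (rule cell_point[OF T N n u])
          have "integral {0..?s n u} (\<lambda>\<tau>. K11 (?s n u) \<tau> * y1 \<tau>) = integral {0..?s n u} (\<lambda>\<tau>. K11 (?s n u) \<tau> * z1 \<tau>)"
            using d1 s by (intro integral_cong) auto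
          then show "integral {0..?s n u} (\<lambda>\<tau>. K12 (?s n u) \<tau> * (y2 \<tau> - z2 \<tau>)) =
              (y1 (?s n u) + I y1 y2 (?s n u)) - (z1 (?s n u) + I z1 z2 (?s n u))"
            using d1 s volterra_diff[where K = K12 and e = y2 and f = z2, OF v12(1)[OF prim[OF S(2)] s] v12(1)[OF prim[OF S(4)] s]]
            unfolding I[OF S(1,2) s] I[OF S(3,4) s] by simp
        qed
        also have "\<dots> = legendre_moment (\<lambda>u. y1 (?s n u) + I y1 y2 (?s n u)) i - legendre_moment (\<lambda>u. z1 (?s n u) + I z1 z2 (?s n u)) i"
          by (intro moment_diff_integrable dg_cell_plus_continuous_integrable[OF T N S(1) cI[OF S(1,2)] n]
              dg_cell_plus_continuous_integrable[OF T N S(3) cI[OF S(3,4)] n])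
        also have "\<dots> = 0"
          using dg_solution_moments(1)[OF T N m sy n i] dg_solution_moments(1)[OF T N m sz n i] by (simp add: I_def)
        finally show "volterra_moment K12 ?h n (\<lambda>t. y2 t - z2 t) i = 0" .
      qed
      show "\<forall>t\<in>{0..T}. y1 t = z1 t \<and> y2 t = z2 t" using d1 d2 by auto
    qed
  qed
qed

text \<open>Two runs of \<open>dg_volterra_error\<close>. For \<open>x1\<close> the moments of the
  defect vanish. For \<open>x2\<close> they are, up to sign, the moments of \<open>e1\<close> plus
  its Volterra integral, and \<open>e1\<close> is controlled only after a division by
  \<open>h\<close>. How much of \<open>e1\<close> the tests see depends on the parity of
  \<open>m\<close>.\<close>

lemma dg_error_estimates:
  fixes K11 K12 K21 :: "real \<Rightarrow> real \<Rightarrow> real" and f1 f2 x1 x2 :: "real \<Rightarrow> real"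
  assumes T: "T > 0" and m: "m \<ge> 1" and K11: "Ck_on 1 (kernel_domain T) (\<lambda>(t, s). K11 t s)"
    and K12: "Ck_on 3 (kernel_domain T) (\<lambda>(t, s). K12 t s)"
    and K21: "Ck_on 3 (kernel_domain T) (\<lambda>(t, s). K21 t s)"
    and k0: "k0 > 0" "\<forall>t\<in>{0..T}. k0 \<le> \<bar>K12 t t\<bar>" "\<forall>t\<in>{0..T}. k0 \<le> \<bar>K21 t t\<bar>"
    and f: "continuous_on {0..T} f1" "continuous_on {0..T} f2"
    and sol: "iae_solution T K11 K12 K21 f1 f2 x1 x2"
    and x: "Ck_on (m + 2) {0..T} x1" "Ck_on (m + 2) {0..T} x2"
    and z: "odd m \<Longrightarrow> deriv_within m {0..T} x1 0 = 0"
  obtains C h0 where "C > 0" "h0 > 0"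
    "\<And>N h y1 y2. N \<ge> 1 \<Longrightarrow> h = stepsize T N \<Longrightarrow> h < h0 \<Longrightarrow> dg_solution T K11 K12 K21 f1 f2 m N y1 y2 \<Longrightarrow>
      (odd m \<longrightarrow> (\<forall>n<N. \<forall>u\<in>{0<..<1}. poly (pderiv (shifted_legendre (m + 1))) u = 0 \<longrightarrow>
          \<bar>x1 (real n * h + u * h) - y1 (real n * h + u * h)\<bar> \<le> C * h ^ (m + 1)) \<and>
        (\<forall>t\<in>{0..T}. \<bar>x2 t - y2 t\<bar> \<le> C * h ^ (m - 1))) \<and>
      (even m \<longrightarrow> (\<forall>n<N. \<forall>u\<in>{0<..<1}. poly (pderiv (shifted_legendre m)) u = 0 \<longrightarrow>
          \<bar>x1 (real n * h + u * h) - y1 (real n * h + u * h)\<bar> \<le> C * h ^ m \<and>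
          \<bar>x2 (real n * h + u * h) - y2 (real n * h + u * h)\<bar> \<le> C * h ^ (m - 2)))"
proof -
  obtain D1 where D1: "D1 0 = x1" "\<And>j t. j < m + 2 \<Longrightarrow> t \<in> {0..T} \<Longrightarrow> (D1 j has_real_derivative D1 (Suc j) t) (at t within {0..T})"
    "\<And>j. j \<le> m + 2 \<Longrightarrow> continuous_on {0..T} (D1 j)"
    by (rule Ck_on_derivs[OF x(1)]) blast
  obtain D2 where D2: "D2 0 = x2" "\<And>j t. j < m + 2 \<Longrightarrow> t \<in> {0..T} \<Longrightarrow> (D2 j has_real_derivative D2 (Suc j) t) (at t within {0..T})"
    "\<And>j. j \<le> m + 2 \<Longrightarrow> continuous_on {0..T} (D2 j)"
    by (rule Ck_on_derivs[OF x(2)]) blast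
  have Dz: "D1 m 0 = 0" if "odd m"
  proof -
    have "deriv_within m {0..T} x1 0 = D1 m 0"
      by (rule deriv_within_eq[where k = m and D = D1, OF T D1(1)]) (use D1(2) T in auto)
    then show ?thesis using z[OF that] by simp
  qed
  obtain C1 h1 where C1: "C1 > 0" "h1 > 0" "h1 \<le> 1" and stage1:
    "\<And>N h y F a b. \<lbrakk>N \<ge> 1; h = stepsize T N; h < h1; y \<in> dg_space T N (m - 1);
      \<And>n j. n < N \<Longrightarrow> j < m \<Longrightarrow> volterra_moment K21 h n (\<lambda>t. x1 t - y t) j = F n j;
      \<And>n j. n < N \<Longrightarrow> j < m \<Longrightarrow> \<bar>F n j\<bar> \<le> a;
      \<And>n j. n < N \<Longrightarrow> j < m \<Longrightarrow> odd (j + m) \<Longrightarrow> \<bar>F n j\<bar> \<le> h * b;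
      0 \<le> a; a \<le> b; h ^ m \<le> b \<or> odd m \<and> D1 m 0 = 0 \<and> h ^ (m + 2) \<le> b\<rbrakk> \<Longrightarrow>
      \<exists>g \<alpha> \<beta>. (\<forall>n<N. continuous_on {0..1} (g n) \<and>
          (\<forall>u\<in>{0<..1}. h * (x1 (real n * h + u * h) - y (real n * h + u * h)) = g n u) \<and>
          \<bar>\<alpha> n\<bar> \<le> C1 * h ^ (m + 1) \<and> \<bar>\<beta> n\<bar> \<le> C1 * b \<and>
          (\<forall>u\<in>{0..1}. \<bar>g n u - \<beta> n * poly (pderiv (shifted_legendre m)) u
             - \<alpha> n * poly (pderiv (shifted_legendre (m + 1))) u\<bar> \<le> C1 * (a + h * b + h ^ (m + 2)))) \<and>
        h * (x1 0 - y 0) = g 0 0 \<and>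
        (\<forall>t\<in>{0..T}. \<bar>integral {0..t} x1 - integral {0..t} y\<bar> \<le> C1 * (b + h ^ (m + 1)))"
    by (rule dg_volterra_error[where D = D1 and m = m, OF T m K21 k0(1,3) D1(1)], erule (1) D1(2), erule D1(3), blast)
  obtain C2 h2 where C2: "C2 > 0" "h2 > 0" "h2 \<le> 1" and stage2:
    "\<And>N h y F a b. \<lbrakk>N \<ge> 1; h = stepsize T N; h < h2; y \<in> dg_space T N (m - 1);
      \<And>n j. n < N \<Longrightarrow> j < m \<Longrightarrow> volterra_moment K12 h n (\<lambda>t. x2 t - y t) j = F n j;
      \<And>n j. n < N \<Longrightarrow> j < m \<Longrightarrow> \<bar>F n j\<bar> \<le> a;
      \<And>n j. n < N \<Longrightarrow> j < m \<Longrightarrow> odd (j + m) \<Longrightarrow> \<bar>F n j\<bar> \<le> h * b;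
      0 \<le> a; a \<le> b; h ^ m \<le> b \<or> odd m \<and> D2 m 0 = 0 \<and> h ^ (m + 2) \<le> b\<rbrakk> \<Longrightarrow>
      \<exists>g \<alpha> \<beta>. (\<forall>n<N. continuous_on {0..1} (g n) \<and>
          (\<forall>u\<in>{0<..1}. h * (x2 (real n * h + u * h) - y (real n * h + u * h)) = g n u) \<and>
          \<bar>\<alpha> n\<bar> \<le> C2 * h ^ (m + 1) \<and> \<bar>\<beta> n\<bar> \<le> C2 * b \<and>
          (\<forall>u\<in>{0..1}. \<bar>g n u - \<beta> n * poly (pderiv (shifted_legendre m)) u
             - \<alpha> n * poly (pderiv (shifted_legendre (m + 1))) u\<bar> \<le> C2 * (a + h * b + h ^ (m + 2)))) \<and>
        h * (x2 0 - y 0) = g 0 0 \<and>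
        (\<forall>t\<in>{0..T}. \<bar>integral {0..t} x2 - integral {0..t} y\<bar> \<le> C2 * (b + h ^ (m + 1)))"
    by (rule dg_volterra_error[where D = D2 and m = m, OF T m K12 k0(1,2) D2(1)], erule (1) D2(2), erule D2(3), blast)
  have K12': "Ck_on 1 (kernel_domain T) (\<lambda>(t, s). K12 t s)" and K21': "Ck_on 1 (kernel_domain T) (\<lambda>(t, s). K21 t s)"
    using Ck_on_mono[OF K12, of 1] Ck_on_mono[OF K21, of 1] by auto
  obtain CV where CV: "CV > 0" and v11: "\<And>e E t. primitive_on T e E \<Longrightarrow> t \<in> {0..T} \<Longrightarrow> (\<lambda>s. K11 t s * e s) integrable_on {0..t}"
    "\<And>e E. primitive_on T e E \<Longrightarrow> continuous_on {0..T} (\<lambda>t. integral {0..t} (\<lambda>s. K11 t s * e s))"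
    "\<And>e E t b. primitive_on T e E \<Longrightarrow> t \<in> {0..T} \<Longrightarrow> (\<And>s. s \<in> {0..T} \<Longrightarrow> \<bar>E s\<bar> \<le> b) \<Longrightarrow>
       \<bar>integral {0..t} (\<lambda>s. K11 t s * e s)\<bar> \<le> CV * b"
    by (rule volterra_primitive[OF K11]) blast
  obtain C12 where v12: "\<And>e E t. primitive_on T e E \<Longrightarrow> t \<in> {0..T} \<Longrightarrow> (\<lambda>s. K12 t s * e s) integrable_on {0..t}"
    "\<And>e E. primitive_on T e E \<Longrightarrow> continuous_on {0..T} (\<lambda>t. integral {0..t} (\<lambda>s. K12 t s * e s))"
    by (rule volterra_primitive[OF K12']) blast
  obtain C21 where v21: "\<And>e E t. primitive_on T e E \<Longrightarrow> t \<in> {0..T} \<Longrightarrow> (\<lambda>s. K21 t s * e s) integrable_on {0..t}"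
    "\<And>e E. primitive_on T e E \<Longrightarrow> continuous_on {0..T} (\<lambda>t. integral {0..t} (\<lambda>s. K21 t s * e s))"
    by (rule volterra_primitive[OF K21']) blast
  obtain B where B: "B \<ge> 1"
    "\<And>j u. j \<le> m + 1 \<Longrightarrow> u \<in> {0..1} \<Longrightarrow> \<bar>poly (pderiv (shifted_legendre j)) u\<bar> \<le> B"
    and Bm: "\<And>j f w. j \<le> m + 1 \<Longrightarrow> continuous_on {0..1} f \<Longrightarrow> (\<And>u. u \<in> {0..1} \<Longrightarrow> \<bar>f u\<bar> \<le> w) \<Longrightarrow> \<bar>legendre_moment f j\<bar> \<le> B * w"
    by (rule legendre_bounds[of "m + 1"]) blast
  have cx: "continuous_on {0..T} x1" "continuous_on {0..T} x2"
    and eq: "\<And>t. t \<in> {0..T} \<Longrightarrow> x1 t + integral {0..t} (\<lambda>s. K11 t s * x1 s + K12 t s * x2 s) = f1 t"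
    "\<And>t. t \<in> {0..T} \<Longrightarrow> integral {0..t} (\<lambda>s. K21 t s * x1 s) = f2 t"
    using sol unfolding iae_solution_def by auto
  note px = primitive_on_continuous[OF cx(1)] primitive_on_continuous[OF cx(2)]
  let ?P = "\<lambda>j. pderiv (shifted_legendre j)"
  \<comment> \<open>\<open>A\<close> bounds the moments handed to the second run: the first summand
    comes from the error of \<open>x1\<close>, the second from the integral with \<open>K11\<close>.
    The summand 1 ensures \<open>A \<ge> 1\<close>, so that the \<open>b\<close> of the second run
    is at least \<open>h^m\<close>.\<close>
  define A where "A = B * (C1 * (2 * B + 2)) + 2 * B * CV * C1 + C1 * B^2 + 1"
  define C where "C = C1 * (B + 2) + C2 * (A * B + B + 2 * A + 1)"
  have A: "A \<ge> 1" using B(1) C1 CV by (simp add: A_def)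
  have Cpos: "C > 0" and Cge: "C1 * (B + 2) \<le> C" "C2 * (A * B + B + 2 * A + 1) \<le> C"
    using B(1) C1 C2 A by (auto simp: C_def intro!: add_pos_nonneg)
  show ?thesis
  proof (rule that[OF Cpos, of "min h1 h2"])
    show "min h1 h2 > 0" using C1 C2 by simp
    fix N h y1 y2
    assume N: "N \<ge> 1" and hdef: "h = stepsize T N" and hmin: "h < min h1 h2"
      and dg: "dg_solution T K11 K12 K21 f1 f2 m N y1 y2"
    have h: "h > 0" "h < h1" "h < h2" "h \<le> 1" using stepsize_pos[OF T N] hdef hmin C1 by auto
    have S: "y1 \<in> dg_space T N (m - 1)" "y2 \<in> dg_space T N (m - 1)" using dg unfolding dg_solution_def by auto
    note py = dg_space_primitive(1)[OF T N S(1)] dg_space_primitive(1)[OF T N S(2)]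
    let ?s = "\<lambda>n u. real n * h + u * h"
    have cp: "?s n u \<in> {0..T}" if "n < N" "u \<in> {0..1}" for n u unfolding hdef by (rule cell_point[OF T N that])
    note cc = continuous_on_cell[OF T N, folded hdef]
    define e1 where "e1 t = x1 t - y1 t" for t
    define e2 where "e2 t = x2 t - y2 t" for t
    define V where "V t = integral {0..t} (\<lambda>s. K11 t s * e1 s)" for t
    define W where "W t = integral {0..t} (\<lambda>s. K12 t s * e2 s)" for t
    define I where "I t = integral {0..t} (\<lambda>s. K11 t s * y1 s + K12 t s * y2 s)" for t
    have pe: "primitive_on T e1 (\<lambda>t. integral {0..t} x1 - integral {0..t} y1)"
      "primitive_on T e2 (\<lambda>t. integral {0..t} x2 - integral {0..t} y2)"
      unfolding e1_def[abs_def] e2_def[abs_def] by (intro primitive_on_diff px py)+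
    have cV: "continuous_on {0..T} V" unfolding V_def[abs_def] by (rule v11(2)[OF pe(1)])
    have cW: "continuous_on {0..T} W" unfolding W_def[abs_def] by (rule v12(2)[OF pe(2)])
    have I: "I t = integral {0..t} (\<lambda>s. K11 t s * y1 s) + integral {0..t} (\<lambda>s. K12 t s * y2 s)" if "t \<in> {0..T}" for t
      unfolding I_def by (rule integral_add[OF v11(1)[OF py(1) that] v12(1)[OF py(2) that]])
    have cI: "continuous_on {0..T} I"
      using continuous_on_add[OF v11(2)[OF py(1)] v12(2)[OF py(2)]]
      by (rule continuous_on_eq) (simp add: I)
    \<comment> \<open>The residual of the first equation. Its moments vanish on every cell, which
      expresses those of \<open>W\<close> by those of \<open>e1\<close> and
      \<open>V\<close>.\<close>
    have res: "f1 t - (y1 t + I t) = e1 t + V t + W t" if t: "t \<in> {0..T}" for t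
    proof -
      have "f1 t = x1 t + (integral {0..t} (\<lambda>s. K11 t s * x1 s) + integral {0..t} (\<lambda>s. K12 t s * x2 s))"
        using eq(1)[OF t] integral_add[OF v11(1)[OF px(1) t] v12(1)[OF px(2) t]] by simp
      moreover have "V t = integral {0..t} (\<lambda>s. K11 t s * x1 s) - integral {0..t} (\<lambda>s. K11 t s * y1 s)"
        unfolding V_def e1_def by (rule volterra_diff[where K = K11 and e = x1 and f = y1, OF v11(1)[OF px(1) t] v11(1)[OF py(1) t]])
      moreover have "W t = integral {0..t} (\<lambda>s. K12 t s * x2 s) - integral {0..t} (\<lambda>s. K12 t s * y2 s)"
        unfolding W_def e2_def by (rule volterra_diff[where K = K12 and e = x2 and f = y2, OF v12(1)[OF px(2) t] v12(1)[OF py(2) t]])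
      ultimately show ?thesis using I[OF t] by (simp add: e1_def)
    qed
    have orth1: "volterra_moment K21 h n (\<lambda>t. x1 t - y1 t) j = 0" if n: "n < N" and j: "j < m" for n j
    proof -
      have "volterra_moment K21 h n (\<lambda>t. x1 t - y1 t) j = legendre_moment (\<lambda>u. f2 (?s n u) -
          integral {0..?s n u} (\<lambda>\<tau>. K21 (?s n u) \<tau> * y1 \<tau>)) j"
        unfolding volterra_moment_def
      proof (rule moment_cong)
        fix u :: real assume u: "u \<in> {0..1}"
        show "integral {0..?s n u} (\<lambda>\<tau>. K21 (?s n u) \<tau> * (x1 \<tau> - y1 \<tau>)) =
            f2 (?s n u) - integral {0..?s n u} (\<lambda>\<tau>. K21 (?s n u) \<tau> * y1 \<tau>)"
          using volterra_diff[where K = K21 and e = x1 and f = y1, OF v21(1)[OF px(1) cp[OF n u]] v21(1)[OF py(1) cp[OF n u]]]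
            eq(2)[OF cp[OF n u]] by simp
      qed
      also have "\<dots> = 0"
        using dg_solution_moments(2)[OF T N m dg n j] cc[OF n f(2)] cc[OF n v21(2)[OF py(1)]]
        by (subst moment_diff) (auto simp: hdef)
      finally show ?thesis .
    qed
    \<comment> \<open>For even \<open>m\<close> the error lemma requires at least
      \<open>h^m\<close>; for odd \<open>m\<close> the condition on the derivative at 0 admits
      \<open>h^(m + 2)\<close>.\<close>
    define b1 where "b1 = (if even m then h ^ m else h ^ (m + 2))"
    have b1: "b1 \<ge> 0" "b1 \<le> h ^ m" "h * b1 \<le> h ^ (m + 1)"
    proof -
      have "h ^ (m + 2) \<le> h ^ m" by (rule power_decreasing) (use h in auto)
      then show 1: "b1 \<le> h ^ m" unfolding b1_def by (cases "even m") (simp_all only: if_True if_False order_refl)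
      show "b1 \<ge> 0" using h by (simp add: b1_def)
      show "h * b1 \<le> h ^ (m + 1)" using mult_left_mono[OF 1, of h] h by simp
    qed
    have b1alt: "h ^ m \<le> b1 \<or> odd m \<and> D1 m 0 = 0 \<and> h ^ (m + 2) \<le> b1"
      using Dz unfolding b1_def by (cases "even m") simp_all
    have hb1: "\<bar>0\<bar> \<le> h * b1" using h b1 by simp
    have "\<exists>g \<alpha> \<beta>. (\<forall>n<N. continuous_on {0..1} (g n) \<and>
          (\<forall>u\<in>{0<..1}. h * (x1 (?s n u) - y1 (?s n u)) = g n u) \<and>
          \<bar>\<alpha> n\<bar> \<le> C1 * h ^ (m + 1) \<and> \<bar>\<beta> n\<bar> \<le> C1 * b1 \<and>
          (\<forall>u\<in>{0..1}. \<bar>g n u - \<beta> n * poly (?P m) u - \<alpha> n * poly (?P (m + 1)) u\<bar> \<le> C1 * (0 + h * b1 + h ^ (m + 2)))) \<and>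
        h * (x1 0 - y1 0) = g 0 0 \<and>
        (\<forall>t\<in>{0..T}. \<bar>integral {0..t} x1 - integral {0..t} y1\<bar> \<le> C1 * (b1 + h ^ (m + 1)))"
      by (rule stage1[of N h y1 "\<lambda>n j. 0" 0 b1]; (fact | rule hb1 | simp))
    then obtain g1 \<alpha>1 \<beta>1 where st1: "\<forall>n<N. continuous_on {0..1} (g1 n) \<and>
          (\<forall>u\<in>{0<..1}. h * (x1 (?s n u) - y1 (?s n u)) = g1 n u) \<and>
          \<bar>\<alpha>1 n\<bar> \<le> C1 * h ^ (m + 1) \<and> \<bar>\<beta>1 n\<bar> \<le> C1 * b1 \<and>
          (\<forall>u\<in>{0..1}. \<bar>g1 n u - \<beta>1 n * poly (?P m) u - \<alpha>1 n * poly (?P (m + 1)) u\<bar> \<le> C1 * (0 + h * b1 + h ^ (m + 2)))"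
      and E1b: "\<forall>t\<in>{0..T}. \<bar>integral {0..t} x1 - integral {0..t} y1\<bar> \<le> C1 * (b1 + h ^ (m + 1))"
      by blast
    have g1: "continuous_on {0..1} (g1 n)" "\<bar>\<alpha>1 n\<bar> \<le> C1 * h ^ (m + 1)" "\<bar>\<beta>1 n\<bar> \<le> C1 * b1" if "n < N" for n using st1 that by blast+
    have g1u: "h * e1 (?s n u) = g1 n u" if "n < N" "u \<in> {0<..1}" for n u using st1 that unfolding e1_def by blast
    have g1b: "\<bar>g1 n u - \<beta>1 n * poly (?P m) u - \<alpha>1 n * poly (?P (m + 1)) u\<bar> \<le> C1 * (h * b1 + h ^ (m + 2))" if "n < N" "u \<in> {0..1}" for n u
      using st1 that by auto
    have \<beta>P: "\<bar>\<beta>1 n * poly (?P m) u\<bar> \<le> C1 * B * b1" and \<alpha>P: "\<bar>\<alpha>1 n * poly (?P (m + 1)) u\<bar> \<le> C1 * B * h ^ (m + 1)"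
      if "n < N" "u \<in> {0..1}" for n u
    proof -
      have "\<bar>\<beta>1 n * poly (?P m) u\<bar> \<le> (C1 * b1) * B"
        unfolding abs_mult using g1(3)[OF that(1)] B(2)[of m u] that C1 b1 by (intro mult_mono) auto
      then show "\<bar>\<beta>1 n * poly (?P m) u\<bar> \<le> C1 * B * b1" by (simp add: mult_ac)
      have "\<bar>\<alpha>1 n * poly (?P (m + 1)) u\<bar> \<le> (C1 * h ^ (m + 1)) * B"
        unfolding abs_mult using g1(2)[OF that(1)] B(2)[of "m + 1" u] that C1 h by (intro mult_mono) auto
      then show "\<bar>\<alpha>1 n * poly (?P (m + 1)) u\<bar> \<le> C1 * B * h ^ (m + 1)" by (simp add: mult_ac)
    qed
    \<comment> \<open>\<open>g1 n u / h\<close> is \<open>e1\<close> on the left-open cell and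
      continuous on the closed one, so \<open>G\<close> has the moments of the perturbation and can
      be treated as a continuous function.\<close>
    define G where "G n u = g1 n u / h + V (?s n u)" for n u
    have cG: "continuous_on {0..1} (G n)" if "n < N" for n
      unfolding G_def using h by (intro continuous_intros g1(1) cc cV that) auto
    have orth2: "volterra_moment K12 h n (\<lambda>t. x2 t - y2 t) j = - legendre_moment (G n) j" if n: "n < N" and j: "j < m" for n j
    proof -
      have "0 = legendre_moment (\<lambda>u. f1 (?s n u)) j - legendre_moment (\<lambda>u. y1 (?s n u) + I (?s n u)) j"
        using dg_solution_moments(1)[OF T N m dg n j] by (simp add: I_def hdef)
      also have "\<dots> = legendre_moment (\<lambda>u. f1 (?s n u) - (y1 (?s n u) + I (?s n u))) j"
      proof (rule moment_diff_integrable[symmetric])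
        show "(\<lambda>u. f1 (?s n u) * poly (shifted_legendre j) u) integrable_on {0..1}"
          by (intro integrable_continuous_real continuous_intros cc f n)
        show "(\<lambda>u. (y1 (?s n u) + I (?s n u)) * poly (shifted_legendre j) u) integrable_on {0..1}"
          unfolding hdef by (rule dg_cell_plus_continuous_integrable[OF T N S(1) cI n])
      qed
      also have "\<dots> = legendre_moment (\<lambda>u. G n u + W (?s n u)) j"
      proof (rule moment_spike)
        fix u :: real assume u: "u \<in> {0<..1}"
        then have "?s n u \<in> {0..T}" by (intro cp n) auto
        moreover have "e1 (?s n u) = g1 n u / h" using g1u[OF n u] h by (simp add: field_simps)
        ultimately show "f1 (?s n u) - (y1 (?s n u) + I (?s n u)) = G n u + W (?s n u)"
          using res by (simp add: G_def)
      qed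
      also have "\<dots> = legendre_moment (G n) j + legendre_moment (\<lambda>u. W (?s n u)) j"
        by (rule moment_add[OF cG[OF n] cc[OF n cW]])
      finally show ?thesis unfolding volterra_moment_def W_def e2_def by linarith
    qed
    have Vb: "\<bar>V t\<bar> \<le> CV * (C1 * (b1 + h ^ (m + 1)))" if "t \<in> {0..T}" for t
      unfolding V_def using E1b by (intro v11(3)[OF pe(1) that]) blast
    \<comment> \<open>Any \<open>r\<close> with the same moment may replace \<open>g1 n\<close>; for
      odd \<open>m\<close> this discards the leading part. The Volterra term is bounded through the
      primitive of \<open>e1\<close> and needs no division by \<open>h\<close>.\<close>
    have momG: "\<bar>legendre_moment (G n) j\<bar> \<le> B * w / h + B * (CV * (C1 * (b1 + h ^ (m + 1))))"
      if n: "n < N" and j: "j < m" and r: "continuous_on {0..1} r" "\<And>u. u \<in> {0..1} \<Longrightarrow> \<bar>r u\<bar> \<le> w"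
        "legendre_moment (g1 n) j = legendre_moment r j" for n j r w
    proof -
      have "legendre_moment (G n) j = legendre_moment (\<lambda>u. (1 / h) * g1 n u) j + legendre_moment (\<lambda>u. V (?s n u)) j"
        unfolding G_def using h by (subst moment_add[symmetric]) (auto intro!: continuous_intros g1(1) cc cV n)
      also have "legendre_moment (\<lambda>u. (1 / h) * g1 n u) j = legendre_moment r j / h"
        unfolding moment_cmult r(3) by simp
      finally have "\<bar>legendre_moment (G n) j\<bar> \<le> \<bar>legendre_moment r j\<bar> / h + \<bar>legendre_moment (\<lambda>u. V (?s n u)) j\<bar>"
        using h by (simp add: abs_divide order_trans[OF abs_triangle_ineq])
      also have "\<dots> \<le> B * w / h + B * (CV * (C1 * (b1 + h ^ (m + 1))))"
        using h j by (intro add_mono divide_right_mono Bm r cc cV n Vb cp) auto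
      finally show ?thesis .
    qed
    have hp: "h ^ (m + 1) \<le> h ^ m" "h ^ (m + 2) \<le> h ^ (m + 1)" "h ^ (m + 2) \<le> h ^ m"
      by (rule power_decreasing; use h in simp)+
    have div: "\<bar>z\<bar> \<le> C * h ^ k" if "h * z = y" "\<bar>y\<bar> \<le> c * h ^ Suc k" "c \<le> C" for z y c k
    proof -
      have "h * \<bar>z\<bar> \<le> h * (c * h ^ k)" using that(1,2) h by (auto simp: abs_mult mult_ac)
      then have "\<bar>z\<bar> \<le> c * h ^ k" using h by simp
      also have "\<dots> \<le> C * h ^ k" using that(3) h by (intro mult_right_mono) auto
      finally show ?thesis .
    qed
    show "(odd m \<longrightarrow> (\<forall>n<N. \<forall>u\<in>{0<..<1}. poly (?P (m + 1)) u = 0 \<longrightarrow>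
          \<bar>x1 (?s n u) - y1 (?s n u)\<bar> \<le> C * h ^ (m + 1)) \<and>
        (\<forall>t\<in>{0..T}. \<bar>x2 t - y2 t\<bar> \<le> C * h ^ (m - 1))) \<and>
      (even m \<longrightarrow> (\<forall>n<N. \<forall>u\<in>{0<..<1}. poly (?P m) u = 0 \<longrightarrow>
          \<bar>x1 (?s n u) - y1 (?s n u)\<bar> \<le> C * h ^ m \<and>
          \<bar>x2 (?s n u) - y2 (?s n u)\<bar> \<le> C * h ^ (m - 2)))"
    proof (cases "even m")
      case even: True
      then obtain k where mk: "m = Suc (Suc k)" using m by (metis One_nat_def Suc_le_D even_Suc not0_implies_Suc odd_one zero_neq_one)
      have b1e: "b1 = h ^ m" using even by (simp add: b1_def)
      have G1: "\<bar>g1 n u\<bar> \<le> C1 * (2 * B + 2) * h ^ m" if n: "n < N" and u: "u \<in> {0..1}" for n u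
      proof -
        have "\<bar>g1 n u\<bar> \<le> C1 * B * h ^ m + C1 * B * h ^ (m + 1) + C1 * (h ^ (m + 1) + h ^ (m + 2))"
          using g1b[OF n u] \<beta>P[OF n u] \<alpha>P[OF n u] by (simp add: b1e)
        also have "\<dots> \<le> C1 * B * h ^ m + C1 * B * h ^ m + C1 * (h ^ m + h ^ m)"
          using hp C1 B(1) by (intro add_mono mult_left_mono order_refl) auto
        finally show ?thesis by (simp add: algebra_simps)
      qed
      have F2: "\<bar>legendre_moment (G n) j\<bar> \<le> A * h ^ (m - 1)" if n: "n < N" and j: "j < m" for n j
      proof -
        have "\<bar>legendre_moment (G n) j\<bar> \<le> B * (C1 * (2 * B + 2) * h ^ m) / h + B * (CV * (C1 * (h ^ m + h ^ (m + 1))))"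
          using momG[OF n j g1(1)[OF n] G1[OF n]] by (simp add: b1e)
        also have "B * (C1 * (2 * B + 2) * h ^ m) / h = B * (C1 * (2 * B + 2)) * h ^ (m - 1)" using h by (simp add: mk)
        also have "B * (CV * (C1 * (h ^ m + h ^ (m + 1)))) \<le> B * (CV * (C1 * (h ^ (m - 1) + h ^ (m - 1))))"
          using h B(1) CV C1 by (intro mult_left_mono add_mono power_decreasing) auto
        finally have "\<bar>legendre_moment (G n) j\<bar> \<le> (B * (C1 * (2 * B + 2)) + 2 * B * CV * C1) * h ^ (m - 1)" by (simp add: algebra_simps)
        also have "\<dots> \<le> A * h ^ (m - 1)" using h C1 by (intro mult_right_mono) (auto simp: A_def)
        finally show ?thesis .
      qed
      \<comment> \<open>Without parity all moments are only bounded by order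
        \<open>h^(m - 1)\<close>. As those with odd \<open>j + m\<close> have to be at most
        \<open>h * b\<close>, \<open>b\<close> is taken as \<open>A * h^(m - 2)\<close>.\<close>
      have ab: "A * h ^ (m - 1) \<le> A * h ^ (m - 2)" "h ^ m \<le> A * h ^ (m - 2)" "h * (A * h ^ (m - 2)) = A * h ^ (m - 1)"
      proof -
        show "A * h ^ (m - 1) \<le> A * h ^ (m - 2)" using h A by (intro mult_left_mono power_decreasing) auto
        have "1 * h ^ m \<le> A * h ^ (m - 2)" using h A by (intro mult_mono power_decreasing) auto
        then show "h ^ m \<le> A * h ^ (m - 2)" by simp
        show "h * (A * h ^ (m - 2)) = A * h ^ (m - 1)" by (simp add: mk)
      qed
      have "\<exists>g \<alpha> \<beta>. (\<forall>n<N. continuous_on {0..1} (g n) \<and>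
          (\<forall>u\<in>{0<..1}. h * (x2 (?s n u) - y2 (?s n u)) = g n u) \<and>
          \<bar>\<alpha> n\<bar> \<le> C2 * h ^ (m + 1) \<and> \<bar>\<beta> n\<bar> \<le> C2 * (A * h ^ (m - 2)) \<and>
          (\<forall>u\<in>{0..1}. \<bar>g n u - \<beta> n * poly (?P m) u - \<alpha> n * poly (?P (m + 1)) u\<bar>
             \<le> C2 * (A * h ^ (m - 1) + h * (A * h ^ (m - 2)) + h ^ (m + 2)))) \<and>
        h * (x2 0 - y2 0) = g 0 0 \<and>
        (\<forall>t\<in>{0..T}. \<bar>integral {0..t} x2 - integral {0..t} y2\<bar> \<le> C2 * (A * h ^ (m - 2) + h ^ (m + 1)))"
      proof (rule stage2[of N h y2 "\<lambda>n j. - legendre_moment (G n) j" "A * h ^ (m - 1)" "A * h ^ (m - 2)"])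
        show "\<bar>- legendre_moment (G n) j\<bar> \<le> h * (A * h ^ (m - 2))" if "n < N" "j < m" "odd (j + m)" for n j
          using F2[OF that(1,2)] unfolding ab(3) by simp
        show "0 \<le> A * h ^ (m - 1)" using A h by simp
        show "\<bar>- legendre_moment (G n) j\<bar> \<le> A * h ^ (m - 1)" if "n < N" "j < m" for n j
          using F2[OF that] by simp
        show "N \<ge> 1" "h = stepsize T N" "h < h2" "y2 \<in> dg_space T N (m - 1)" by (fact N, fact hdef, fact h(3), fact S(2))
        show "volterra_moment K12 h n (\<lambda>t. x2 t - y2 t) j = - legendre_moment (G n) j" if "n < N" "j < m" for n j
          using orth2[OF that] .
        show "A * h ^ (m - 1) \<le> A * h ^ (m - 2)" by (fact ab(1))
        show "h ^ m \<le> A * h ^ (m - 2) \<or> odd m \<and> D2 m 0 = 0 \<and> h ^ (m + 2) \<le> A * h ^ (m - 2)" using ab(2) by blast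
      qed
      then obtain g2 \<alpha>2 \<beta>2 where st2: "\<forall>n<N. continuous_on {0..1} (g2 n) \<and>
          (\<forall>u\<in>{0<..1}. h * (x2 (?s n u) - y2 (?s n u)) = g2 n u) \<and>
          \<bar>\<alpha>2 n\<bar> \<le> C2 * h ^ (m + 1) \<and> \<bar>\<beta>2 n\<bar> \<le> C2 * (A * h ^ (m - 2)) \<and>
          (\<forall>u\<in>{0..1}. \<bar>g2 n u - \<beta>2 n * poly (?P m) u - \<alpha>2 n * poly (?P (m + 1)) u\<bar>
             \<le> C2 * (A * h ^ (m - 1) + h * (A * h ^ (m - 2)) + h ^ (m + 2)))" by blast
      \<comment> \<open>At a zero of P'_m the \<open>\<beta>\<close> terms drop out. Before the
        division by \<open>h\<close> this leaves order \<open>h^(m + 1)\<close> for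
        \<open>x1\<close> and \<open>h^(m - 1)\<close> for \<open>x2\<close>.\<close>
      have "\<bar>x1 (?s n u) - y1 (?s n u)\<bar> \<le> C * h ^ m \<and> \<bar>x2 (?s n u) - y2 (?s n u)\<bar> \<le> C * h ^ (m - 2)"
        if n: "n < N" and u: "u \<in> {0<..<1}" and root: "poly (?P m) u = 0" for n u
      proof
        have u': "u \<in> {0..1}" "u \<in> {0<..1}" using u by auto
        have "\<bar>g1 n u\<bar> \<le> C1 * B * h ^ (m + 1) + C1 * (h ^ (m + 1) + h ^ (m + 2))"
          using g1b[OF n u'(1)] \<alpha>P[OF n u'(1)] root by (simp add: b1e)
        also have "\<dots> \<le> C1 * B * h ^ (m + 1) + C1 * (h ^ (m + 1) + h ^ (m + 1))"
          using hp C1 by (intro add_mono mult_left_mono order_refl) auto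
        finally have "\<bar>g1 n u\<bar> \<le> C1 * (B + 2) * h ^ Suc m" by (simp add: algebra_simps)
        from div[OF g1u[OF n u'(2)] this Cge(1)] show "\<bar>x1 (?s n u) - y1 (?s n u)\<bar> \<le> C * h ^ m" by (simp add: e1_def)
        have a2: "\<bar>\<alpha>2 n * poly (?P (m + 1)) u\<bar> \<le> (C2 * h ^ (m + 1)) * B"
          unfolding abs_mult using st2 n B(2)[of "m + 1" u] u' C2 h by (intro mult_mono) auto
        have "\<bar>g2 n u - \<beta>2 n * poly (?P m) u - \<alpha>2 n * poly (?P (m + 1)) u\<bar>
            \<le> C2 * (A * h ^ (m - 1) + h * (A * h ^ (m - 2)) + h ^ (m + 2))"
          using st2 n u' by blast
        then have "\<bar>g2 n u - \<alpha>2 n * poly (?P (m + 1)) u\<bar> \<le> C2 * (A * h ^ (m - 1) + A * h ^ (m - 1) + h ^ (m + 2))"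
          unfolding root ab(3) by simp
        then have "\<bar>g2 n u\<bar> \<le> (C2 * h ^ (m + 1)) * B + C2 * (A * h ^ (m - 1) + A * h ^ (m - 1) + h ^ (m + 2))"
          using a2 by linarith
        also have "\<dots> \<le> (C2 * h ^ (m - 1)) * B + C2 * (A * h ^ (m - 1) + A * h ^ (m - 1) + h ^ (m - 1))"
          using h C2 B(1) by (intro add_mono mult_left_mono mult_right_mono power_decreasing order_refl) auto
        also have "\<dots> = C2 * (B + 2 * A + 1) * h ^ Suc (m - 2)" by (simp add: mk algebra_simps)
        finally have g2: "\<bar>g2 n u\<bar> \<le> C2 * (B + 2 * A + 1) * h ^ Suc (m - 2)" .
        have "C2 * (B + 2 * A + 1) \<le> C2 * (A * B + B + 2 * A + 1)" using C2 A B(1) by (intro mult_left_mono) auto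
        then have "C2 * (B + 2 * A + 1) \<le> C" using Cge(2) by linarith
        moreover have "h * (x2 (?s n u) - y2 (?s n u)) = g2 n u" using st2 n u' by blast
        ultimately show "\<bar>x2 (?s n u) - y2 (?s n u)\<bar> \<le> C * h ^ (m - 2)" using div g2 by blast
      qed
      then show ?thesis using even by blast
    next
      case odd: False
      have b1o: "b1 = h ^ (m + 2)" using odd by (simp add: b1_def)
      have mk: "m = Suc (m - 1)" using m by simp
      have hb: "h * h ^ (m + 2) \<le> h ^ (m + 2)" using h by (simp add: mult_left_le_one_le)
      \<comment> \<open>The \<open>\<beta>\<close> term is already of order \<open>h^(m + 2)\<close>
        here, so only the multiple of P'_(m + 1) exceeds that order.\<close>
      have R1: "\<bar>g1 n u - \<alpha>1 n * poly (?P (m + 1)) u\<bar> \<le> C1 * (B + 2) * h ^ (m + 2)" if n: "n < N" and u: "u \<in> {0..1}" for n u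
      proof -
        have "\<bar>g1 n u - \<alpha>1 n * poly (?P (m + 1)) u\<bar> \<le> C1 * B * h ^ (m + 2) + C1 * (h * h ^ (m + 2) + h ^ (m + 2))"
          using g1b[OF n u] \<beta>P[OF n u] by (simp add: b1o)
        also have "\<dots> \<le> C1 * B * h ^ (m + 2) + C1 * (h ^ (m + 2) + h ^ (m + 2))"
          using hb C1 by (intro add_mono mult_left_mono order_refl) auto
        finally show ?thesis by (simp add: algebra_simps)
      qed
      have V1: "B * (CV * (C1 * (b1 + h ^ (m + 1)))) \<le> 2 * B * CV * C1 * h ^ (m + 1)"
      proof -
        have "B * (CV * (C1 * (b1 + h ^ (m + 1)))) \<le> B * (CV * (C1 * (h ^ (m + 1) + h ^ (m + 1))))"
          unfolding b1o using hp B(1) CV C1 by (intro mult_left_mono add_mono) auto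
        then show ?thesis by (simp add: algebra_simps)
      qed
      \<comment> \<open>For odd \<open>m\<close> the polynomial P'_(m + 1) is antisymmetric about
        the midpoint, so its moments of even index vanish, and these are the ones with odd
        \<open>j + m\<close>. Such moments see only \<open>r\<close>, which supplies the additional
        factor \<open>h\<close> that the error lemma asks for.\<close>
      have Fo: "\<bar>legendre_moment (G n) j\<bar> \<le> A * h ^ (m + 1)" if n: "n < N" and j: "j < m" and o: "odd (j + m)" for n j
      proof -
        define r where "r u = g1 n u - \<alpha>1 n * poly (?P (m + 1)) u" for u
        have cr: "continuous_on {0..1} r" unfolding r_def by (intro continuous_intros g1(1) n)
        have "legendre_moment (poly (?P (m + 1))) j = 0"
        proof (rule moment_parity_zero)
          show "even j" using o odd by simp
          show "poly (?P (m + 1)) (1 - u) = - poly (?P (m + 1)) u" for u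
            using legendre_deriv_reflect[of "m + 1" u] odd by simp
        qed
        then have "legendre_moment r j = legendre_moment (g1 n) j"
          unfolding r_def by (subst moment_diff) (auto intro!: continuous_intros g1(1) n simp: moment_cmult)
        then have "\<bar>legendre_moment (G n) j\<bar> \<le> B * (C1 * (B + 2) * h ^ (m + 2)) / h + B * (CV * (C1 * (b1 + h ^ (m + 1))))"
          using momG[OF n j cr, of "C1 * (B + 2) * h ^ (m + 2)"] R1[OF n] by (simp add: r_def)
        also have "B * (C1 * (B + 2) * h ^ (m + 2)) / h = B * (C1 * (B + 2)) * h ^ (m + 1)" using h by simp
        also have "B * (C1 * (B + 2)) * h ^ (m + 1) + B * (CV * (C1 * (b1 + h ^ (m + 1))))
          \<le> B * (C1 * (B + 2)) * h ^ (m + 1) + 2 * B * CV * C1 * h ^ (m + 1)"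
          using V1 by linarith
        also have "\<dots> \<le> A * h ^ (m + 1)"
        proof -
          have "B * (C1 * (B + 2)) \<le> B * (C1 * (2 * B + 2))" using B(1) C1 by (intro mult_left_mono) auto
          moreover have "0 \<le> C1 * B^2" using C1 by simp
          ultimately have "B * (C1 * (B + 2)) + 2 * B * CV * C1 \<le> A" unfolding A_def by linarith
          from mult_right_mono[OF this, of "h ^ (m + 1)"] h show ?thesis by (simp add: distrib_right)
        qed
        finally show ?thesis .
      qed
      have Fa: "\<bar>legendre_moment (G n) j\<bar> \<le> A * h ^ m" if n: "n < N" and j: "j < m" for n j
      proof -
        have "\<bar>g1 n u\<bar> \<le> C1 * (2 * B + 2) * h ^ (m + 1)" if u: "u \<in> {0..1}" for u
        proof -
          have "\<bar>g1 n u\<bar> \<le> C1 * (B + 2) * h ^ (m + 2) + C1 * B * h ^ (m + 1)"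
            using R1[OF n u] \<alpha>P[OF n u] by linarith
          also have "\<dots> \<le> C1 * (B + 2) * h ^ (m + 1) + C1 * B * h ^ (m + 1)"
            using hp C1 B(1) by (intro add_mono mult_left_mono order_refl) auto
          finally show ?thesis by (simp add: algebra_simps)
        qed
        from momG[OF n j g1(1)[OF n] this]
        have "\<bar>legendre_moment (G n) j\<bar> \<le> B * (C1 * (2 * B + 2) * h ^ (m + 1)) / h + B * (CV * (C1 * (b1 + h ^ (m + 1))))" by simp
        also have "B * (C1 * (2 * B + 2) * h ^ (m + 1)) / h = B * (C1 * (2 * B + 2)) * h ^ m" using h by simp
        also have "B * (C1 * (2 * B + 2)) * h ^ m + B * (CV * (C1 * (b1 + h ^ (m + 1))))
          \<le> B * (C1 * (2 * B + 2)) * h ^ m + 2 * B * CV * C1 * h ^ (m + 1)"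
          using V1 by linarith
        also have "\<dots> \<le> B * (C1 * (2 * B + 2)) * h ^ m + 2 * B * CV * C1 * h ^ m"
          using hp B(1) CV C1 by (intro add_mono mult_left_mono order_refl) auto
        also have "\<dots> \<le> A * h ^ m"
        proof -
          have "B * (C1 * (2 * B + 2)) + 2 * B * CV * C1 \<le> A" using C1 by (simp add: A_def)
          from mult_right_mono[OF this, of "h ^ m"] h show ?thesis by (simp add: distrib_right)
        qed
        finally show ?thesis .
      qed
      have Fo': "\<bar>legendre_moment (G n) j\<bar> \<le> h * (A * h ^ m)" if "n < N" "j < m" "odd (j + m)" for n j
        using Fo[OF that] by (simp add: mult_ac)
      have hA: "h ^ m \<le> A * h ^ m" using mult_right_mono[OF A, of "h ^ m"] h by simp
      have "\<exists>g \<alpha> \<beta>. (\<forall>n<N. continuous_on {0..1} (g n) \<and>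
          (\<forall>u\<in>{0<..1}. h * (x2 (?s n u) - y2 (?s n u)) = g n u) \<and>
          \<bar>\<alpha> n\<bar> \<le> C2 * h ^ (m + 1) \<and> \<bar>\<beta> n\<bar> \<le> C2 * (A * h ^ m) \<and>
          (\<forall>u\<in>{0..1}. \<bar>g n u - \<beta> n * poly (?P m) u - \<alpha> n * poly (?P (m + 1)) u\<bar>
             \<le> C2 * (A * h ^ m + h * (A * h ^ m) + h ^ (m + 2)))) \<and>
        h * (x2 0 - y2 0) = g 0 0 \<and>
        (\<forall>t\<in>{0..T}. \<bar>integral {0..t} x2 - integral {0..t} y2\<bar> \<le> C2 * (A * h ^ m + h ^ (m + 1)))"
      proof (rule stage2[of N h y2 "\<lambda>n j. - legendre_moment (G n) j" "A * h ^ m" "A * h ^ m"])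
        show "\<bar>- legendre_moment (G n) j\<bar> \<le> h * (A * h ^ m)" if "n < N" "j < m" "odd (j + m)" for n j
          using Fo'[OF that] by simp
        show "0 \<le> A * h ^ m" using A h by simp
        show "\<bar>- legendre_moment (G n) j\<bar> \<le> A * h ^ m" if "n < N" "j < m" for n j
          using Fa[OF that] by simp
        show "N \<ge> 1" "h = stepsize T N" "h < h2" "y2 \<in> dg_space T N (m - 1)" by (fact N, fact hdef, fact h(3), fact S(2))
        show "volterra_moment K12 h n (\<lambda>t. x2 t - y2 t) j = - legendre_moment (G n) j" if "n < N" "j < m" for n j
          using orth2[OF that] .
        show "A * h ^ m \<le> A * h ^ m" by (rule order_refl)
        show "h ^ m \<le> A * h ^ m \<or> odd m \<and> D2 m 0 = 0 \<and> h ^ (m + 2) \<le> A * h ^ m" using hA by blast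
      qed
      then obtain g2 \<alpha>2 \<beta>2 where st2: "\<forall>n<N. continuous_on {0..1} (g2 n) \<and>
          (\<forall>u\<in>{0<..1}. h * (x2 (?s n u) - y2 (?s n u)) = g2 n u) \<and>
          \<bar>\<alpha>2 n\<bar> \<le> C2 * h ^ (m + 1) \<and> \<bar>\<beta>2 n\<bar> \<le> C2 * (A * h ^ m) \<and>
          (\<forall>u\<in>{0..1}. \<bar>g2 n u - \<beta>2 n * poly (?P m) u - \<alpha>2 n * poly (?P (m + 1)) u\<bar>
             \<le> C2 * (A * h ^ m + h * (A * h ^ m) + h ^ (m + 2)))"
        and g20: "h * (x2 0 - y2 0) = g2 0 0" by blast
      \<comment> \<open>Both \<open>a\<close> and \<open>b\<close> are of order \<open>h^m\<close>,
        so even the \<open>\<beta>\<close> term is small enough and the bound holds on the whole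
        cell, not only at special points.\<close>
      have G2: "\<bar>g2 n u\<bar> \<le> C2 * (A * B + B + 2 * A + 1) * h ^ Suc (m - 1)" if n: "n < N" and u: "u \<in> {0..1}" for n u
      proof -
        have a2: "\<bar>\<alpha>2 n * poly (?P (m + 1)) u\<bar> \<le> (C2 * h ^ (m + 1)) * B"
          unfolding abs_mult using st2 n B(2)[of "m + 1" u] u C2 h by (intro mult_mono) auto
        have b2: "\<bar>\<beta>2 n * poly (?P m) u\<bar> \<le> (C2 * (A * h ^ m)) * B"
          unfolding abs_mult using st2 n B(2)[of m u] u C2 h A by (intro mult_mono) auto
        have "\<bar>g2 n u - \<beta>2 n * poly (?P m) u - \<alpha>2 n * poly (?P (m + 1)) u\<bar> \<le> C2 * (A * h ^ m + h * (A * h ^ m) + h ^ (m + 2))"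
          using st2 n u by blast
        then have "\<bar>g2 n u\<bar> \<le> (C2 * (A * h ^ m)) * B + (C2 * h ^ (m + 1)) * B + C2 * (A * h ^ m + h * (A * h ^ m) + h ^ (m + 2))"
          using a2 b2 by linarith
        also have "\<dots> \<le> (C2 * (A * h ^ m)) * B + (C2 * h ^ m) * B + C2 * (A * h ^ m + 1 * (A * h ^ m) + h ^ m)"
          using h hp C2 B(1) A by (intro add_mono mult_left_mono mult_right_mono order_refl) auto
        also have "\<dots> = C2 * (A * B + B + 2 * A + 1) * h ^ m" by (simp add: algebra_simps)
        finally show ?thesis using mk by simp
      qed
      have "\<bar>x1 (?s n u) - y1 (?s n u)\<bar> \<le> C * h ^ (m + 1)"
        if n: "n < N" and u: "u \<in> {0<..<1}" and root: "poly (?P (m + 1)) u = 0" for n u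
      proof -
        have u': "u \<in> {0..1}" "u \<in> {0<..1}" using u by auto
        have "\<bar>g1 n u\<bar> \<le> C1 * (B + 2) * h ^ Suc (m + 1)" using R1[OF n u'(1)] root by simp
        from div[OF g1u[OF n u'(2)] this Cge(1)] show ?thesis by (simp add: e1_def)
      qed
      moreover have "\<bar>x2 t - y2 t\<bar> \<le> C * h ^ (m - 1)" if t: "t \<in> {0..T}" for t
      proof (cases "t = 0")
        case True
        have "\<bar>g2 0 0\<bar> \<le> C2 * (A * B + B + 2 * A + 1) * h ^ Suc (m - 1)" using N by (intro G2) auto
        from div[OF g20 this Cge(2)] show ?thesis using True by simp
      next
        case False
        then have "t \<in> {0<..T}" using t by auto
        then obtain n u where nu: "n < N" "u \<in> {0<..1}" "t = ?s n u"
          unfolding hdef by (rule cell_cover[OF T N]) blast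
        have "h * (x2 t - y2 t) = g2 n u" using st2 nu by blast
        moreover have "\<bar>g2 n u\<bar> \<le> C2 * (A * B + B + 2 * A + 1) * h ^ Suc (m - 1)" using nu by (intro G2) auto
        ultimately show ?thesis by (rule div[OF _ _ Cge(2)])
      qed
      ultimately show ?thesis using odd by blast
    qed
  qed
qed

section \<open>Uniformity over all admissible meshes\<close>

lemma dg_space_bounded:
  assumes T: "T > 0" "N \<ge> 1" and y: "y \<in> dg_space T N q"
  obtains M where "\<And>t. t \<in> {0..T} \<Longrightarrow> \<bar>y t\<bar> \<le> M"
proof -
  let ?h = "stepsize T N"
  obtain p where p: "\<And>n. n < N \<Longrightarrow> degree (p n) \<le> q"
    "\<And>n u. n < N \<Longrightarrow> u \<in> {0<..1} \<Longrightarrow> y (real n * ?h + u * ?h) = poly (p n) u"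
    "y 0 = poly (p 0) 0"
    using dg_space_cells[OF T y] by metis
  have "\<forall>n. \<exists>b. b > 0 \<and> (\<forall>u\<in>{0..1}. \<bar>poly (p n) u\<bar> \<le> b)"
    using poly_bounded_01 by metis
  then obtain b where b: "\<And>n. b n > 0" "\<And>n u. u \<in> {0..1} \<Longrightarrow> \<bar>poly (p n) u\<bar> \<le> b n" by metis
  have le: "b n \<le> (\<Sum>n<N. b n)" if "n < N" for n
    using that b(1) by (intro member_le_sum) (auto intro: less_imp_le)
  show ?thesis
  proof (rule that)
    fix t assume t: "t \<in> {0..T}"
    show "\<bar>y t\<bar> \<le> (\<Sum>n<N. b n)"
    proof (cases "t = 0")
      case True
      then show ?thesis using p(3) b(2)[of 0 0] le[of 0] T by simp
    next
      case False
      then have "t \<in> {0<..T}" using t by auto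
      then obtain n u where nu: "n < N" "u \<in> {0<..1}" "t = real n * ?h + u * ?h"
        by (rule cell_cover[OF T]) blast
      then show ?thesis using p(2)[OF nu(1,2)] b(2)[of u n] le[OF nu(1)] by auto
    qed
  qed
qed

text \<open>An asymptotic estimate covers all but finitely many \<open>N\<close>. Each remaining
  coarse mesh has its own constant, and the sum of the absolute values dominates them all.\<close>

lemma uniform_constant:
  fixes P :: "real \<Rightarrow> nat \<Rightarrow> bool"
  assumes mono: "\<And>C C' N. P C N \<Longrightarrow> C \<le> C' \<Longrightarrow> P C' N"
    and each: "\<And>N. N < N0 \<Longrightarrow> Q N \<Longrightarrow> \<exists>C. P C N" and large: "\<And>N. N \<ge> N0 \<Longrightarrow> Q N \<Longrightarrow> P C0 N"
  shows "\<exists>C. \<forall>N. Q N \<longrightarrow> P C N"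
proof -
  obtain c where c: "\<And>N. N < N0 \<Longrightarrow> Q N \<Longrightarrow> P (c N) N" using each by metis
  define C where "C = \<bar>C0\<bar> + (\<Sum>N<N0. \<bar>c N\<bar>)"
  have "P C N" if "Q N" for N
  proof (cases "N < N0")
    case True
    then have "\<bar>c N\<bar> \<le> (\<Sum>N<N0. \<bar>c N\<bar>)" by (intro member_le_sum) auto
    then show ?thesis using mono[OF c[OF True that]] by (simp add: C_def)
  next
    case False
    have "C0 \<le> C" unfolding C_def by (simp add: add_increasing2 sum_nonneg)
    then show ?thesis using mono[OF large[OF _ that]] False by simp
  qed
  then show ?thesis by blast
qed

theorem theorem4p4:
  fixes T k0 :: real and m d :: nat
    and K11 K12 K21 :: "real \<Rightarrow> real \<Rightarrow> real"
    and f1 f2 x1 x2 :: "real \<Rightarrow> real"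
  assumes "T > 0"
    and "m \<ge> 1"
    and "d = (if even m then m + 2 else m + 3)"
    and "Ck_on (d + 1) {0..T} f1"
    and "Ck_on (d + 2) {0..T} f2"
    and "Ck_on (d + 1) (kernel_domain T) (\<lambda>(t, s). K11 t s)"
    and "Ck_on (d + 2) (kernel_domain T) (\<lambda>(t, s). K12 t s)"
    and "Ck_on (d + 2) (kernel_domain T) (\<lambda>(t, s). K21 t s)"
    and "f2 0 = 0"
    and "k0 > 0"
    and "\<And>t. t \<in> {0..T} \<Longrightarrow> \<bar>K21 t t * K12 t t\<bar> \<ge> k0"
    and "iae_solution T K11 K12 K21 f1 f2 x1 x2"
    and "odd m \<Longrightarrow> deriv_within m {0..T} x1 0 = 0"
  shows "Ck_on d {0..T} x1 \<and> Ck_on d {0..T} x2 \<and>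
    (\<exists>hbar>0. \<forall>N\<ge>2. stepsize T N < hbar \<longrightarrow> dg_uniquely_solvable T K11 K12 K21 f1 f2 m N) \<and>
    (\<forall>hbar>0.
      (\<forall>N\<ge>2. stepsize T N < hbar \<longrightarrow> dg_uniquely_solvable T K11 K12 K21 f1 f2 m N) \<longrightarrow>
      (\<exists>C. \<forall>N\<ge>2. stepsize T N < hbar \<longrightarrow>
        (\<forall>x1h x2h. dg_solution T K11 K12 K21 f1 f2 m N x1h x2h \<longrightarrow>
          (let h = stepsize T N; e1 = (\<lambda>t. x1 t - x1h t); e2 = (\<lambda>t. x2 t - x2h t) in
            (odd m \<longrightarrow>
              (\<forall>n<N. \<forall>s. poly (pderiv (shifted_legendre (m + 1))) s = 0 \<longrightarrow>
                 \<bar>e1 (mesh T N n + s * h)\<bar> \<le> C * h ^ (m + 1)) \<and>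
              bdd_above ((\<lambda>t. \<bar>e2 t\<bar>) ` {0..T}) \<and>
              (SUP t\<in>{0..T}. \<bar>e2 t\<bar>) \<le> C * h ^ (m - 1)) \<and>
            (even m \<longrightarrow>
              (\<forall>n<N. \<forall>s. poly (pderiv (shifted_legendre m)) s = 0 \<longrightarrow>
                 \<bar>e1 (mesh T N n + s * h)\<bar> \<le> C * h ^ m \<and>
                 \<bar>e2 (mesh T N n + s * h)\<bar> \<le> C * h ^ (m - 2)))))))"
proof -
  note T = \<open>T > 0\<close> and m = \<open>m \<ge> 1\<close>
  have d: "m + 2 \<le> d" using assms(3) by auto
  have cx: "continuous_on {0..T} x1" "continuous_on {0..T} x2"
    and eq: "\<And>t. t \<in> {0..T} \<Longrightarrow> x1 t + integral {0..t} (\<lambda>s. K11 t s * x1 s + K12 t s * x2 s) = f1 t"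
    "\<And>t. t \<in> {0..T} \<Longrightarrow> integral {0..t} (\<lambda>s. K21 t s * x1 s) = f2 t"
    using assms(12) unfolding iae_solution_def by auto
  have nz: "K21 t t \<noteq> 0" "K12 t t \<noteq> 0" if "t \<in> {0..T}" for t
    using assms(11)[OF that] assms(10) by auto
  have K21: "Ck_on (Suc (d + 1)) (kernel_domain T) (\<lambda>(t, s). K21 t s)"
    and f2: "Ck_on (Suc (d + 1)) {0..T} f2" using assms(5,8) by auto
  \<comment> \<open>The smoothness of the exact solution is derived: the second equation costs
    \<open>x1\<close> one derivative of \<open>f2\<close>. Then the first equation, read as one for
    \<open>x2\<close>, has a right-hand side of class \<open>d + 1\<close> and costs one
    more.\<close>
  have x1: "Ck_on (d + 1) {0..T} x1"
    by (rule first_kind_regularity[OF T K21 nz(1) cx(1) f2 eq(2)])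
  have c: "Ck_on 1 (kernel_domain T) (\<lambda>(t, s). K11 t s)" "Ck_on 3 (kernel_domain T) (\<lambda>(t, s). K12 t s)"
    "Ck_on 3 (kernel_domain T) (\<lambda>(t, s). K21 t s)" "Ck_on 1 (kernel_domain T) (\<lambda>(t, s). K12 t s)"
    by (rule Ck_on_mono[OF assms(6)] Ck_on_mono[OF assms(7)] Ck_on_mono[OF assms(8)]; use d m in simp)+
  have x2: "Ck_on d {0..T} x2"
  proof (rule first_kind_regularity[OF T _ nz(2) cx(2)])
    show "Ck_on (Suc d) (kernel_domain T) (\<lambda>(t, s). K12 t s)" by (rule Ck_on_mono[OF assms(7)]) simp
    have "Ck_on (d + 1) {0..T} (\<lambda>t. f1 t - x1 t - integral {0..t} (\<lambda>s. K11 t s * x1 s))"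
      by (intro Ck_on_diff assms(4) x1 volterra_Ck[OF T] assms(6) Ck_on_mono[OF x1]) simp
    then show "Ck_on (Suc d) {0..T} (\<lambda>t. f1 t - x1 t - integral {0..t} (\<lambda>s. K11 t s * x1 s))" by simp
    fix t assume t: "t \<in> {0..T}"
    have "continuous_on {0..t} x1" "continuous_on {0..t} x2"
      using cx t by (auto intro: continuous_on_subset)
    then have "(\<lambda>s. K11 t s * x1 s) integrable_on {0..t}" "(\<lambda>s. K12 t s * x2 s) integrable_on {0..t}"
      using t by (intro integrable_continuous_real continuous_intros continuous_on_kernel_section[OF Ck_on_continuous[OF c(1)]]
         continuous_on_kernel_section[OF Ck_on_continuous[OF c(4)]]; simp)+
    then show "integral {0..t} (\<lambda>s. K12 t s * x2 s) = f1 t - x1 t - integral {0..t} (\<lambda>s. K11 t s * x1 s)"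
      using eq(1)[OF t] by (simp add: integral_add)
  qed
  have x: "Ck_on (m + 2) {0..T} x1" "Ck_on (m + 2) {0..T} x2"
    by (rule Ck_on_mono[OF x1] Ck_on_mono[OF x2]; use d in simp)+
  have cf: "continuous_on {0..T} f1" "continuous_on {0..T} f2"
    using Ck_on_continuous assms(4,5) by blast+
  obtain M12 M21 where M12: "M12 > 0" "\<And>t s. 0 \<le> s \<Longrightarrow> s \<le> t \<Longrightarrow> t \<le> T \<Longrightarrow> \<bar>K12 t s\<bar> \<le> M12"
    and M21: "M21 > 0" "\<And>t s. 0 \<le> s \<Longrightarrow> s \<le> t \<Longrightarrow> t \<le> T \<Longrightarrow> \<bar>K21 t s\<bar> \<le> M21"
    using kernel_bounded[OF Ck_on_continuous[OF c(2)]] kernel_bounded[OF Ck_on_continuous[OF c(3)]] by metis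
  \<comment> \<open>Both kernels are bounded above on the compact triangle, so the lower bound for
    the product of their diagonals gives one for each factor.\<close>
  define k1 where "k1 = min (k0 / M12) (k0 / M21)"
  have k1: "k1 > 0" using assms(10) M12 M21 by (simp add: k1_def)
  have kb: "k1 \<le> \<bar>K12 t t\<bar> \<and> k1 \<le> \<bar>K21 t t\<bar>" if t: "t \<in> {0..T}" for t
  proof -
    have p: "k0 \<le> \<bar>K21 t t\<bar> * \<bar>K12 t t\<bar>" using assms(11)[OF t] by (simp add: abs_mult)
    have b: "\<bar>K12 t t\<bar> \<le> M12" "\<bar>K21 t t\<bar> \<le> M21" using M12(2)[of t t] M21(2)[of t t] t by auto
    have "k0 \<le> \<bar>K21 t t\<bar> * M12" using p mult_left_mono[OF b(1), of "\<bar>K21 t t\<bar>"] by simp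
    moreover have "k0 \<le> M21 * \<bar>K12 t t\<bar>" using p mult_right_mono[OF b(2), of "\<bar>K12 t t\<bar>"] by simp
    ultimately have "k0 / M12 \<le> \<bar>K21 t t\<bar>" "k0 / M21 \<le> \<bar>K12 t t\<bar>"
      using M12(1) M21(1) by (simp_all add: divide_le_eq mult.commute)
    then show ?thesis by (auto simp: k1_def)
  qed
  then have kb12: "\<forall>t\<in>{0..T}. k1 \<le> \<bar>K12 t t\<bar>" and kb21: "\<forall>t\<in>{0..T}. k1 \<le> \<bar>K21 t t\<bar>" by auto
  obtain hbar0 where hbar0: "hbar0 > 0" "\<And>N. N \<ge> 1 \<Longrightarrow> stepsize T N < hbar0 \<Longrightarrow> dg_uniquely_solvable T K11 K12 K21 f1 f2 m N"
    by (fact dg_uniquely_solvable_small[OF T m c(1,2,3) k1 kb12 kb21 cf])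
  obtain C0 h0 where C0: "C0 > 0" "h0 > 0" and est:
    "\<And>N h y1 y2. N \<ge> 1 \<Longrightarrow> h = stepsize T N \<Longrightarrow> h < h0 \<Longrightarrow> dg_solution T K11 K12 K21 f1 f2 m N y1 y2 \<Longrightarrow>
      (odd m \<longrightarrow> (\<forall>n<N. \<forall>u\<in>{0<..<1}. poly (pderiv (shifted_legendre (m + 1))) u = 0 \<longrightarrow>
          \<bar>x1 (real n * h + u * h) - y1 (real n * h + u * h)\<bar> \<le> C0 * h ^ (m + 1)) \<and>
        (\<forall>t\<in>{0..T}. \<bar>x2 t - y2 t\<bar> \<le> C0 * h ^ (m - 1))) \<and>
      (even m \<longrightarrow> (\<forall>n<N. \<forall>u\<in>{0<..<1}. poly (pderiv (shifted_legendre m)) u = 0 \<longrightarrow>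
          \<bar>x1 (real n * h + u * h) - y1 (real n * h + u * h)\<bar> \<le> C0 * h ^ m \<and>
          \<bar>x2 (real n * h + u * h) - y2 (real n * h + u * h)\<bar> \<le> C0 * h ^ (m - 2)))"
    by (rule dg_error_estimates[OF T m c(1,2,3) k1 kb12 kb21 cf assms(12) x]) (use assms(13) in blast)+
  define P where "P C N \<longleftrightarrow> (\<forall>y1 y2. dg_solution T K11 K12 K21 f1 f2 m N y1 y2 \<longrightarrow>
      (odd m \<longrightarrow> (\<forall>n<N. \<forall>u\<in>{0<..<1}. poly (pderiv (shifted_legendre (m + 1))) u = 0 \<longrightarrow>
          \<bar>x1 (real n * stepsize T N + u * stepsize T N) - y1 (real n * stepsize T N + u * stepsize T N)\<bar> \<le> C * stepsize T N ^ (m + 1)) \<and>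
        (\<forall>t\<in>{0..T}. \<bar>x2 t - y2 t\<bar> \<le> C * stepsize T N ^ (m - 1))) \<and>
      (even m \<longrightarrow> (\<forall>n<N. \<forall>u\<in>{0<..<1}. poly (pderiv (shifted_legendre m)) u = 0 \<longrightarrow>
          \<bar>x1 (real n * stepsize T N + u * stepsize T N) - y1 (real n * stepsize T N + u * stepsize T N)\<bar> \<le> C * stepsize T N ^ m \<and>
          \<bar>x2 (real n * stepsize T N + u * stepsize T N) - y2 (real n * stepsize T N + u * stepsize T N)\<bar> \<le> C * stepsize T N ^ (m - 2))))" for C N
  have mono: "P C' N" if "P C N" "C \<le> C'" for C C' N
  proof -
    have "stepsize T N \<ge> 0" using T by (simp add: stepsize_def)
    then have "C * stepsize T N ^ k \<le> C' * stepsize T N ^ k" for k using that(2) by (intro mult_right_mono) auto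
    then show ?thesis using that(1) unfolding P_def by (meson order_trans)
  qed
  \<comment> \<open>On a single mesh the discrete solution is unique and piecewise polynomial, so
    one bound holds for the errors of all solution pairs, and dividing it by the powers of
    \<open>h\<close> gives a constant for this mesh.\<close>
  have each: "\<exists>C. P C N" if N: "N \<ge> 2" and u: "dg_uniquely_solvable T K11 K12 K21 f1 f2 m N" for N
  proof -
    have N1: "N \<ge> 1" using N by simp
    define h where "h = stepsize T N"
    have h: "h > 0" using stepsize_pos[OF T N1] by (simp add: h_def)
    obtain z1 z2 where z: "dg_solution T K11 K12 K21 f1 f2 m N z1 z2" using u unfolding dg_uniquely_solvable_def by blast
    have uniq: "y1 t = z1 t \<and> y2 t = z2 t" if "dg_solution T K11 K12 K21 f1 f2 m N y1 y2" "t \<in> {0..T}" for y1 y2 t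
      using u z that unfolding dg_uniquely_solvable_def by blast
    have S: "z1 \<in> dg_space T N (m - 1)" "z2 \<in> dg_space T N (m - 1)" using z unfolding dg_solution_def by auto
    obtain a1 where a1: "\<And>t. t \<in> {0..T} \<Longrightarrow> \<bar>z1 t\<bar> \<le> a1" by (rule dg_space_bounded[OF T N1 S(1)]) blast
    obtain a2 where a2: "\<And>t. t \<in> {0..T} \<Longrightarrow> \<bar>z2 t\<bar> \<le> a2" by (rule dg_space_bounded[OF T N1 S(2)]) blast
    have bd: "\<exists>C. \<forall>t\<in>{0..T}. \<bar>g t\<bar> \<le> C" if "continuous_on {0..T} g" for g :: "real \<Rightarrow> real"
      using compact_imp_bounded[OF compact_continuous_image[OF that compact_Icc]] unfolding bounded_iff by auto
    obtain b1 b2 where b: "\<forall>t\<in>{0..T}. \<bar>x1 t\<bar> \<le> b1" "\<forall>t\<in>{0..T}. \<bar>x2 t\<bar> \<le> b2" using bd[OF cx(1)] bd[OF cx(2)] by blast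
    define M where "M = \<bar>a1\<bar> + \<bar>a2\<bar> + \<bar>b1\<bar> + \<bar>b2\<bar>"
    have M: "M \<ge> 0" "\<bar>x1 t - y1 t\<bar> \<le> M" "\<bar>x2 t - y2 t\<bar> \<le> M"
      if "dg_solution T K11 K12 K21 f1 f2 m N y1 y2" "t \<in> {0..T}" for y1 y2 t
    proof -
      have "y1 t = z1 t" "y2 t = z2 t" using uniq[OF that] by auto
      moreover have "\<bar>x1 t\<bar> \<le> b1" "\<bar>x2 t\<bar> \<le> b2" using b that(2) by auto
      ultimately show "M \<ge> 0" "\<bar>x1 t - y1 t\<bar> \<le> M" "\<bar>x2 t - y2 t\<bar> \<le> M"
        using a1[OF that(2)] a2[OF that(2)] by (simp_all add: M_def)
    qed
    \<comment> \<open>One quotient for each power of \<open>h\<close> in the estimates; the sum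
      dominates every one of them.\<close>
    define C where "C = M / h ^ (m + 1) + M / h ^ (m - 1) + M / h ^ m + M / h ^ (m - 2)"
    have M0: "M \<ge> 0" by (simp add: M_def)
    have C: "M \<le> C * h ^ k" if "k \<in> {m + 1, m - 1, m, m - 2}" for k
    proof -
      have "M / h ^ k \<le> C" using that M0 h unfolding C_def by auto
      then show ?thesis using h by (simp add: divide_le_eq)
    qed
    have cell: "real n * h + u * h \<in> {0..T}" if "n < N" "u \<in> {0<..<1}" for n u
      unfolding h_def using that by (intro cell_point[OF T N1]) auto
    have "P C N"
      unfolding P_def h_def[symmetric]
    proof (intro allI impI conjI ballI)
      fix y1 y2 assume y: "dg_solution T K11 K12 K21 f1 f2 m N y1 y2"
      show "\<bar>x2 t - y2 t\<bar> \<le> C * h ^ (m - 1)" if "t \<in> {0..T}" for t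
        using M(3)[OF y that] C[of "m - 1"] by simp
      fix n u assume nu: "n < N" "u \<in> {0<..<(1::real)}"
      show "\<bar>x1 (real n * h + u * h) - y1 (real n * h + u * h)\<bar> \<le> C * h ^ (m + 1)"
        using M(2)[OF y cell[OF nu]] C[of "m + 1"] by simp
      show "\<bar>x1 (real n * h + u * h) - y1 (real n * h + u * h)\<bar> \<le> C * h ^ m"
        using M(2)[OF y cell[OF nu]] C[of m] by simp
      show "\<bar>x2 (real n * h + u * h) - y2 (real n * h + u * h)\<bar> \<le> C * h ^ (m - 2)"
        using M(3)[OF y cell[OF nu]] C[of "m - 2"] by simp
    qed
    then show ?thesis by blast
  qed
  have final: "let h = stepsize T N; e1 = (\<lambda>t. x1 t - x1h t); e2 = (\<lambda>t. x2 t - x2h t) in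
            (odd m \<longrightarrow>
              (\<forall>n<N. \<forall>s. poly (pderiv (shifted_legendre (m + 1))) s = 0 \<longrightarrow>
                 \<bar>e1 (mesh T N n + s * h)\<bar> \<le> C * h ^ (m + 1)) \<and>
              bdd_above ((\<lambda>t. \<bar>e2 t\<bar>) ` {0..T}) \<and>
              (SUP t\<in>{0..T}. \<bar>e2 t\<bar>) \<le> C * h ^ (m - 1)) \<and>
            (even m \<longrightarrow>
              (\<forall>n<N. \<forall>s. poly (pderiv (shifted_legendre m)) s = 0 \<longrightarrow>
                 \<bar>e1 (mesh T N n + s * h)\<bar> \<le> C * h ^ m \<and>
                 \<bar>e2 (mesh T N n + s * h)\<bar> \<le> C * h ^ (m - 2)))"
    if P: "P C N" and y: "dg_solution T K11 K12 K21 f1 f2 m N x1h x2h" for C N x1h x2h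
  proof -
    have roots: "s \<in> {0<..<1}" if "poly (pderiv (shifted_legendre j)) s = 0" "j \<ge> 1" for s j
      using legendre_deriv_roots[OF that(2,1)] by auto
    note bounds = P[unfolded P_def, rule_format, OF y]
    show ?thesis
      unfolding Let_def mesh_def
    proof (intro conjI impI allI)
      assume o: "odd m"
      show "\<bar>x1 (real n * stepsize T N + s * stepsize T N) - x1h (real n * stepsize T N + s * stepsize T N)\<bar> \<le> C * stepsize T N ^ (m + 1)"
        if "n < N" "poly (pderiv (shifted_legendre (m + 1))) s = 0" for n s
        using bounds o that roots[OF that(2)] by auto
      have b: "\<bar>x2 t - x2h t\<bar> \<le> C * stepsize T N ^ (m - 1)" if "t \<in> {0..T}" for t using bounds o that by auto
      then show "bdd_above ((\<lambda>t. \<bar>x2 t - x2h t\<bar>) ` {0..T})" by (rule bdd_aboveI2)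
      show "(SUP t\<in>{0..T}. \<bar>x2 t - x2h t\<bar>) \<le> C * stepsize T N ^ (m - 1)"
        using b T by (intro cSUP_least) auto
    next
      fix n s assume e: "even m" and n: "n < N" and s: "poly (pderiv (shifted_legendre m)) s = 0"
      show "\<bar>x1 (real n * stepsize T N + s * stepsize T N) - x1h (real n * stepsize T N + s * stepsize T N)\<bar> \<le> C * stepsize T N ^ m"
        "\<bar>x2 (real n * stepsize T N + s * stepsize T N) - x2h (real n * stepsize T N + s * stepsize T N)\<bar> \<le> C * stepsize T N ^ (m - 2)"
        using bounds e n s roots[OF s m] by auto
    qed
  qed
  \<comment> \<open>The given \<open>hbar\<close> may exceed the threshold \<open>h0\<close> of the
    asymptotic estimate. Meshes with \<open>N\<close> larger than \<open>T / h0\<close> satisfy that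
    estimate; the others are finitely many and uniquely solvable by assumption.\<close>
  have "\<exists>C. \<forall>N. (N \<ge> 2 \<and> stepsize T N < hbar) \<longrightarrow> P C N"
    if hb: "\<forall>N\<ge>2. stepsize T N < hbar \<longrightarrow> dg_uniquely_solvable T K11 K12 K21 f1 f2 m N" for hbar
  proof (rule uniform_constant[of P "nat \<lceil>T / h0\<rceil> + 1" "\<lambda>N. 2 \<le> N \<and> stepsize T N < hbar" C0, OF mono])
    show "\<exists>C. P C N" if "2 \<le> N \<and> stepsize T N < hbar" for N using each hb that by blast
    show "P C0 N" if "nat \<lceil>T / h0\<rceil> + 1 \<le> N" "2 \<le> N \<and> stepsize T N < hbar" for N
    proof -
      have N1: "N \<ge> 1" using that by simp
      have "T / h0 < real N" using that(1) by linarith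
      then have "stepsize T N < h0" using C0(2) N1 by (simp add: stepsize_def divide_less_eq mult.commute)
      then show ?thesis unfolding P_def using est[OF N1 refl] by blast
    qed
  qed
  then have bound: "\<exists>C. \<forall>N\<ge>2. stepsize T N < hbar \<longrightarrow> P C N"
    if "\<forall>N\<ge>2. stepsize T N < hbar \<longrightarrow> dg_uniquely_solvable T K11 K12 K21 f1 f2 m N" for hbar
    using that by blast
  show ?thesis
  proof (intro conjI allI impI)
    show "Ck_on d {0..T} x1" by (rule Ck_on_mono[OF x1]) simp
    show "Ck_on d {0..T} x2" by (rule x2)
    show "\<exists>hbar>0. \<forall>N\<ge>2. stepsize T N < hbar \<longrightarrow> dg_uniquely_solvable T K11 K12 K21 f1 f2 m N"
      using hbar0 by (intro exI[of _ hbar0]) auto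
    fix hbar :: real
    assume "\<forall>N\<ge>2. stepsize T N < hbar \<longrightarrow> dg_uniquely_solvable T K11 K12 K21 f1 f2 m N"
    from bound[OF this] obtain C where "\<forall>N\<ge>2. stepsize T N < hbar \<longrightarrow> P C N" by blast
    then show "\<exists>C. \<forall>N\<ge>2. stepsize T N < hbar \<longrightarrow>
        (\<forall>x1h x2h. dg_solution T K11 K12 K21 f1 f2 m N x1h x2h \<longrightarrow>
          (let h = stepsize T N; e1 = (\<lambda>t. x1 t - x1h t); e2 = (\<lambda>t. x2 t - x2h t) in
            (odd m \<longrightarrow>
              (\<forall>n<N. \<forall>s. poly (pderiv (shifted_legendre (m + 1))) s = 0 \<longrightarrow>
                 \<bar>e1 (mesh T N n + s * h)\<bar> \<le> C * h ^ (m + 1)) \<and>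
              bdd_above ((\<lambda>t. \<bar>e2 t\<bar>) ` {0..T}) \<and>
              (SUP t\<in>{0..T}. \<bar>e2 t\<bar>) \<le> C * h ^ (m - 1)) \<and>
            (even m \<longrightarrow>
              (\<forall>n<N. \<forall>s. poly (pderiv (shifted_legendre m)) s = 0 \<longrightarrow>
                 \<bar>e1 (mesh T N n + s * h)\<bar> \<le> C * h ^ m \<and>
                 \<bar>e2 (mesh T N n + s * h)\<bar> \<le> C * h ^ (m - 2)))))"
      using final by blast
  qed
qed

end
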